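(* Let $\mathbb{H}=\{(z_1,z_2)\in\mathbb{C}^2 : |z_1|<|z_2|<1\}$ and let $\mathbb{D}$ be the unit disk in $\mathbb{C}$. Assume that $p>1$. Let $\mu(z)=|z_2|^{s'}|g(z_2)|^2$ for $z\in\mathbb{H}$, where $s'\in\mathbb{R}$ and $g$ is a non-vanishing holomorphic function on $\mathbb{D}$. Suppose that the weighted Bergman projection $\mathcal{B}_{\mathbb{D},|g|^2}$ on $\mathbb{D}$ with the weight $|g|^2$ is $L^p(\mathbb{D},|g|^2)$ bounded if and only if $p\in(p_0,p_0')$ for some $p_0\ge1$, and suppose that the weighted Bergman projection $\mathcal{B}_{\mathbb{H},s'}$ on $\mathbb{H}$ with the weight $\lambda(z)=|z_2|^{s'}$ is $L^p(\mathbb{H},\lambda)$ bounded if and only if $p\in(p_1,p_1')$ for some $p_1\ge1$. Then the weighted Bergman projection $\mathcal{B}_{\mathbb{H},\mu}$ on $\mathbb{H}$ with the weight $\mu$ is $L^p(\mathbb{H},\mu)$ bounded if $p\in(p_0,p_0')\cap(p_1,p_1')$. In addition, if $(p_1,p_1')\subset(p_0,p_0')$ properly, then $\mathcal{B}_{\mathbb{H},\mu}$ is $L^p(\mathbb{H},\mu)$ bounded if and only if $p\in(p_1,p_1')$.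
   Context: For an exponent $q\in[1,\infty)$, $q'$ denotes the conjugate exponent ($1'=\infty$). For a domain $\Omega\subset\mathbb{C}^n$ and a continuous non-vanishing weight $\mu>0$ on $\Omega$, $L^p(\Omega,\mu)$ is the space of measurable $f$ with $\|f\|_{L^p(\Omega,\mu)}=\left(\int_\Omega|f|^p\mu\,dV\right)^{1/p}<\infty$; $A^2(\Omega,\mu)$ is the closed subspace of holomorphic functions in $L^2(\Omega,\mu)$; the weighted Bergman projection on $\Omega$ with the weight $\mu$ is the orthogonal projection from $L^2(\Omega,\mu)$ onto $A^2(\Omega,\mu)$. It is $L^p(\Omega,\mu)$ bounded if, as usual, there is a constant $C$ such that $\|Tf\|_{L^p(\Omega,\mu)}\le C\|f\|_{L^p(\Omega,\mu)}$ for all $f\in L^p(\Omega,\mu)\cap L^2(\Omega,\mu)$, where $T$ denotes the projection. The number $p_1$ is the one determined by $s'=s+2k$ ($k\in\mathbb{Z}$, $s\in(0,2]$) as follows: $p_1=\frac{s+2k+4}{s+k+2}$ if $s'>-2$; $p_1=1$ if $s'\in[-5,-2]$ or $s'=-6$; $p_1=2-s$ if $s'\in(-6,-5)$; $p_1=\frac{s+2k+4}{k+2}$ if $s'<-6$. *)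

theory Defs
  imports "HOL-Analysis.Analysis"
begin

definition weighted_Lp :: "real \<Rightarrow> 'a::euclidean_space set \<Rightarrow> ('a \<Rightarrow> real) \<Rightarrow> ('a \<Rightarrow> complex) set" where
  "weighted_Lp p \<Omega> \<mu> =
     {f \<in> borel_measurable (lebesgue_on \<Omega>).
        integrable (lebesgue_on \<Omega>) (\<lambda>z. cmod (f z) powr p * \<mu> z)}"

definition weighted_Lp_norm :: "real \<Rightarrow> 'a::euclidean_space set \<Rightarrow> ('a \<Rightarrow> real) \<Rightarrow> ('a \<Rightarrow> complex) \<Rightarrow> real" where
  "weighted_Lp_norm p \<Omega> \<mu> f =
     (integral\<^sup>L (lebesgue_on \<Omega>) (\<lambda>z. cmod (f z) powr p * \<mu> z)) powr (1 / p)"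

definition weighted_inner :: "'a::euclidean_space set \<Rightarrow> ('a \<Rightarrow> real) \<Rightarrow> ('a \<Rightarrow> complex) \<Rightarrow> ('a \<Rightarrow> complex) \<Rightarrow> complex" where
  "weighted_inner \<Omega> \<mu> f h =
     integral\<^sup>L (lebesgue_on \<Omega>) (\<lambda>z. f z * cnj (h z) * complex_of_real (\<mu> z))"

text \<open>The parameter \<open>hol\<close> of the next definitions is the notion of holomorphy on subsets of
  the ambient space, so that they apply to domains in \<open>complex\<close>
  and in \<open>complex \<times> complex\<close> alike.\<close>

definition bergman_space ::
  "(('a \<Rightarrow> complex) \<Rightarrow> 'a set \<Rightarrow> bool) \<Rightarrow> 'a::euclidean_space set \<Rightarrow> ('a \<Rightarrow> real) \<Rightarrow> ('a \<Rightarrow> complex) set" where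
  "bergman_space hol \<Omega> \<mu> = {f \<in> weighted_Lp 2 \<Omega> \<mu>. hol f \<Omega>}"

text \<open>Functions on \<open>\<Omega>\<close> are represented by total functions; the clause fixing the value \<open>0\<close>
  off \<open>\<Omega>\<close> serves only to make the description unique.\<close>

definition bergman_projection ::
  "(('a \<Rightarrow> complex) \<Rightarrow> 'a set \<Rightarrow> bool) \<Rightarrow> 'a::euclidean_space set \<Rightarrow> ('a \<Rightarrow> real)
     \<Rightarrow> ('a \<Rightarrow> complex) \<Rightarrow> 'a \<Rightarrow> complex" where
  "bergman_projection hol \<Omega> \<mu> f =
     (THE h. h \<in> bergman_space hol \<Omega> \<mu> \<and> (\<forall>z. z \<notin> \<Omega> \<longrightarrow> h z = 0) \<and>
        (\<forall>u \<in> bergman_space hol \<Omega> \<mu>. weighted_inner \<Omega> \<mu> (\<lambda>z. f z - h z) u = 0))"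

text \<open>The integral in the norm is \<open>0\<close> for non-integrable functions, hence the explicit
  requirement that the image lies in the weighted space.\<close>

definition Lp_bounded ::
  "real \<Rightarrow> 'a::euclidean_space set \<Rightarrow> ('a \<Rightarrow> real) \<Rightarrow> (('a \<Rightarrow> complex) \<Rightarrow> 'a \<Rightarrow> complex) \<Rightarrow> bool" where
  "Lp_bounded p \<Omega> \<mu> T \<longleftrightarrow>
     (\<exists>C. \<forall>f \<in> weighted_Lp p \<Omega> \<mu> \<inter> weighted_Lp 2 \<Omega> \<mu>.
        T f \<in> weighted_Lp p \<Omega> \<mu> \<and> weighted_Lp_norm p \<Omega> \<mu> (T f) \<le> C * weighted_Lp_norm p \<Omega> \<mu> f)"

definition holomorphic2_on :: "(complex \<times> complex \<Rightarrow> complex) \<Rightarrow> (complex \<times> complex) set \<Rightarrow> bool" where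
  "holomorphic2_on f \<Omega> \<longleftrightarrow>
     (\<forall>z\<in>\<Omega>. \<exists>a b. (f has_derivative (\<lambda>(h1, h2). a * h1 + b * h2)) (at z within \<Omega>))"

definition unit_disk :: "complex set" where
  "unit_disk = {z. cmod z < 1}"

definition hartogs_triangle :: "(complex \<times> complex) set" where
  "hartogs_triangle = {(z1, z2). cmod z1 < cmod z2 \<and> cmod z2 < 1}"

definition conj_exponent :: "real \<Rightarrow> ereal" where
  "conj_exponent q = (if q = 1 then \<infinity> else ereal (q / (q - 1)))"

definition conj_interval :: "real \<Rightarrow> real set" where
  "conj_interval q = {p. q < p \<and> ereal p < conj_exponent q}"

text \<open>The two arguments are \<open>s \<in> (0, 2]\<close> and the integer \<open>k\<close> of the decomposition
  \<open>s' = s + 2 * k\<close>.\<close>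

definition hartogs_exponent :: "real \<Rightarrow> int \<Rightarrow> real" where
  "hartogs_exponent s k =
     (let s' = s + 2 * of_int k in
      if s' > - 2 then (s + 2 * of_int k + 4) / (s + of_int k + 2)
      else if s' \<in> {-5..-2} \<or> s' = - 6 then 1
      else if s' \<in> {-6<..<-5} then 2 - s
      else (s + 2 * of_int k + 4) / (of_int k + 2))"

end

theory Submission
  imports Defs "HOL-Complex_Analysis.Complex_Analysis"
begin

text \<open>The coordinates \<open>(z\<^sub>1 / z\<^sub>2, z\<^sub>2)\<close> turn the Hartogs triangle into the product of the disk and the punctured
  disk, and multiplication by \<open>z\<^sub>2\<^sup>k\<^sup>+\<^sup>2 g(z\<^sub>2)\<close> turns the projection with weight \<open>|z\<^sub>2|\<^sup>s\<^sup>' |g(z\<^sub>2)|\<^sup>2\<close> into the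
  tensor product of the Bergman projections of the disk with weights \<open>1\<close> and \<open>|w|\<^sup>a\<close>, \<open>a = s - 2\<close>. The kernels are
  explicit: up to the factor \<open>1 / \<pi>\<close>, with \<open>x = z cnj w\<close>, the second is \<open>(1 - x)\<^sup>-\<^sup>2 + (a / 2) (1 - x)\<^sup>-\<^sup>1\<close>. Schur's
  test shows that they define bounded operators, hence projections. The first factor is bounded on every \<open>L\<^sup>p\<close>
  with \<open>1 < p < \<infinity>\<close>. The kernel of the second is bounded unless both points are far from the origin, and there
  \<open>(1 - x)\<^sup>-\<^sup>1 = (1 - x) (1 - x)\<^sup>-\<^sup>2\<close> expresses it by the projection of the disk, to which the hypothesis on
  \<open>|g|\<^sup>2\<close> applies. What remains is the integrability near the origin of the weights for \<open>p\<close> and for its conjugate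
  exponent; this is the condition \<open>p \<in> (p\<^sub>1, p\<^sub>1')\<close>, and it is also necessary, as one sees by testing on powers of
  \<open>|z\<^sub>2|\<close> supported in annuli around the origin.\<close>

subsection \<open>Lebesgue measure on the plane\<close>

text \<open>The range \<open>a \<in> (-2, 0]\<close> makes the reduction exact. For
  \<open>a > -2\<close> the weight |w|^a is integrable at the puncture, so every power w^n with n
  \<ge> 0 is square integrable; for \<open>a \<le> 0\<close> no negative power is, so square
  integrable holomorphic functions on the punctured disk extend and the kernel of the full disk
  reproduces them. The obstacle is that |g|^2 is arbitrary near the boundary. No estimate of the
  kernel in absolute value survives the weight |g|^(2 - p) there; the cancellation has to come from
  the hypothesis on the disk, and only the part of the kernel with both points far from 0 is handed
  to it. The bounded rest costs, by Hoelder, exactly the finiteness of the integrals of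
  |\<gamma>|^(2 - p) and |\<gamma>|^(2 - q), where q is conjugate to p and \<gamma> is the
  multiplier. Away from 0 this is a condition on |g|^(2 - p) and |g|^(2 - q) that is not assumed: it
  is extracted from the boundedness on the disk for p and for q, and q is available because (p0,
  p0') is closed under conjugation. The first variable is harmless, since the weight does not depend
  on it.\<close>

lemma lborel_complex_eq_distr:
  "(lborel :: complex measure) = distr (lborel \<Otimes>\<^sub>M lborel) borel (\<lambda>(x, y). Complex x y)"
proof (rule lborel_eqI)
  have [measurable]: "(\<lambda>(x, y). Complex x y) \<in> borel_measurable (lborel \<Otimes>\<^sub>M lborel)"
    by (subst lborel_prod, intro borel_measurable_continuous_onI[THEN measurable_cong_sets[OF sets_lborel refl, THEN equalityD2, THEN subsetD]])
       (auto simp: case_prod_unfold intro!: continuous_intros)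
  show "sets (distr (lborel \<Otimes>\<^sub>M lborel) borel (\<lambda>(x, y). Complex x y)) = sets borel" by simp
  fix l u :: complex assume lu: "\<And>b. b \<in> Basis \<Longrightarrow> l \<bullet> b \<le> u \<bullet> b"
  have le: "Re l \<le> Re u" "Im l \<le> Im u" using lu[of 1] lu[of \<i>] by (auto simp: Basis_complex_def)
  have vim: "(\<lambda>(x, y). Complex x y) -` box l u \<inter> space (lborel \<Otimes>\<^sub>M lborel) = {Re l<..<Re u} \<times> {Im l<..<Im u}"
    by (auto simp: box_def Basis_complex_def space_pair_measure)
  have "emeasure (distr (lborel \<Otimes>\<^sub>M lborel) borel (\<lambda>(x, y). Complex x y)) (box l u)
      = emeasure (lborel \<Otimes>\<^sub>M lborel) ({Re l<..<Re u} \<times> {Im l<..<Im u})"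
    by (subst emeasure_distr) (auto simp: vim)
  also have "\<dots> = ennreal (Re u - Re l) * ennreal (Im u - Im l)"
    using le by (subst lborel.emeasure_pair_measure_Times) auto
  also have "\<dots> = ennreal (\<Prod>b\<in>Basis. (u - l) \<bullet> b)"
    using le by (simp add: Basis_complex_def ennreal_mult')
  finally show "emeasure (distr (lborel \<Otimes>\<^sub>M lborel) borel (\<lambda>(x, y). Complex x y)) (box l u)
      = ennreal (\<Prod>b\<in>Basis. (u - l) \<bullet> b)" .
qed

lemma measurable_Complex [measurable (raw)]:
  assumes "f \<in> borel_measurable M" "g \<in> borel_measurable M"
  shows "(\<lambda>x. Complex (f x) (g x)) \<in> borel_measurable M"
  using assms by (auto simp: borel_measurable_complex_iff)

lemma nn_integral_complex_fubini:
  assumes [measurable]: "f \<in> borel_measurable borel"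
  shows "(\<integral>\<^sup>+z. f z \<partial>lborel) = (\<integral>\<^sup>+y. \<integral>\<^sup>+x. f (Complex x y) \<partial>lborel \<partial>lborel)"
proof -
  have [measurable]: "(\<lambda>(x, y). Complex x y) \<in> borel_measurable (lborel \<Otimes>\<^sub>M lborel)"
    by measurable
  have "(\<integral>\<^sup>+z. f z \<partial>lborel) = (\<integral>\<^sup>+p. f (case p of (x, y) \<Rightarrow> Complex x y) \<partial>(lborel \<Otimes>\<^sub>M lborel))"
    by (subst lborel_complex_eq_distr, subst nn_integral_distr) auto
  also have "\<dots> = (\<integral>\<^sup>+y. \<integral>\<^sup>+x. f (Complex x y) \<partial>lborel \<partial>lborel)"
    by (subst lborel_pair.nn_integral_snd[symmetric]) auto
  finally show ?thesis .
qed

text \<open>Multiplication by a + ib is a composition of two shears: an affine substitution in x for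
  fixed y turns the real part into x, and after exchanging the order one in y for fixed x does the
  same for the imaginary part. The factors 1 / |a| and |a| / (a^2 + b^2) multiply to 1 / |c|^2; the
  first substitution is why the real part must not vanish.\<close>

lemma nn_integral_complex_mult_aux:
  assumes [measurable]: "f \<in> borel_measurable borel" and c: "Re c \<noteq> 0"
  shows "(\<integral>\<^sup>+z. f z \<partial>lborel) = ennreal ((cmod c)\<^sup>2) * (\<integral>\<^sup>+z. f (c * z) \<partial>lborel)"
proof -
  let ?a = "Re c" and ?b = "Im c"
  have n2: "(cmod c)\<^sup>2 = ?a\<^sup>2 + ?b\<^sup>2" by (simp add: cmod_power2)
  have pos: "?a\<^sup>2 + ?b\<^sup>2 > 0" using c by (simp add: sum_power2_gt_zero_iff)
  have "(\<integral>\<^sup>+z. f (c * z) \<partial>lborel)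
      = (\<integral>\<^sup>+y. \<integral>\<^sup>+x. f (Complex (?a * x - ?b * y) (?a * y + ?b * x)) \<partial>lborel \<partial>lborel)"
  proof -
    have "c * Complex x y = Complex (?a * x - ?b * y) (?a * y + ?b * x)" for x y
      by (simp add: complex_eq_iff)
    thus ?thesis by (subst nn_integral_complex_fubini) simp_all
  qed
  also have "\<dots> = (\<integral>\<^sup>+y. ennreal \<bar>1 / ?a\<bar> * (\<integral>\<^sup>+x. f (Complex x (((?a\<^sup>2 + ?b\<^sup>2) * y + ?b * x) / ?a)) \<partial>lborel) \<partial>lborel)"
  proof (rule nn_integral_cong)
    fix y :: real
    have e1: "?a * (?b * y / ?a + 1 / ?a * x) - ?b * y = x" for x
      using c by (simp add: field_simps)
    have e2: "?a * y + ?b * (?b * y / ?a + 1 / ?a * x) = ((?a\<^sup>2 + ?b\<^sup>2) * y + ?b * x) / ?a" for x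
      using c by (simp add: field_simps power2_eq_square)
    have "(\<integral>\<^sup>+x. f (Complex (?a * x - ?b * y) (?a * y + ?b * x)) \<partial>lborel)
      = ennreal \<bar>1 / ?a\<bar> * (\<integral>\<^sup>+x. f (Complex (?a * (?b * y / ?a + 1 / ?a * x) - ?b * y) (?a * y + ?b * (?b * y / ?a + 1 / ?a * x))) \<partial>lborel)"
      using c by (subst nn_integral_real_affine[where c = "1 / ?a" and t = "?b * y / ?a"]) auto
    thus "(\<integral>\<^sup>+x. f (Complex (?a * x - ?b * y) (?a * y + ?b * x)) \<partial>lborel)
      = ennreal \<bar>1 / ?a\<bar> * (\<integral>\<^sup>+x. f (Complex x (((?a\<^sup>2 + ?b\<^sup>2) * y + ?b * x) / ?a)) \<partial>lborel)"
      by (simp only: e1 e2)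
  qed
  also have "\<dots> = ennreal \<bar>1 / ?a\<bar> * (\<integral>\<^sup>+y. \<integral>\<^sup>+x. f (Complex x (((?a\<^sup>2 + ?b\<^sup>2) * y + ?b * x) / ?a)) \<partial>lborel \<partial>lborel)"
    by (subst nn_integral_cmult) auto
  also have "(\<integral>\<^sup>+y. \<integral>\<^sup>+x. f (Complex x (((?a\<^sup>2 + ?b\<^sup>2) * y + ?b * x) / ?a)) \<partial>lborel \<partial>lborel)
      = (\<integral>\<^sup>+x. \<integral>\<^sup>+y. f (Complex x (((?a\<^sup>2 + ?b\<^sup>2) * y + ?b * x) / ?a)) \<partial>lborel \<partial>lborel)"
    by (rule lborel_pair.Fubini'[symmetric]) measurable
  also have "\<dots> = (\<integral>\<^sup>+x. ennreal (\<bar>?a\<bar> / (?a\<^sup>2 + ?b\<^sup>2)) * (\<integral>\<^sup>+y. f (Complex x y) \<partial>lborel) \<partial>lborel)"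
  proof (rule nn_integral_cong)
    fix x :: real
    let ?d = "?a / (?a\<^sup>2 + ?b\<^sup>2)" and ?t = "- ?b * x / (?a\<^sup>2 + ?b\<^sup>2)"
    have e1: "((?a\<^sup>2 + ?b\<^sup>2) * (?t + ?d * y) + ?b * x) / ?a = y" for y
    proof -
      define d where "d = ?a\<^sup>2 + ?b\<^sup>2"
      have "d > 0" using pos by (simp add: d_def)
      hence "(d * (- ?b * x / d + ?a / d * y) + ?b * x) / ?a = y"
        using c by (simp add: field_simps)
      thus ?thesis by (simp add: d_def)
    qed
    have e2: "\<bar>?d\<bar> = \<bar>?a\<bar> / (?a\<^sup>2 + ?b\<^sup>2)" using pos by (simp add: abs_divide)
    have "(\<integral>\<^sup>+y. f (Complex x (((?a\<^sup>2 + ?b\<^sup>2) * y + ?b * x) / ?a)) \<partial>lborel)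
      = ennreal \<bar>?d\<bar> * (\<integral>\<^sup>+y. f (Complex x (((?a\<^sup>2 + ?b\<^sup>2) * (?t + ?d * y) + ?b * x) / ?a)) \<partial>lborel)"
      using c pos by (subst nn_integral_real_affine[where c = ?d and t = ?t]) auto
    thus "(\<integral>\<^sup>+y. f (Complex x (((?a\<^sup>2 + ?b\<^sup>2) * y + ?b * x) / ?a)) \<partial>lborel)
      = ennreal (\<bar>?a\<bar> / (?a\<^sup>2 + ?b\<^sup>2)) * (\<integral>\<^sup>+y. f (Complex x y) \<partial>lborel)"
      by (simp only: e1 e2)
  qed
  also have "\<dots> = ennreal (\<bar>?a\<bar> / (?a\<^sup>2 + ?b\<^sup>2)) * (\<integral>\<^sup>+x. \<integral>\<^sup>+y. f (Complex x y) \<partial>lborel \<partial>lborel)"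
    by (subst nn_integral_cmult) auto
  also have "(\<integral>\<^sup>+x. \<integral>\<^sup>+y. f (Complex x y) \<partial>lborel \<partial>lborel) = (\<integral>\<^sup>+y. \<integral>\<^sup>+x. f (Complex x y) \<partial>lborel \<partial>lborel)"
    by (rule lborel_pair.Fubini') measurable
  also have "\<dots> = (\<integral>\<^sup>+z. f z \<partial>lborel)" by (rule nn_integral_complex_fubini[symmetric]) measurable
  finally have "ennreal ((cmod c)\<^sup>2) * (\<integral>\<^sup>+z. f (c * z) \<partial>lborel)
     = ennreal ((cmod c)\<^sup>2 * (\<bar>1 / ?a\<bar> * (\<bar>?a\<bar> / (?a\<^sup>2 + ?b\<^sup>2)))) * (\<integral>\<^sup>+z. f z \<partial>lborel)"
    using pos by (simp only: ennreal_mult' ennreal_mult'' mult.assoc zero_le_power2 divide_nonneg_nonneg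
        abs_ge_zero add_nonneg_nonneg mult_nonneg_nonneg)
  also have "(cmod c)\<^sup>2 * (\<bar>1 / ?a\<bar> * (\<bar>?a\<bar> / (?a\<^sup>2 + ?b\<^sup>2))) = 1"
    using c pos by (simp add: n2 abs_divide)
  finally show ?thesis by simp
qed

lemma nn_integral_complex_mult:
  assumes f[measurable]: "f \<in> borel_measurable borel" and c: "c \<noteq> 0"
  shows "(\<integral>\<^sup>+z. f z \<partial>lborel) = ennreal ((cmod c)\<^sup>2) * (\<integral>\<^sup>+z. f (c * z) \<partial>lborel)"
proof (cases "Re c = 0")
  case True
  \<comment> \<open>A purely imaginary factor is split into two factors with non-zero real part: for
    c = iy one has b = (y + iy) / 2.\<close>
  define b where "b = c / (1 + \<i>)"
  have nz: "1 + \<i> \<noteq> 0" by (simp add: complex_eq_iff)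
  have cb: "c = (1 + \<i>) * b" using nz by (simp add: b_def)
  have reb: "Re b \<noteq> 0"
    using True c by (simp add: b_def Re_divide complex_eq_iff power2_eq_square)
  have "(\<integral>\<^sup>+z. f z \<partial>lborel) = ennreal ((cmod (1 + \<i>))\<^sup>2) * (\<integral>\<^sup>+z. f ((1 + \<i>) * z) \<partial>lborel)"
    by (rule nn_integral_complex_mult_aux) auto
  also have "(\<integral>\<^sup>+z. f ((1 + \<i>) * z) \<partial>lborel) = ennreal ((cmod b)\<^sup>2) * (\<integral>\<^sup>+z. f ((1 + \<i>) * (b * z)) \<partial>lborel)"
    by (rule nn_integral_complex_mult_aux[OF _ reb]) auto
  finally show ?thesis
    by (simp add: cb norm_mult power_mult_distrib ennreal_mult' mult.assoc)
qed (rule nn_integral_complex_mult_aux, auto)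

subsection \<open>Integration over the unit disk\<close>

text \<open>The measure lives on the whole plane and its density vanishes off the disk, so functions
  never have to be restricted. As \<open>0 powr a = 0\<close> for every \<open>a\<close>, also for
  \<open>a = 0\<close>, the density vanishes at the origin too; this null set is why the puncture
  appears in almost-everywhere statements.\<close>

definition disk_measure :: "real \<Rightarrow> complex measure" where
  "disk_measure a = density lborel (\<lambda>w. indicator unit_disk w * ennreal (cmod w powr a))"

lemma sets_disk_measure [measurable_cong, simp]: "sets (disk_measure a) = sets borel"
  by (simp add: disk_measure_def)

lemma space_disk_measure [simp]: "space (disk_measure a) = UNIV"
  by (simp add: disk_measure_def)

lemma unit_disk_eq_ball: "unit_disk = ball 0 1"
  by (auto simp: unit_disk_def)

lemma unit_disk_borel [measurable]: "unit_disk \<in> sets borel"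
  by (simp add: unit_disk_eq_ball)

lemma nn_integral_disk_measure:
  assumes [measurable]: "f \<in> borel_measurable borel"
  shows "(\<integral>\<^sup>+w. f w \<partial>disk_measure a) = (\<integral>\<^sup>+w. indicator unit_disk w * ennreal (cmod w powr a) * f w \<partial>lborel)"
  unfolding disk_measure_def by (rule nn_integral_density) measurable

lemma AE_disk_measure_iff:
  "(AE w in disk_measure a. P w) \<longleftrightarrow> (AE w in lborel. w \<in> unit_disk \<longrightarrow> P w)"
proof -
  have "AE w in lborel. w \<noteq> (0::complex)" by (rule AE_lborel_singleton)
  hence "AE w in lborel. (w \<in> unit_disk \<longrightarrow> P w) \<longleftrightarrow> (0 < indicator unit_disk w * ennreal (cmod w powr a) \<longrightarrow> P w)"
    by eventually_elim (auto simp: indicator_def)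
  thus ?thesis unfolding disk_measure_def
    by (subst AE_density) (auto elim: AE_mp)
qed

lemma sigma_finite_disk_measure [simp]: "sigma_finite_measure (disk_measure a)"
  unfolding disk_measure_def
  by (subst sigma_finite_measure.sigma_finite_iff_density_finite[OF lborel.sigma_finite_measure_axioms])
     (auto simp: ennreal_mult_less_top indicator_def)

interpretation disk_measure: sigma_finite_measure "disk_measure a" for a
  by simp

lemma emeasure_restrict_density:
  assumes "A \<in> sets M" "B \<in> sets M"
  shows "emeasure (density M (indicator A)) B = emeasure M (A \<inter> B)"
proof -
  have "(\<lambda>x. indicator A x * indicator B x :: ennreal) = indicator (A \<inter> B)"
    by (auto simp: indicator_def)
  thus ?thesis using assms by (simp add: emeasure_density sets.Int)
qed

text \<open>Polar coordinates with the angle integrated out: the disk with squared radius u has area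
  \<pi> u. Two such measures agree once they agree, with finite values, on all half-lines.\<close>

lemma distr_disk_norm_square:
  "distr (density lborel (indicator unit_disk)) borel (\<lambda>w. (cmod w)\<^sup>2)
     = density lborel (\<lambda>u. ennreal pi * indicator {0<..<1::real} u)" (is "?M = ?N")
proof (rule measure_eqI_lessThan)
  fix x :: real
  have em: "emeasure ?M {x<..} = emeasure lborel (unit_disk \<inter> {w. x < (cmod w)\<^sup>2})"
  proof -
    have v: "(\<lambda>w::complex. (cmod w)\<^sup>2) -` {x<..} = {w. x < (cmod w)\<^sup>2}" by auto
    have [measurable]: "{w::complex. x < (cmod w)\<^sup>2} \<in> sets borel" by measurable
    show ?thesis
      by (subst emeasure_distr) (simp_all add: v emeasure_restrict_density)
  qed
  have en: "emeasure ?N {x<..} = ennreal pi * emeasure lborel ({x<..} \<inter> {0<..<1})"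
    by (subst emeasure_density)
       (auto simp: mult.assoc nn_integral_cmult nn_integral_indicator[symmetric] indicator_def
         simp del: nn_integral_indicator intro!: nn_integral_cong arg_cong[where f = "\<lambda>t. ennreal pi * t"])
  have ball: "emeasure lborel (ball (0::complex) r) = ennreal (pi * r\<^sup>2)" if "r \<ge> 0" for r
    using that by (simp add: emeasure_ball unit_ball_vol_2 eval_nat_numeral)
  have cball: "emeasure lborel (cball (0::complex) r) = ennreal (pi * r\<^sup>2)" if "r \<ge> 0" for r
    using that by (simp add: emeasure_cball unit_ball_vol_2 eval_nat_numeral)
  consider "x < 0" | "0 \<le> x" "x < 1" | "x \<ge> 1" by linarith
  hence "emeasure ?M {x<..} = emeasure ?N {x<..} \<and> emeasure ?M {x<..} < \<infinity>"
  proof cases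
    case 1
    have a: "unit_disk \<inter> {w. x < (cmod w)\<^sup>2} = ball 0 1"
      using 1 by (auto simp: unit_disk_eq_ball intro: less_le_trans)
    have b: "{x<..} \<inter> {0<..<1} = {0<..<1::real}" using 1 by auto
    show ?thesis unfolding em en a b by (simp add: ball)
  next
    case 2
    have a: "unit_disk \<inter> {w. x < (cmod w)\<^sup>2} = ball 0 1 - cball 0 (sqrt x)"
    proof -
      have eq: "x < (cmod w)\<^sup>2 \<longleftrightarrow> \<not> cmod w \<le> sqrt x" for w
        using real_sqrt_less_iff[of x "(cmod w)\<^sup>2"] by (auto simp: not_le)
      have "{w. x < (cmod w)\<^sup>2} = - cball 0 (sqrt x)"
        unfolding eq by auto
      thus ?thesis by (simp add: unit_disk_eq_ball Diff_eq)
    qed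
    have b: "{x<..} \<inter> {0<..<1} = {x<..<1::real}" using 2 by auto
    have "emeasure lborel (ball 0 1 - cball (0::complex) (sqrt x))
        = emeasure lborel (ball (0::complex) 1) - emeasure lborel (cball (0::complex) (sqrt x))"
      using 2 by (intro emeasure_Diff) (auto simp: cball cball_subset_ball_iff)
    also have "\<dots> = ennreal (pi - pi * x)"
      using 2 by (simp add: ball cball ennreal_minus)
    also have "\<dots> = ennreal pi * ennreal (1 - x)"
      using 2 by (simp add: ennreal_mult'[symmetric] algebra_simps)
    finally show ?thesis unfolding em en a b using 2 by (simp add: ennreal_mult_less_top)
  next
    case 3
    have a: "unit_disk \<inter> {w. x < (cmod w)\<^sup>2} = {}"
    proof -
      have "(cmod w)\<^sup>2 \<le> 1" if "cmod w < 1" for w :: complex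
        using that by (simp add: abs_square_le_1)
      thus ?thesis using 3 by (force simp: unit_disk_def)
    qed
    have b: "{x<..} \<inter> {0<..<1} = ({}::real set)" using 3 by auto
    show ?thesis unfolding em en a b by simp
  qed
  thus "emeasure ?M {x<..} < \<infinity>" "emeasure ?M {x<..} = emeasure ?N {x<..}" by auto
qed auto

lemma nn_integral_disk_radial:
  assumes [measurable]: "f \<in> borel_measurable borel"
  shows "(\<integral>\<^sup>+w. f ((cmod w)\<^sup>2) \<partial>disk_measure a)
     = ennreal pi * (\<integral>\<^sup>+u. indicator {0<..<1::real} u * ennreal (u powr (a / 2)) * f u \<partial>lborel)"
proof -
  have pw: "cmod w powr a = (cmod w)\<^sup>2 powr (a / 2)" for w :: complex
    by (cases "w = 0") (auto simp: powr_powr simp flip: powr_numeral)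
  have "(\<integral>\<^sup>+w. f ((cmod w)\<^sup>2) \<partial>disk_measure a)
      = (\<integral>\<^sup>+w. ennreal ((cmod w)\<^sup>2 powr (a / 2)) * f ((cmod w)\<^sup>2) \<partial>density lborel (indicator unit_disk))"
    by (subst nn_integral_disk_measure, measurable, subst nn_integral_density) (auto simp: pw mult.assoc)
  also have "\<dots> = (\<integral>\<^sup>+u. ennreal (u powr (a / 2)) * f u \<partial>distr (density lborel (indicator unit_disk)) borel (\<lambda>w. (cmod w)\<^sup>2))"
    by (subst nn_integral_distr) auto
  also have "\<dots> = (\<integral>\<^sup>+u. ennreal pi * (indicator {0<..<1::real} u * ennreal (u powr (a / 2)) * f u) \<partial>lborel)"
    unfolding distr_disk_norm_square
    by (subst nn_integral_density) (auto simp: mult.assoc)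
  also have "\<dots> = ennreal pi * (\<integral>\<^sup>+u. indicator {0<..<1::real} u * ennreal (u powr (a / 2)) * f u \<partial>lborel)"
    by (rule nn_integral_cmult) measurable
  finally show ?thesis .
qed

lemma nn_integral_disk_rotate:
  assumes [measurable]: "f \<in> borel_measurable borel" and c: "cmod c = 1"
  shows "(\<integral>\<^sup>+w. f (c * w) \<partial>disk_measure a) = (\<integral>\<^sup>+w. f w \<partial>disk_measure a)"
proof -
  have c0: "c \<noteq> 0" using c by auto
  have i: "indicator unit_disk (c * w) = (indicator unit_disk w :: ennreal)" for w
    using c by (simp add: indicator_def unit_disk_def norm_mult)
  show ?thesis
    using nn_integral_complex_mult[OF _ c0, of "\<lambda>w. indicator unit_disk w * ennreal (cmod w powr a) * f w"] c
    by (simp add: nn_integral_disk_measure i norm_mult)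
qed

subsection \<open>Hoelder's inequality and Schur's test\<close>

text \<open>The p-th power with the value \<open>top\<close> at \<open>top\<close>: inner integrals
  of kernel operators may be infinite before an estimate shows that they are not.\<close>

definition epow :: "real \<Rightarrow> ennreal \<Rightarrow> ennreal" where
  "epow p x = (if x = top then top else ennreal (enn2real x powr p))"

lemma epow_ennreal: "0 \<le> r \<Longrightarrow> epow p (ennreal r) = ennreal (r powr p)"
  by (simp add: epow_def)

lemma epow_top [simp]: "epow p top = top"
  by (simp add: epow_def)

lemma epow_mono:
  assumes "0 \<le> p" "x \<le> y"
  shows "epow p x \<le> epow p y"
proof (cases "y = top")
  case False
  hence "x \<noteq> top" using assms by (auto simp: top_unique)
  with False show ?thesis
    using assms by (auto simp: epow_def less_top intro!: ennreal_leI powr_mono2 enn2real_mono)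
qed simp

lemma measurable_epow [measurable]: "epow p \<in> borel_measurable borel"
  unfolding epow_def by measurable

text \<open>Young's inequality for l f and g / l is integrated and l is optimised. Only an upper
  bound \<open>B\<close> of the q-th integral enters, so that it can be taken positive and replaced
  by the bound of a Schur test.\<close>

lemma nn_integral_Hoelder:
  fixes f g :: "'a \<Rightarrow> real"
  assumes pq: "p > 1" "q > 1" "1 / p + 1 / q = 1"
    and f [measurable]: "f \<in> borel_measurable M" and f0: "\<And>x. f x \<ge> 0"
    and g [measurable]: "g \<in> borel_measurable M" and g0: "\<And>x. g x \<ge> 0"
    and B: "B > 0" "(\<integral>\<^sup>+x. ennreal (g x powr q) \<partial>M) \<le> ennreal B"
  shows "epow p (\<integral>\<^sup>+x. ennreal (f x * g x) \<partial>M) \<le> (\<integral>\<^sup>+x. ennreal (f x powr p) \<partial>M) * ennreal (B powr (p - 1))"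
proof (cases "(\<integral>\<^sup>+x. ennreal (f x powr p) \<partial>M)" rule: ennreal_cases)
  case top
  thus ?thesis using B by (simp add: ennreal_top_mult)
next
  case (real A)
  have young: "(\<integral>\<^sup>+x. ennreal (f x * g x) \<partial>M) \<le> ennreal (l powr p * A / p + l powr (- q) * B / q)" if l: "l > 0" for l
  proof -
    have pt: "f x * g x \<le> l powr p / p * f x powr p + l powr (- q) / q * g x powr q" for x
      using Youngs_inequality[OF pq, of "l * f x" "g x / l"] l f0[of x] g0[of x]
      by (simp add: powr_mult powr_divide powr_minus field_simps)
    have "(\<integral>\<^sup>+x. ennreal (f x * g x) \<partial>M)
       \<le> (\<integral>\<^sup>+x. ennreal (l powr p / p) * ennreal (f x powr p) + ennreal (l powr (- q) / q) * ennreal (g x powr q) \<partial>M)"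
      using pq pt by (intro nn_integral_mono) (simp add: ennreal_mult'[symmetric] ennreal_plus[symmetric] ennreal_leI del: ennreal_plus)
    also have "\<dots> = ennreal (l powr p / p) * (\<integral>\<^sup>+x. ennreal (f x powr p) \<partial>M)
        + ennreal (l powr (- q) / q) * (\<integral>\<^sup>+x. ennreal (g x powr q) \<partial>M)"
      by (subst nn_integral_add) (auto simp: nn_integral_cmult)
    also have "\<dots> \<le> ennreal (l powr p / p) * ennreal A + ennreal (l powr (- q) / q) * ennreal B"
      using B real by (intro add_mono mult_left_mono) auto
    also have "\<dots> = ennreal (l powr p * A / p + l powr (- q) * B / q)"
      using pq real B by (simp add: ennreal_mult'[symmetric] ennreal_plus[symmetric] del: ennreal_plus)
    finally show ?thesis .
  qed
  show ?thesis
  proof (cases "A = 0")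
    case True
    hence "AE x in M. ennreal (f x powr p) = 0"
      using real by (subst nn_integral_0_iff_AE[symmetric]) auto
    hence "AE x in M. ennreal (f x * g x) = 0"
    proof eventually_elim
      fix x assume "ennreal (f x powr p) = 0"
      hence "f x = 0" using f0[of x] by (simp add: ennreal_eq_0_iff)
      thus "ennreal (f x * g x) = 0" by simp
    qed
    hence "(\<integral>\<^sup>+x. ennreal (f x * g x) \<partial>M) = 0"
      by (subst nn_integral_0_iff_AE) auto
    thus ?thesis by (simp add: epow_def)
  next
    case False
    hence A: "A > 0" using real by auto
    have pq': "p + q = p * q" using pq by (simp add: field_simps)
    \<comment> \<open>This l balances the two terms of \<open>young\<close>: both l^p A and l^(-q) B
      become A^(1/p) B^(1/q).\<close>
    define l where "l = (B / A) powr (1 / (p * q))"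
    have l: "l > 0" using A B by (simp add: l_def)
    have lp: "l powr p * A = A powr (1 / p) * B powr (1 / q)"
    proof -
      have "l powr p = (B / A) powr (1 / q)" using pq by (simp add: l_def powr_powr)
      also have "\<dots> * A = B powr (1/q) * (A powr 1 / A powr (1 / q))"
        using A B by (simp add: powr_divide)
      also have "A powr 1 / A powr (1 / q) = A powr (1 - 1 / q)" by (rule powr_diff[symmetric])
      also have "1 - 1 / q = 1 / p" using pq by linarith
      finally show ?thesis by simp
    qed
    have lq: "l powr (- q) * B = A powr (1 / p) * B powr (1 / q)"
    proof -
      have "l powr (- q) = (B / A) powr (- (1 / p))" using pq by (simp add: l_def powr_powr)
      also have "\<dots> * B = A powr (1 / p) * (B powr 1 / B powr (1 / p))"
        using A B by (simp add: powr_divide powr_minus field_simps)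
      also have "B powr 1 / B powr (1 / p) = B powr (1 - 1 / p)" by (rule powr_diff[symmetric])
      also have "1 - 1 / p = 1 / q" using pq by linarith
      finally show ?thesis by simp
    qed
    have "l powr p * A / p + l powr (- q) * B / q = A powr (1 / p) * B powr (1 / q) * (1 / p + 1 / q)"
      unfolding lp lq by (simp add: distrib_left)
    hence "(\<integral>\<^sup>+x. ennreal (f x * g x) \<partial>M) \<le> ennreal (A powr (1 / p) * B powr (1 / q))"
      using young[OF l] pq(3) by simp
    hence "epow p (\<integral>\<^sup>+x. ennreal (f x * g x) \<partial>M) \<le> epow p (ennreal (A powr (1 / p) * B powr (1 / q)))"
      using pq by (intro epow_mono) auto
    also have "\<dots> = ennreal (A * B powr (p / q))"
      using pq A by (simp add: epow_ennreal powr_mult powr_powr)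
    also have "p / q = p - 1" using pq by (simp add: field_simps)
    finally show ?thesis using real A B by (simp add: ennreal_mult')
  qed
qed

text \<open>For fixed x, Hoelder with respect to the measure k(x, y) dM(y) is applied to f = (f /
  \<phi>) \<phi>. The row bound controls the factor \<phi>; after exchanging the integrals the
  column bound gives \<phi>(y)^p back and cancels the quotient.\<close>

lemma schur_test:
  fixes k :: "'a \<Rightarrow> 'a \<Rightarrow> real" and \<phi> f :: "'a \<Rightarrow> real"
  assumes M: "sigma_finite_measure M"
    and pq: "p > 1" "q > 1" "1 / p + 1 / q = 1"
    and k [measurable]: "case_prod k \<in> borel_measurable (M \<Otimes>\<^sub>M M)" and k0: "\<And>x y. k x y \<ge> 0"
    and phi [measurable]: "\<phi> \<in> borel_measurable M" and phi0: "\<And>x. \<phi> x > 0"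
    and f [measurable]: "f \<in> borel_measurable M" and f0: "\<And>x. f x \<ge> 0"
    and C: "C > 0"
    and row: "AE x in M. (\<integral>\<^sup>+y. ennreal (k x y * \<phi> y powr q) \<partial>M) \<le> ennreal (C * \<phi> x powr q)"
    and col: "AE y in M. (\<integral>\<^sup>+x. ennreal (k x y * \<phi> x powr p) \<partial>M) \<le> ennreal (C * \<phi> y powr p)"
  shows "(\<integral>\<^sup>+x. epow p (\<integral>\<^sup>+y. ennreal (k x y * f y) \<partial>M) \<partial>M) \<le> ennreal (C powr p) * (\<integral>\<^sup>+x. ennreal (f x powr p) \<partial>M)"
proof -
  interpret M: sigma_finite_measure M by (rule M)
  interpret MM: pair_sigma_finite M M by unfold_locales
  have pq': "(p - 1) * q = p" using pq by (simp add: field_simps)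
  have kx [measurable]: "(\<lambda>y. k x y) \<in> borel_measurable M" if "x \<in> space M" for x
    using measurable_Pair2[OF k that] by simp
  have 1: "AE x in M. epow p (\<integral>\<^sup>+y. ennreal (k x y * f y) \<partial>M)
      \<le> (\<integral>\<^sup>+y. ennreal (C powr (p - 1) * (k x y * (\<phi> x powr p * (f y / \<phi> y) powr p))) \<partial>M)"
    using row
  proof (rule AE_mp, intro AE_I2 impI)
    fix x assume x: "x \<in> space M" and r: "(\<integral>\<^sup>+y. ennreal (k x y * \<phi> y powr q) \<partial>M) \<le> ennreal (C * \<phi> x powr q)"
    note [measurable] = kx[OF x]
    let ?K = "density M (\<lambda>y. ennreal (k x y))"
    have "epow p (\<integral>\<^sup>+y. ennreal (k x y * f y) \<partial>M) = epow p (\<integral>\<^sup>+y. ennreal (f y / \<phi> y * \<phi> y) \<partial>?K)"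
      using phi0 k0 f0 by (subst nn_integral_density) (auto simp: ennreal_mult'[symmetric] less_imp_neq[THEN not_sym])
    also have "\<dots> \<le> (\<integral>\<^sup>+y. ennreal ((f y / \<phi> y) powr p) \<partial>?K) * ennreal ((C * \<phi> x powr q) powr (p - 1))"
    proof (rule nn_integral_Hoelder[OF pq])
      show "(\<integral>\<^sup>+y. ennreal (\<phi> y powr q) \<partial>?K) \<le> ennreal (C * \<phi> x powr q)"
        using r k0 by (subst nn_integral_density) (auto simp: ennreal_mult'[symmetric])
      show "0 < C * \<phi> x powr q" using phi0[of x] C by simp
    qed (use phi0 f0 less_imp_le[OF phi0] in auto)
    \<comment> \<open>As (p - 1) q = p, the row bound contributes C^(p - 1) \<phi>(x)^p; the column
      bound adds the last factor C.\<close>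
    also have "(C * \<phi> x powr q) powr (p - 1) = C powr (p - 1) * \<phi> x powr p"
      using C pq' by (simp add: powr_mult powr_powr mult.commute)
    also have "(\<integral>\<^sup>+y. ennreal ((f y / \<phi> y) powr p) \<partial>?K) * ennreal (C powr (p - 1) * \<phi> x powr p)
       = (\<integral>\<^sup>+y. ennreal (C powr (p - 1) * (k x y * (\<phi> x powr p * (f y / \<phi> y) powr p))) \<partial>M)"
      using k0 by (subst nn_integral_density, simp_all, subst nn_integral_multc[symmetric], simp_all)
         (auto intro!: nn_integral_cong simp: ennreal_mult'[symmetric] algebra_simps)
    finally show "epow p (\<integral>\<^sup>+y. ennreal (k x y * f y) \<partial>M)
      \<le> (\<integral>\<^sup>+y. ennreal (C powr (p - 1) * (k x y * (\<phi> x powr p * (f y / \<phi> y) powr p))) \<partial>M)" .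
  qed
  have "(\<integral>\<^sup>+x. epow p (\<integral>\<^sup>+y. ennreal (k x y * f y) \<partial>M) \<partial>M)
     \<le> (\<integral>\<^sup>+x. \<integral>\<^sup>+y. ennreal (C powr (p - 1) * (k x y * (\<phi> x powr p * (f y / \<phi> y) powr p))) \<partial>M \<partial>M)"
    by (rule nn_integral_mono_AE[OF 1])
  also have "\<dots> = (\<integral>\<^sup>+y. \<integral>\<^sup>+x. ennreal (C powr (p - 1) * (k x y * (\<phi> x powr p * (f y / \<phi> y) powr p))) \<partial>M \<partial>M)"
    by (rule MM.Fubini'[symmetric]) measurable
  also have "\<dots> \<le> (\<integral>\<^sup>+y. ennreal (C powr p) * ennreal (f y powr p) \<partial>M)"
    using col
  proof (intro nn_integral_mono_AE, elim AE_mp, intro AE_I2 impI)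
    fix y assume y: "y \<in> space M" and r: "(\<integral>\<^sup>+x. ennreal (k x y * \<phi> x powr p) \<partial>M) \<le> ennreal (C * \<phi> y powr p)"
    have [measurable]: "(\<lambda>x. k x y) \<in> borel_measurable M"
      using measurable_Pair1[OF k y] by simp
    have "(\<integral>\<^sup>+x. ennreal (C powr (p - 1) * (k x y * (\<phi> x powr p * (f y / \<phi> y) powr p))) \<partial>M)
       = (\<integral>\<^sup>+x. ennreal (C powr (p - 1) * (f y / \<phi> y) powr p) * ennreal (k x y * \<phi> x powr p) \<partial>M)"
      using k0 by (intro nn_integral_cong) (simp add: ennreal_mult'[symmetric] algebra_simps)
    also have "\<dots> = ennreal (C powr (p - 1) * (f y / \<phi> y) powr p) * (\<integral>\<^sup>+x. ennreal (k x y * \<phi> x powr p) \<partial>M)"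
      by (subst nn_integral_cmult) auto
    also have "\<dots> \<le> ennreal (C powr (p - 1) * (f y / \<phi> y) powr p) * ennreal (C * \<phi> y powr p)"
      by (rule mult_left_mono[OF r]) simp
    also have "\<dots> = ennreal (C powr (p - 1) * C * ((f y / \<phi> y) powr p * \<phi> y powr p))"
      using C by (simp add: ennreal_mult'[symmetric] algebra_simps)
    also have "(f y / \<phi> y) powr p * \<phi> y powr p = f y powr p"
      using phi0[of y] f0[of y] by (simp add: powr_divide)
    also have "C powr (p - 1) * C = C powr p" using C by (simp add: powr_diff)
    finally show "(\<integral>\<^sup>+x. ennreal (C powr (p - 1) * (k x y * (\<phi> x powr p * (f y / \<phi> y) powr p))) \<partial>M)
       \<le> ennreal (C powr p) * ennreal (f y powr p)" using C by (simp add: ennreal_mult')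
  qed
  also have "\<dots> = ennreal (C powr p) * (\<integral>\<^sup>+x. ennreal (f x powr p) \<partial>M)"
    by (rule nn_integral_cmult) auto
  finally show ?thesis .
qed

lemma powr_norm_integral_le_epow:
  fixes F :: "'a \<Rightarrow> complex"
  assumes "p \<ge> 0"
  shows "ennreal (cmod (integral\<^sup>L M F) powr p) \<le> epow p (\<integral>\<^sup>+x. ennreal (cmod (F x)) \<partial>M)"
proof -
  have "ennreal (cmod (integral\<^sup>L M F)) \<le> (\<integral>\<^sup>+x. ennreal (cmod (F x)) \<partial>M)"
  proof (cases "integrable M F")
    case True
    thus ?thesis by (rule integral_norm_bound_ennreal)
  qed (simp add: not_integrable_integral_eq)
  hence "epow p (ennreal (cmod (integral\<^sup>L M F))) \<le> epow p (\<integral>\<^sup>+x. ennreal (cmod (F x)) \<partial>M)"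
    by (rule epow_mono[OF assms])
  thus ?thesis by (simp add: epow_ennreal)
qed

subsection \<open>Circle means\<close>

text \<open>The angle runs over [0, 1] to match the parametrisation of
  \<open>circlepath\<close>.\<close>

definition rot :: "real \<Rightarrow> complex" where
  "rot t = exp (2 * of_real pi * \<i> * of_real t)"

lemma norm_rot [simp]: "cmod (rot t) = 1"
  by (simp add: rot_def norm_exp_eq_Re)

lemma continuous_on_rot [continuous_intros]: "continuous_on S rot"
  unfolding rot_def by (intro continuous_intros)

lemma measurable_rot [measurable]: "rot \<in> borel_measurable borel"
  by (intro borel_measurable_continuous_onI continuous_on_rot)

lemma one_minus_mult_cnj_neq_0: "cmod z < 1 \<Longrightarrow> cmod w < 1 \<Longrightarrow> 1 - z * cnj w \<noteq> 0"
  by (metis complex_mod_cnj eq_iff_diff_eq_0 less_irrefl mult_strict_mono' norm_ge_zero norm_mult norm_one mult_1)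

text \<open>On the circle \<open>|u| = r\<close> the conjugate of \<open>u\<close> is \<open>r\<^sup>2 / u\<close>, so the means below are Cauchy integrals
  over that circle.\<close>

lemma circle_mean_power:
  fixes z w :: complex
  assumes h: "h holomorphic_on unit_disk" and z: "cmod z < 1" and w: "cmod w < 1" and w0: "w \<noteq> 0"
  shows "((\<lambda>t. h (rot t * w) * (1 / (1 - z * cnj (rot t * w))) ^ Suc k) has_integral
           ((deriv ^^ k) (\<lambda>u. h (u * (w / cmod w)) * u ^ k) ((cmod w)\<^sup>2 * (z * cnj (w / cmod w))) / fact k)) {0..1}"
proof -
  define r c where "r = cmod w" and "c = w / of_real (cmod w)"
  define a where "a = of_real (r\<^sup>2) * (z * cnj c)"
  \<comment> \<open>With w = r c and u = r \<open>rot t\<close>, the quantity 1 - z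
    cnj(\<open>rot t\<close> w) equals (u - a) / u. Its inverse to the power k + 1 therefore carries
    u^(k + 1); one factor u is absorbed by du and the remaining u^k goes into
    \<open>f\<close>.\<close>
  define f where "f = (\<lambda>u. h (u * c) * u ^ k)"
  have r: "0 < r" "r < 1" using w w0 by (auto simp: r_def)
  have c: "cmod c = 1" "of_real r * c = w" using w0 by (auto simp: c_def r_def norm_divide)
  have ccnj: "c * cnj c = 1" using c(1) by (simp add: complex_norm_square[symmetric])
  have sub: "(\<lambda>u. u * c) ` cball 0 r \<subseteq> unit_disk"
    using r c by (auto simp: unit_disk_def norm_mult)
  have "(h \<circ> (\<lambda>u. u * c)) holomorphic_on cball 0 r"
    by (rule holomorphic_on_compose[OF _ holomorphic_on_subset[OF h sub]]) (intro holomorphic_intros)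
  hence f: "f holomorphic_on cball 0 r"
    unfolding f_def o_def by (intro holomorphic_intros)
  have "cmod a < r"
  proof -
    have "cmod a = r * (r * cmod z)" using r c by (simp add: a_def norm_mult power2_eq_square)
    also have "r * cmod z < 1 * 1" using r z by (intro mult_strict_mono') auto
    hence "r * (r * cmod z) < r * 1" using r by (intro mult_strict_left_mono) auto
    finally show ?thesis by simp
  qed
  hence "((\<lambda>u. f u / (u - a) ^ Suc k) has_contour_integral (2 * pi * \<i> / fact k * (deriv ^^ k) f a)) (circlepath 0 r)"
    using f by (intro Cauchy_has_contour_integral_higher_derivative_circlepath holomorphic_on_imp_continuous_on)
      (auto intro: holomorphic_on_subset)
  hence "((\<lambda>t. f (circlepath 0 r t) / (circlepath 0 r t - a) ^ Suc k *
        vector_derivative (circlepath 0 r) (at t within {0..1}))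
      has_integral (2 * pi * \<i> / fact k * (deriv ^^ k) f a)) {0..1}"
    by (simp only: has_contour_integral_def)
  moreover have "circlepath 0 r t = r * rot t" for t by (simp add: circlepath rot_def)
  moreover have "vector_derivative (circlepath 0 r) (at t within {0..1}) = 2 * pi * \<i> * r * rot t"
    if "t \<in> {0..1}" for t using that by (simp add: vector_derivative_circlepath01 rot_def)
  ultimately have "((\<lambda>t. f (r * rot t) / (r * rot t - a) ^ Suc k * (2 * pi * \<i> * r * rot t))
      has_integral (2 * pi * \<i> / fact k * (deriv ^^ k) f a)) {0..1}"
    by (simp only: cong: has_integral_cong)
  from has_integral_mult_right[OF this, of "1 / (2 * pi * \<i>)"]
  have 1: "((\<lambda>t. 1 / (2 * pi * \<i>) * (f (r * rot t) / (r * rot t - a) ^ Suc k * (2 * pi * \<i> * r * rot t)))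
      has_integral ((deriv ^^ k) f a / fact k)) {0..1}"
    by (rule has_integral_eq_rhs) simp
  have 2: "1 / (2 * pi * \<i>) * (f (r * rot t) / (r * rot t - a) ^ Suc k * (2 * pi * \<i> * r * rot t))
      = h (rot t * w) * (1 / (1 - z * cnj (rot t * w))) ^ Suc k" for t
  proof -
    have e1: "rot t * cnj (rot t) = 1" by (simp add: complex_norm_square[symmetric])
    have e2: "r * rot t * c = rot t * w" using c by (simp add: mult.commute mult.left_commute)
    have eq: "r * rot t - a = r * rot t * (1 - z * cnj (rot t * w))"
    proof -
      have "r * rot t * (z * cnj (rot t * w)) = of_real r * (rot t * cnj (rot t)) * z * cnj (of_real r * c)"
        unfolding c(2) by simp
      also have "\<dots> = a" by (simp add: e1 a_def power2_eq_square)
      finally show ?thesis by (simp add: algebra_simps)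
    qed
    have "rot t \<noteq> 0" using norm_rot[of t] by (metis norm_zero zero_neq_one)
    moreover have "1 - z * cnj (rot t * w) \<noteq> 0"
      using z w by (intro one_minus_mult_cnj_neq_0) (auto simp: norm_mult)
    ultimately show ?thesis
      unfolding eq f_def e2 using r by (simp add: power_mult_distrib power_divide)
  qed
  show ?thesis
    using 1 unfolding 2 by (simp add: f_def a_def c_def r_def)
qed

lemma holomorphic_unit_disk_deriv:
  assumes "h holomorphic_on unit_disk" "cmod u < 1"
  shows "(h has_field_derivative deriv h u) (at u)"
  using assms by (intro holomorphic_derivI[of h unit_disk]) (auto simp: unit_disk_eq_ball)

lemma norm_square_mult_less:
  fixes z w :: complex
  shows "cmod z < 1 \<Longrightarrow> cmod w < 1 \<Longrightarrow> cmod ((cmod w)\<^sup>2 * z) < 1"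
proof -
  assume "cmod z < 1" "cmod w < 1"
  hence "(cmod w)\<^sup>2 \<le> 1" by (simp add: abs_square_le_1)
  hence "(cmod w)\<^sup>2 * cmod z \<le> 1 * cmod z" by (intro mult_right_mono) auto
  thus ?thesis using \<open>cmod z < 1\<close> by (simp add: norm_mult norm_power)
qed

lemma circle_mean_1:
  fixes z w :: complex
  assumes h: "h holomorphic_on unit_disk" and z: "cmod z < 1" and w: "cmod w < 1"
  shows "((\<lambda>t. h (rot t * w) * (1 / (1 - z * cnj (rot t * w)))) has_integral h ((cmod w)\<^sup>2 * z)) {0..1}"
proof (cases "w = 0")
  case True
  thus ?thesis using has_integral_const_real[of "h 0" 0 1] by simp
next
  case False
  have c: "cnj (w / cmod w) * (w / cmod w) = 1"
    using False by (simp add: complex_norm_square[symmetric] power2_eq_square mult.commute)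
  have "(cmod w)\<^sup>2 * (z * cnj (w / cmod w)) * (w / cmod w) = (cmod w)\<^sup>2 * z"
    using c by (simp add: mult.assoc)
  thus ?thesis using circle_mean_power[OF h z w False, of 0] by simp
qed

text \<open>The case k = 1 of the Cauchy integral: the derivative of h(uc) u is evaluated where uc =
  x. The point w = 0 is treated apart because it has no direction c = w / |w|.\<close>

lemma circle_mean_2:
  fixes z w :: complex
  assumes h: "h holomorphic_on unit_disk" and z: "cmod z < 1" and w: "cmod w < 1"
  defines "x \<equiv> of_real ((cmod w)\<^sup>2) * z"
  shows "((\<lambda>t. h (rot t * w) * (1 / (1 - z * cnj (rot t * w)))\<^sup>2) has_integral h x + x * deriv h x) {0..1}"
proof (cases "w = 0")
  case True
  thus ?thesis using has_integral_const_real[of "h 0" 0 1] by (simp add: x_def)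
next
  case False
  define c where "c = w / of_real (cmod w)"
  have cc: "cnj c * c = 1"
    using False by (simp add: c_def complex_norm_square[symmetric] power2_eq_square mult.commute)
  have xc: "x * cnj c * c = x" using cc by (simp add: mult.assoc)
  have x1: "cmod x < 1" unfolding x_def using norm_square_mult_less[OF z w] by simp
  have d: "(h has_field_derivative deriv h x) (at (x * cnj c * c))"
    unfolding xc by (rule holomorphic_unit_disk_deriv[OF h x1])
  have "((\<lambda>u. h (u * c)) has_field_derivative (deriv h x * c)) (at (x * cnj c))"
    by (rule DERIV_chain2[where f = h and g = "\<lambda>u. u * c", OF d]) (auto intro!: derivative_eq_intros)
  hence "((\<lambda>u. h (u * c) * u) has_field_derivative (deriv h x * c * (x * cnj c) + h (x * cnj c * c))) (at (x * cnj c))"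
    by (auto intro!: derivative_eq_intros)
  hence "deriv (\<lambda>u. h (u * c) * u) (x * cnj c) = deriv h x * c * (x * cnj c) + h (x * cnj c * c)"
    by (rule DERIV_imp_deriv)
  also have "\<dots> = deriv h x * (x * cnj c * c) + h (x * cnj c * c)"
    by (simp add: ac_simps)
  also have "\<dots> = h x + x * deriv h x" unfolding xc by (simp add: ac_simps)
  finally have "deriv (\<lambda>u. h (u * c) * u) (x * cnj c) = h x + x * deriv h x" .
  thus ?thesis using circle_mean_power[OF h z w False, of 1]
    by (simp add: x_def c_def power2_eq_square mult.assoc)
qed

subsection \<open>Averaging over rotations\<close>

text \<open>The image of \<open>disk_measure a\<close> under the squared modulus, which is why the
  exponent is halved and \<pi> appears.\<close>

definition radial_measure :: "real \<Rightarrow> real measure" where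
  "radial_measure a = density lborel (\<lambda>u. ennreal (pi * u powr (a / 2)) * indicator {0<..<1} u)"

lemma sets_radial_measure [measurable_cong, simp]: "sets (radial_measure a) = sets borel"
  by (simp add: radial_measure_def)

lemma space_radial_measure [simp]: "space (radial_measure a) = UNIV"
  by (simp add: radial_measure_def)

lemma distr_disk_measure_norm_square:
  "distr (disk_measure a) borel (\<lambda>w. (cmod w)\<^sup>2) = radial_measure a"
proof (rule measure_eqI)
  fix A :: "real set" assume "A \<in> sets (distr (disk_measure a) borel (\<lambda>w. (cmod w)\<^sup>2))"
  hence A [measurable]: "A \<in> sets borel" by simp
  have "emeasure (distr (disk_measure a) borel (\<lambda>w. (cmod w)\<^sup>2)) A
     = (\<integral>\<^sup>+u. indicator A u \<partial>distr (disk_measure a) borel (\<lambda>w. (cmod w)\<^sup>2))" by simp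
  also have "\<dots> = (\<integral>\<^sup>+w. indicator A ((cmod w)\<^sup>2) \<partial>disk_measure a)"
    by (subst nn_integral_distr) auto
  also have "\<dots> = ennreal pi * (\<integral>\<^sup>+u. indicator {0<..<1::real} u * ennreal (u powr (a / 2)) * indicator A u \<partial>lborel)"
    by (rule nn_integral_disk_radial) measurable
  also have "\<dots> = (\<integral>\<^sup>+u. ennreal (pi * u powr (a / 2)) * indicator {0<..<1} u * indicator A u \<partial>lborel)"
    by (subst nn_integral_cmult[symmetric]) (auto intro!: nn_integral_cong simp: ennreal_mult' ac_simps)
  also have "\<dots> = emeasure (radial_measure a) A"
    unfolding radial_measure_def by (subst emeasure_density) auto
  finally show "emeasure (distr (disk_measure a) borel (\<lambda>w. (cmod w)\<^sup>2)) A = emeasure (radial_measure a) A" .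
qed simp

lemma distr_disk_measure_rotate:
  assumes "cmod c = 1"
  shows "distr (disk_measure a) borel ((*) c) = disk_measure a"
proof (rule measure_eqI)
  fix A assume "A \<in> sets (distr (disk_measure a) borel ((*) c))"
  hence A [measurable]: "A \<in> sets borel" by simp
  have "emeasure (distr (disk_measure a) borel ((*) c)) A = (\<integral>\<^sup>+u. indicator A u \<partial>distr (disk_measure a) borel ((*) c))"
    by simp
  also have "\<dots> = (\<integral>\<^sup>+w. indicator A (c * w) \<partial>disk_measure a)" by (subst nn_integral_distr) auto
  also have "\<dots> = (\<integral>\<^sup>+w. indicator A w \<partial>disk_measure a)"
    using assms by (intro nn_integral_disk_rotate) auto
  finally show "emeasure (distr (disk_measure a) borel ((*) c)) A = emeasure (disk_measure a) A" by simp
qed simp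

definition circle_measure :: "real measure" where
  "circle_measure = density lborel (indicator {0..1})"

lemma sets_circle_measure [measurable_cong, simp]: "sets circle_measure = sets borel"
  by (simp add: circle_measure_def)

lemma space_circle_measure [simp]: "space circle_measure = UNIV"
  by (simp add: circle_measure_def)

lemma emeasure_circle_measure: "emeasure circle_measure UNIV = 1"
  unfolding circle_measure_def by (subst emeasure_restrict_density) auto

lemma finite_circle_measure: "finite_measure circle_measure"
  by (rule finite_measureI) (simp add: emeasure_circle_measure)

interpretation circle_measure: finite_measure circle_measure
  by (rule finite_circle_measure)

interpretation disk_circle: pair_sigma_finite "disk_measure a" circle_measure for a
  by unfold_locales

lemma nn_integral_disk_average:
  assumes [measurable]: "F \<in> borel_measurable borel"
  shows "(\<integral>\<^sup>+w. F w \<partial>disk_measure a) = (\<integral>\<^sup>+w. \<integral>\<^sup>+t. F (rot t * w) \<partial>circle_measure \<partial>disk_measure a)"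
proof -
  have "(\<integral>\<^sup>+w. \<integral>\<^sup>+t. F (rot t * w) \<partial>circle_measure \<partial>disk_measure a)
      = (\<integral>\<^sup>+t. \<integral>\<^sup>+w. F (rot t * w) \<partial>disk_measure a \<partial>circle_measure)"
    by (rule disk_circle.Fubini'[symmetric]) measurable
  also have "\<dots> = (\<integral>\<^sup>+t. (\<integral>\<^sup>+w. F w \<partial>disk_measure a) \<partial>circle_measure)"
    by (intro nn_integral_cong nn_integral_disk_rotate) auto
  also have "\<dots> = (\<integral>\<^sup>+w. F w \<partial>disk_measure a)" by (simp add: emeasure_circle_measure)
  finally show ?thesis by simp
qed

lemma integral_circle_measure_has_integral:
  fixes f :: "real \<Rightarrow> complex"
  assumes "continuous_on {0..1} f" "(f has_integral I) {0..1}" "f \<in> borel_measurable borel"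
  shows "integral\<^sup>L circle_measure f = I"
proof -
  have s: "set_integrable lborel {0..1} f"
    unfolding set_integrable_def by (rule borel_integrable_compact) (use assms in auto)
  have "integral\<^sup>L circle_measure f = integral\<^sup>L (density lborel (\<lambda>x. ennreal (indicator {0..1} x))) f"
    by (simp add: circle_measure_def ennreal_indicator)
  also have "\<dots> = set_lebesgue_integral lborel {0..1} f"
    using assms(3) unfolding set_lebesgue_integral_def by (intro integral_density) auto
  also have "\<dots> = I" using set_borel_integral_eq_integral(2)[OF s] assms(2) by (simp add: integral_unique)
  finally show ?thesis .
qed

text \<open>Rotation invariance allows \<open>F\<close> to be replaced by its mean over all
  rotations, by Fubini the mean over each circle. By assumption that mean is a function \<Psi> of
  the squared modulus, so the integral becomes one-dimensional.\<close>

lemma disk_integral_average: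
  fixes F :: "complex \<Rightarrow> complex"
  assumes F: "integrable (disk_measure a) F" and cont: "\<And>w. cmod w < 1 \<Longrightarrow> continuous_on {0..1} (\<lambda>t. F (rot t * w))"
    and mean: "\<And>w. cmod w < 1 \<Longrightarrow> ((\<lambda>t. F (rot t * w)) has_integral \<Psi> ((cmod w)\<^sup>2)) {0..1}"
    and [measurable]: "\<Psi> \<in> borel_measurable borel"
  shows "integrable (radial_measure a) \<Psi>" "integral\<^sup>L (disk_measure a) F = integral\<^sup>L (radial_measure a) \<Psi>"
proof -
  have Fm [measurable]: "F \<in> borel_measurable borel"
    using borel_measurable_integrable[OF F] by simp
  have fin: "(\<integral>\<^sup>+w. norm (F w) \<partial>disk_measure a) < \<infinity>"
    using F by (simp add: integrable_iff_bounded)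
  have int: "integrable (disk_measure a \<Otimes>\<^sub>M circle_measure) (\<lambda>(w, t). F (rot t * w))"
  proof (rule integrableI_bounded)
    have "(\<integral>\<^sup>+x. norm (case x of (w, t) \<Rightarrow> F (rot t * w)) \<partial>(disk_measure a \<Otimes>\<^sub>M circle_measure))
       = (\<integral>\<^sup>+w. \<integral>\<^sup>+t. norm (F (rot t * w)) \<partial>circle_measure \<partial>disk_measure a)"
      by (subst circle_measure.nn_integral_fst[symmetric]) auto
    also have "\<dots> = (\<integral>\<^sup>+w. norm (F w) \<partial>disk_measure a)"
      by (rule nn_integral_disk_average[symmetric]) measurable
    finally show "(\<integral>\<^sup>+x. norm (case x of (w, t) \<Rightarrow> F (rot t * w)) \<partial>(disk_measure a \<Otimes>\<^sub>M circle_measure)) < \<infinity>"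
      using fin by simp
  qed measurable
  have "(\<integral>w. \<integral>t. F (rot t * w) \<partial>circle_measure \<partial>disk_measure a)
      = (\<integral>t. \<integral>w. F (rot t * w) \<partial>disk_measure a \<partial>circle_measure)"
    by (rule disk_circle.Fubini_integral[symmetric, OF int])
  also have "\<dots> = (\<integral>t. integral\<^sup>L (disk_measure a) F \<partial>circle_measure)"
  proof (rule Bochner_Integration.integral_cong[OF refl])
    fix t
    have "integral\<^sup>L (disk_measure a) F = integral\<^sup>L (distr (disk_measure a) borel ((*) (rot t))) F"
      by (simp add: distr_disk_measure_rotate)
    also have "\<dots> = (\<integral>w. F (rot t * w) \<partial>disk_measure a)" by (rule integral_distr) auto
    finally show "(\<integral>w. F (rot t * w) \<partial>disk_measure a) = integral\<^sup>L (disk_measure a) F" by simp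
  qed
  also have "\<dots> = integral\<^sup>L (disk_measure a) F"
    by (simp add: measure_def emeasure_circle_measure)
  finally have 1: "integral\<^sup>L (disk_measure a) F = (\<integral>w. \<integral>t. F (rot t * w) \<partial>circle_measure \<partial>disk_measure a)" ..
  have 2: "(\<integral>t. F (rot t * w) \<partial>circle_measure) = \<Psi> ((cmod w)\<^sup>2)" if w: "cmod w < 1" for w
  proof (rule integral_circle_measure_has_integral)
    show "continuous_on {0..1} (\<lambda>t. F (rot t * w))" by (rule cont[OF w])
  qed (use mean[OF w] in auto)
  have ae: "AE w in disk_measure a. (\<integral>t. F (rot t * w) \<partial>circle_measure) = \<Psi> ((cmod w)\<^sup>2)"
    unfolding AE_disk_measure_iff by (auto simp: 2 unit_disk_def)
  have "integrable (disk_measure a) (\<lambda>w. \<integral>t. F (rot t * w) \<partial>circle_measure)"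
    using disk_circle.integrable_fst'[OF int] by simp
  hence "integrable (disk_measure a) (\<lambda>w. \<Psi> ((cmod w)\<^sup>2))"
    by (rule integrable_cong_AE_imp) (use ae in auto)
  thus "integrable (radial_measure a) \<Psi>"
    unfolding distr_disk_measure_norm_square[symmetric] by (subst integrable_distr_eq) auto
  have "integral\<^sup>L (disk_measure a) F = (\<integral>w. \<Psi> ((cmod w)\<^sup>2) \<partial>disk_measure a)"
    unfolding 1 by (rule integral_cong_AE) (use ae in auto)
  also have "\<dots> = integral\<^sup>L (radial_measure a) \<Psi>"
    unfolding distr_disk_measure_norm_square[symmetric] by (subst integral_distr) auto
  finally show "integral\<^sup>L (disk_measure a) F = integral\<^sup>L (radial_measure a) \<Psi>" .
qed

lemma nn_integral_radial_measure:
  assumes [measurable]: "f \<in> borel_measurable borel"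
  shows "(\<integral>\<^sup>+w. f ((cmod w)\<^sup>2) \<partial>disk_measure a) = (\<integral>\<^sup>+u. f u \<partial>radial_measure a)"
  unfolding distr_disk_measure_norm_square[symmetric] by (subst nn_integral_distr) auto

lemma finite_disk_measure:
  assumes a: "a > - 2"
  shows "finite_measure (disk_measure a)"
proof (rule finite_measureI)
  have "emeasure (disk_measure a) (space (disk_measure a)) = (\<integral>\<^sup>+w. 1 \<partial>disk_measure a)" by simp
  also have "\<dots> = ennreal pi * (\<integral>\<^sup>+u. indicator {0<..<1::real} u * ennreal (u powr (a / 2)) * 1 \<partial>lborel)"
    by (rule nn_integral_disk_radial) simp
  also have "\<dots> \<le> ennreal pi * (\<integral>\<^sup>+u. ennreal (indicator {0..1::real} u * u powr (a / 2)) \<partial>lborel)"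
    by (intro mult_left_mono nn_integral_mono) (auto simp: indicator_def)
  also have "(\<integral>\<^sup>+u. ennreal (indicator {0..1::real} u * u powr (a / 2)) \<partial>lborel) = ennreal (1 powr (a / 2 + 1) / (a / 2 + 1))"
    by (rule nn_integral_has_integral_lebesgue) (use has_integral_powr_from_0[of "a / 2" 1] a in auto)
  finally show "emeasure (disk_measure a) (space (disk_measure a)) \<noteq> \<infinity>"
    by (auto simp: ennreal_mult_eq_top_iff top_unique)
qed

subsection \<open>The Bergman kernel of the disk with a radial power weight\<close>

text \<open>The orthogonal expansion in powers: the square norm of w^n for the weight |w|^a is \<pi>
  / (n + 1 + a / 2), so the kernel is the sum of (n + 1 + a / 2) x^n / \<pi> with x = z cnj w. The
  part n + 1 sums to (1 - x)^(-2) and the part a / 2 to a multiple of (1 - x)^(-1).\<close>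

definition bergman_kernel :: "real \<Rightarrow> complex \<Rightarrow> complex \<Rightarrow> complex" where
  "bergman_kernel a z w =
     ((1 / (1 - z * cnj w))\<^sup>2 + of_real (a / 2) * (1 / (1 - z * cnj w))) / of_real pi"

definition abs_kernel :: "complex \<Rightarrow> complex \<Rightarrow> real" where
  "abs_kernel z w = (1 / cmod (1 - z * cnj w))\<^sup>2"

lemma measurable_cnj [measurable (raw)]: "f \<in> borel_measurable M \<Longrightarrow> (\<lambda>x. cnj (f x)) \<in> borel_measurable M"
  by (rule measurable_compose[OF _ borel_measurable_continuous_onI]) (auto intro!: continuous_intros)

lemma measurable_bergman_kernel [measurable (raw)]:
  assumes [measurable]: "f \<in> borel_measurable M" "g \<in> borel_measurable M"
  shows "(\<lambda>x. bergman_kernel a (f x) (g x)) \<in> borel_measurable M"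
  unfolding bergman_kernel_def by measurable

lemma measurable_abs_kernel [measurable (raw)]:
  assumes [measurable]: "f \<in> borel_measurable M" "g \<in> borel_measurable M"
  shows "(\<lambda>x. abs_kernel (f x) (g x)) \<in> borel_measurable M"
  unfolding abs_kernel_def by measurable

lemma abs_kernel_nonneg [simp]: "0 \<le> abs_kernel z w"
  by (simp add: abs_kernel_def)

lemma abs_kernel_commute: "abs_kernel z w = abs_kernel w z"
proof -
  have "cmod (1 - z * cnj w) = cmod (cnj (1 - z * cnj w))" by (rule complex_mod_cnj[symmetric])
  thus ?thesis by (simp add: abs_kernel_def mult.commute)
qed

lemma cnj_bergman_kernel: "cnj (bergman_kernel a z w) = bergman_kernel a w z"
  by (simp add: bergman_kernel_def mult.commute)

lemma norm_one_minus_ge: "cmod w \<le> 1 \<Longrightarrow> 1 - cmod z \<le> cmod (1 - z * cnj w)"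
proof -
  assume w: "cmod w \<le> 1"
  have "1 - cmod z \<le> 1 - cmod z * cmod w" using w by (simp add: mult_left_le)
  also have "\<dots> \<le> cmod (1 - z * cnj w)"
    using norm_triangle_ineq2[of 1 "z * cnj w"] by (simp add: norm_mult)
  finally show ?thesis .
qed

text \<open>Since |1 - z cnj w| \<le> 2, its inverse y is at least 1/2, hence y / 2 \<le> y^2 and
  the first-order term is absorbed.\<close>

lemma norm_bergman_kernel_le:
  assumes z: "cmod z < 1" and w: "cmod w < 1"
  shows "cmod (bergman_kernel a z w) \<le> (1 + \<bar>a\<bar>) * abs_kernel z w"
proof -
  define y where "y = 1 / cmod (1 - z * cnj w)"
  have "cmod (z * cnj w) \<le> 1" using z w by (simp add: norm_mult mult_le_one)
  hence "cmod (1 - z * cnj w) \<le> 2" using norm_triangle_ineq4[of 1 "z * cnj w"] by simp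
  moreover have "cmod (1 - z * cnj w) > 0" using one_minus_mult_cnj_neq_0[OF z w] by simp
  ultimately have y: "1 / 2 \<le> y" by (simp add: y_def field_simps)
  have "cmod ((1 / (1 - z * cnj w))\<^sup>2 + of_real (a / 2) * (1 / (1 - z * cnj w)))
      \<le> cmod ((1 / (1 - z * cnj w))\<^sup>2) + cmod (of_real (a / 2) * (1 / (1 - z * cnj w)))"
    by (rule norm_triangle_ineq)
  also have "\<dots> = y\<^sup>2 + \<bar>a\<bar> / 2 * y"
    unfolding y_def norm_mult norm_power norm_divide norm_of_real norm_one by (simp add: abs_divide)
  finally have "cmod (bergman_kernel a z w) \<le> (y\<^sup>2 + \<bar>a\<bar> / 2 * y) / pi"
    unfolding bergman_kernel_def norm_divide by (simp add: divide_right_mono)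
  also have "\<dots> \<le> (y\<^sup>2 + \<bar>a\<bar> / 2 * y) / 1"
    using y pi_gt3 by (intro divide_left_mono) auto
  also have "\<bar>a\<bar> / 2 * y \<le> \<bar>a\<bar> * y\<^sup>2"
  proof -
    have "1 / 2 * y \<le> y * y" using y by (intro mult_right_mono) auto
    hence "\<bar>a\<bar> * (1 / 2 * y) \<le> \<bar>a\<bar> * (y * y)" by (intro mult_left_mono) auto
    thus ?thesis by (simp add: power2_eq_square)
  qed
  finally show ?thesis by (simp add: abs_kernel_def y_def algebra_simps)
qed

lemma abs_kernel_le:
  assumes z: "cmod z < 1" and w: "cmod w \<le> 1"
  shows "abs_kernel z w \<le> (1 / (1 - cmod z))\<^sup>2"
  unfolding abs_kernel_def using norm_one_minus_ge[OF w, of z] z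
  by (intro power_mono divide_left_mono mult_pos_pos) auto

text \<open>Near u = 0 only the weight matters and \<open>a > -2\<close> makes it integrable. Near u
  = 1 the weight is bounded and 1 - ur is at least both 1 - u and d = 1 - r; using d for 1 - u \<le>
  d and 1 - u otherwise leaves two power integrals of size d^(-al).\<close>

lemma nn_integral_radial_estimate:
  assumes al: "0 < al" "al < 1" and a: "- 2 < a" "a \<le> 0"
  shows "\<exists>C>0. \<forall>r. 0 \<le> r \<longrightarrow> r < 1 \<longrightarrow>
     (\<integral>\<^sup>+u. ennreal ((1 - u) powr (- al) / (1 - u * r)) \<partial>radial_measure a) \<le> ennreal (C * (1 - r) powr (- al))"
proof (intro exI conjI allI impI)
  \<comment> \<open>The three summands belong to u \<le> 1/2, to 1 - u \<le> d and to 1 - u > d. On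
    u \<le> 1/2 the two factors are at most 2 each, hence the 4; on u > 1/2 the weight is at most 2
    because a / 2 > -1.\<close>
  let ?C = "pi * (4 / (a / 2 + 1) + 2 / (1 - al) + 2 / al)"
  show "0 < ?C" using al a by (intro mult_pos_pos add_pos_pos) auto
  fix r :: real assume r: "0 \<le> r" "r < 1"
  define d where "d = 1 - r"
  have d: "0 < d" "d \<le> 1" using r by (auto simp: d_def)
  let ?A = "\<lambda>u. indicator {0..1} u * u powr (a / 2)"
  let ?B = "\<lambda>v. indicator {0..d} v * v powr (- al)"
  let ?D = "\<lambda>v. indicator {d..} v * v powr (- al - 1)"
  have A: "(\<integral>\<^sup>+u. ennreal (?A u) \<partial>lborel) = ennreal (1 / (a / 2 + 1))"
    by (rule nn_integral_has_integral_lebesgue) (use has_integral_powr_from_0[of "a / 2" 1] a in auto)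
  have "(\<integral>\<^sup>+u. ennreal (?B u) \<partial>lborel) = ennreal (d powr (- al + 1) / (- al + 1))"
    by (rule nn_integral_has_integral_lebesgue) (use has_integral_powr_from_0[of "- al" d] al d in auto)
  moreover have "(\<integral>\<^sup>+u. ennreal (?B u) \<partial>lborel) = (\<integral>\<^sup>+u. ennreal (?B (1 - u)) \<partial>lborel)"
    by (subst nn_integral_real_affine[where c = "- 1" and t = 1]) auto
  ultimately have B: "(\<integral>\<^sup>+u. ennreal (?B (1 - u)) \<partial>lborel) = ennreal (d powr (- al + 1) / (- al + 1))" by simp
  have "(\<integral>\<^sup>+u. ennreal (?D u) \<partial>lborel) = ennreal (- (d powr (- al - 1 + 1)) / (- al - 1 + 1))"
    by (rule nn_integral_has_integral_lebesgue) (use has_integral_powr_to_inf[of "- al - 1" d] al d in auto)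
  moreover have "(\<integral>\<^sup>+u. ennreal (?D u) \<partial>lborel) = (\<integral>\<^sup>+u. ennreal (?D (1 - u)) \<partial>lborel)"
    by (subst nn_integral_real_affine[where c = "- 1" and t = 1]) auto
  ultimately have D: "(\<integral>\<^sup>+u. ennreal (?D (1 - u)) \<partial>lborel) = ennreal (d powr (- al) / al)" using al by simp
  have lin: "(\<integral>\<^sup>+u. c1 * (c2 * X u + (c3 * Y u + c4 * Z u)) \<partial>lborel) = c1 * (c2 * (\<integral>\<^sup>+u. X u \<partial>lborel)
      + (c3 * (\<integral>\<^sup>+u. Y u \<partial>lborel) + c4 * (\<integral>\<^sup>+u. Z u \<partial>lborel)))"
    if [measurable]: "X \<in> borel_measurable borel" "Y \<in> borel_measurable borel" "Z \<in> borel_measurable borel"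
    for X Y Z :: "real \<Rightarrow> ennreal" and c1 c2 c3 c4
    by (simp add: nn_integral_cmult nn_integral_add)
  have pt: "u powr (a / 2) * ((1 - u) powr (- al) / (1 - u * r)) \<le> 4 * ?A u + (2 / d * ?B (1 - u) + 2 * ?D (1 - u))"
    if u: "0 < u" "u < 1" for u
  proof -
    have ur: "u * r \<le> u * 1" "u * r \<le> 1 * r" using u r mult_right_mono[of u 1 r] mult_left_mono[of r 1 u] by auto
    have pos: "1 - u * r \<ge> 1 - u" "1 - u * r \<ge> d" using ur by (auto simp: d_def)
    have i1: "1 / (1 - u * r) \<le> 1 / d" using pos d by (intro divide_left_mono mult_pos_pos) linarith+
    have i2: "1 / (1 - u * r) \<le> 1 / (1 - u)" using pos u d by (intro divide_left_mono mult_pos_pos) linarith+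
    show ?thesis
    proof (cases "u \<le> 1 / 2")
      case True
      have "(1 - u) powr (- al) \<le> (1 / 2) powr (- al)" using True u al by (intro powr_mono2') auto
      also have "\<dots> \<le> (1 / 2) powr (- 1)" using al by (intro powr_mono') auto
      finally have "(1 - u) powr (- al) \<le> 2" by (simp add: powr_minus)
      moreover have "1 / (1 - u * r) \<le> 2"
      proof -
        have "1 / (1 - u) \<le> 1 / (1 / 2)" using True by (intro divide_left_mono) auto
        thus ?thesis using i2 by simp
      qed
      ultimately have "(1 - u) powr (- al) * (1 / (1 - u * r)) \<le> 2 * 2"
        using pos d by (intro mult_mono) auto
      hence "u powr (a / 2) * ((1 - u) powr (- al) / (1 - u * r)) \<le> u powr (a / 2) * 4"
        by (intro mult_left_mono) auto
      moreover have "0 \<le> 2 / d * ?B (1 - u)" "0 \<le> 2 * ?D (1 - u)" using d by (auto simp: indicator_def)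
      moreover have "?A u = u powr (a / 2)" using u by simp
      ultimately show ?thesis by linarith
    next
      case False
      have "u powr (a / 2) \<le> u powr (- 1)" using u a by (intro powr_mono') auto
      also have "\<dots> \<le> 2" using u False by (simp add: powr_minus field_simps)
      finally have p2: "u powr (a / 2) \<le> 2" .
      have "(1 - u) powr (- al) * (1 / (1 - u * r)) \<le> ?B (1 - u) / d + ?D (1 - u)"
      proof (cases "1 - u \<le> d")
        case True
        have "(1 - u) powr (- al) * (1 / (1 - u * r)) \<le> (1 - u) powr (- al) * (1 / d)"
          using i1 by (intro mult_left_mono) auto
        moreover have "?B (1 - u) / d = (1 - u) powr (- al) * (1 / d)" using True u by simp
        moreover have "0 \<le> ?D (1 - u)" by simp
        ultimately show ?thesis by linarith
      next
        case False
        have "(1 - u) powr (- al) * (1 / (1 - u * r)) \<le> (1 - u) powr (- al) * (1 / (1 - u))"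
          using i2 by (intro mult_left_mono) auto
        also have "\<dots> = (1 - u) powr (- al - 1)" using u by (simp add: powr_diff)
        finally show ?thesis using False u d by (auto simp: indicator_def)
      qed
      hence "u powr (a / 2) * ((1 - u) powr (- al) * (1 / (1 - u * r))) \<le> 2 * (?B (1 - u) / d + ?D (1 - u))"
        using p2 pos d by (intro mult_mono) auto
      also have "\<dots> = 2 / d * ?B (1 - u) + 2 * ?D (1 - u)"
        using d by (simp add: field_simps)
      also have "\<dots> \<le> 4 * ?A u + (2 / d * ?B (1 - u) + 2 * ?D (1 - u))"
        by (simp only: le_add_same_cancel2) simp
      finally show ?thesis by (simp only: times_divide_eq_right mult_1_right)
    qed
  qed
  have "(\<integral>\<^sup>+u. ennreal ((1 - u) powr (- al) / (1 - u * r)) \<partial>radial_measure a)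
      = (\<integral>\<^sup>+u. ennreal (pi * u powr (a / 2)) * indicator {0<..<1} u * ennreal ((1 - u) powr (- al) / (1 - u * r)) \<partial>lborel)"
    unfolding radial_measure_def by (rule nn_integral_density) measurable
  also have "\<dots> \<le> (\<integral>\<^sup>+u. ennreal pi * (ennreal 4 * ennreal (?A u) + (ennreal (2 / d) * ennreal (?B (1 - u)) + ennreal 2 * ennreal (?D (1 - u)))) \<partial>lborel)"
  proof (rule nn_integral_mono)
    fix u :: real
    show "ennreal (pi * u powr (a / 2)) * indicator {0<..<1} u * ennreal ((1 - u) powr (- al) / (1 - u * r))
       \<le> ennreal pi * (ennreal 4 * ennreal (?A u) + (ennreal (2 / d) * ennreal (?B (1 - u)) + ennreal 2 * ennreal (?D (1 - u))))"
    proof (cases "0 < u \<and> u < 1")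
      case True
      have nn: "0 \<le> ?A u" "0 \<le> ?B (1 - u)" "0 \<le> ?D (1 - u)" by auto
      have "ennreal (pi * u powr (a / 2)) * indicator {0<..<1} u * ennreal ((1 - u) powr (- al) / (1 - u * r))
         = ennreal pi * ennreal (u powr (a / 2) * ((1 - u) powr (- al) / (1 - u * r)))"
        using True ennreal_mult'[of pi "u powr (a / 2)"]
          ennreal_mult'[of "u powr (a / 2)" "(1 - u) powr (- al) / (1 - u * r)"]
        by (simp add: mult.assoc del: times_divide_eq_right)
      also have "\<dots> \<le> ennreal pi * ennreal (4 * ?A u + (2 / d * ?B (1 - u) + 2 * ?D (1 - u)))"
        using pt True by (intro mult_left_mono ennreal_leI) auto
      also have "ennreal (4 * ?A u + (2 / d * ?B (1 - u) + 2 * ?D (1 - u)))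
        = ennreal 4 * ennreal (?A u) + (ennreal (2 / d) * ennreal (?B (1 - u)) + ennreal 2 * ennreal (?D (1 - u)))"
        using nn d by (simp only: ennreal_mult'[symmetric] ennreal_plus[symmetric] mult_nonneg_nonneg add_nonneg_nonneg
          zero_le_numeral divide_nonneg_nonneg less_imp_le)
      finally show ?thesis .
    qed (auto simp: indicator_def)
  qed
  also have "\<dots> = ennreal pi * (ennreal 4 * (\<integral>\<^sup>+u. ennreal (?A u) \<partial>lborel)
       + (ennreal (2 / d) * (\<integral>\<^sup>+u. ennreal (?B (1 - u)) \<partial>lborel) + ennreal 2 * (\<integral>\<^sup>+u. ennreal (?D (1 - u)) \<partial>lborel)))"
    by (rule lin) measurable
  also have "\<dots> = ennreal (pi * (4 * (1 / (a / 2 + 1)) + (2 / d * (d powr (- al + 1) / (- al + 1)) + 2 * (d powr (- al) / al))))"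
    unfolding A B D using al a d
    by (simp only: ennreal_mult'[symmetric] ennreal_plus[symmetric] mult_nonneg_nonneg add_nonneg_nonneg
          zero_le_numeral divide_nonneg_nonneg less_imp_le powr_ge_zero pi_ge_zero)
  also have "\<dots> \<le> ennreal (?C * (1 - r) powr (- al))"
  proof (rule ennreal_leI)
    have "d powr (- al + 1) = d powr (- al) * d" using d powr_add[of d "- al" 1] by simp
    hence e: "2 / d * (d powr (- al + 1) / (- al + 1)) = 2 / (1 - al) * d powr (- al)" using d by simp
    have "d powr 0 \<le> d powr (- al)" using d al by (intro powr_mono') auto
    hence "1 \<le> d powr (- al)" using d by simp
    hence "4 / (a / 2 + 1) * 1 \<le> 4 / (a / 2 + 1) * d powr (- al)" using a by (intro mult_left_mono) auto
    hence "4 * (1 / (a / 2 + 1)) + (2 / d * (d powr (- al + 1) / (- al + 1)) + 2 * (d powr (- al) / al))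
        \<le> (4 / (a / 2 + 1) + 2 / (1 - al) + 2 / al) * d powr (- al)"
      unfolding e by (simp add: distrib_right)
    thus "pi * (4 * (1 / (a / 2 + 1)) + (2 / d * (d powr (- al + 1) / (- al + 1)) + 2 * (d powr (- al) / al))) \<le> ?C * (1 - r) powr (- al)"
      unfolding d_def[symmetric] mult.assoc by (intro mult_left_mono) auto
  qed
  finally show "(\<integral>\<^sup>+u. ennreal ((1 - u) powr (- al) / (1 - u * r)) \<partial>radial_measure a) \<le> ennreal (?C * (1 - r) powr (- al))" .
qed

text \<open>The absolute kernel factors as 1 / (1 - u cnj z), holomorphic in u, times 1 / (1 - z cnj
  u). So \<open>circle_mean_1\<close> evaluates its mean exactly.\<close>

lemma circle_mean_abs_kernel:
  assumes z: "cmod z < 1" and w: "cmod w < 1"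
  shows "(\<integral>\<^sup>+t. ennreal (abs_kernel z (rot t * w)) \<partial>circle_measure) = ennreal (1 / (1 - (cmod w)\<^sup>2 * (cmod z)\<^sup>2))"
proof -
  have ne: "1 - cnj z * u \<noteq> 0" if "cmod u < 1" for u
    using one_minus_mult_cnj_neq_0[of "cnj z" "cnj u"] z that by simp
  have "(\<lambda>u. 1 / (1 - cnj z * u)) holomorphic_on unit_disk"
    by (intro holomorphic_intros) (auto simp: unit_disk_def dest: ne)
  from has_integral_Re[OF circle_mean_1[OF this z w]]
  have "((\<lambda>t. Re (1 / (1 - cnj z * (rot t * w)) * (1 / (1 - z * cnj (rot t * w))))) has_integral
     Re (1 / (1 - cnj z * ((cmod w)\<^sup>2 * z)))) {0..1}" .
  moreover have "1 / (1 - cnj z * u) * (1 / (1 - z * cnj u)) = of_real (abs_kernel z u)" for u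
  proof -
    have "(1 - cnj z * u) * (1 - z * cnj u) = of_real ((cmod (1 - z * cnj u))\<^sup>2)"
      unfolding complex_norm_square by (simp add: mult.commute)
    thus ?thesis by (simp add: abs_kernel_def power_divide)
  qed
  moreover have "1 / (1 - cnj z * ((cmod w)\<^sup>2 * z)) = of_real (1 / (1 - (cmod w)\<^sup>2 * (cmod z)\<^sup>2))"
  proof -
    have "cnj z * ((cmod w)\<^sup>2 * z) = of_real ((cmod w)\<^sup>2) * (z * cnj z)" by simp
    also have "\<dots> = of_real ((cmod w)\<^sup>2 * (cmod z)\<^sup>2)"
      unfolding complex_norm_square[symmetric] by (rule of_real_mult[symmetric])
    finally show ?thesis by (simp only: of_real_diff of_real_divide of_real_1)
  qed
  ultimately have "((\<lambda>t. abs_kernel z (rot t * w)) has_integral (1 / (1 - (cmod w)\<^sup>2 * (cmod z)\<^sup>2))) {0..1}"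
    by (simp only: Re_complex_of_real)
  hence "(\<integral>\<^sup>+t. ennreal (indicator {0..1} t * abs_kernel z (rot t * w)) \<partial>lborel) = ennreal (1 / (1 - (cmod w)\<^sup>2 * (cmod z)\<^sup>2))"
    by (intro nn_integral_has_integral_lebesgue) auto
  thus ?thesis unfolding circle_measure_def
    by (subst nn_integral_density) (auto simp: ennreal_mult' ennreal_indicator)
qed

text \<open>A Forelli-Rudin estimate; the factor in |w| is constant on circles, so averaging over
  them reduces it to the one-dimensional integral.\<close>

lemma nn_integral_abs_kernel_le:
  assumes "0 < al" "al < 1" "- 2 < a" "a \<le> 0"
  shows "\<exists>C>0. \<forall>z. cmod z < 1 \<longrightarrow>
     (\<integral>\<^sup>+w. ennreal (abs_kernel z w * (1 - (cmod w)\<^sup>2) powr (- al)) \<partial>disk_measure a) \<le> ennreal (C * (1 - (cmod z)\<^sup>2) powr (- al))"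
proof -
  obtain C where C: "C > 0" "\<And>r. 0 \<le> r \<Longrightarrow> r < 1 \<Longrightarrow>
     (\<integral>\<^sup>+u. ennreal ((1 - u) powr (- al) / (1 - u * r)) \<partial>radial_measure a) \<le> ennreal (C * (1 - r) powr (- al))"
    using nn_integral_radial_estimate[OF assms] by blast
  show ?thesis
  proof (intro exI conjI allI impI)
    fix z :: complex assume z: "cmod z < 1"
    have "(\<integral>\<^sup>+w. ennreal (abs_kernel z w * (1 - (cmod w)\<^sup>2) powr (- al)) \<partial>disk_measure a)
       = (\<integral>\<^sup>+w. \<integral>\<^sup>+t. ennreal (abs_kernel z (rot t * w) * (1 - (cmod (rot t * w))\<^sup>2) powr (- al)) \<partial>circle_measure \<partial>disk_measure a)"
      by (rule nn_integral_disk_average) measurable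
    also have "\<dots> = (\<integral>\<^sup>+w. ennreal ((1 - (cmod w)\<^sup>2) powr (- al) / (1 - (cmod w)\<^sup>2 * (cmod z)\<^sup>2)) \<partial>disk_measure a)"
    proof (rule nn_integral_cong_AE, unfold AE_disk_measure_iff, intro AE_I2 impI)
      fix w assume "w \<in> unit_disk"
      hence w: "cmod w < 1" by (simp add: unit_disk_def)
      have "(\<integral>\<^sup>+t. ennreal (abs_kernel z (rot t * w) * (1 - (cmod (rot t * w))\<^sup>2) powr (- al)) \<partial>circle_measure)
         = (\<integral>\<^sup>+t. ennreal (abs_kernel z (rot t * w)) * ennreal ((1 - (cmod w)\<^sup>2) powr (- al)) \<partial>circle_measure)"
        by (simp add: norm_mult ennreal_mult')
      also have "\<dots> = ennreal (1 / (1 - (cmod w)\<^sup>2 * (cmod z)\<^sup>2)) * ennreal ((1 - (cmod w)\<^sup>2) powr (- al))"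
        by (subst nn_integral_multc) (auto simp: circle_mean_abs_kernel[OF z w])
      finally show "(\<integral>\<^sup>+t. ennreal (abs_kernel z (rot t * w) * (1 - (cmod (rot t * w))\<^sup>2) powr (- al)) \<partial>circle_measure)
         = ennreal ((1 - (cmod w)\<^sup>2) powr (- al) / (1 - (cmod w)\<^sup>2 * (cmod z)\<^sup>2))"
        by (simp add: ennreal_mult''[symmetric])
    qed
    also have "\<dots> = (\<integral>\<^sup>+u. ennreal ((1 - u) powr (- al) / (1 - u * (cmod z)\<^sup>2)) \<partial>radial_measure a)"
      by (rule nn_integral_radial_measure) measurable
    also have "\<dots> \<le> ennreal (C * (1 - (cmod z)\<^sup>2) powr (- al))"
      using z by (intro C(2)) (auto simp: abs_square_less_1)
    finally show "(\<integral>\<^sup>+w. ennreal (abs_kernel z w * (1 - (cmod w)\<^sup>2) powr (- al)) \<partial>disk_measure a)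
      \<le> ennreal (C * (1 - (cmod z)\<^sup>2) powr (- al))" .
  qed (rule C(1))
qed

lemma abs_kernel_Lp_bound:
  assumes p: "p > 1" and a: "- 2 < a" "a \<le> 0"
  shows "\<exists>C>0. \<forall>f::complex \<Rightarrow> real. f \<in> borel_measurable borel \<longrightarrow> (\<forall>x. f x \<ge> 0) \<longrightarrow>
     (\<integral>\<^sup>+z. epow p (\<integral>\<^sup>+w. ennreal (abs_kernel z w * f w) \<partial>disk_measure a) \<partial>disk_measure a)
       \<le> ennreal C * (\<integral>\<^sup>+w. ennreal (f w powr p) \<partial>disk_measure a)"
proof -
  define q where "q = p / (p - 1)"
  have pq: "q > 1" "1 / p + 1 / q = 1" using p by (auto simp: q_def field_simps)
  have ran: "0 < 1 / p" "1 / p < 1" "0 < 1 / q" "1 / q < 1" using p pq by auto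
  obtain C1 where C1: "C1 > 0" "\<And>z. cmod z < 1 \<Longrightarrow>
     (\<integral>\<^sup>+w. ennreal (abs_kernel z w * (1 - (cmod w)\<^sup>2) powr (- (1 / p))) \<partial>disk_measure a) \<le> ennreal (C1 * (1 - (cmod z)\<^sup>2) powr (- (1 / p)))"
    using nn_integral_abs_kernel_le[OF ran(1,2) a] by blast
  obtain C2 where C2: "C2 > 0" "\<And>z. cmod z < 1 \<Longrightarrow>
     (\<integral>\<^sup>+w. ennreal (abs_kernel z w * (1 - (cmod w)\<^sup>2) powr (- (1 / q))) \<partial>disk_measure a) \<le> ennreal (C2 * (1 - (cmod z)\<^sup>2) powr (- (1 / q)))"
    using nn_integral_abs_kernel_le[OF ran(3,4) a] by blast
  define C where "C = max C1 C2"
  \<comment> \<open>The exponent is chosen so that \<phi>^q and \<phi>^p carry the exponents -1/p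
    and -1/q, both in (-1, 0) as the integral estimate demands. The value 1 off the disk only keeps
    \<phi> positive everywhere.\<close>
  define \<phi> where "\<phi> w = (if w \<in> unit_disk then (1 - (cmod w)\<^sup>2) powr (- 1 / (p * q)) else 1)" for w
  have phim [measurable]: "\<phi> \<in> borel_measurable borel" unfolding \<phi>_def by measurable
  have dp: "1 - (cmod w)\<^sup>2 > 0" if "cmod w < 1" for w :: complex
    using that by (simp add: abs_square_less_1)
  have phi0: "\<phi> w > 0" for w using dp[of w] by (auto simp: \<phi>_def unit_disk_def)
  have phiq: "\<phi> w powr q = (1 - (cmod w)\<^sup>2) powr (- (1 / p))" if "cmod w < 1" for w
    using that pq by (simp add: \<phi>_def unit_disk_def powr_powr)
  have phip: "\<phi> w powr p = (1 - (cmod w)\<^sup>2) powr (- (1 / q))" if "cmod w < 1" for w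
    using that p by (simp add: \<phi>_def unit_disk_def powr_powr)
  show ?thesis
  proof (intro exI conjI allI impI)
    show "0 < C powr p" using C1 by (simp add: C_def)
    fix f :: "complex \<Rightarrow> real" assume f: "f \<in> borel_measurable borel" "\<forall>x. f x \<ge> 0"
    show "(\<integral>\<^sup>+z. epow p (\<integral>\<^sup>+w. ennreal (abs_kernel z w * f w) \<partial>disk_measure a) \<partial>disk_measure a)
       \<le> ennreal (C powr p) * (\<integral>\<^sup>+w. ennreal (f w powr p) \<partial>disk_measure a)"
    proof (rule schur_test[OF sigma_finite_disk_measure p pq, where \<phi> = \<phi>])
      show "AE x in disk_measure a. (\<integral>\<^sup>+y. ennreal (abs_kernel x y * \<phi> y powr q) \<partial>disk_measure a) \<le> ennreal (C * \<phi> x powr q)"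
        unfolding AE_disk_measure_iff
      proof (intro AE_I2 impI)
        fix x assume "x \<in> unit_disk" hence x: "cmod x < 1" by (simp add: unit_disk_def)
        have "(\<integral>\<^sup>+y. ennreal (abs_kernel x y * \<phi> y powr q) \<partial>disk_measure a)
           = (\<integral>\<^sup>+w. ennreal (abs_kernel x w * (1 - (cmod w)\<^sup>2) powr (- (1 / p))) \<partial>disk_measure a)"
          by (rule nn_integral_cong_AE) (auto simp: AE_disk_measure_iff phiq unit_disk_def)
        also have "\<dots> \<le> ennreal (C1 * (1 - (cmod x)\<^sup>2) powr (- (1 / p)))" by (rule C1(2)[OF x])
        also have "\<dots> \<le> ennreal (C * \<phi> x powr q)"
          unfolding phiq[OF x] by (intro ennreal_leI mult_right_mono) (auto simp: C_def)
        finally show "(\<integral>\<^sup>+y. ennreal (abs_kernel x y * \<phi> y powr q) \<partial>disk_measure a) \<le> ennreal (C * \<phi> x powr q)" .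
      qed
      show "AE y in disk_measure a. (\<integral>\<^sup>+x. ennreal (abs_kernel x y * \<phi> x powr p) \<partial>disk_measure a) \<le> ennreal (C * \<phi> y powr p)"
        unfolding AE_disk_measure_iff
      proof (intro AE_I2 impI)
        fix y assume "y \<in> unit_disk" hence y: "cmod y < 1" by (simp add: unit_disk_def)
        have "(\<integral>\<^sup>+x. ennreal (abs_kernel x y * \<phi> x powr p) \<partial>disk_measure a)
           = (\<integral>\<^sup>+w. ennreal (abs_kernel y w * (1 - (cmod w)\<^sup>2) powr (- (1 / q))) \<partial>disk_measure a)"
          by (rule nn_integral_cong_AE) (auto simp: AE_disk_measure_iff phip unit_disk_def abs_kernel_commute)
        also have "\<dots> \<le> ennreal (C2 * (1 - (cmod y)\<^sup>2) powr (- (1 / q)))" by (rule C2(2)[OF y])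
        also have "\<dots> \<le> ennreal (C * \<phi> y powr p)"
          unfolding phip[OF y] by (intro ennreal_leI mult_right_mono) (auto simp: C_def)
        finally show "(\<integral>\<^sup>+x. ennreal (abs_kernel x y * \<phi> x powr p) \<partial>disk_measure a) \<le> ennreal (C * \<phi> y powr p)" .
      qed
    qed (use f phi0 C1 in \<open>auto simp: C_def\<close>)
  qed
qed

subsection \<open>The reproducing property\<close>

lemma integrable_kernel_mult:
  fixes h :: "complex \<Rightarrow> complex"
  assumes h: "integrable (disk_measure a) h" and z: "cmod z < 1"
  shows "integrable (disk_measure a) (\<lambda>w. bergman_kernel b z w * h w)"
proof (rule Bochner_Integration.integrable_bound)
  show "integrable (disk_measure a) (\<lambda>w. ((1 + \<bar>b\<bar>) * (1 / (1 - cmod z))\<^sup>2) * cmod (h w))"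
    using h by simp
  have [measurable]: "h \<in> borel_measurable borel" using borel_measurable_integrable[OF h] by simp
  show "(\<lambda>w. bergman_kernel b z w * h w) \<in> borel_measurable (disk_measure a)" by measurable
  show "AE w in disk_measure a. norm (bergman_kernel b z w * h w) \<le> norm (((1 + \<bar>b\<bar>) * (1 / (1 - cmod z))\<^sup>2) * cmod (h w))"
    unfolding AE_disk_measure_iff
  proof (intro AE_I2 impI)
    fix w assume "w \<in> unit_disk" hence w: "cmod w < 1" by (simp add: unit_disk_def)
    have "cmod (bergman_kernel b z w) \<le> (1 + \<bar>b\<bar>) * abs_kernel z w" by (rule norm_bergman_kernel_le[OF z w])
    also have "\<dots> \<le> (1 + \<bar>b\<bar>) * (1 / (1 - cmod z))\<^sup>2"
      using abs_kernel_le[OF z, of w] w by (intro mult_left_mono) auto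
    finally show "norm (bergman_kernel b z w * h w) \<le> norm (((1 + \<bar>b\<bar>) * (1 / (1 - cmod z))\<^sup>2) * cmod (h w))"
      by (simp add: norm_mult mult_right_mono abs_mult)
  qed
qed

text \<open>Averaging over circles turns the integral into one over u from 0 to 1 whose integrand is
  the derivative of u^(a/2 + 1) h(uz). The value at 1 is h(z), and the value at 0 vanishes because
  \<open>a > -2\<close>.\<close>

lemma bergman_reproducing:
  assumes h: "h holomorphic_on unit_disk" and int: "integrable (disk_measure a) h" and a: "- 2 < a" and z: "cmod z < 1"
  shows "(\<integral>w. bergman_kernel a z w * h w \<partial>disk_measure a) = h z"
proof -
  define F where "F w = bergman_kernel a z w * h w" for w
  \<comment> \<open>The circle mean supplied by \<open>circle_mean_1\<close> and
    \<open>circle_mean_2\<close>. The indicator keeps uz inside the disk, where \<open>h\<close> and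
    its derivative are continuous, and so makes \<Psi> a Borel function.\<close>
  define \<Psi> where "\<Psi> u = indicator {0..<1} u *\<^sub>R ((h (of_real u * z) + of_real u * z * deriv h (of_real u * z)
     + of_real (a / 2) * h (of_real u * z)) / of_real pi)" for u :: real
  have op: "open unit_disk" by (simp add: unit_disk_eq_ball)
  have hc: "continuous_on unit_disk h" by (rule holomorphic_on_imp_continuous_on[OF h])
  have dc: "continuous_on unit_disk (deriv h)"
    by (rule holomorphic_on_imp_continuous_on[OF holomorphic_deriv[OF h op]])
  have uz: "cmod (of_real u * z) < 1" if "0 \<le> u" "u \<le> 1" for u
  proof -
    have "u * cmod z \<le> 1 * cmod z" using that by (intro mult_right_mono) auto
    thus ?thesis using z that by (simp add: norm_mult)
  qed
  have Fint: "integrable (disk_measure a) F"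
    unfolding F_def by (rule integrable_kernel_mult[OF int z])
  have Fc: "continuous_on unit_disk F"
    unfolding F_def bergman_kernel_def
    by (intro continuous_intros hc) (use z one_minus_mult_cnj_neq_0[OF z] in \<open>auto simp: unit_disk_def\<close>)
  have Fcirc: "continuous_on {0..1} (\<lambda>t. F (rot t * w))" if "cmod w < 1" for w
    by (rule continuous_on_compose2[OF Fc]) (use that in \<open>auto intro!: continuous_intros simp: unit_disk_def norm_mult\<close>)
  have Psim: "\<Psi> \<in> borel_measurable borel"
    unfolding \<Psi>_def
    by (intro borel_measurable_continuous_on_indicator continuous_intros
         continuous_on_compose2[OF hc] continuous_on_compose2[OF dc])
       (auto simp: unit_disk_def intro: uz)
  have mean: "((\<lambda>t. F (rot t * w)) has_integral \<Psi> ((cmod w)\<^sup>2)) {0..1}" if w: "cmod w < 1" for w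
  proof -
    let ?x = "of_real ((cmod w)\<^sup>2) * z"
    have x: "cmod w ^ 2 < 1" using w by (simp add: abs_square_less_1)
    have "((\<lambda>t. (h (rot t * w) * (1 / (1 - z * cnj (rot t * w)))\<^sup>2 + of_real (a / 2) * (h (rot t * w) * (1 / (1 - z * cnj (rot t * w))))) / of_real pi)
       has_integral (h ?x + ?x * deriv h ?x + of_real (a / 2) * h ?x) / of_real pi) {0..1}"
      using circle_mean_1[OF h z w]
      by (intro has_integral_divide has_integral_add has_integral_mult_right circle_mean_2[OF h z w]) simp
    moreover have "(h (rot t * w) * (1 / (1 - z * cnj (rot t * w)))\<^sup>2 + of_real (a / 2) * (h (rot t * w) * (1 / (1 - z * cnj (rot t * w))))) / of_real pi
       = F (rot t * w)" for t
      unfolding F_def bergman_kernel_def by (simp add: add_divide_distrib ring_distribs ac_simps)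
    ultimately show ?thesis using x by (simp add: \<Psi>_def)
  qed
  have avg: "integrable (radial_measure a) \<Psi>" "integral\<^sup>L (disk_measure a) F = integral\<^sup>L (radial_measure a) \<Psi>"
    using disk_integral_average[OF Fint Fcirc _ Psim] mean by blast+
  define G where "G u = of_real (u powr (a / 2)) * (h (of_real u * z) + of_real u * z * deriv h (of_real u * z)
     + of_real (a / 2) * h (of_real u * z))" for u :: real
  have dens: "(pi * u powr (a / 2) * indicator {0<..<1} u) *\<^sub>R \<Psi> u = indicator {0<..<1} u *\<^sub>R G u" for u
    by (auto simp: \<Psi>_def G_def indicator_def scaleR_conv_of_real)
  have rm: "radial_measure a = density lborel (\<lambda>u. ennreal (pi * u powr (a / 2) * indicator {0<..<1} u))"
    unfolding radial_measure_def by (auto intro!: arg_cong[where f = "density lborel"] simp: indicator_def)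
  have sG: "set_integrable lborel {0<..<1} G"
    using avg(1) Psim unfolding rm set_integrable_def by (subst (asm) integrable_density) (auto simp: dens)
  have "integral\<^sup>L (disk_measure a) F = integral\<^sup>L (radial_measure a) \<Psi>" by (rule avg(2))
  also have "\<dots> = set_lebesgue_integral lborel {0<..<1} G"
    unfolding rm set_lebesgue_integral_def using Psim by (subst integral_density) (auto simp: dens)
  also have "\<dots> = integral {0<..<1} G" by (rule set_borel_integral_eq_integral(2)[OF sG])
  also have "\<dots> = h z"
  proof (rule integral_unique, subst has_integral_Icc_iff_Ioo[symmetric])
    \<comment> \<open>The antiderivative of \<open>G\<close>: the product rule gives the term with
      h' and (a / 2 + 1) h, which is the sum of h and (a / 2) h.\<close>
    let ?H = "\<lambda>u::real. of_real (u powr (a / 2 + 1)) * h (of_real u * z)"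
    have "(G has_integral (?H 1 - ?H 0)) {0..1}"
    proof (rule fundamental_theorem_of_calculus_interior)
      have pw: "continuous_on {0..1} (\<lambda>u::real. u powr (a / 2 + 1))"
        by (intro continuous_on_powr') (use a in \<open>auto intro!: continuous_intros\<close>)
      show "continuous_on {0..1} ?H"
        by (intro continuous_intros pw continuous_on_compose2[OF hc]) (auto simp: unit_disk_def intro: uz)
    next
      fix u :: real assume u: "u \<in> {0<..<1}"
      have "(h has_field_derivative deriv h (of_real u * z)) (at (of_real u * z))"
        using u by (intro holomorphic_unit_disk_deriv[OF h] uz) auto
      moreover have "((\<lambda>u::real. of_real u * z) has_vector_derivative z) (at u)"
        by (auto intro!: derivative_eq_intros simp: has_vector_derivative_def scaleR_conv_of_real)
      ultimately have d1: "((\<lambda>u::real. h (of_real u * z)) has_vector_derivative (z * deriv h (of_real u * z))) (at u)"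
        using field_vector_diff_chain_at[of "\<lambda>u. of_real u * z" z u h] by (simp add: o_def)
      have d2: "((\<lambda>u::real. u powr (a / 2 + 1)) has_real_derivative (a / 2 + 1) * u powr (a / 2)) (at u)"
        using u DERIV_powr[of "\<lambda>u. u" 1 u "\<lambda>_. a / 2 + 1" 0] has_real_derivative_powr[of u "a / 2 + 1"] by simp
      hence d3: "((\<lambda>u::real. of_real (u powr (a / 2 + 1)) :: complex) has_vector_derivative of_real ((a / 2 + 1) * u powr (a / 2))) (at u)"
        by (rule has_vector_derivative_of_real)
      have "(?H has_vector_derivative (of_real (u powr (a / 2 + 1)) * (z * deriv h (of_real u * z))
          + of_real ((a / 2 + 1) * u powr (a / 2)) * h (of_real u * z))) (at u)"
        using has_vector_derivative_mult[OF d3 d1] by simp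
      moreover have "u powr (a / 2 + 1) = u powr (a / 2) * u" using u by (simp add: powr_add)
      ultimately show "(?H has_vector_derivative G u) (at u)"
        by (simp add: G_def algebra_simps)
    qed simp
    thus "(G has_integral h z) {0..1}" using a by simp
  qed
  finally show ?thesis by (simp only: F_def[abs_def])
qed

lemma epow_2: "epow 2 x = x\<^sup>2"
proof (cases x rule: ennreal_cases)
  case (real r)
  thus ?thesis by (simp add: epow_ennreal ennreal_power powr_numeral)
qed (simp add: power2_eq_square)

abbreviation sq_mass :: "'a measure \<Rightarrow> ('a \<Rightarrow> complex) \<Rightarrow> ennreal" where
  "sq_mass M f \<equiv> (\<integral>\<^sup>+x. ennreal ((cmod (f x))\<^sup>2) \<partial>M)"

subsection \<open>Square integrable holomorphic functions extend across a puncture\<close>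

lemma nn_integral_complex_affine:
  assumes [measurable]: "f \<in> borel_measurable borel" and r: "r > (0::real)"
  shows "(\<integral>\<^sup>+w. f (z + of_real r * w) \<partial>lborel) = ennreal (1 / r\<^sup>2) * (\<integral>\<^sup>+w. f w \<partial>(lborel :: complex measure))"
proof -
  have "(\<integral>\<^sup>+w. f w \<partial>(lborel :: complex measure)) = (\<integral>\<^sup>+w. f w \<partial>distr lborel borel ((+) z))"
    by (simp only: lborel_distr_plus)
  also have "\<dots> = (\<integral>\<^sup>+w. f (z + w) \<partial>lborel)" by (subst nn_integral_distr) auto
  also have "\<dots> = ennreal (r\<^sup>2) * (\<integral>\<^sup>+w. f (z + of_real r * w) \<partial>lborel)"
    using r by (subst nn_integral_complex_mult[of _ "of_real r"]) auto
  finally have "ennreal (1 / r\<^sup>2) * (\<integral>\<^sup>+w. f w \<partial>(lborel :: complex measure))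
     = (ennreal (1 / r\<^sup>2) * ennreal (r\<^sup>2)) * (\<integral>\<^sup>+w. f (z + of_real r * w) \<partial>lborel)"
    by (simp only: mult.assoc)
  also have "ennreal (1 / r\<^sup>2) * ennreal (r\<^sup>2) = 1"
    using r by (simp add: ennreal_mult'[symmetric])
  finally show ?thesis by simp
qed

lemma square_integrable_imp_integrable:
  fixes G :: "'a \<Rightarrow> complex"
  assumes "finite_measure M" and [measurable]: "G \<in> borel_measurable M"
    and fin: "sq_mass M G < \<infinity>"
  shows "integrable M G"
proof -
  interpret finite_measure M by fact
  have "integrable M (\<lambda>x. 1 + (cmod (G x))\<^sup>2)"
    using fin by (intro Bochner_Integration.integrable_add integrable_const integrableI_bounded) auto
  thus ?thesis
  proof (rule Bochner_Integration.integrable_bound)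
    show "AE x in M. norm (G x) \<le> norm (1 + (cmod (G x))\<^sup>2)"
    proof (rule AE_I2)
      fix x
      have "cmod (G x) \<le> 2 * 1 * cmod (G x)" by simp
      also have "\<dots> \<le> 1\<^sup>2 + (cmod (G x))\<^sup>2" by (rule sum_squares_bound)
      finally show "norm (G x) \<le> norm (1 + (cmod (G x))\<^sup>2)" by simp
    qed
  qed measurable
qed

text \<open>At z = 0 the unweighted kernel is the constant 1 / \<pi>, so the reproducing formula is
  the mean value property, and Hoelder with exponent 2 bounds the mean. The constant does not depend
  on \<open>f\<close>, so it can be used on small disks after scaling.\<close>

lemma norm_square_le_disk_average:
  "\<exists>K>0. \<forall>f::complex \<Rightarrow> complex. f holomorphic_on unit_disk \<longrightarrow> f \<in> borel_measurable borel \<longrightarrow>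
     ennreal ((cmod (f 0))\<^sup>2) \<le> ennreal K * sq_mass (disk_measure 0) f"
proof -
  interpret D: finite_measure "disk_measure 0" by (rule finite_disk_measure) simp
  define B where "B = measure (disk_measure 0) UNIV + 1"
  have B: "B > 0" "emeasure (disk_measure 0) UNIV \<le> ennreal B"
    by (auto simp: B_def D.emeasure_eq_measure intro!: ennreal_leI add_nonneg_pos)
  show ?thesis
  proof (intro exI conjI allI impI)
    show "B > 0" by fact
    fix f :: "complex \<Rightarrow> complex"
    assume h: "f holomorphic_on unit_disk" and f [measurable]: "f \<in> borel_measurable borel"
    show "ennreal ((cmod (f 0))\<^sup>2) \<le> ennreal B * sq_mass (disk_measure 0) f"
    proof (cases "sq_mass (disk_measure 0) f = \<infinity>")
      case True
      thus ?thesis using B by (simp add: ennreal_mult_top)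
    next
      case False
      have int: "integrable (disk_measure 0) f"
        using False by (intro square_integrable_imp_integrable D.finite_measure_axioms) (auto simp: less_top)
      have "ennreal ((cmod (f 0))\<^sup>2) = ennreal (cmod (\<integral>w. bergman_kernel 0 0 w * f w \<partial>disk_measure 0) powr 2)"
        by (subst bergman_reproducing[OF h int]) (auto simp: powr_numeral)
      also have "\<dots> \<le> epow 2 (\<integral>\<^sup>+w. ennreal (cmod (bergman_kernel 0 0 w * f w)) \<partial>disk_measure 0)"
        by (rule powr_norm_integral_le_epow) simp
      also have "\<dots> \<le> epow 2 (\<integral>\<^sup>+w. ennreal (cmod (f w) * 1) \<partial>disk_measure 0)"
        using pi_gt3 by (intro epow_mono nn_integral_mono ennreal_leI)
          (auto simp: bergman_kernel_def norm_mult norm_divide field_simps intro: order_trans[OF _ mult_right_mono[of 1 pi]])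
      also have "\<dots> \<le> (\<integral>\<^sup>+w. ennreal (cmod (f w) powr 2) \<partial>disk_measure 0) * ennreal (B powr (2 - 1))"
        by (rule nn_integral_Hoelder[where q = 2]) (use B in auto)
      also have "\<dots> = ennreal B * sq_mass (disk_measure 0) f"
        using B by (simp add: powr_numeral mult.commute)
      finally show ?thesis .
    qed
  qed
qed

text \<open>The mean value bound on the disk of radius |z| / 2 around z shows that |z h(z)|^2 is at
  most a constant times the mass of h on the ball of radius 2|z| around 0. That mass tends to 0, so
  z h(z) tends to 0 and the singularity is removable.\<close>

lemma square_integrable_extend:
  assumes h: "h holomorphic_on unit_disk - {0}" and hm [measurable]: "h \<in> borel_measurable borel"
    and fin: "sq_mass (disk_measure a) h < \<infinity>" and a: "a \<le> 0"
  shows "\<exists>h'. h' holomorphic_on unit_disk \<and> (\<forall>z\<in>unit_disk - {0}. h' z = h z)"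
proof -
  obtain K where K: "K > 0" "\<And>f::complex \<Rightarrow> complex. f holomorphic_on unit_disk \<Longrightarrow> f \<in> borel_measurable borel \<Longrightarrow>
     ennreal ((cmod (f 0))\<^sup>2) \<le> ennreal K * sq_mass (disk_measure 0) f"
    using norm_square_le_disk_average by blast
  define N where "N = density (disk_measure a) (\<lambda>w. ennreal ((cmod (h w))\<^sup>2))"
  have setsN [simp]: "sets N = sets borel" by (simp add: N_def)
  have eN: "emeasure N A = (\<integral>\<^sup>+w. indicator unit_disk w * ennreal (cmod w powr a) * ennreal ((cmod (h w))\<^sup>2) * indicator A w \<partial>lborel)"
    if [measurable]: "A \<in> sets borel" for A
    unfolding N_def by (subst emeasure_density) (auto simp: nn_integral_disk_measure mult.assoc)
  have eNfin: "emeasure N A \<noteq> \<infinity>" if [measurable]: "A \<in> sets borel" for A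
  proof -
    have "emeasure N A \<le> sq_mass (disk_measure a) h"
      unfolding N_def by (subst emeasure_density) (auto intro!: nn_integral_mono simp: indicator_def)
    thus ?thesis using fin by (auto simp: top_unique)
  qed
  \<comment> \<open>The factor 4 is |z|^2 / r^2 for the radius r = |z| / 2.\<close>
  have key: "ennreal ((cmod (z * h z))\<^sup>2) \<le> ennreal (4 * K) * emeasure N (ball 0 (2 * cmod z))"
    if z: "z \<noteq> 0" "cmod z < 1 / 2" for z
  proof -
    define r where "r = cmod z / 2"
    have r: "r > 0" using z by (simp add: r_def)
    have im: "z + of_real r * w \<in> (unit_disk - {0}) \<inter> ball 0 (2 * cmod z)" if "cmod w < 1" for w
    proof -
      have rw: "cmod (of_real r * w) \<le> r" using that r by (simp add: norm_mult mult_left_le)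
      have "cmod (z + of_real r * w) \<le> cmod z + r" using rw norm_triangle_ineq[of z "of_real r * w"] by linarith
      moreover have "cmod (z + of_real r * w) \<ge> cmod z - r" using rw norm_triangle_ineq2[of z "- (of_real r * w)"] by simp
      moreover have "cmod z - r > 0" "cmod z + r < 1" "cmod z + r < 2 * cmod z" using z by (auto simp: r_def)
      ultimately show ?thesis by (auto simp: unit_disk_def)
    qed
    have "(\<lambda>w. z + of_real r * w) ` unit_disk \<subseteq> unit_disk - {0}"
    proof (rule image_subsetI)
      fix w assume "w \<in> unit_disk"
      thus "z + of_real r * w \<in> unit_disk - {0}" using im[of w] by (auto simp: unit_disk_def)
    qed
    moreover have "(\<lambda>w. z + of_real r * w) holomorphic_on unit_disk" by (intro holomorphic_intros)
    ultimately have "(h \<circ> (\<lambda>w. z + of_real r * w)) holomorphic_on unit_disk"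
      by (intro holomorphic_on_compose_gen[OF _ h])
    hence "ennreal ((cmod (h (z + of_real r * 0)))\<^sup>2) \<le> ennreal K * (\<integral>\<^sup>+w. ennreal ((cmod (h (z + of_real r * w)))\<^sup>2) \<partial>disk_measure 0)"
      by (intro K(2)) (auto simp: o_def)
    also have "(\<integral>\<^sup>+w. ennreal ((cmod (h (z + of_real r * w)))\<^sup>2) \<partial>disk_measure 0)
      \<le> (\<integral>\<^sup>+w. (\<lambda>v. indicator unit_disk v * ennreal (cmod v powr a) * ennreal ((cmod (h v))\<^sup>2) * indicator (ball 0 (2 * cmod z)) v) (z + of_real r * w) \<partial>lborel)"
    proof (subst nn_integral_disk_measure, measurable, rule nn_integral_mono)
      fix w
      let ?v = "z + of_real r * w"
      show "indicator unit_disk w * ennreal (cmod w powr 0) * ennreal ((cmod (h ?v))\<^sup>2)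
         \<le> indicator unit_disk ?v * ennreal (cmod ?v powr a) * ennreal ((cmod (h ?v))\<^sup>2) * indicator (ball 0 (2 * cmod z)) ?v"
      proof (cases "w \<in> unit_disk")
        case True
        hence v: "?v \<in> unit_disk" "?v \<noteq> 0" "?v \<in> ball 0 (2 * cmod z)" using im[of w] by (auto simp: unit_disk_def)
        \<comment> \<open>This is where \<open>a \<le> 0\<close> enters: inside the disk |v|^a \<ge>
          1, so the unweighted mass on the small disk is dominated by the weighted one.\<close>
        have "1 \<le> cmod ?v powr a"
        proof -
          have "cmod ?v powr 0 \<le> cmod ?v powr a" using v a by (intro powr_mono') (auto simp: unit_disk_def)
          thus ?thesis using v by simp
        qed
        hence "ennreal (cmod w powr 0) \<le> ennreal (cmod ?v powr a)" by (intro ennreal_leI) auto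
        thus ?thesis using v True by (simp add: mult_right_mono)
      qed simp
    qed
    also have "\<dots> = ennreal (1 / r\<^sup>2) * emeasure N (ball 0 (2 * cmod z))"
      using r by (subst nn_integral_complex_affine) (measurable, auto simp: eN)
    finally have "ennreal ((cmod (h z))\<^sup>2) \<le> ennreal (K / r\<^sup>2) * emeasure N (ball 0 (2 * cmod z))"
      using K by (simp add: ennreal_mult'[symmetric] mult.assoc[symmetric] mult_left_mono)
    hence "ennreal ((cmod z)\<^sup>2) * ennreal ((cmod (h z))\<^sup>2) \<le> ennreal ((cmod z)\<^sup>2) * (ennreal (K / r\<^sup>2) * emeasure N (ball 0 (2 * cmod z)))"
      by (rule mult_left_mono) simp
    also have "\<dots> = ennreal (4 * K) * emeasure N (ball 0 (2 * cmod z))"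
      using z K by (simp add: mult.assoc[symmetric] ennreal_mult'[symmetric] r_def power_divide mult.commute[of 4])
    finally show ?thesis by (simp add: norm_mult power_mult_distrib ennreal_mult')
  qed
  have lim: "((\<lambda>z. (z - 0) * h z) \<longlongrightarrow> 0) (at 0)"
  proof (rule tendstoI)
    fix e :: real assume e: "e > 0"
    define A where "A n = ball (0::complex) (1 / real (Suc n))" for n
    have "(\<lambda>n. emeasure N (A n)) \<longlonglongrightarrow> emeasure N (\<Inter>n. A n)"
    proof (rule Lim_emeasure_decseq)
      show "decseq A" unfolding A_def decseq_def by (auto intro!: subset_ball divide_left_mono)
    qed (use eNfin in \<open>auto simp: A_def\<close>)
    also have "(\<Inter>n. A n) = {0}"
    proof -
      have "x = 0" if "\<forall>n. cmod x < 1 / real (Suc n)" for x :: complex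
      proof (rule ccontr)
        assume "x \<noteq> 0"
        then obtain n where "inverse (real (Suc n)) < cmod x" using reals_Archimedean[of "cmod x"] by auto
        with that show False by (metis inverse_eq_divide less_asym)
      qed
      thus ?thesis by (auto simp: A_def)
    qed
    also have "emeasure N {0} = 0"
    proof -
      have "emeasure N {0} = (\<integral>\<^sup>+w. 0 \<partial>(lborel :: complex measure))"
        unfolding eN[OF borel_closed[OF closed_singleton]]
      proof (rule nn_integral_cong_AE)
        show "AE w in lborel. indicator unit_disk w * ennreal (cmod w powr a) * ennreal ((cmod (h w))\<^sup>2) * indicator {0} w = 0"
          using AE_lborel_singleton[of "0::complex"] by eventually_elim simp
      qed
      thus ?thesis by simp
    qed
    finally have l: "(\<lambda>n. ennreal (4 * K) * emeasure N (A n)) \<longlonglongrightarrow> ennreal (4 * K) * 0"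
      by (intro ennreal_tendsto_cmult) auto
    have "eventually (\<lambda>n. ennreal (4 * K) * emeasure N (A n) < ennreal (e\<^sup>2)) sequentially"
      using e by (intro order_tendstoD(2)[OF l]) auto
    then obtain n where n: "ennreal (4 * K) * emeasure N (A n) < ennreal (e\<^sup>2)"
      by (auto simp: eventually_sequentially)
    show "eventually (\<lambda>z. dist ((z - 0) * h z) 0 < e) (at 0)"
      unfolding eventually_at
    proof (intro exI conjI ballI impI)
      show "1 / (2 * real (Suc n)) > 0" by simp
      fix z :: complex assume z: "z \<noteq> 0 \<and> dist z 0 < 1 / (2 * real (Suc n))"
      have "1 / (2 * real (Suc n)) \<le> 1 / 2" by (simp add: field_simps)
      moreover have z1: "cmod z < 1 / (2 * real (Suc n))" using z by (simp only: dist_norm diff_zero)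
      ultimately have z': "z \<noteq> 0" "cmod z < 1 / 2" using z less_le_trans by blast+
      have "2 * cmod z \<le> 1 / real (Suc n)" using z by (simp add: field_simps)
      hence "ball 0 (2 * cmod z) \<subseteq> A n" unfolding A_def by (rule subset_ball)
      hence "emeasure N (ball 0 (2 * cmod z)) \<le> emeasure N (A n)"
        by (rule emeasure_mono) (simp add: A_def)
      hence "ennreal ((cmod (z * h z))\<^sup>2) \<le> ennreal (4 * K) * emeasure N (A n)"
        using key[OF z'] by (meson mult_left_mono order_trans zero_le)
      hence "ennreal ((cmod (z * h z))\<^sup>2) < ennreal (e\<^sup>2)" using n by simp
      hence "(cmod (z * h z))\<^sup>2 < e\<^sup>2" by (simp add: ennreal_less_iff)
      hence "cmod (z * h z) < e" using e by (simp add: power_less_imp_less_base)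
      thus "dist ((z - 0) * h z) 0 < e" by simp
    qed
  qed
  have "0 \<in> interior unit_disk" by (simp add: unit_disk_eq_ball interior_open)
  from holomorphic_on_extend_lim[OF h this] lim show ?thesis by blast
qed

subsection \<open>Hermitian kernels\<close>

text \<open>Fubini. Assumption \<open>TG\<close> says that the kernel in absolute value maps |G|
  into L^2; Cauchy-Schwarz against \<open>U\<close> then makes the double integral absolutely
  convergent.\<close>

lemma hermitian_kernel_adjoint:
  fixes Q :: "'a \<Rightarrow> 'a \<Rightarrow> complex" and G U :: "'a \<Rightarrow> complex"
  assumes M: "sigma_finite_measure M"
    and Q [measurable]: "case_prod Q \<in> borel_measurable (M \<Otimes>\<^sub>M M)"
    and herm: "\<And>x y. cnj (Q x y) = Q y x"
    and G [measurable]: "G \<in> borel_measurable M" and U [measurable]: "U \<in> borel_measurable M"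
    and TG: "(\<integral>\<^sup>+x. epow 2 (\<integral>\<^sup>+y. ennreal (cmod (Q x y) * cmod (G y)) \<partial>M) \<partial>M) < \<infinity>"
    and UL: "sq_mass M U < \<infinity>"
  shows "(\<integral>x. (\<integral>y. Q x y * G y \<partial>M) * cnj (U x) \<partial>M) = (\<integral>y. G y * cnj (\<integral>x. Q y x * U x \<partial>M) \<partial>M)"
proof -
  interpret M: sigma_finite_measure M by (rule M)
  interpret MM: pair_sigma_finite M M by unfold_locales
  have Qm [measurable]: "(\<lambda>y. Q x y) \<in> borel_measurable M" if "x \<in> space M" for x
    using measurable_Pair2[OF Q that] by simp
  have int: "integrable (M \<Otimes>\<^sub>M M) (\<lambda>(x, y). Q x y * G y * cnj (U x))"
  proof (rule integrableI_bounded)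
    have "(\<integral>\<^sup>+z. ennreal (norm (case z of (x, y) \<Rightarrow> Q x y * G y * cnj (U x))) \<partial>(M \<Otimes>\<^sub>M M))
       = (\<integral>\<^sup>+x. \<integral>\<^sup>+y. ennreal (norm (Q x y * G y * cnj (U x))) \<partial>M \<partial>M)"
      by (subst M.nn_integral_fst[symmetric]) auto
    also have "\<dots> = (\<integral>\<^sup>+x. (\<integral>\<^sup>+y. ennreal (cmod (Q x y) * cmod (G y)) \<partial>M) * ennreal (cmod (U x)) \<partial>M)"
    proof (rule nn_integral_cong)
      fix x assume "x \<in> space M"
      note [measurable] = Qm[OF this]
      show "(\<integral>\<^sup>+y. ennreal (norm (Q x y * G y * cnj (U x))) \<partial>M)
        = (\<integral>\<^sup>+y. ennreal (cmod (Q x y) * cmod (G y)) \<partial>M) * ennreal (cmod (U x))"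
        by (subst nn_integral_multc[symmetric]) (auto simp: norm_mult ennreal_mult')
    qed
    also have "\<dots> < \<infinity>"
    proof -
      have "(\<integral>\<^sup>+x. (\<integral>\<^sup>+y. ennreal (cmod (Q x y) * cmod (G y)) \<partial>M) * ennreal (cmod (U x)) \<partial>M)\<^sup>2
         \<le> (\<integral>\<^sup>+x. (\<integral>\<^sup>+y. ennreal (cmod (Q x y) * cmod (G y)) \<partial>M)\<^sup>2 \<partial>M) * (\<integral>\<^sup>+x. (ennreal (cmod (U x)))\<^sup>2 \<partial>M)"
        by (rule Cauchy_Schwarz_nn_integral) measurable
      also have "\<dots> < \<infinity>" using TG UL by (simp add: epow_2 ennreal_power ennreal_mult_less_top)
      finally show ?thesis by (auto simp: power2_eq_square ennreal_mult_less_top less_top[symmetric])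
    qed
    finally show "(\<integral>\<^sup>+z. ennreal (norm (case z of (x, y) \<Rightarrow> Q x y * G y * cnj (U x))) \<partial>(M \<Otimes>\<^sub>M M)) < \<infinity>" .
  qed measurable
  have "(\<integral>x. (\<integral>y. Q x y * G y \<partial>M) * cnj (U x) \<partial>M) = (\<integral>x. (\<integral>y. Q x y * G y * cnj (U x) \<partial>M) \<partial>M)"
    by simp
  also have "\<dots> = (\<integral>y. (\<integral>x. Q x y * G y * cnj (U x) \<partial>M) \<partial>M)"
    by (rule MM.Fubini_integral[symmetric, OF int])
  also have "\<dots> = (\<integral>y. G y * cnj (\<integral>x. Q y x * U x \<partial>M) \<partial>M)"
  proof (rule Bochner_Integration.integral_cong[OF refl])
    fix y
    have "(\<integral>x. Q x y * G y * cnj (U x) \<partial>M) = (\<integral>x. G y * cnj (Q y x * U x) \<partial>M)"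
      by (intro Bochner_Integration.integral_cong refl) (simp add: herm)
    also have "\<dots> = G y * cnj (\<integral>x. Q y x * U x \<partial>M)"
      by (simp only: integral_mult_right_zero Bochner_Integration.integral_cnj)
    finally show "(\<integral>x. Q x y * G y * cnj (U x) \<partial>M) = G y * cnj (\<integral>x. Q y x * U x \<partial>M)"
      by simp
  qed
  finally show ?thesis .
qed

subsection \<open>Weighted spaces in terms of Borel functions\<close>

text \<open>The p-th power of the norm as an extended number, so that membership in the space
  becomes finiteness of the mass.\<close>

definition Lp_mass :: "real \<Rightarrow> 'a::euclidean_space set \<Rightarrow> ('a \<Rightarrow> real) \<Rightarrow> ('a \<Rightarrow> complex) \<Rightarrow> ennreal" where
  "Lp_mass p \<Omega> \<mu> f = (\<integral>\<^sup>+x. indicator \<Omega> x * ennreal (cmod (f x) powr p * \<mu> x) \<partial>lborel)"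

lemma integrable_lebesgue_on_borel_iff:
  fixes F :: "'a::euclidean_space \<Rightarrow> 'b::euclidean_space"
  assumes [measurable]: "\<Omega> \<in> sets borel" "F \<in> borel_measurable borel"
  shows "integrable (lebesgue_on \<Omega>) F \<longleftrightarrow> integrable lborel (\<lambda>x. indicator \<Omega> x *\<^sub>R F x)"
    and "integral\<^sup>L (lebesgue_on \<Omega>) F = integral\<^sup>L lborel (\<lambda>x. indicator \<Omega> x *\<^sub>R F x)"
proof -
  have s: "\<Omega> \<inter> space lebesgue \<in> sets lebesgue" by simp
  have m: "(\<lambda>x. indicator \<Omega> x *\<^sub>R F x) \<in> borel_measurable lborel" by measurable
  show "integrable (lebesgue_on \<Omega>) F \<longleftrightarrow> integrable lborel (\<lambda>x. indicator \<Omega> x *\<^sub>R F x)"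
    using integrable_restrict_space[OF s, of F] integrable_completion[OF m] by simp
  show "integral\<^sup>L (lebesgue_on \<Omega>) F = integral\<^sup>L lborel (\<lambda>x. indicator \<Omega> x *\<^sub>R F x)"
    using integral_restrict_space[OF s, of F] integral_completion[OF m] by simp
qed

lemma borel_measurable_lebesgue_on:
  "\<Omega> \<in> sets borel \<Longrightarrow> f \<in> borel_measurable borel \<Longrightarrow> f \<in> borel_measurable (lebesgue_on \<Omega>)"
  by (intro measurable_restrict_space1 measurable_completion) simp

lemma AE_lebesgue_on_iff:
  assumes "\<Omega> \<in> sets borel"
  shows "(AE x in lebesgue_on \<Omega>. P x) \<longleftrightarrow> (AE x in lebesgue. x \<in> \<Omega> \<longrightarrow> P x)"
  using assms by (intro AE_restrict_space_iff) auto

text \<open>The spaces consist of Lebesgue measurable functions, while Fubini and the substitutions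
  below are stated for Borel functions. Changing a function on a null set affects neither norms nor
  projections.\<close>

lemma borel_representative:
  fixes f :: "'a::euclidean_space \<Rightarrow> complex"
  assumes O: "\<Omega> \<in> sets borel" and f: "f \<in> borel_measurable (lebesgue_on \<Omega>)"
  shows "\<exists>f0\<in>borel_measurable borel. AE x in lebesgue_on \<Omega>. f x = f0 x"
proof -
  let ?F = "\<lambda>x. indicator \<Omega> x *\<^sub>R f x"
  have F: "?F \<in> borel_measurable lebesgue"
    using f O by (subst (asm) borel_measurable_restrict_space_iff) auto
  have Re: "(\<lambda>x. Re (?F x)) \<in> borel_measurable lebesgue" "(\<lambda>x. Im (?F x)) \<in> borel_measurable lebesgue"
    using F by (simp_all only: borel_measurable_complex_iff)
  obtain a where a: "a \<in> borel_measurable lborel" "AE x in lborel. Re (?F x) = a x"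
    using completion_ex_borel_measurable_real[OF Re(1)] by auto
  obtain b where b: "b \<in> borel_measurable lborel" "AE x in lborel. Im (?F x) = b x"
    using completion_ex_borel_measurable_real[OF Re(2)] by auto
  have [measurable]: "a \<in> borel_measurable borel" "b \<in> borel_measurable borel" using a b by auto
  show ?thesis
  proof (rule bexI)
    show "(\<lambda>x. Complex (a x) (b x)) \<in> borel_measurable borel" by measurable
    have "AE x in lborel. x \<in> \<Omega> \<longrightarrow> f x = Complex (a x) (b x)"
      using a(2) b(2) by eventually_elim (auto simp: complex_eq_iff)
    thus "AE x in lebesgue_on \<Omega>. f x = Complex (a x) (b x)"
      unfolding AE_lebesgue_on_iff[OF O] by (rule AE_completion)
  qed
qed

text \<open>Measurability and non-negativity of the weight are required on the whole space,
  positivity only on the domain. A weight given on the domain alone must therefore be extended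
  first.\<close>

locale weighted_domain =
  fixes \<Omega> :: "'a::euclidean_space set" and \<mu> :: "'a \<Rightarrow> real"
  assumes open_dom: "open \<Omega>"
    and weight_meas [measurable]: "\<mu> \<in> borel_measurable borel"
    and weight_nonneg: "\<And>x. 0 \<le> \<mu> x"
    and weight_pos: "\<And>x. x \<in> \<Omega> \<Longrightarrow> 0 < \<mu> x"
begin

lemma dom_borel [measurable]: "\<Omega> \<in> sets borel"
  using open_dom by simp

lemma weighted_Lp_iff:
  assumes [measurable]: "f \<in> borel_measurable borel"
  shows "f \<in> weighted_Lp p \<Omega> \<mu> \<longleftrightarrow> Lp_mass p \<Omega> \<mu> f < \<infinity>"
    and "weighted_Lp_norm p \<Omega> \<mu> f = enn2real (Lp_mass p \<Omega> \<mu> f) powr (1 / p)"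
proof -
  let ?F = "\<lambda>x. cmod (f x) powr p * \<mu> x"
  have m: "Lp_mass p \<Omega> \<mu> f = (\<integral>\<^sup>+x. ennreal (indicator \<Omega> x *\<^sub>R ?F x) \<partial>lborel)"
    unfolding Lp_mass_def by (intro nn_integral_cong) (auto simp: indicator_def)
  have 1: "integrable (lebesgue_on \<Omega>) ?F \<longleftrightarrow> integrable lborel (\<lambda>x. indicator \<Omega> x *\<^sub>R ?F x)"
    and 2: "integral\<^sup>L (lebesgue_on \<Omega>) ?F = integral\<^sup>L lborel (\<lambda>x. indicator \<Omega> x *\<^sub>R ?F x)"
    by (rule integrable_lebesgue_on_borel_iff; measurable)+
  have nn: "0 \<le> indicator \<Omega> x *\<^sub>R ?F x" for x by (simp add: weight_nonneg)
  show "f \<in> weighted_Lp p \<Omega> \<mu> \<longleftrightarrow> Lp_mass p \<Omega> \<mu> f < \<infinity>"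
  proof -
    have "f \<in> weighted_Lp p \<Omega> \<mu> \<longleftrightarrow> integrable (lebesgue_on \<Omega>) ?F"
      by (simp add: weighted_Lp_def borel_measurable_lebesgue_on)
    also have "\<dots> \<longleftrightarrow> (\<integral>\<^sup>+x. ennreal (norm (indicator \<Omega> x *\<^sub>R ?F x)) \<partial>lborel) < \<infinity>"
      by (subst 1, subst integrable_iff_bounded) simp
    also have "(\<integral>\<^sup>+x. ennreal (norm (indicator \<Omega> x *\<^sub>R ?F x)) \<partial>lborel) = Lp_mass p \<Omega> \<mu> f"
      unfolding m real_norm_def abs_of_nonneg[OF nn] ..
    finally show ?thesis .
  qed
  show "weighted_Lp_norm p \<Omega> \<mu> f = enn2real (Lp_mass p \<Omega> \<mu> f) powr (1 / p)"
    unfolding weighted_Lp_norm_def 2 m using nn by (subst integral_eq_nn_integral) auto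
qed

lemma weighted_Lp_cong_AE:
  assumes f: "f \<in> weighted_Lp p \<Omega> \<mu>" and f0: "f0 \<in> borel_measurable borel" and eq: "AE x in lebesgue_on \<Omega>. f x = f0 x"
  shows "f0 \<in> weighted_Lp p \<Omega> \<mu>" "weighted_Lp_norm p \<Omega> \<mu> f0 = weighted_Lp_norm p \<Omega> \<mu> f"
proof -
  have [measurable]: "f \<in> borel_measurable (lebesgue_on \<Omega>)" "f0 \<in> borel_measurable (lebesgue_on \<Omega>)"
     "\<mu> \<in> borel_measurable (lebesgue_on \<Omega>)"
    using f f0 by (auto simp: weighted_Lp_def intro!: borel_measurable_lebesgue_on)
  have ae: "AE x in lebesgue_on \<Omega>. cmod (f x) powr p * \<mu> x = cmod (f0 x) powr p * \<mu> x"
    using eq by eventually_elim simp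
  have "integrable (lebesgue_on \<Omega>) (\<lambda>x. cmod (f0 x) powr p * \<mu> x)"
    by (rule integrable_cong_AE_imp[of _ "\<lambda>x. cmod (f x) powr p * \<mu> x"])
       (use f ae in \<open>auto simp: weighted_Lp_def\<close>)
  thus "f0 \<in> weighted_Lp p \<Omega> \<mu>" by (simp add: weighted_Lp_def)
  show "weighted_Lp_norm p \<Omega> \<mu> f0 = weighted_Lp_norm p \<Omega> \<mu> f"
    unfolding weighted_Lp_norm_def using ae by (intro arg_cong[where f = "\<lambda>t. t powr (1 / p)"] integral_cong_AE) auto
qed

lemma weighted_L2_mult_integrable:
  assumes f: "f \<in> weighted_Lp 2 \<Omega> \<mu>" and h: "h \<in> weighted_Lp 2 \<Omega> \<mu>"
  shows "integrable (lebesgue_on \<Omega>) (\<lambda>z. f z * cnj (h z) * complex_of_real (\<mu> z))"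
proof (rule Bochner_Integration.integrable_bound)
  have [measurable]: "f \<in> borel_measurable (lebesgue_on \<Omega>)" "h \<in> borel_measurable (lebesgue_on \<Omega>)"
     "\<mu> \<in> borel_measurable (lebesgue_on \<Omega>)"
    using f h by (auto simp: weighted_Lp_def intro!: borel_measurable_lebesgue_on)
  show "integrable (lebesgue_on \<Omega>) (\<lambda>z. cmod (f z) powr 2 * \<mu> z + cmod (h z) powr 2 * \<mu> z)"
    using f h by (intro Bochner_Integration.integrable_add) (auto simp: weighted_Lp_def)
  show "(\<lambda>z. f z * cnj (h z) * complex_of_real (\<mu> z)) \<in> borel_measurable (lebesgue_on \<Omega>)"
    by measurable
  show "AE z in lebesgue_on \<Omega>. norm (f z * cnj (h z) * complex_of_real (\<mu> z)) \<le> norm (cmod (f z) powr 2 * \<mu> z + cmod (h z) powr 2 * \<mu> z)"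
  proof (rule AE_I2)
    fix z
    have "cmod (f z) * cmod (h z) \<le> (cmod (f z))\<^sup>2 + (cmod (h z))\<^sup>2"
    proof -
      have "cmod (f z) * cmod (h z) \<le> 2 * cmod (f z) * cmod (h z)" by simp
      also have "\<dots> \<le> (cmod (f z))\<^sup>2 + (cmod (h z))\<^sup>2" by (rule sum_squares_bound)
      finally show ?thesis .
    qed
    hence "cmod (f z) * cmod (h z) * \<mu> z \<le> ((cmod (f z))\<^sup>2 + (cmod (h z))\<^sup>2) * \<mu> z"
      by (rule mult_right_mono[OF _ weight_nonneg])
    thus "norm (f z * cnj (h z) * complex_of_real (\<mu> z)) \<le> norm (cmod (f z) powr 2 * \<mu> z + cmod (h z) powr 2 * \<mu> z)"
      using weight_nonneg[of z] by (simp add: norm_mult distrib_right powr_numeral)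
  qed
qed

lemma weighted_L2_diff:
  assumes f: "f \<in> weighted_Lp 2 \<Omega> \<mu>" and h: "h \<in> weighted_Lp 2 \<Omega> \<mu>"
  shows "(\<lambda>z. f z - h z) \<in> weighted_Lp 2 \<Omega> \<mu>"
proof -
  have [measurable]: "f \<in> borel_measurable (lebesgue_on \<Omega>)" "h \<in> borel_measurable (lebesgue_on \<Omega>)"
     "\<mu> \<in> borel_measurable (lebesgue_on \<Omega>)"
    using f h by (auto simp: weighted_Lp_def intro!: borel_measurable_lebesgue_on)
  have "integrable (lebesgue_on \<Omega>) (\<lambda>z. cmod (f z - h z) powr 2 * \<mu> z)"
  proof (rule Bochner_Integration.integrable_bound)
    show "integrable (lebesgue_on \<Omega>) (\<lambda>z. 2 * (cmod (f z) powr 2 * \<mu> z) + 2 * (cmod (h z) powr 2 * \<mu> z))"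
      using f h by (intro Bochner_Integration.integrable_add integrable_mult_right) (auto simp: weighted_Lp_def)
    show "AE z in lebesgue_on \<Omega>. norm (cmod (f z - h z) powr 2 * \<mu> z) \<le> norm (2 * (cmod (f z) powr 2 * \<mu> z) + 2 * (cmod (h z) powr 2 * \<mu> z))"
    proof (rule AE_I2)
      fix z
      have "(cmod (f z - h z))\<^sup>2 \<le> (cmod (f z) + cmod (h z))\<^sup>2"
        by (intro power_mono norm_triangle_ineq4) auto
      also have "\<dots> \<le> 2 * (cmod (f z))\<^sup>2 + 2 * (cmod (h z))\<^sup>2"
        using sum_squares_bound[of "cmod (f z)" "cmod (h z)"] by (simp add: power2_sum)
      finally have "(cmod (f z - h z))\<^sup>2 * \<mu> z \<le> (2 * (cmod (f z))\<^sup>2 + 2 * (cmod (h z))\<^sup>2) * \<mu> z"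
        by (rule mult_right_mono[OF _ weight_nonneg])
      thus "norm (cmod (f z - h z) powr 2 * \<mu> z) \<le> norm (2 * (cmod (f z) powr 2 * \<mu> z) + 2 * (cmod (h z) powr 2 * \<mu> z))"
        using weight_nonneg[of z] by (simp add: distrib_right powr_numeral mult.assoc)
    qed
  qed measurable
  thus ?thesis by (simp add: weighted_Lp_def)
qed

lemma continuous_AE_zero:
  fixes d :: "'a \<Rightarrow> complex"
  assumes cont: "continuous_on \<Omega> d" and ae: "AE x in lebesgue_on \<Omega>. d x = 0" and x: "x \<in> \<Omega>"
  shows "d x = 0"
proof (rule ccontr)
  assume nz: "d x \<noteq> 0"
  let ?U = "\<Omega> \<inter> d -` (- {0})"
  have U: "open ?U" by (rule continuous_open_preimage[OF cont open_dom]) auto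
  have "AE y in lebesgue. y \<notin> ?U" using ae unfolding AE_lebesgue_on_iff[OF dom_borel] by eventually_elim auto
  hence "?U \<in> null_sets lebesgue" using U by (subst (asm) AE_iff_null_sets[symmetric]) auto
  hence "negligible ?U" by (simp add: negligible_iff_null_sets)
  moreover have "?U \<noteq> {}" using x nz by auto
  ultimately show False using open_not_negligible[OF U] by blast
qed

text \<open>The difference of two candidates belongs to the Bergman space and is orthogonal to
  itself, hence 0 almost everywhere on the domain, hence everywhere there by continuity. Of the
  notion \<open>hol\<close> only continuity and closure under differences are used, so one lemma
  serves one and two variables.\<close>

lemma bergman_projection_eqI:
  assumes cont: "\<And>u. hol u \<Omega> \<Longrightarrow> continuous_on \<Omega> u"
    and diff: "\<And>u v. hol u \<Omega> \<Longrightarrow> hol v \<Omega> \<Longrightarrow> hol (\<lambda>z. u z - v z) \<Omega>"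
    and f: "f \<in> weighted_Lp 2 \<Omega> \<mu>" and h: "h \<in> bergman_space hol \<Omega> \<mu>" and h0: "\<And>z. z \<notin> \<Omega> \<Longrightarrow> h z = 0"
    and orth: "\<And>u. u \<in> bergman_space hol \<Omega> \<mu> \<Longrightarrow> weighted_inner \<Omega> \<mu> (\<lambda>z. f z - h z) u = 0"
  shows "bergman_projection hol \<Omega> \<mu> f = h"
  unfolding bergman_projection_def
proof (rule the_equality)
  fix h' assume h': "h' \<in> bergman_space hol \<Omega> \<mu> \<and> (\<forall>z. z \<notin> \<Omega> \<longrightarrow> h' z = 0) \<and>
        (\<forall>u \<in> bergman_space hol \<Omega> \<mu>. weighted_inner \<Omega> \<mu> (\<lambda>z. f z - h' z) u = 0)"
  define d where "d z = h' z - h z" for z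
  have L: "h \<in> weighted_Lp 2 \<Omega> \<mu>" "h' \<in> weighted_Lp 2 \<Omega> \<mu>" "hol h \<Omega>" "hol h' \<Omega>"
    using h h' by (auto simp: bergman_space_def)
  have dB: "d \<in> bergman_space hol \<Omega> \<mu>"
    unfolding d_def bergman_space_def using L by (auto intro!: weighted_L2_diff diff)
  hence dL: "d \<in> weighted_Lp 2 \<Omega> \<mu>" "hol d \<Omega>" by (auto simp: bergman_space_def)
  have i1: "integrable (lebesgue_on \<Omega>) (\<lambda>z. (f z - h z) * cnj (d z) * complex_of_real (\<mu> z))"
    and i2: "integrable (lebesgue_on \<Omega>) (\<lambda>z. (f z - h' z) * cnj (d z) * complex_of_real (\<mu> z))"
    using L dL f by (auto intro!: weighted_L2_mult_integrable weighted_L2_diff)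
  have "0 = weighted_inner \<Omega> \<mu> (\<lambda>z. f z - h z) d - weighted_inner \<Omega> \<mu> (\<lambda>z. f z - h' z) d"
    using orth[OF dB] h' dB by simp
  also have "\<dots> = (\<integral>z. (f z - h z) * cnj (d z) * complex_of_real (\<mu> z) - (f z - h' z) * cnj (d z) * complex_of_real (\<mu> z) \<partial>lebesgue_on \<Omega>)"
    unfolding weighted_inner_def by (rule Bochner_Integration.integral_diff[symmetric, OF i1 i2])
  also have "\<dots> = (\<integral>z. complex_of_real (cmod (d z) powr 2 * \<mu> z) \<partial>lebesgue_on \<Omega>)"
  proof (intro Bochner_Integration.integral_cong refl)
    fix z
    have "(f z - h z) * cnj (d z) * complex_of_real (\<mu> z) - (f z - h' z) * cnj (d z) * complex_of_real (\<mu> z)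
       = d z * cnj (d z) * complex_of_real (\<mu> z)" by (simp add: d_def algebra_simps)
    also have "\<dots> = complex_of_real (cmod (d z) powr 2 * \<mu> z)"
      unfolding complex_norm_square[symmetric] by (simp add: powr_numeral)
    finally show "(f z - h z) * cnj (d z) * complex_of_real (\<mu> z) - (f z - h' z) * cnj (d z) * complex_of_real (\<mu> z)
       = complex_of_real (cmod (d z) powr 2 * \<mu> z)" .
  qed
  also have "\<dots> = complex_of_real (\<integral>z. cmod (d z) powr 2 * \<mu> z \<partial>lebesgue_on \<Omega>)"
    by (rule integral_complex_of_real)
  finally have "(\<integral>z. cmod (d z) powr 2 * \<mu> z \<partial>lebesgue_on \<Omega>) = 0" by (metis of_real_eq_0_iff)
  hence "AE z in lebesgue_on \<Omega>. cmod (d z) powr 2 * \<mu> z = 0"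
    using dL weight_nonneg by (subst (asm) integral_nonneg_eq_0_iff_AE) (auto simp: weighted_Lp_def)
  hence "AE z in lebesgue. z \<in> \<Omega> \<longrightarrow> d z = 0"
    unfolding AE_lebesgue_on_iff[OF dom_borel] by eventually_elim (use weight_pos in force)
  hence "d z = 0" if "z \<in> \<Omega>" for z
    using continuous_AE_zero[OF cont[OF dL(2)] _ that] unfolding AE_lebesgue_on_iff[OF dom_borel] by simp
  hence "h' z = h z" for z using h' h0 by (cases "z \<in> \<Omega>") (auto simp: d_def)
  thus "h' = h" by auto
qed (use h h0 orth in auto)

lemma bergman_projection_cong_AE:
  assumes f: "f \<in> weighted_Lp 2 \<Omega> \<mu>" and f0: "f0 \<in> borel_measurable borel" and eq: "AE x in lebesgue_on \<Omega>. f x = f0 x"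
  shows "bergman_projection hol \<Omega> \<mu> f = bergman_projection hol \<Omega> \<mu> f0"
proof -
  have inner: "weighted_inner \<Omega> \<mu> (\<lambda>z. f z - h z) u = weighted_inner \<Omega> \<mu> (\<lambda>z. f0 z - h z) u"
    if "h \<in> bergman_space hol \<Omega> \<mu>" "u \<in> bergman_space hol \<Omega> \<mu>" for h u
  proof -
    have [measurable]: "f \<in> borel_measurable (lebesgue_on \<Omega>)" "f0 \<in> borel_measurable (lebesgue_on \<Omega>)"
      "h \<in> borel_measurable (lebesgue_on \<Omega>)" "u \<in> borel_measurable (lebesgue_on \<Omega>)"
      "\<mu> \<in> borel_measurable (lebesgue_on \<Omega>)"
      using f f0 that by (auto simp: weighted_Lp_def bergman_space_def intro!: borel_measurable_lebesgue_on)
    show ?thesis unfolding weighted_inner_def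
      by (rule integral_cong_AE) (use eq in \<open>auto elim: AE_mp\<close>)
  qed
  show ?thesis unfolding bergman_projection_def
    by (rule arg_cong[where f = The]) (use inner in \<open>auto simp: fun_eq_iff\<close>)
qed

text \<open>Replaces the projection by an explicit operator on Borel functions and norms by masses.
  Accordingly the constants on the two sides differ by a p-th power, and a possibly negative
  constant is replaced by its maximum with 0.\<close>

lemma Lp_bounded_iff:
  assumes p: "p > 0"
    and T: "\<And>f. f \<in> borel_measurable borel \<Longrightarrow> Lp_mass 2 \<Omega> \<mu> f < \<infinity> \<Longrightarrow> bergman_projection hol \<Omega> \<mu> f = T f"
    and Tm: "\<And>f. f \<in> borel_measurable borel \<Longrightarrow> T f \<in> borel_measurable borel"
  shows "Lp_bounded p \<Omega> \<mu> (bergman_projection hol \<Omega> \<mu>) \<longleftrightarrow>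
    (\<exists>C::real. \<forall>f. f \<in> borel_measurable borel \<longrightarrow> Lp_mass 2 \<Omega> \<mu> f < \<infinity> \<longrightarrow> Lp_mass p \<Omega> \<mu> f < \<infinity> \<longrightarrow>
       Lp_mass p \<Omega> \<mu> (T f) \<le> ennreal C * Lp_mass p \<Omega> \<mu> f)" (is "_ = ?R")
proof
  assume "Lp_bounded p \<Omega> \<mu> (bergman_projection hol \<Omega> \<mu>)"
  then obtain C where C: "\<And>f. f \<in> weighted_Lp p \<Omega> \<mu> \<inter> weighted_Lp 2 \<Omega> \<mu> \<Longrightarrow>
     bergman_projection hol \<Omega> \<mu> f \<in> weighted_Lp p \<Omega> \<mu> \<and>
     weighted_Lp_norm p \<Omega> \<mu> (bergman_projection hol \<Omega> \<mu> f) \<le> C * weighted_Lp_norm p \<Omega> \<mu> f"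
    unfolding Lp_bounded_def by blast
  show ?R
  proof (intro exI[of _ "(max C 0) powr p"] allI impI)
    fix f :: "'a \<Rightarrow> complex" assume f: "f \<in> borel_measurable borel" "Lp_mass 2 \<Omega> \<mu> f < \<infinity>" "Lp_mass p \<Omega> \<mu> f < \<infinity>"
    have b: "T f \<in> weighted_Lp p \<Omega> \<mu>" "weighted_Lp_norm p \<Omega> \<mu> (T f) \<le> C * weighted_Lp_norm p \<Omega> \<mu> f"
      using C[of f] f T[OF f(1,2)] by (auto simp: weighted_Lp_iff(1))
    define x y where "x = enn2real (Lp_mass p \<Omega> \<mu> (T f))" and "y = enn2real (Lp_mass p \<Omega> \<mu> f)"
    have xy: "Lp_mass p \<Omega> \<mu> (T f) = ennreal x" "Lp_mass p \<Omega> \<mu> f = ennreal y" "0 \<le> x" "0 \<le> y"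
      using b(1) f Tm[OF f(1)] by (auto simp: x_def y_def weighted_Lp_iff(1))
    have "x powr (1 / p) \<le> C * y powr (1 / p)"
      using b(2) f Tm[OF f(1)] by (simp add: weighted_Lp_iff(2) x_def y_def)
    also have "\<dots> \<le> max C 0 * y powr (1 / p)" by (intro mult_right_mono) auto
    finally have "(x powr (1 / p)) powr p \<le> (max C 0 * y powr (1 / p)) powr p"
      using p by (intro powr_mono2) auto
    hence "x \<le> max C 0 powr p * y" using p xy by (simp add: powr_mult powr_powr)
    thus "Lp_mass p \<Omega> \<mu> (T f) \<le> ennreal (max C 0 powr p) * Lp_mass p \<Omega> \<mu> f"
      unfolding xy by (simp add: ennreal_mult'[symmetric] ennreal_leI)
  qed
next
  assume ?R
  then obtain C where C: "\<And>f. f \<in> borel_measurable borel \<Longrightarrow> Lp_mass 2 \<Omega> \<mu> f < \<infinity> \<Longrightarrow> Lp_mass p \<Omega> \<mu> f < \<infinity> \<Longrightarrow>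
       Lp_mass p \<Omega> \<mu> (T f) \<le> ennreal C * Lp_mass p \<Omega> \<mu> f" by blast
  define D where "D = max C 0"
  show "Lp_bounded p \<Omega> \<mu> (bergman_projection hol \<Omega> \<mu>)"
    unfolding Lp_bounded_def
  proof (intro exI[of _ "D powr (1 / p)"] ballI)
    fix f assume "f \<in> weighted_Lp p \<Omega> \<mu> \<inter> weighted_Lp 2 \<Omega> \<mu>"
    hence f: "f \<in> weighted_Lp p \<Omega> \<mu>" "f \<in> weighted_Lp 2 \<Omega> \<mu>" by auto
    have "f \<in> borel_measurable (lebesgue_on \<Omega>)" using f by (simp add: weighted_Lp_def)
    from borel_representative[OF dom_borel this] obtain f0
      where f0 [measurable]: "f0 \<in> borel_measurable borel" and eq: "AE x in lebesgue_on \<Omega>. f x = f0 x" by blast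
    have fin: "Lp_mass p \<Omega> \<mu> f0 < \<infinity>" "Lp_mass 2 \<Omega> \<mu> f0 < \<infinity>"
      using weighted_Lp_cong_AE(1)[OF f(1) f0 eq] weighted_Lp_cong_AE(1)[OF f(2) f0 eq]
      by (auto simp: weighted_Lp_iff(1))
    have B: "bergman_projection hol \<Omega> \<mu> f = T f0"
      using bergman_projection_cong_AE[OF f(2) f0 eq] T[OF f0 fin(2)] by simp
    have le: "Lp_mass p \<Omega> \<mu> (T f0) \<le> ennreal D * Lp_mass p \<Omega> \<mu> f0"
      by (rule order_trans[OF C[OF f0 fin(2,1)]]) (auto intro!: mult_right_mono ennreal_leI simp: D_def)
    hence fin2: "Lp_mass p \<Omega> \<mu> (T f0) < \<infinity>"
      using fin(1) by (auto intro: le_less_trans simp: ennreal_mult_less_top)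
    define x y where "x = enn2real (Lp_mass p \<Omega> \<mu> (T f0))" and "y = enn2real (Lp_mass p \<Omega> \<mu> f0)"
    have xy: "Lp_mass p \<Omega> \<mu> (T f0) = ennreal x" "Lp_mass p \<Omega> \<mu> f0 = ennreal y" "0 \<le> x" "0 \<le> y"
      using fin2 fin by (auto simp: x_def y_def)
    have "x \<le> D * y" using le xy by (simp add: ennreal_mult'[symmetric] D_def)
    hence "x powr (1 / p) \<le> (D * y) powr (1 / p)" using p xy by (intro powr_mono2) auto
    hence "x powr (1 / p) \<le> D powr (1 / p) * y powr (1 / p)" using xy by (simp add: powr_mult D_def)
    moreover have "weighted_Lp_norm p \<Omega> \<mu> f = y powr (1 / p)"
      using weighted_Lp_cong_AE(2)[OF f(1) f0 eq] by (simp add: weighted_Lp_iff(2) y_def)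
    moreover have "weighted_Lp_norm p \<Omega> \<mu> (T f0) = x powr (1 / p)"
      using Tm[OF f0] by (simp add: weighted_Lp_iff(2) x_def)
    ultimately show "bergman_projection hol \<Omega> \<mu> f \<in> weighted_Lp p \<Omega> \<mu> \<and>
        weighted_Lp_norm p \<Omega> \<mu> (bergman_projection hol \<Omega> \<mu> f) \<le> D powr (1 / p) * weighted_Lp_norm p \<Omega> \<mu> f"
      using fin2 Tm[OF f0] by (simp add: B weighted_Lp_iff(1))
  qed
qed

end

text \<open>Extends the bound to functions with values in [0, \<infinity>], because on the bidisk
  the function fed into one variable is itself an integral over the other. If the right side is
  finite, \<open>f\<close> is finite almost everywhere.\<close>

lemma kernel_Lp_bound:
  assumes p: "p > 1" and a: "- 2 < a" "a \<le> 0"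
  shows "\<exists>C>0. \<forall>f::complex \<Rightarrow> ennreal. f \<in> borel_measurable borel \<longrightarrow>
     (\<integral>\<^sup>+z. epow p (\<integral>\<^sup>+w. ennreal (cmod (bergman_kernel a z w)) * f w \<partial>disk_measure a) \<partial>disk_measure a)
       \<le> ennreal C * (\<integral>\<^sup>+w. epow p (f w) \<partial>disk_measure a)"
proof -
  obtain C where C: "C > 0" "\<And>f::complex \<Rightarrow> real. f \<in> borel_measurable borel \<Longrightarrow> (\<And>x. f x \<ge> 0) \<Longrightarrow>
     (\<integral>\<^sup>+z. epow p (\<integral>\<^sup>+w. ennreal (abs_kernel z w * f w) \<partial>disk_measure a) \<partial>disk_measure a)
       \<le> ennreal C * (\<integral>\<^sup>+w. ennreal (f w powr p) \<partial>disk_measure a)"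
    using abs_kernel_Lp_bound[OF p a] by blast
  define K where "K = 1 + \<bar>a\<bar>"
  have K: "K > 0" by (simp add: K_def)
  show ?thesis
  proof (intro exI conjI allI impI)
    show "C * K powr p > 0" using C K by simp
    fix f :: "complex \<Rightarrow> ennreal" assume f [measurable]: "f \<in> borel_measurable borel"
    show "(\<integral>\<^sup>+z. epow p (\<integral>\<^sup>+w. ennreal (cmod (bergman_kernel a z w)) * f w \<partial>disk_measure a) \<partial>disk_measure a)
       \<le> ennreal (C * K powr p) * (\<integral>\<^sup>+w. epow p (f w) \<partial>disk_measure a)"
    proof (cases "(\<integral>\<^sup>+w. epow p (f w) \<partial>disk_measure a) = \<infinity>")
      case True
      thus ?thesis using C K by (simp add: ennreal_mult_top)
    next
      case False
      have "AE w in disk_measure a. epow p (f w) \<noteq> \<infinity>"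
        by (rule nn_integral_PInf_AE) (use False in auto)
      hence fin: "AE w in disk_measure a. f w = ennreal (enn2real (f w))"
        by eventually_elim (auto simp: epow_def less_top split: if_splits)
      define F where "F w = K * enn2real (f w)" for w
      have F: "F \<in> borel_measurable borel" "\<And>w. F w \<ge> 0" using K unfolding F_def by auto
      have "(\<integral>\<^sup>+z. epow p (\<integral>\<^sup>+w. ennreal (cmod (bergman_kernel a z w)) * f w \<partial>disk_measure a) \<partial>disk_measure a)
        \<le> (\<integral>\<^sup>+z. epow p (\<integral>\<^sup>+w. ennreal (abs_kernel z w * F w) \<partial>disk_measure a) \<partial>disk_measure a)"
      proof (rule nn_integral_mono_AE, unfold AE_disk_measure_iff, intro AE_I2 impI)
        fix z assume "z \<in> unit_disk" hence z: "cmod z < 1" by (simp add: unit_disk_def)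
        have d: "AE w in disk_measure a. cmod w < 1" by (simp add: AE_disk_measure_iff unit_disk_def)
        have "(\<integral>\<^sup>+w. ennreal (cmod (bergman_kernel a z w)) * f w \<partial>disk_measure a)
           \<le> (\<integral>\<^sup>+w. ennreal (abs_kernel z w * F w) \<partial>disk_measure a)"
        proof (rule nn_integral_mono_AE)
          show "AE w in disk_measure a. ennreal (cmod (bergman_kernel a z w)) * f w \<le> ennreal (abs_kernel z w * F w)"
            using fin d
          proof eventually_elim
            fix w assume w: "f w = ennreal (enn2real (f w))" "cmod w < 1"
            have "cmod (bergman_kernel a z w) * enn2real (f w) \<le> K * abs_kernel z w * enn2real (f w)"
              unfolding K_def by (intro mult_right_mono norm_bergman_kernel_le z w) simp
            hence "ennreal (cmod (bergman_kernel a z w)) * ennreal (enn2real (f w)) \<le> ennreal (abs_kernel z w * F w)"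
              unfolding F_def by (simp add: ennreal_mult'[symmetric] ennreal_leI ac_simps)
            thus "ennreal (cmod (bergman_kernel a z w)) * f w \<le> ennreal (abs_kernel z w * F w)"
              by (subst w(1))
          qed
        qed
        thus "epow p (\<integral>\<^sup>+w. ennreal (cmod (bergman_kernel a z w)) * f w \<partial>disk_measure a)
          \<le> epow p (\<integral>\<^sup>+w. ennreal (abs_kernel z w * F w) \<partial>disk_measure a)"
          using p by (intro epow_mono) auto
      qed
      also have "\<dots> \<le> ennreal C * (\<integral>\<^sup>+w. ennreal (F w powr p) \<partial>disk_measure a)"
        by (rule C(2)[OF F])
      also have "(\<integral>\<^sup>+w. ennreal (F w powr p) \<partial>disk_measure a) = (\<integral>\<^sup>+w. ennreal (K powr p) * epow p (f w) \<partial>disk_measure a)"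
      proof (rule nn_integral_cong_AE)
        show "AE w in disk_measure a. ennreal (F w powr p) = ennreal (K powr p) * epow p (f w)"
          using fin
        proof eventually_elim
          fix w assume "f w = ennreal (enn2real (f w))"
          hence "epow p (f w) = ennreal (enn2real (f w) powr p)" by (metis epow_ennreal enn2real_nonneg)
          thus "ennreal (F w powr p) = ennreal (K powr p) * epow p (f w)"
            using K by (simp add: F_def powr_mult ennreal_mult')
        qed
      qed
      also have "\<dots> = ennreal (K powr p) * (\<integral>\<^sup>+w. epow p (f w) \<partial>disk_measure a)"
        by (rule nn_integral_cmult) measurable
      finally show ?thesis using C by (simp add: ennreal_mult' mult.assoc)
    qed
  qed
qed

subsection \<open>Differentiation under the integral sign\<close>

text \<open>A remainder that is quadratic in the increment, with an integrable factor \<phi>, stays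
  quadratic after integration and is below e times the increment once that is less than e / C. The
  domain is a normed space so that the lemma covers functions of one and of two complex
  variables.\<close>

lemma has_derivative_integral_quadratic:
  fixes K :: "'x::real_normed_vector \<Rightarrow> 'y \<Rightarrow> complex"
  assumes d: "d > 0" and int: "\<And>x. norm (x - x0) < d \<Longrightarrow> integrable M (K x)"
    and Dint: "\<And>h. integrable M (\<lambda>y. D y h)" and lin: "bounded_linear (\<lambda>h. \<integral>y. D y h \<partial>M)"
    and phi: "integrable M \<phi>"
    and bd: "\<And>x. norm (x - x0) < d \<Longrightarrow> AE y in M. cmod (K x y - K x0 y - D y (x - x0)) \<le> (norm (x - x0))\<^sup>2 * \<phi> y"
  shows "((\<lambda>x. \<integral>y. K x y \<partial>M) has_derivative (\<lambda>h. \<integral>y. D y h \<partial>M)) (at x0)"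
  unfolding has_derivative_at_alt
proof (intro conjI lin allI impI)
  fix e :: real assume e: "e > 0"
  define C where "C = \<bar>integral\<^sup>L M \<phi>\<bar> + 1"
  have C: "C > 0" "integral\<^sup>L M \<phi> \<le> C" by (auto simp: C_def)
  show "\<exists>d'>0. \<forall>y. norm (y - x0) < d' \<longrightarrow>
     norm ((\<integral>z. K y z \<partial>M) - (\<integral>z. K x0 z \<partial>M) - (\<integral>z. D z (y - x0) \<partial>M)) \<le> e * norm (y - x0)"
  proof (intro exI[of _ "min d (e / C)"] conjI allI impI)
    show "0 < min d (e / C)" using d e C by simp
    fix x assume "norm (x - x0) < min d (e / C)"
    hence x: "norm (x - x0) < d" "norm (x - x0) < e / C" by auto
    have i: "integrable M (K x)" "integrable M (K x0)" "integrable M (\<lambda>y. D y (x - x0))"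
      using int[OF x(1)] int[of x0] d Dint by auto
    have "(\<integral>z. K x z \<partial>M) - (\<integral>z. K x0 z \<partial>M) - (\<integral>z. D z (x - x0) \<partial>M)
       = (\<integral>z. K x z - K x0 z - D z (x - x0) \<partial>M)" using i by simp
    also have "norm \<dots> \<le> (\<integral>z. (norm (x - x0))\<^sup>2 * \<phi> z \<partial>M)"
      by (rule order_trans[OF integral_norm_bound integral_mono_AE]) (use i phi bd[OF x(1)] in auto)
    also have "\<dots> = (norm (x - x0))\<^sup>2 * integral\<^sup>L M \<phi>" by simp
    also have "\<dots> \<le> norm (x - x0) * (norm (x - x0) * C)"
      using C by (simp add: power2_eq_square mult.assoc mult_left_mono)
    also have "norm (x - x0) * C \<le> e" using x(2) C by (simp add: field_simps)
    hence "norm (x - x0) * (norm (x - x0) * C) \<le> norm (x - x0) * e" by (rule mult_left_mono) simp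
    finally show "norm ((\<integral>z. K x z \<partial>M) - (\<integral>z. K x0 z \<partial>M) - (\<integral>z. D z (x - x0) \<partial>M)) \<le> e * norm (x - x0)"
      by (simp add: mult.commute)
  qed
qed

text \<open>The complex derivative of \<open>bergman_kernel a z w\<close> in z.\<close>

definition kernel_deriv :: "real \<Rightarrow> complex \<Rightarrow> complex \<Rightarrow> complex" where
  "kernel_deriv a z w =
     cnj w * (2 * (1 / (1 - z * cnj w)) ^ 3 + of_real (a / 2) * (1 / (1 - z * cnj w))\<^sup>2) / of_real pi"

lemma measurable_kernel_deriv [measurable (raw)]:
  assumes [measurable]: "f \<in> borel_measurable M" "g \<in> borel_measurable M"
  shows "(\<lambda>x. kernel_deriv a (f x) (g x)) \<in> borel_measurable M"
  unfolding kernel_deriv_def by measurable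

text \<open>For z in a smaller closed ball |1 / (1 - z cnj w)| is bounded uniformly in w, hence so
  are the kernel and its first two derivatives, and Taylor's formula on the convex ball gives the
  remainders.\<close>

lemma kernel_taylor:
  assumes r: "0 \<le> r" "r < 1"
  shows "\<exists>C\<ge>0. \<forall>w. cmod w < 1 \<longrightarrow> (\<forall>z\<in>cball 0 r. \<forall>z'\<in>cball 0 r.
     cmod (bergman_kernel a z' w - bergman_kernel a z w - kernel_deriv a z w * (z' - z)) \<le> C * (cmod (z' - z))\<^sup>2 \<and>
     cmod (bergman_kernel a z' w - bergman_kernel a z w) \<le> C * cmod (z' - z) \<and>
     cmod (bergman_kernel a z w) \<le> C \<and> cmod (kernel_deriv a z w) \<le> C)"
proof -
  define R where "R = 1 / (1 - r)"
  have R: "R \<ge> 1" using r by (simp add: R_def)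
  \<comment> \<open>The second derivative is (cnj w)^2 (6 Y^4 + a Y^3) / \<pi> with Y = 1 / (1 - z
    cnj w). Its coefficients and its highest power also dominate the kernel and the first
    derivative, as R \<ge> 1.\<close>
  define C where "C = (6 + \<bar>a\<bar>) * R ^ 4"
  have C0: "C \<ge> 0" using R by (simp add: C_def)
  show ?thesis
  proof (intro exI[of _ C] conjI C0 allI impI ballI)
    fix w z z' :: complex assume w: "cmod w < 1" and z: "z \<in> cball 0 r" and z': "z' \<in> cball 0 r"
    define Y where "Y z = 1 / (1 - z * cnj w)" for z
    have ne: "1 - x * cnj w \<noteq> 0" if "x \<in> cball 0 r" for x
      using one_minus_mult_cnj_neq_0[of x w] w that r by auto
    have Y: "cmod (Y x) \<le> R" if "x \<in> cball 0 r" for x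
    proof -
      have "1 - r \<le> cmod (1 - x * cnj w)" using norm_one_minus_ge[of w x] w that by auto
      thus ?thesis unfolding Y_def R_def norm_divide using r by (auto intro!: divide_left_mono mult_pos_pos)
    qed
    have Yp: "cmod (Y x) ^ n \<le> R ^ 4" if "x \<in> cball 0 r" "n \<le> 4" for x n
    proof -
      have "cmod (Y x) ^ n \<le> R ^ n" using Y[OF that(1)] by (intro power_mono) auto
      also have "\<dots> \<le> R ^ 4" using R that by (intro power_increasing) auto
      finally show ?thesis .
    qed
    have pi1: "cmod (x / of_real pi) \<le> cmod x" for x
      using pi_gt3 by (simp add: norm_divide divide_le_eq mult_le_cancel_left1)
    have bnd: "cmod (c * (of_real m * Y x ^ i + of_real n * Y x ^ j) / of_real pi) \<le> C"
      if "x \<in> cball 0 r" "cmod c \<le> 1" "\<bar>m\<bar> \<le> 6" "\<bar>n\<bar> \<le> \<bar>a\<bar>" "i \<le> 4" "j \<le> 4" for x c m n i j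
    proof -
      have "cmod (c * (of_real m * Y x ^ i + of_real n * Y x ^ j) / of_real pi) \<le> cmod (c * (of_real m * Y x ^ i + of_real n * Y x ^ j))"
        by (rule pi1)
      also have "\<dots> \<le> 1 * cmod (of_real m * Y x ^ i + of_real n * Y x ^ j)"
        unfolding norm_mult[of c] using that by (intro mult_right_mono) auto
      also have "\<dots> \<le> \<bar>m\<bar> * cmod (Y x) ^ i + \<bar>n\<bar> * cmod (Y x) ^ j"
        using norm_triangle_ineq[of "of_real m * Y x ^ i" "of_real n * Y x ^ j"] by (simp add: norm_mult norm_power)
      also have "\<dots> \<le> 6 * R ^ 4 + \<bar>a\<bar> * R ^ 4"
        using that Yp by (intro add_mono mult_mono) auto
      finally show ?thesis by (simp add: C_def distrib_right)
    qed
    define F where "F i x = (if i = 0 then bergman_kernel a x w else if i = 1 then kernel_deriv a x w else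
        (cnj w)\<^sup>2 * (of_real 6 * Y x ^ 4 + of_real a * Y x ^ 3) / of_real pi)" for i :: nat and x
    have c1: "cmod (cnj w) \<le> 1" "cmod ((cnj w)\<^sup>2) \<le> 1" using w by (auto simp: norm_power power_le_one)
    have b0: "cmod (F 0 x) \<le> C" if "x \<in> cball 0 r" for x
      using bnd[OF that, of 1 1 "a / 2" 2 1] by (simp add: F_def bergman_kernel_def Y_def)
    have b1: "cmod (F (Suc 0) x) \<le> C" if "x \<in> cball 0 r" for x
      using bnd[OF that c1(1), of 2 "a / 2" 3 2] by (simp add: F_def kernel_deriv_def Y_def)
    have b2: "cmod (F (Suc (Suc 0)) x) \<le> C" if "x \<in> cball 0 r" for x
      using bnd[OF that c1(2), of 6 a 4 3] by (simp add: F_def)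
    have dY: "(Y has_field_derivative cnj w * (Y x)\<^sup>2) (at x within cball 0 r)" if "x \<in> cball 0 r" for x
      unfolding Y_def using ne[OF that] by (auto intro!: derivative_eq_intros simp: power2_eq_square)
    have d0: "(F 0 has_field_derivative F (Suc 0) x) (at x within cball 0 r)" if "x \<in> cball 0 r" for x
    proof -
      have "((\<lambda>x. ((Y x)\<^sup>2 + of_real (a / 2) * Y x) / of_real pi) has_field_derivative F (Suc 0) x) (at x within cball 0 r)"
        by (auto intro!: derivative_eq_intros dY[OF that])
           (simp add: F_def kernel_deriv_def Y_def[symmetric] field_simps power2_eq_square power3_eq_cube)
      thus ?thesis unfolding F_def bergman_kernel_def Y_def by simp
    qed
    have d1: "(F (Suc 0) has_field_derivative F (Suc (Suc 0)) x) (at x within cball 0 r)" if "x \<in> cball 0 r" for x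
    proof -
      have "((\<lambda>x. cnj w * (2 * Y x ^ 3 + of_real (a / 2) * (Y x)\<^sup>2) / of_real pi) has_field_derivative F (Suc (Suc 0)) x) (at x within cball 0 r)"
        by (auto intro!: derivative_eq_intros dY[OF that])
           (simp add: F_def field_simps power2_eq_square power3_eq_cube power4_eq_xxxx)
      thus ?thesis unfolding F_def kernel_deriv_def Y_def by simp
    qed
    have "cmod (F 0 z' - (\<Sum>i\<le>1. F i z * (z' - z) ^ i / fact i)) \<le> C * cmod (z' - z) ^ Suc 1 / fact 1"
    proof (rule field_Taylor[OF convex_cball _ _ z z'])
      fix i :: nat and x :: complex assume "x \<in> cball 0 r" "i \<le> 1"
      thus "(F i has_field_derivative F (Suc i) x) (at x within cball 0 r)"
        using d0 d1 by (cases i) auto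
    qed (use b2 in auto)
    thus "cmod (bergman_kernel a z' w - bergman_kernel a z w - kernel_deriv a z w * (z' - z)) \<le> C * (cmod (z' - z))\<^sup>2"
      by (simp add: F_def power2_eq_square algebra_simps)
    have "cmod (F 0 z' - (\<Sum>i\<le>0. F i z * (z' - z) ^ i / fact i)) \<le> C * cmod (z' - z) ^ Suc 0 / fact 0"
      by (rule field_Taylor[OF convex_cball _ _ z z']) (use b1 d0 in auto)
    thus "cmod (bergman_kernel a z' w - bergman_kernel a z w) \<le> C * cmod (z' - z)"
      by (simp add: F_def)
    show "cmod (bergman_kernel a z w) \<le> C" using b0[OF z] by (simp add: F_def)
    show "cmod (kernel_deriv a z w) \<le> C" using b1[OF z] by (simp add: F_def)
  qed
qed

subsection \<open>The weighted Bergman projection of the disk\<close>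

text \<open>Hermitian symmetry moves the operator from \<open>G\<close> to \<open>U\<close>, and by
  \<open>rep\<close> it fixes \<open>U\<close>; so the inner products of \<open>G\<close> and of its
  image with \<open>U\<close> coincide.\<close>

lemma kernel_projection_orthogonal:
  fixes Q :: "'a \<Rightarrow> 'a \<Rightarrow> complex" and G U :: "'a \<Rightarrow> complex"
  assumes M: "sigma_finite_measure M"
    and Q [measurable]: "case_prod Q \<in> borel_measurable (M \<Otimes>\<^sub>M M)"
    and herm: "\<And>x y. cnj (Q x y) = Q y x"
    and G [measurable]: "G \<in> borel_measurable M" and U [measurable]: "U \<in> borel_measurable M"
    and TG: "(\<integral>\<^sup>+x. epow 2 (\<integral>\<^sup>+y. ennreal (cmod (Q x y) * cmod (G y)) \<partial>M) \<partial>M) < \<infinity>"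
    and GL: "sq_mass M G < \<infinity>"
    and UL: "sq_mass M U < \<infinity>"
    and rep: "AE x in M. (\<integral>y. Q x y * U y \<partial>M) = U x"
  shows "(\<integral>x. (G x - (\<integral>y. Q x y * G y \<partial>M)) * cnj (U x) \<partial>M) = 0"
proof -
  interpret M: sigma_finite_measure M by (rule M)
  define T where "T x = (\<integral>y. Q x y * G y \<partial>M)" for x
  have Tm [measurable]: "T \<in> borel_measurable M" unfolding T_def by measurable
  have prod: "integrable M (\<lambda>x. V x * cnj (U x))"
    if [measurable]: "V \<in> borel_measurable M" and VL: "sq_mass M V < \<infinity>" for V
  proof (rule integrableI_bounded)
    have "(\<integral>\<^sup>+x. ennreal (cmod (V x)) * ennreal (cmod (U x)) \<partial>M)\<^sup>2
       \<le> (\<integral>\<^sup>+x. (ennreal (cmod (V x)))\<^sup>2 \<partial>M) * (\<integral>\<^sup>+x. (ennreal (cmod (U x)))\<^sup>2 \<partial>M)"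
      by (rule Cauchy_Schwarz_nn_integral) measurable
    also have "\<dots> < \<infinity>" using VL UL by (simp add: ennreal_power ennreal_mult_less_top)
    finally have "(\<integral>\<^sup>+x. ennreal (cmod (V x)) * ennreal (cmod (U x)) \<partial>M) < \<infinity>"
      by (auto simp: power2_eq_square ennreal_mult_less_top less_top[symmetric])
    thus "(\<integral>\<^sup>+x. ennreal (norm (V x * cnj (U x))) \<partial>M) < \<infinity>" by (simp add: norm_mult ennreal_mult')
  qed measurable
  have TL: "sq_mass M T < \<infinity>"
  proof -
    have "ennreal ((cmod (T x))\<^sup>2) \<le> epow 2 (\<integral>\<^sup>+y. ennreal (cmod (Q x y) * cmod (G y)) \<partial>M)" for x
      using powr_norm_integral_le_epow[of 2 M "\<lambda>y. Q x y * G y"] by (simp add: T_def norm_mult powr_numeral)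
    hence "sq_mass M T \<le> (\<integral>\<^sup>+x. epow 2 (\<integral>\<^sup>+y. ennreal (cmod (Q x y) * cmod (G y)) \<partial>M) \<partial>M)"
      by (intro nn_integral_mono)
    thus ?thesis using TG by simp
  qed
  have "(\<integral>x. (G x - T x) * cnj (U x) \<partial>M) = (\<integral>x. G x * cnj (U x) - T x * cnj (U x) \<partial>M)"
    by (simp add: left_diff_distrib)
  also have "\<dots> = (\<integral>x. G x * cnj (U x) \<partial>M) - (\<integral>x. T x * cnj (U x) \<partial>M)"
    by (rule Bochner_Integration.integral_diff[OF prod[OF G GL] prod[OF Tm TL]])
  also have "(\<integral>x. T x * cnj (U x) \<partial>M) = (\<integral>y. G y * cnj (\<integral>x. Q y x * U x \<partial>M) \<partial>M)"
    unfolding T_def by (rule hermitian_kernel_adjoint[OF M Q herm G U TG UL])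
  also have "\<dots> = (\<integral>x. G x * cnj (U x) \<partial>M)"
    by (rule integral_cong_AE) (measurable, use rep in \<open>auto elim: AE_mp\<close>)
  finally show ?thesis by (simp add: T_def)
qed

text \<open>The Bergman projection of the disk with weight 1 as an integral operator. Its conjugate
  under multiplication by g is the projection with weight |g|^2.\<close>

definition disk_op :: "(complex \<Rightarrow> complex) \<Rightarrow> complex \<Rightarrow> complex" where
  "disk_op G z = (\<integral>w. bergman_kernel 0 z w * G w \<partial>disk_measure 0)"

lemma measurable_disk_op [measurable]:
  assumes [measurable]: "G \<in> borel_measurable borel"
  shows "disk_op G \<in> borel_measurable borel"
proof -
  have "(\<lambda>z. \<integral>w. bergman_kernel 0 z w * G w \<partial>disk_measure 0) \<in> borel_measurable (borel :: complex measure)"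
    by (rule disk_measure.borel_measurable_lebesgue_integral) measurable
  thus ?thesis by (simp add: disk_op_def[abs_def])
qed

lemma norm_less_1_nbhd:
  assumes "cmod z < 1"
  obtains r d where "0 \<le> r" "r < 1" "d > 0" "\<And>z'. cmod (z' - z) < d \<Longrightarrow> z' \<in> cball 0 r"
proof
  define d where "d = (1 - cmod z) / 2"
  show "0 \<le> cmod z + d" "cmod z + d < 1" "d > 0" using assms by (auto simp: d_def field_simps)
  fix z' assume "cmod (z' - z) < d"
  thus "z' \<in> cball 0 (cmod z + d)" using norm_triangle_sub[of z' z] by simp
qed

text \<open>Differentiation under the integral sign: around z all points stay in a ball of radius r
  < 1, where the Taylor remainder of the kernel is uniform in w and |G| is an integrable
  majorant.\<close>

lemma disk_op_holomorphic:
  assumes G: "integrable (disk_measure 0) G"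
  shows "disk_op G holomorphic_on unit_disk"
  unfolding holomorphic_on_def
proof
  fix z assume "z \<in> unit_disk"
  hence z: "cmod z < 1" by (simp add: unit_disk_def)
  have [measurable]: "G \<in> borel_measurable borel" using borel_measurable_integrable[OF G] by simp
  obtain r d where r: "0 \<le> r" "r < 1" and d: "d > 0" "\<And>z'. cmod (z' - z) < d \<Longrightarrow> z' \<in> cball 0 r"
    using norm_less_1_nbhd[OF z] by metis
  obtain C where C: "C \<ge> 0" "\<And>w z z'. cmod w < 1 \<Longrightarrow> z \<in> cball 0 r \<Longrightarrow> z' \<in> cball 0 r \<Longrightarrow>
     cmod (bergman_kernel 0 z' w - bergman_kernel 0 z w - kernel_deriv 0 z w * (z' - z)) \<le> C * (cmod (z' - z))\<^sup>2 \<and>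
     cmod (kernel_deriv 0 z w) \<le> C"
    using kernel_taylor[OF r, of 0] by metis
  have zr: "z \<in> cball 0 r" using d(2)[of z] d(1) by simp
  have ae: "AE w in disk_measure 0. cmod w < 1" by (simp add: AE_disk_measure_iff unit_disk_def)
  let ?D = "\<lambda>w h. kernel_deriv 0 z w * G w * h"
  have Di: "integrable (disk_measure 0) (\<lambda>w. kernel_deriv 0 z w * G w)"
  proof (rule Bochner_Integration.integrable_bound)
    show "integrable (disk_measure 0) (\<lambda>w. C * cmod (G w))" using G by simp
    show "AE w in disk_measure 0. norm (kernel_deriv 0 z w * G w) \<le> norm (C * cmod (G w))"
      using ae by eventually_elim (use C zr in \<open>auto simp: norm_mult abs_mult intro!: mult_right_mono\<close>)
  qed measurable
  have "((\<lambda>z. \<integral>w. bergman_kernel 0 z w * G w \<partial>disk_measure 0) has_derivative (\<lambda>h. \<integral>w. ?D w h \<partial>disk_measure 0)) (at z)"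
  proof (rule has_derivative_integral_quadratic[OF d(1), where \<phi> = "\<lambda>w. C * cmod (G w)"])
    fix x assume x: "norm (x - z) < d"
    show "integrable (disk_measure 0) (\<lambda>w. bergman_kernel 0 x w * G w)"
      using d(2)[OF x] r by (intro integrable_kernel_mult G) auto
    show "AE w in disk_measure 0. cmod (bergman_kernel 0 x w * G w - bergman_kernel 0 z w * G w - ?D w (x - z))
        \<le> (norm (x - z))\<^sup>2 * (C * cmod (G w))"
      using ae
    proof eventually_elim
      fix w assume w: "cmod w < 1"
      have "bergman_kernel 0 x w * G w - bergman_kernel 0 z w * G w - ?D w (x - z)
         = (bergman_kernel 0 x w - bergman_kernel 0 z w - kernel_deriv 0 z w * (x - z)) * G w"
        by (simp add: algebra_simps)
      also have "cmod \<dots> \<le> (C * (cmod (x - z))\<^sup>2) * cmod (G w)"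
        unfolding norm_mult[of _ "G w"] using C(2)[OF w zr d(2)[OF x]] by (intro mult_right_mono) auto
      finally show "cmod (bergman_kernel 0 x w * G w - bergman_kernel 0 z w * G w - ?D w (x - z))
        \<le> (norm (x - z))\<^sup>2 * (C * cmod (G w))" by (simp add: ac_simps)
    qed
  next
    show "integrable (disk_measure 0) (\<lambda>y. kernel_deriv 0 z y * G y * h)" for h
      by (rule integrable_mult_left) (rule Di)
    show "bounded_linear (\<lambda>h. \<integral>w. ?D w h \<partial>disk_measure 0)"
      by (simp add: bounded_linear_mult_right)
  qed (use G in simp)
  hence "(disk_op G has_field_derivative (\<integral>w. kernel_deriv 0 z w * G w \<partial>disk_measure 0)) (at z)"
    unfolding has_field_derivative_def disk_op_def by simp
  thus "disk_op G field_differentiable at z within unit_disk"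
    using field_differentiable_at_within field_differentiable_def by blast
qed

lemma nn_integral_disk_measure_0:
  assumes [measurable]: "f \<in> borel_measurable borel"
  shows "(\<integral>\<^sup>+w. f w \<partial>disk_measure 0) = (\<integral>\<^sup>+w. indicator unit_disk w * f w \<partial>lborel)"
proof (subst nn_integral_disk_measure[OF assms], rule nn_integral_cong_AE)
  show "AE w in lborel. indicator unit_disk w * ennreal (cmod w powr 0) * f w = indicator unit_disk w * f w"
    using AE_lborel_singleton[of "0::complex"] by eventually_elim simp
qed

lemma disk_measure_0: "disk_measure 0 = density lborel (indicator unit_disk)"
proof (rule measure_eqI)
  fix A assume "A \<in> sets (disk_measure 0)"
  hence [measurable]: "A \<in> sets borel" by simp
  have "emeasure (disk_measure 0) A = (\<integral>\<^sup>+w. indicator A w \<partial>disk_measure 0)" by simp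
  also have "\<dots> = emeasure (density lborel (indicator unit_disk)) A"
    by (subst nn_integral_disk_measure_0) (auto simp: emeasure_density)
  finally show "emeasure (disk_measure 0) A = emeasure (density lborel (indicator unit_disk)) A" .
qed simp

lemma integral_disk_measure_0:
  fixes f :: "complex \<Rightarrow> complex"
  assumes "f \<in> borel_measurable borel"
  shows "integral\<^sup>L (disk_measure 0) f = (\<integral>w. indicator unit_disk w *\<^sub>R f w \<partial>lborel)"
proof -
  have "disk_measure 0 = density lborel (\<lambda>w. ennreal (indicator unit_disk w))"
    unfolding disk_measure_0 by (simp add: ennreal_indicator)
  thus ?thesis using assms by (simp add: integral_density)
qed

text \<open>Multiplication by g removes the weight only for p = 2; in general |f|^p |g|^2 = |g f|^p
  |g|^(2 - p). This is the origin of the weight |g|^(2 - p) in all later estimates.\<close>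

lemma Lp_mass_unit_disk:
  assumes [measurable]: "g \<in> borel_measurable borel" "f \<in> borel_measurable borel" and g: "\<And>w. g w \<noteq> 0"
  shows "Lp_mass p unit_disk (\<lambda>w. (cmod (g w))\<^sup>2) f
     = (\<integral>\<^sup>+w. ennreal (cmod (g w * f w) powr p * cmod (g w) powr (2 - p)) \<partial>disk_measure 0)"
proof -
  have "cmod (f w) powr p * (cmod (g w))\<^sup>2 = cmod (g w * f w) powr p * cmod (g w) powr (2 - p)" for w
  proof -
    have "(cmod (g w))\<^sup>2 = cmod (g w) powr (p + (2 - p))" using g[of w] by (simp add: powr_numeral)
    thus ?thesis unfolding powr_add by (simp add: norm_mult powr_mult)
  qed
  thus ?thesis unfolding Lp_mass_def by (subst nn_integral_disk_measure_0) auto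
qed

lemma weighted_domain_disk:
  assumes "g \<in> borel_measurable borel" "\<And>w. g w \<noteq> 0"
  shows "weighted_domain unit_disk (\<lambda>w. (cmod (g w))\<^sup>2)"
  using assms by unfold_locales (auto simp: unit_disk_eq_ball)

text \<open>As g has no zeros, multiplication by g is an isometry onto the unweighted L^2 that
  preserves holomorphy in both directions, so the projection is conjugated by it.\<close>

lemma disk_projection:
  assumes g [measurable]: "g \<in> borel_measurable borel" and g0: "\<And>w. g w \<noteq> 0" and gh: "g holomorphic_on unit_disk"
    and f [measurable]: "f \<in> borel_measurable borel" and fL: "Lp_mass 2 unit_disk (\<lambda>w. (cmod (g w))\<^sup>2) f < \<infinity>"
  shows "bergman_projection (holomorphic_on) unit_disk (\<lambda>w. (cmod (g w))\<^sup>2) f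
     = (\<lambda>z. indicator unit_disk z * (disk_op (\<lambda>w. g w * f w) z / g z))" (is "_ = ?h")
proof -
  interpret weighted_domain unit_disk "\<lambda>w. (cmod (g w))\<^sup>2" by (rule weighted_domain_disk[OF g g0])
  define G where "G w = g w * f w" for w
  have Gm [measurable]: "G \<in> borel_measurable borel" unfolding G_def by measurable
  have L2: "Lp_mass 2 unit_disk (\<lambda>w. (cmod (g w))\<^sup>2) v = (\<integral>\<^sup>+w. ennreal ((cmod (g w * v w))\<^sup>2) \<partial>disk_measure 0)"
    if "v \<in> borel_measurable borel" for v
    using Lp_mass_unit_disk[OF g that g0, of 2] g0 by (simp add: powr_numeral)
  have GL: "sq_mass (disk_measure 0) G < \<infinity>"
    using fL unfolding L2[OF f] G_def .
  have fin: "finite_measure (disk_measure 0)" by (rule finite_disk_measure) simp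
  have Gint: "integrable (disk_measure 0) G"
    using square_integrable_imp_integrable[OF fin _ GL] by simp
  obtain C where C: "\<And>f::complex \<Rightarrow> ennreal. f \<in> borel_measurable borel \<Longrightarrow>
     (\<integral>\<^sup>+z. epow 2 (\<integral>\<^sup>+w. ennreal (cmod (bergman_kernel 0 z w)) * f w \<partial>disk_measure 0) \<partial>disk_measure 0)
       \<le> ennreal C * (\<integral>\<^sup>+w. epow 2 (f w) \<partial>disk_measure 0)"
    using kernel_Lp_bound[of 2 0] by auto
  \<comment> \<open>The kernel is bounded on L^2 even in absolute value, by Schur's test; this makes
    the use of Fubini in the orthogonality relation legitimate.\<close>
  have TG: "(\<integral>\<^sup>+z. epow 2 (\<integral>\<^sup>+w. ennreal (cmod (bergman_kernel 0 z w) * cmod (G w)) \<partial>disk_measure 0) \<partial>disk_measure 0) < \<infinity>"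
  proof -
    have "(\<integral>\<^sup>+z. epow 2 (\<integral>\<^sup>+w. ennreal (cmod (bergman_kernel 0 z w) * cmod (G w)) \<partial>disk_measure 0) \<partial>disk_measure 0)
       \<le> ennreal C * (\<integral>\<^sup>+w. epow 2 (ennreal (cmod (G w))) \<partial>disk_measure 0)"
      using C[of "\<lambda>w. ennreal (cmod (G w))"] by (simp add: ennreal_mult')
    also have "\<dots> < \<infinity>" using GL by (simp add: epow_2 ennreal_power ennreal_mult_less_top)
    finally show ?thesis .
  qed
  have TGL: "sq_mass (disk_measure 0) (disk_op G) < \<infinity>"
  proof -
    have "ennreal ((cmod (disk_op G x))\<^sup>2) \<le> epow 2 (\<integral>\<^sup>+w. ennreal (cmod (bergman_kernel 0 x w) * cmod (G w)) \<partial>disk_measure 0)" for x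
      using powr_norm_integral_le_epow[of 2 "disk_measure 0" "\<lambda>w. bergman_kernel 0 x w * G w"]
      by (simp add: disk_op_def norm_mult powr_numeral)
    hence "sq_mass (disk_measure 0) (disk_op G)
       \<le> (\<integral>\<^sup>+z. epow 2 (\<integral>\<^sup>+w. ennreal (cmod (bergman_kernel 0 z w) * cmod (G w)) \<partial>disk_measure 0) \<partial>disk_measure 0)"
      by (intro nn_integral_mono)
    thus ?thesis using TG by simp
  qed
  have hm [measurable]: "?h \<in> borel_measurable borel" by measurable
  show ?thesis
  proof (rule bergman_projection_eqI)
    show "f \<in> weighted_Lp 2 unit_disk (\<lambda>w. (cmod (g w))\<^sup>2)"
      using fL by (simp add: weighted_Lp_iff(1))
    have "Lp_mass 2 unit_disk (\<lambda>w. (cmod (g w))\<^sup>2) ?h \<le> sq_mass (disk_measure 0) (disk_op G)"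
      unfolding L2[OF hm] using g0 by (intro nn_integral_mono) (auto simp: indicator_def G_def[abs_def])
    hence "?h \<in> weighted_Lp 2 unit_disk (\<lambda>w. (cmod (g w))\<^sup>2)"
      using TGL by (simp add: weighted_Lp_iff(1))
    moreover have "(\<lambda>z. disk_op G z / g z) holomorphic_on unit_disk"
      using g0 by (intro holomorphic_intros disk_op_holomorphic Gint gh) auto
    hence "?h holomorphic_on unit_disk"
      by (rule holomorphic_transform) (simp add: G_def[abs_def])
    ultimately show "?h \<in> bergman_space (holomorphic_on) unit_disk (\<lambda>w. (cmod (g w))\<^sup>2)"
      by (simp add: bergman_space_def)
  next
    fix u assume "u \<in> bergman_space (holomorphic_on) unit_disk (\<lambda>w. (cmod (g w))\<^sup>2)"
    hence u: "u \<in> weighted_Lp 2 unit_disk (\<lambda>w. (cmod (g w))\<^sup>2)" "u holomorphic_on unit_disk"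
      by (auto simp: bergman_space_def)
    \<comment> \<open>Nothing is known about \<open>u\<close> off the disk; cutting it off by 0
      gives a Borel function with the same inner products.\<close>
    define v where "v w = indicator unit_disk w *\<^sub>R u w" for w
    define U where "U w = g w * v w" for w
    have vm [measurable]: "v \<in> borel_measurable borel" unfolding v_def
      using holomorphic_on_imp_continuous_on[OF u(2)] by (intro borel_measurable_continuous_on_indicator) auto
    have Um [measurable]: "U \<in> borel_measurable borel" unfolding U_def by measurable
    have "AE x in lebesgue_on unit_disk. u x = v x" unfolding AE_lebesgue_on_iff[OF dom_borel] by (simp add: v_def)
    from weighted_Lp_cong_AE(1)[OF u(1) vm this]
    have UL: "sq_mass (disk_measure 0) U < \<infinity>"
      unfolding weighted_Lp_iff(1)[OF vm] L2[OF vm] U_def .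
    have Uint: "integrable (disk_measure 0) U"
      using square_integrable_imp_integrable[OF fin _ UL] by simp
    have "(\<lambda>w. g w * u w) holomorphic_on unit_disk" by (intro holomorphic_intros gh u)
    hence Uh: "U holomorphic_on unit_disk" by (rule holomorphic_transform) (simp add: U_def v_def)
    have rep: "AE z in disk_measure 0. (\<integral>w. bergman_kernel 0 z w * U w \<partial>disk_measure 0) = U z"
      unfolding AE_disk_measure_iff using bergman_reproducing[OF Uh Uint] by (auto simp: unit_disk_def)
    have "weighted_inner unit_disk (\<lambda>w. (cmod (g w))\<^sup>2) (\<lambda>z. f z - ?h z) u
       = (\<integral>z. (f z - ?h z) * cnj (v z) * complex_of_real ((cmod (g z))\<^sup>2) \<partial>lebesgue_on unit_disk)"
      unfolding weighted_inner_def by (intro Bochner_Integration.integral_cong refl) (simp add: v_def)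
    also have "\<dots> = (\<integral>z. indicator unit_disk z *\<^sub>R ((f z - ?h z) * cnj (v z) * complex_of_real ((cmod (g z))\<^sup>2)) \<partial>lborel)"
      by (rule integrable_lebesgue_on_borel_iff(2)) measurable
    also have "\<dots> = (\<integral>z. indicator unit_disk z *\<^sub>R ((G z - disk_op G z) * cnj (U z)) \<partial>lborel)"
    proof (intro Bochner_Integration.integral_cong refl)
      fix z
      show "indicator unit_disk z *\<^sub>R ((f z - ?h z) * cnj (v z) * complex_of_real ((cmod (g z))\<^sup>2))
         = indicator unit_disk z *\<^sub>R ((G z - disk_op G z) * cnj (U z))"
        unfolding complex_norm_square
        using g0[of z] by (auto simp: indicator_def G_def[abs_def] U_def field_simps)
    qed
    also have "\<dots> = (\<integral>z. (G z - disk_op G z) * cnj (U z) \<partial>disk_measure 0)"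
      by (rule integral_disk_measure_0[symmetric]) measurable
    also have "\<dots> = 0"
      unfolding disk_op_def
      by (rule kernel_projection_orthogonal[OF sigma_finite_disk_measure _ cnj_bergman_kernel _ _ TG GL UL rep]) measurable
    finally show "weighted_inner unit_disk (\<lambda>w. (cmod (g w))\<^sup>2) (\<lambda>z. f z - ?h z) u = 0" .
  qed (auto intro: holomorphic_on_imp_continuous_on holomorphic_intros)
qed

subsection \<open>Product kernels on the bidisk\<close>

definition bidisk_measure :: "real \<Rightarrow> (complex \<times> complex) measure" where
  "bidisk_measure a = disk_measure 0 \<Otimes>\<^sub>M disk_measure a"

definition bidisk_kernel :: "real \<Rightarrow> complex \<times> complex \<Rightarrow> complex \<times> complex \<Rightarrow> complex" where
  "bidisk_kernel a x y = bergman_kernel 0 (fst x) (fst y) * bergman_kernel a (snd x) (snd y)"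

definition bidisk_op :: "real \<Rightarrow> (complex \<times> complex \<Rightarrow> complex) \<Rightarrow> complex \<times> complex \<Rightarrow> complex" where
  "bidisk_op a G x = (\<integral>y. bidisk_kernel a x y * G y \<partial>bidisk_measure a)"

interpretation disk_disk: pair_sigma_finite "disk_measure a" "disk_measure b" for a b
  by unfold_locales

lemma sets_bidisk_measure [measurable_cong, simp]: "sets (bidisk_measure a) = sets borel"
proof -
  have "sets (disk_measure 0 \<Otimes>\<^sub>M disk_measure a) = sets (borel \<Otimes>\<^sub>M borel)"
    by (rule sets_pair_measure_cong) auto
  thus ?thesis by (simp only: bidisk_measure_def borel_prod)
qed

lemma space_bidisk_measure [simp]: "space (bidisk_measure a) = UNIV"
  by (simp add: bidisk_measure_def space_pair_measure)

lemma measurable_fst_borel [measurable (raw)]: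
  fixes f :: "'a \<Rightarrow> 'b::topological_space \<times> 'c::topological_space"
  shows "f \<in> borel_measurable M \<Longrightarrow> (\<lambda>x. fst (f x)) \<in> borel_measurable M"
  by (erule measurable_compose) (intro borel_measurable_continuous_onI continuous_intros)

lemma measurable_snd_borel [measurable (raw)]:
  fixes f :: "'a \<Rightarrow> 'b::topological_space \<times> 'c::topological_space"
  shows "f \<in> borel_measurable M \<Longrightarrow> (\<lambda>x. snd (f x)) \<in> borel_measurable M"
  by (erule measurable_compose) (intro borel_measurable_continuous_onI continuous_intros)

lemma sigma_finite_bidisk_measure: "sigma_finite_measure (bidisk_measure a)"
  unfolding bidisk_measure_def by (rule sigma_finite_pair_measure) simp_all

lemma nn_integral_bidisk:
  assumes [measurable]: "F \<in> borel_measurable borel"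
  shows "(\<integral>\<^sup>+x. F x \<partial>bidisk_measure a) = (\<integral>\<^sup>+z. \<integral>\<^sup>+w. F (z, w) \<partial>disk_measure a \<partial>disk_measure 0)"
    and "(\<integral>\<^sup>+x. F x \<partial>bidisk_measure a) = (\<integral>\<^sup>+w. \<integral>\<^sup>+z. F (z, w) \<partial>disk_measure 0 \<partial>disk_measure a)"
proof -
  have m: "F \<in> borel_measurable (disk_measure 0 \<Otimes>\<^sub>M disk_measure a)"
    using assms sets_bidisk_measure[of a] by (simp add: bidisk_measure_def cong: measurable_cong_sets)
  show "(\<integral>\<^sup>+x. F x \<partial>bidisk_measure a) = (\<integral>\<^sup>+z. \<integral>\<^sup>+w. F (z, w) \<partial>disk_measure a \<partial>disk_measure 0)"
    unfolding bidisk_measure_def by (rule disk_measure.nn_integral_fst[symmetric]) (rule m)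
  show "(\<integral>\<^sup>+x. F x \<partial>bidisk_measure a) = (\<integral>\<^sup>+w. \<integral>\<^sup>+z. F (z, w) \<partial>disk_measure 0 \<partial>disk_measure a)"
    unfolding bidisk_measure_def by (rule disk_disk.nn_integral_snd[symmetric]) (rule m)
qed

lemma finite_bidisk_measure: "a > - 2 \<Longrightarrow> finite_measure (bidisk_measure a)"
proof (rule finite_measureI)
  assume a: "a > - 2"
  interpret D: finite_measure "disk_measure a" by (rule finite_disk_measure[OF a])
  interpret D0: finite_measure "disk_measure 0" by (rule finite_disk_measure) simp
  have "emeasure (bidisk_measure a) (UNIV \<times> UNIV) = emeasure (disk_measure 0) UNIV * emeasure (disk_measure a) UNIV"
    unfolding bidisk_measure_def by (rule disk_measure.emeasure_pair_measure_Times) auto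
  thus "emeasure (bidisk_measure a) (space (bidisk_measure a)) \<noteq> \<infinity>"
    using D.emeasure_finite[of UNIV] D0.emeasure_finite[of UNIV]
    by (auto simp: ennreal_mult_eq_top_iff)
qed

lemma AE_bidisk_measure:
  assumes P: "{x. P x} \<in> sets borel" and ae: "AE z in disk_measure 0. AE w in disk_measure a. P (z, w)"
  shows "AE x in bidisk_measure a. P x"
  unfolding bidisk_measure_def
proof (rule disk_disk.AE_pair_measure)
  show "{x \<in> space (disk_measure 0 \<Otimes>\<^sub>M disk_measure a). P x} \<in> sets (disk_measure 0 \<Otimes>\<^sub>M disk_measure a)"
  proof -
    have "{x \<in> space (disk_measure 0 \<Otimes>\<^sub>M disk_measure a). P x} = {x. P x}"
      by (simp add: space_pair_measure)
    thus ?thesis using P sets_bidisk_measure[of a] unfolding bidisk_measure_def by (simp only:)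
  qed
qed (rule ae)

lemma AE_disk_measure_punctured: "AE w in disk_measure a. cmod w < 1 \<and> w \<noteq> 0"
  unfolding AE_disk_measure_iff
  using AE_lborel_singleton[of "0::complex"] by eventually_elim (simp add: unit_disk_def)

lemma AE_bidisk: "AE x in bidisk_measure a. cmod (fst x) < 1 \<and> cmod (snd x) < 1 \<and> snd x \<noteq> 0"
proof (rule AE_bidisk_measure)
  show "{x :: complex \<times> complex. cmod (fst x) < 1 \<and> cmod (snd x) < 1 \<and> snd x \<noteq> 0} \<in> sets borel"
    by measurable
  show "AE z in disk_measure 0. AE w in disk_measure a. cmod (fst (z, w)) < 1 \<and> cmod (snd (z, w)) < 1 \<and> snd (z, w) \<noteq> 0"
    using AE_disk_measure_punctured
  proof eventually_elim
    fix z :: complex assume z: "cmod z < 1 \<and> z \<noteq> 0"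
    show "AE w in disk_measure a. cmod (fst (z, w)) < 1 \<and> cmod (snd (z, w)) < 1 \<and> snd (z, w) \<noteq> 0"
      using AE_disk_measure_punctured by eventually_elim (use z in simp)
  qed
qed

lemma measurable_bidisk_kernel [measurable (raw)]:
  assumes [measurable]: "f \<in> borel_measurable M" "g \<in> borel_measurable M"
  shows "(\<lambda>x. bidisk_kernel a (f x) (g x)) \<in> borel_measurable M"
  unfolding bidisk_kernel_def by measurable

lemma measurable_bidisk_op [measurable]:
  assumes [measurable]: "G \<in> borel_measurable borel"
  shows "bidisk_op a G \<in> borel_measurable borel"
proof -
  have "(\<lambda>x. \<integral>y. bidisk_kernel a x y * G y \<partial>bidisk_measure a) \<in> borel_measurable (borel :: (complex \<times> complex) measure)"
    by (rule sigma_finite_measure.borel_measurable_lebesgue_integral[OF sigma_finite_bidisk_measure]) measurable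
  thus ?thesis by (simp add: bidisk_op_def[abs_def])
qed

text \<open>The one-variable bound is used in the second variable for fixed \<zeta>, applied to the
  inner integral \<open>S\<close> over the first, and then in the first variable for fixed w. All
  integrands are non-negative, so the order of integration is free.\<close>

lemma bidisk_kernel_Lp_bound:
  assumes p: "p > 1" and a: "- 2 < a" "a \<le> 0"
  shows "\<exists>C>0. \<forall>G::complex \<times> complex \<Rightarrow> complex. G \<in> borel_measurable borel \<longrightarrow>
     (\<integral>\<^sup>+x. epow p (\<integral>\<^sup>+y. ennreal (cmod (bidisk_kernel a x y) * cmod (G y)) \<partial>bidisk_measure a) \<partial>bidisk_measure a)
       \<le> ennreal C * (\<integral>\<^sup>+x. ennreal (cmod (G x) powr p) \<partial>bidisk_measure a)"
proof -
  obtain C0 where C0: "C0 > 0" "\<And>f::complex \<Rightarrow> ennreal. f \<in> borel_measurable borel \<Longrightarrow>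
     (\<integral>\<^sup>+z. epow p (\<integral>\<^sup>+w. ennreal (cmod (bergman_kernel 0 z w)) * f w \<partial>disk_measure 0) \<partial>disk_measure 0)
       \<le> ennreal C0 * (\<integral>\<^sup>+w. epow p (f w) \<partial>disk_measure 0)"
    using kernel_Lp_bound[OF p, of 0] by auto
  obtain C1 where C1: "C1 > 0" "\<And>f::complex \<Rightarrow> ennreal. f \<in> borel_measurable borel \<Longrightarrow>
     (\<integral>\<^sup>+z. epow p (\<integral>\<^sup>+w. ennreal (cmod (bergman_kernel a z w)) * f w \<partial>disk_measure a) \<partial>disk_measure a)
       \<le> ennreal C1 * (\<integral>\<^sup>+w. epow p (f w) \<partial>disk_measure a)"
    using kernel_Lp_bound[OF p a] by auto
  show ?thesis
  proof (intro exI conjI allI impI)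
    show "C1 * C0 > 0" using C0 C1 by simp
    fix G :: "complex \<times> complex \<Rightarrow> complex" assume G [measurable]: "G \<in> borel_measurable borel"
    define S where "S \<zeta> w = (\<integral>\<^sup>+\<omega>. ennreal (cmod (bergman_kernel 0 \<zeta> \<omega>)) * ennreal (cmod (G (\<omega>, w))) \<partial>disk_measure 0)" for \<zeta> w
    have Sm0: "(\<lambda>x. S (fst x) (snd x)) \<in> borel_measurable (borel :: (complex \<times> complex) measure)"
      unfolding S_def by measurable
    have Sm [measurable]: "(\<lambda>x. S (f x) (g x)) \<in> borel_measurable M"
      if "f \<in> borel_measurable M" "g \<in> borel_measurable M" for f g and M :: "'z measure"
      using measurable_compose[OF borel_measurable_Pair[OF that] Sm0] by simp
    have inner: "(\<integral>\<^sup>+y. ennreal (cmod (bidisk_kernel a (\<zeta>, z) y) * cmod (G y)) \<partial>bidisk_measure a)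
      = (\<integral>\<^sup>+w. ennreal (cmod (bergman_kernel a z w)) * S \<zeta> w \<partial>disk_measure a)" for \<zeta> z
      by (subst nn_integral_bidisk(2), measurable)
         (auto simp: bidisk_kernel_def S_def norm_mult ennreal_mult' nn_integral_cmult[symmetric] ac_simps
            intro!: nn_integral_cong)
    have "(\<integral>\<^sup>+x. epow p (\<integral>\<^sup>+y. ennreal (cmod (bidisk_kernel a x y) * cmod (G y)) \<partial>bidisk_measure a) \<partial>bidisk_measure a)
      = (\<integral>\<^sup>+\<zeta>. \<integral>\<^sup>+z. epow p (\<integral>\<^sup>+w. ennreal (cmod (bergman_kernel a z w)) * S \<zeta> w \<partial>disk_measure a) \<partial>disk_measure a \<partial>disk_measure 0)"
    proof (subst nn_integral_bidisk(1))
      have "(\<lambda>x. \<integral>\<^sup>+y. ennreal (cmod (bidisk_kernel a x y) * cmod (G y)) \<partial>bidisk_measure a)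
         \<in> borel_measurable (borel :: (complex \<times> complex) measure)"
        by (rule sigma_finite_measure.borel_measurable_nn_integral[OF sigma_finite_bidisk_measure]) measurable
      thus "(\<lambda>x. epow p (\<integral>\<^sup>+y. ennreal (cmod (bidisk_kernel a x y) * cmod (G y)) \<partial>bidisk_measure a))
         \<in> borel_measurable (borel :: (complex \<times> complex) measure)" by measurable
    qed (simp only: inner)
    also have "\<dots> \<le> (\<integral>\<^sup>+\<zeta>. ennreal C1 * (\<integral>\<^sup>+w. epow p (S \<zeta> w) \<partial>disk_measure a) \<partial>disk_measure 0)"
      by (intro nn_integral_mono C1) measurable
    also have "\<dots> = ennreal C1 * (\<integral>\<^sup>+w. \<integral>\<^sup>+\<zeta>. epow p (S \<zeta> w) \<partial>disk_measure 0 \<partial>disk_measure a)"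
      by (subst nn_integral_cmult, measurable, subst disk_disk.Fubini', measurable)
    also have "\<dots> \<le> ennreal C1 * (\<integral>\<^sup>+w. ennreal C0 * (\<integral>\<^sup>+\<omega>. epow p (ennreal (cmod (G (\<omega>, w)))) \<partial>disk_measure 0) \<partial>disk_measure a)"
      unfolding S_def by (intro mult_left_mono nn_integral_mono C0) measurable
    also have "\<dots> = ennreal (C1 * C0) * (\<integral>\<^sup>+w. (\<integral>\<^sup>+\<omega>. epow p (ennreal (cmod (G (\<omega>, w)))) \<partial>disk_measure 0) \<partial>disk_measure a)"
      using C0 C1 by (subst nn_integral_cmult, measurable) (simp add: ennreal_mult' mult.assoc)
    also have "(\<integral>\<^sup>+w. (\<integral>\<^sup>+\<omega>. epow p (ennreal (cmod (G (\<omega>, w)))) \<partial>disk_measure 0) \<partial>disk_measure a)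
       = (\<integral>\<^sup>+x. ennreal (cmod (G x) powr p) \<partial>bidisk_measure a)"
      by (subst nn_integral_bidisk(2), measurable) (simp add: epow_ennreal)
    finally show "(\<integral>\<^sup>+x. epow p (\<integral>\<^sup>+y. ennreal (cmod (bidisk_kernel a x y) * cmod (G y)) \<partial>bidisk_measure a) \<partial>bidisk_measure a)
       \<le> ennreal (C1 * C0) * (\<integral>\<^sup>+x. ennreal (cmod (G x) powr p) \<partial>bidisk_measure a)" .
  qed
qed

lemma norm_kernel_bounded:
  assumes "cmod z < 1"
  shows "\<exists>C\<ge>0. \<forall>w. cmod w < 1 \<longrightarrow> cmod (bergman_kernel a z w) \<le> C"
proof (intro exI conjI allI impI)
  show "0 \<le> (1 + \<bar>a\<bar>) * (1 / (1 - cmod z))\<^sup>2" by simp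
  fix w assume w: "cmod w < 1"
  have "cmod (bergman_kernel a z w) \<le> (1 + \<bar>a\<bar>) * abs_kernel z w" by (rule norm_bergman_kernel_le[OF assms w])
  also have "\<dots> \<le> (1 + \<bar>a\<bar>) * (1 / (1 - cmod z))\<^sup>2"
    using abs_kernel_le[OF assms, of w] w by (intro mult_left_mono) auto
  finally show "cmod (bergman_kernel a z w) \<le> (1 + \<bar>a\<bar>) * (1 / (1 - cmod z))\<^sup>2" .
qed

lemma integrable_bidisk_kernel:
  assumes G: "integrable (bidisk_measure a) G" and x: "cmod (fst x) < 1" "cmod (snd x) < 1"
  shows "integrable (bidisk_measure a) (\<lambda>y. bidisk_kernel a x y * G y)"
proof -
  have [measurable]: "G \<in> borel_measurable borel" using borel_measurable_integrable[OF G] by simp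
  obtain C0 where C0: "C0 \<ge> 0" "\<And>w. cmod w < 1 \<Longrightarrow> cmod (bergman_kernel 0 (fst x) w) \<le> C0"
    using norm_kernel_bounded[OF x(1), of 0] by blast
  obtain C1 where C1: "C1 \<ge> 0" "\<And>w. cmod w < 1 \<Longrightarrow> cmod (bergman_kernel a (snd x) w) \<le> C1"
    using norm_kernel_bounded[OF x(2), of a] by blast
  show ?thesis
  proof (rule Bochner_Integration.integrable_bound)
    show "integrable (bidisk_measure a) (\<lambda>y. C0 * C1 * cmod (G y))" using G by simp
    show "AE y in bidisk_measure a. norm (bidisk_kernel a x y * G y) \<le> norm (C0 * C1 * cmod (G y))"
      using AE_bidisk[of a] by eventually_elim
        (use C0 C1 in \<open>auto simp: bidisk_kernel_def norm_mult abs_mult intro!: mult_right_mono mult_mono\<close>)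
  qed measurable
qed

lemma bidisk_op_iterated:
  assumes G: "integrable (bidisk_measure a) G" and z: "cmod \<zeta> < 1" "cmod z < 1"
  shows "bidisk_op a G (\<zeta>, z) = (\<integral>w. bergman_kernel a z w * (\<integral>\<omega>. bergman_kernel 0 \<zeta> \<omega> * G (\<omega>, w) \<partial>disk_measure 0) \<partial>disk_measure a)"
proof -
  have i: "integrable (disk_measure 0 \<Otimes>\<^sub>M disk_measure a) (\<lambda>(\<omega>, w). bidisk_kernel a (\<zeta>, z) (\<omega>, w) * G (\<omega>, w))"
    using integrable_bidisk_kernel[OF G, of "(\<zeta>, z)"] z unfolding bidisk_measure_def by (simp add: case_prod_unfold)
  have "bidisk_op a G (\<zeta>, z) = (\<integral>(\<omega>, w). bidisk_kernel a (\<zeta>, z) (\<omega>, w) * G (\<omega>, w) \<partial>(disk_measure 0 \<Otimes>\<^sub>M disk_measure a))"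
    unfolding bidisk_op_def bidisk_measure_def by (simp add: case_prod_unfold)
  also have "\<dots> = (\<integral>w. (\<integral>\<omega>. bidisk_kernel a (\<zeta>, z) (\<omega>, w) * G (\<omega>, w) \<partial>disk_measure 0) \<partial>disk_measure a)"
    by (rule disk_disk.integral_snd[symmetric, OF i])
  also have "\<dots> = (\<integral>w. bergman_kernel a z w * (\<integral>\<omega>. bergman_kernel 0 \<zeta> \<omega> * G (\<omega>, w) \<partial>disk_measure 0) \<partial>disk_measure a)"
  proof (intro Bochner_Integration.integral_cong refl)
    fix w
    have "(\<integral>\<omega>. bidisk_kernel a (\<zeta>, z) (\<omega>, w) * G (\<omega>, w) \<partial>disk_measure 0)
       = (\<integral>\<omega>. bergman_kernel a z w * (bergman_kernel 0 \<zeta> \<omega> * G (\<omega>, w)) \<partial>disk_measure 0)"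
      by (intro Bochner_Integration.integral_cong refl) (simp add: bidisk_kernel_def)
    also have "\<dots> = bergman_kernel a z w * (\<integral>\<omega>. bergman_kernel 0 \<zeta> \<omega> * G (\<omega>, w) \<partial>disk_measure 0)"
      by (rule integral_mult_right_zero)
    finally show "(\<integral>\<omega>. bidisk_kernel a (\<zeta>, z) (\<omega>, w) * G (\<omega>, w) \<partial>disk_measure 0)
       = bergman_kernel a z w * (\<integral>\<omega>. bergman_kernel 0 \<zeta> \<omega> * G (\<omega>, w) \<partial>disk_measure 0)" .
  qed
  finally show ?thesis .
qed

text \<open>\<open>holomorphic2_on\<close> asks for a total derivative, so the remainder of the
  product kernel is estimated in both variables at once; separate holomorphy would not suffice by
  itself.\<close>

lemma bidisk_op_has_derivative:
  assumes G: "integrable (bidisk_measure a) G" and x: "cmod (fst x) < 1" "cmod (snd x) < 1"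
  shows "\<exists>A B. (bidisk_op a G has_derivative (\<lambda>(h1, h2). A * h1 + B * h2)) (at x)"
proof -
  have [measurable]: "G \<in> borel_measurable borel" using borel_measurable_integrable[OF G] by simp
  obtain r1 d1 where r1: "0 \<le> r1" "r1 < 1" and d1: "d1 > 0" "\<And>z'. cmod (z' - fst x) < d1 \<Longrightarrow> z' \<in> cball 0 r1"
    using norm_less_1_nbhd[OF x(1)] by metis
  obtain r2 d2 where r2: "0 \<le> r2" "r2 < 1" and d2: "d2 > 0" "\<And>z'. cmod (z' - snd x) < d2 \<Longrightarrow> z' \<in> cball 0 r2"
    using norm_less_1_nbhd[OF x(2)] by metis
  obtain C1 where C1: "C1 \<ge> 0" "\<And>w z z'. cmod w < 1 \<Longrightarrow> z \<in> cball 0 r1 \<Longrightarrow> z' \<in> cball 0 r1 \<Longrightarrow>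
     cmod (bergman_kernel 0 z' w - bergman_kernel 0 z w - kernel_deriv 0 z w * (z' - z)) \<le> C1 * (cmod (z' - z))\<^sup>2 \<and>
     cmod (bergman_kernel 0 z' w - bergman_kernel 0 z w) \<le> C1 * cmod (z' - z) \<and>
     cmod (bergman_kernel 0 z w) \<le> C1 \<and> cmod (kernel_deriv 0 z w) \<le> C1"
    using kernel_taylor[OF r1, of 0] by metis
  obtain C2 where C2: "C2 \<ge> 0" "\<And>w z z'. cmod w < 1 \<Longrightarrow> z \<in> cball 0 r2 \<Longrightarrow> z' \<in> cball 0 r2 \<Longrightarrow>
     cmod (bergman_kernel a z' w - bergman_kernel a z w - kernel_deriv a z w * (z' - z)) \<le> C2 * (cmod (z' - z))\<^sup>2 \<and>
     cmod (bergman_kernel a z' w - bergman_kernel a z w) \<le> C2 * cmod (z' - z) \<and>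
     cmod (bergman_kernel a z w) \<le> C2 \<and> cmod (kernel_deriv a z w) \<le> C2"
    using kernel_taylor[OF r2, of a] by metis
  have xr: "fst x \<in> cball 0 r1" "snd x \<in> cball 0 r2" using d1 d2 by auto
  define P where "P y = kernel_deriv 0 (fst x) (fst y) * bergman_kernel a (snd x) (snd y) * G y" for y
  define Q where "Q y = bergman_kernel 0 (fst x) (fst y) * kernel_deriv a (snd x) (snd y) * G y" for y
  have [measurable]: "P \<in> borel_measurable borel" "Q \<in> borel_measurable borel"
    unfolding P_def Q_def by measurable
  have Pi: "integrable (bidisk_measure a) P"
  proof (rule Bochner_Integration.integrable_bound)
    show "integrable (bidisk_measure a) (\<lambda>y. C1 * C2 * cmod (G y))" using G by simp
    show "AE y in bidisk_measure a. norm (P y) \<le> norm (C1 * C2 * cmod (G y))"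
      using AE_bidisk[of a] by eventually_elim
        (use C1 C2 xr in \<open>auto simp: P_def norm_mult abs_mult intro!: mult_right_mono mult_mono\<close>)
  qed measurable
  have Qi: "integrable (bidisk_measure a) Q"
  proof (rule Bochner_Integration.integrable_bound)
    show "integrable (bidisk_measure a) (\<lambda>y. C1 * C2 * cmod (G y))" using G by simp
    show "AE y in bidisk_measure a. norm (Q y) \<le> norm (C1 * C2 * cmod (G y))"
      using AE_bidisk[of a] by eventually_elim
        (use C1 C2 xr in \<open>auto simp: Q_def norm_mult abs_mult intro!: mult_right_mono mult_mono\<close>)
  qed measurable
  define A B where "A = integral\<^sup>L (bidisk_measure a) P" and "B = integral\<^sup>L (bidisk_measure a) Q"
  have DI: "(\<integral>y. P y * fst h + Q y * snd h \<partial>bidisk_measure a) = (case h of (h1, h2) \<Rightarrow> A * h1 + B * h2)" for h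
    using Pi Qi by (cases h) (simp add: A_def B_def)
  have "((\<lambda>x. \<integral>y. bidisk_kernel a x y * G y \<partial>bidisk_measure a) has_derivative
      (\<lambda>h. \<integral>y. P y * fst h + Q y * snd h \<partial>bidisk_measure a)) (at x)"
  proof (rule has_derivative_integral_quadratic[where d = "min d1 d2" and \<phi> = "\<lambda>y. 3 * (C1 * C2) * cmod (G y)"])
    fix x' assume x': "norm (x' - x) < min d1 d2"
    have n: "cmod (fst x' - fst x) \<le> norm (x' - x)" "cmod (snd x' - snd x) \<le> norm (x' - x)"
      using norm_fst_le[of "fst (x' - x)" "snd (x' - x)"] norm_snd_le[of "snd (x' - x)" "fst (x' - x)"]
      unfolding prod.collapse by simp_all
    have x'r: "fst x' \<in> cball 0 r1" "snd x' \<in> cball 0 r2"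
      using n x' d1(2)[of "fst x'"] d2(2)[of "snd x'"] by (simp_all del: mem_cball)
    show "integrable (bidisk_measure a) (\<lambda>y. bidisk_kernel a x' y * G y)"
      using x'r r1 r2 by (intro integrable_bidisk_kernel[OF G]) auto
    show "AE y in bidisk_measure a. cmod (bidisk_kernel a x' y * G y - bidisk_kernel a x y * G y
        - (P y * fst (x' - x) + Q y * snd (x' - x))) \<le> (norm (x' - x))\<^sup>2 * (3 * (C1 * C2) * cmod (G y))"
      using AE_bidisk[of a]
    proof eventually_elim
      fix y assume y: "cmod (fst y) < 1 \<and> cmod (snd y) < 1 \<and> snd y \<noteq> 0"
      define h e :: complex where "h = fst x' - fst x" and "e = snd x' - snd x"
      define t where "t = norm (x' - x)"
      define k k' k1 where "k = bergman_kernel 0 (fst x) (fst y)" and "k' = bergman_kernel 0 (fst x') (fst y)"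
        and "k1 = kernel_deriv 0 (fst x) (fst y)"
      define l l' l1 where "l = bergman_kernel a (snd x) (snd y)" and "l' = bergman_kernel a (snd x') (snd y)"
        and "l1 = kernel_deriv a (snd x) (snd y)"
      have t: "0 \<le> t" "cmod h \<le> t" "cmod e \<le> t" using n by (auto simp: t_def h_def e_def)
      have bk: "cmod (k' - k - k1 * h) \<le> C1 * (cmod h)\<^sup>2" "cmod k \<le> C1" "cmod k1 \<le> C1"
        using C1(2)[of "fst y" "fst x" "fst x'"] y xr x'r by (auto simp: k_def k'_def k1_def h_def)
      have bl: "cmod (l' - l - l1 * e) \<le> C2 * (cmod e)\<^sup>2" "cmod (l' - l) \<le> C2 * cmod e" "cmod l' \<le> C2"
        using C2(2)[of "snd y" "snd x" "snd x'"] C2(2)[of "snd y" "snd x'" "snd x"] y xr x'r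
        by (auto simp: l_def l'_def l1_def e_def)
      have h2: "(cmod h)\<^sup>2 \<le> t\<^sup>2" "(cmod e)\<^sup>2 \<le> t\<^sup>2" using t by (auto intro: power_mono)
      \<comment> \<open>The remainder of a product: two terms carry the quadratic remainder of one
        factor, the third is a product of two first-order increments. Each is at most C1 C2 t^2,
        whence the factor 3.\<close>
      have "k' * l' - k * l - (k1 * l * h + k * l1 * e)
         = (k' - k - k1 * h) * l' + k * (l' - l - l1 * e) + k1 * h * (l' - l)"
        by (simp add: algebra_simps)
      also have "cmod \<dots> \<le> cmod (k' - k - k1 * h) * cmod l' + cmod k * cmod (l' - l - l1 * e) + cmod k1 * cmod h * cmod (l' - l)"
        by (intro order_trans[OF norm_triangle_ineq] add_mono) (simp_all add: norm_mult)
      also have "\<dots> \<le> (C1 * t\<^sup>2) * C2 + C1 * (C2 * t\<^sup>2) + C1 * t * (C2 * t)"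
      proof (intro add_mono mult_mono)
        show "cmod (k' - k - k1 * h) \<le> C1 * t\<^sup>2"
          using bk(1) mult_left_mono[OF h2(1) C1(1)] by linarith
        show "cmod (l' - l - l1 * e) \<le> C2 * t\<^sup>2"
          using bl(1) mult_left_mono[OF h2(2) C2(1)] by linarith
        show "cmod (l' - l) \<le> C2 * t"
          using bl(2) mult_left_mono[OF t(3) C2(1)] by linarith
      qed (use bk bl t C1(1) C2(1) in auto)
      also have "\<dots> = t\<^sup>2 * (3 * (C1 * C2))" by (simp add: power2_eq_square)
      finally have "cmod (k' * l' - k * l - (k1 * l * h + k * l1 * e)) * cmod (G y) \<le> t\<^sup>2 * (3 * (C1 * C2)) * cmod (G y)"
        by (rule mult_right_mono) simp
      moreover have "bidisk_kernel a x' y * G y - bidisk_kernel a x y * G y - (P y * fst (x' - x) + Q y * snd (x' - x))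
         = (k' * l' - k * l - (k1 * l * h + k * l1 * e)) * G y"
        by (simp add: bidisk_kernel_def P_def Q_def k_def k'_def k1_def l_def l'_def l1_def h_def e_def algebra_simps)
      ultimately show "cmod (bidisk_kernel a x' y * G y - bidisk_kernel a x y * G y
        - (P y * fst (x' - x) + Q y * snd (x' - x))) \<le> (norm (x' - x))\<^sup>2 * (3 * (C1 * C2) * cmod (G y))"
        by (simp add: norm_mult t_def mult.assoc)
    qed
  next
    show "min d1 d2 > 0" using d1 d2 by simp
    show "integrable (bidisk_measure a) (\<lambda>y. P y * fst h + Q y * snd h)" for h
      using Pi Qi by (intro Bochner_Integration.integrable_add integrable_mult_left)
    show "bounded_linear (\<lambda>h. \<integral>y. P y * fst h + Q y * snd h \<partial>bidisk_measure a)"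
      unfolding DI case_prod_unfold
      by (intro bounded_linear_add bounded_linear_const_mult bounded_linear_fst bounded_linear_snd)
    show "integrable (bidisk_measure a) (\<lambda>y. 3 * (C1 * C2) * cmod (G y))" using G by simp
  qed
  thus ?thesis unfolding DI bidisk_op_def[abs_def] by blast
qed

text \<open>The reproducing formula is applied first in \<zeta> for almost every w, then in w for
  almost every \<zeta>. Almost every is unavoidable because only almost all slices are square
  integrable. In w the slice is holomorphic only off 0 and is extended across the puncture before
  the formula applies.\<close>

lemma bidisk_reproducing:
  assumes U [measurable]: "U \<in> borel_measurable borel" and a: "- 2 < a" "a \<le> 0"
    and UL: "sq_mass (bidisk_measure a) U < \<infinity>"
    and h1: "\<And>w. cmod w < 1 \<Longrightarrow> w \<noteq> 0 \<Longrightarrow> (\<lambda>\<zeta>. U (\<zeta>, w)) holomorphic_on unit_disk"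
    and h2: "\<And>\<zeta>. cmod \<zeta> < 1 \<Longrightarrow> (\<lambda>w. U (\<zeta>, w)) holomorphic_on unit_disk - {0}"
  shows "AE x in bidisk_measure a. bidisk_op a U x = U x"
proof (rule AE_bidisk_measure)
  show "{x. bidisk_op a U x = U x} \<in> sets borel" by measurable
  have Uint: "integrable (bidisk_measure a) U"
    using square_integrable_imp_integrable[OF finite_bidisk_measure[OF a(1)] _ UL] by simp
  have "(\<integral>\<^sup>+w. \<integral>\<^sup>+\<zeta>. ennreal ((cmod (U (\<zeta>, w)))\<^sup>2) \<partial>disk_measure 0 \<partial>disk_measure a) \<noteq> \<infinity>"
    using UL by (subst (asm) nn_integral_bidisk(2)) auto
  hence "AE w in disk_measure a. (\<integral>\<^sup>+\<zeta>. ennreal ((cmod (U (\<zeta>, w)))\<^sup>2) \<partial>disk_measure 0) \<noteq> \<infinity>"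
    by (intro nn_integral_PInf_AE) auto
  hence inner: "AE w in disk_measure a. \<forall>\<zeta>. cmod \<zeta> < 1 \<longrightarrow> (\<integral>\<omega>. bergman_kernel 0 \<zeta> \<omega> * U (\<omega>, w) \<partial>disk_measure 0) = U (\<zeta>, w)"
    using AE_disk_measure_punctured
  proof eventually_elim
    fix w assume f: "(\<integral>\<^sup>+\<zeta>. ennreal ((cmod (U (\<zeta>, w)))\<^sup>2) \<partial>disk_measure 0) \<noteq> \<infinity>" and w: "cmod w < 1 \<and> w \<noteq> 0"
    have "integrable (disk_measure 0) (\<lambda>\<zeta>. U (\<zeta>, w))"
      using f by (intro square_integrable_imp_integrable finite_disk_measure) (auto simp: less_top)
    thus "\<forall>\<zeta>. cmod \<zeta> < 1 \<longrightarrow> (\<integral>\<omega>. bergman_kernel 0 \<zeta> \<omega> * U (\<omega>, w) \<partial>disk_measure 0) = U (\<zeta>, w)"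
      using w by (intro allI impI bergman_reproducing h1) auto
  qed
  have "(\<integral>\<^sup>+\<zeta>. \<integral>\<^sup>+w. ennreal ((cmod (U (\<zeta>, w)))\<^sup>2) \<partial>disk_measure a \<partial>disk_measure 0) \<noteq> \<infinity>"
    using UL by (subst (asm) nn_integral_bidisk(1)) auto
  hence "AE \<zeta> in disk_measure 0. (\<integral>\<^sup>+w. ennreal ((cmod (U (\<zeta>, w)))\<^sup>2) \<partial>disk_measure a) \<noteq> \<infinity>"
    by (intro nn_integral_PInf_AE) auto
  thus "AE \<zeta> in disk_measure 0. AE w in disk_measure a. bidisk_op a U (\<zeta>, w) = U (\<zeta>, w)"
    using AE_disk_measure_punctured
  proof eventually_elim
    fix \<zeta> assume f: "(\<integral>\<^sup>+w. ennreal ((cmod (U (\<zeta>, w)))\<^sup>2) \<partial>disk_measure a) \<noteq> \<infinity>" and z: "cmod \<zeta> < 1 \<and> \<zeta> \<noteq> 0"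
    obtain h' where h': "h' holomorphic_on unit_disk" "\<And>w. w \<in> unit_disk - {0} \<Longrightarrow> h' w = U (\<zeta>, w)"
      using square_integrable_extend[OF h2, of \<zeta> a] f z a by (auto simp: less_top)
    have int: "integrable (disk_measure a) (\<lambda>w. U (\<zeta>, w))"
      using f a by (intro square_integrable_imp_integrable finite_disk_measure) (auto simp: less_top)
    \<comment> \<open>The Borel version of the extended slice; it differs from the slice in the disk
      at most at 0, a null set.\<close>
    define k where "k w = indicator unit_disk w *\<^sub>R h' w" for w
    have km [measurable]: "k \<in> borel_measurable borel" unfolding k_def
      using holomorphic_on_imp_continuous_on[OF h'(1)] by (intro borel_measurable_continuous_on_indicator) auto
    have kh: "k holomorphic_on unit_disk"
      using h'(1) by (rule holomorphic_transform) (simp add: k_def)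
    have eq: "k w = U (\<zeta>, w)" if "cmod w < 1 \<and> w \<noteq> 0" for w
      using that h'(2)[of w] by (simp add: k_def unit_disk_def)
    have ae: "AE w in disk_measure a. U (\<zeta>, w) = k w"
      using AE_disk_measure_punctured by eventually_elim (simp add: eq)
    have kint: "integrable (disk_measure a) k"
      by (rule integrable_cong_AE_imp[OF int]) (use ae in \<open>auto elim: AE_mp\<close>)
    show "AE w in disk_measure a. bidisk_op a U (\<zeta>, w) = U (\<zeta>, w)"
      using AE_disk_measure_punctured
    proof eventually_elim
      fix w assume w: "cmod w < 1 \<and> w \<noteq> 0"
      have "bidisk_op a U (\<zeta>, w) = (\<integral>v. bergman_kernel a w v * (\<integral>\<omega>. bergman_kernel 0 \<zeta> \<omega> * U (\<omega>, v) \<partial>disk_measure 0) \<partial>disk_measure a)"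
        using z w by (intro bidisk_op_iterated Uint) auto
      also have "\<dots> = (\<integral>v. bergman_kernel a w v * k v \<partial>disk_measure a)"
      proof (rule integral_cong_AE)
        show "AE v in disk_measure a. bergman_kernel a w v * (\<integral>\<omega>. bergman_kernel 0 \<zeta> \<omega> * U (\<omega>, v) \<partial>disk_measure 0) = bergman_kernel a w v * k v"
          using inner ae by eventually_elim (use z in simp)
      qed measurable
      also have "\<dots> = k w" using w a by (intro bergman_reproducing kh kint) auto
      finally show "bidisk_op a U (\<zeta>, w) = U (\<zeta>, w)" using eq[OF w] by simp
    qed
  qed
qed

subsection \<open>The weighted Bergman projection of the Hartogs triangle\<close>

definition hartogs_map :: "complex \<times> complex \<Rightarrow> complex \<times> complex" where
  "hartogs_map x = (fst x * snd x, snd x)"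

lemma measurable_hartogs_map [measurable]: "hartogs_map \<in> borel_measurable borel"
  unfolding hartogs_map_def by measurable

lemma hartogs_triangle_alt: "hartogs_triangle = {x. cmod (fst x) < cmod (snd x) \<and> cmod (snd x) < 1}"
  by (auto simp: hartogs_triangle_def)

lemma open_hartogs_triangle: "open hartogs_triangle"
  unfolding hartogs_triangle_alt by (intro open_Collect_conj open_Collect_less continuous_intros)

lemma hartogs_triangle_borel [measurable]: "hartogs_triangle \<in> sets borel"
  using open_hartogs_triangle by simp

lemma hartogs_map_mem_iff: "w \<noteq> 0 \<Longrightarrow> (z * w, w) \<in> hartogs_triangle \<longleftrightarrow> z \<in> unit_disk \<and> w \<in> unit_disk"
  by (auto simp: hartogs_triangle_def unit_disk_def norm_mult)

text \<open>For fixed w the substitution z to zw has Jacobian |w|^2, written as |w|^a |w|^(2 - a);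
  the first factor is already contained in \<open>bidisk_measure a\<close>. Any \<open>a\<close> is
  allowed.\<close>

lemma nn_integral_hartogs:
  assumes [measurable]: "F \<in> borel_measurable borel"
  shows "(\<integral>\<^sup>+x. indicator hartogs_triangle x * F x \<partial>lborel)
     = (\<integral>\<^sup>+x. F (hartogs_map x) * ennreal (cmod (snd x) powr (2 - a)) \<partial>bidisk_measure a)"
proof -
  let ?F = "\<lambda>x. indicator hartogs_triangle x * F x"
  have m: "?F \<in> borel_measurable (lborel \<Otimes>\<^sub>M lborel)"
    unfolding lborel_prod by measurable
  have "(\<integral>\<^sup>+x. ?F x \<partial>lborel) = (\<integral>\<^sup>+x. ?F x \<partial>(lborel \<Otimes>\<^sub>M lborel))" by (simp only: lborel_prod)
  also have "\<dots> = (\<integral>\<^sup>+w. \<integral>\<^sup>+z. ?F (z, w) \<partial>lborel \<partial>lborel)"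
    by (rule lborel_pair.nn_integral_snd[symmetric, OF m])
  also have "\<dots> = (\<integral>\<^sup>+w. indicator unit_disk w * ennreal (cmod w powr a) *
      (\<integral>\<^sup>+z. F (hartogs_map (z, w)) * ennreal (cmod w powr (2 - a)) \<partial>disk_measure 0) \<partial>lborel)"
  proof (rule nn_integral_cong_AE)
    show "AE w in lborel. (\<integral>\<^sup>+z. ?F (z, w) \<partial>lborel) = indicator unit_disk w * ennreal (cmod w powr a) *
      (\<integral>\<^sup>+z. F (hartogs_map (z, w)) * ennreal (cmod w powr (2 - a)) \<partial>disk_measure 0)"
      using AE_lborel_singleton[of "0::complex"]
    proof eventually_elim
      fix w :: complex assume w: "w \<noteq> 0"
      have pw: "(cmod w)\<^sup>2 = cmod w powr a * cmod w powr (2 - a)"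
        using w by (simp add: powr_add[symmetric] powr_numeral)
      have "(\<integral>\<^sup>+z. ?F (z, w) \<partial>lborel) = ennreal ((cmod w)\<^sup>2) * (\<integral>\<^sup>+z. ?F (w * z, w) \<partial>lborel)"
        by (rule nn_integral_complex_mult[OF _ w]) measurable
      also have "(\<integral>\<^sup>+z. ?F (w * z, w) \<partial>lborel) = (\<integral>\<^sup>+z. indicator unit_disk w * (indicator unit_disk z * F (hartogs_map (z, w))) \<partial>lborel)"
        using hartogs_map_mem_iff[OF w] by (intro nn_integral_cong) (auto simp: indicator_def hartogs_map_def mult.commute)
      also have "\<dots> = indicator unit_disk w * (\<integral>\<^sup>+z. F (hartogs_map (z, w)) \<partial>disk_measure 0)"
        by (subst nn_integral_cmult, measurable, subst nn_integral_disk_measure_0) auto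
      also have "ennreal ((cmod w)\<^sup>2) * \<dots> = indicator unit_disk w * ennreal (cmod w powr a) *
          ((\<integral>\<^sup>+z. F (hartogs_map (z, w)) \<partial>disk_measure 0) * ennreal (cmod w powr (2 - a)))"
        unfolding pw by (simp add: ennreal_mult' ac_simps)
      also have "(\<integral>\<^sup>+z. F (hartogs_map (z, w)) \<partial>disk_measure 0) * ennreal (cmod w powr (2 - a))
         = (\<integral>\<^sup>+z. F (hartogs_map (z, w)) * ennreal (cmod w powr (2 - a)) \<partial>disk_measure 0)"
        by (subst nn_integral_multc) auto
      finally show "(\<integral>\<^sup>+z. ?F (z, w) \<partial>lborel) = indicator unit_disk w * ennreal (cmod w powr a) *
         (\<integral>\<^sup>+z. F (hartogs_map (z, w)) * ennreal (cmod w powr (2 - a)) \<partial>disk_measure 0)" .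
    qed
  qed
  also have "\<dots> = (\<integral>\<^sup>+w. \<integral>\<^sup>+z. F (hartogs_map (z, w)) * ennreal (cmod w powr (2 - a)) \<partial>disk_measure 0 \<partial>disk_measure a)"
    by (rule nn_integral_disk_measure[symmetric]) measurable
  also have "\<dots> = (\<integral>\<^sup>+x. F (hartogs_map x) * ennreal (cmod (snd x) powr (2 - a)) \<partial>bidisk_measure a)"
    by (subst nn_integral_bidisk(2)) auto
  finally show ?thesis .
qed

lemma integral_hartogs:
  fixes F :: "complex \<times> complex \<Rightarrow> complex"
  assumes F [measurable]: "F \<in> borel_measurable borel"
  shows "(\<integral>x. indicator hartogs_triangle x *\<^sub>R F x \<partial>lborel)
     = (\<integral>x. (cmod (snd x) powr (2 - a)) *\<^sub>R F (hartogs_map x) \<partial>bidisk_measure a)"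
proof -
  \<comment> \<open>The formula for non-negative functions, applied to indicators, is an identity of
    measures and so transfers to Bochner integrals.\<close>
  have eq: "density lborel (\<lambda>x. ennreal (indicator hartogs_triangle x))
     = distr (density (bidisk_measure a) (\<lambda>x. ennreal (cmod (snd x) powr (2 - a)))) borel hartogs_map"
  proof (rule measure_eqI)
    fix A assume "A \<in> sets (density lborel (\<lambda>x. ennreal (indicator hartogs_triangle x)))"
    hence [measurable]: "A \<in> sets (borel :: (complex \<times> complex) measure)" by simp
    have "emeasure (density lborel (\<lambda>x. ennreal (indicator hartogs_triangle x))) A
       = (\<integral>\<^sup>+x. indicator hartogs_triangle x * indicator A x \<partial>lborel)"
      by (subst emeasure_density) (auto simp: ennreal_indicator)
    also have "\<dots> = (\<integral>\<^sup>+x. indicator A (hartogs_map x) * ennreal (cmod (snd x) powr (2 - a)) \<partial>bidisk_measure a)"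
      by (rule nn_integral_hartogs) measurable
    also have "\<dots> = (\<integral>\<^sup>+x. indicator A (hartogs_map x) \<partial>density (bidisk_measure a) (\<lambda>x. ennreal (cmod (snd x) powr (2 - a))))"
      by (subst nn_integral_density) (auto simp: mult.commute)
    also have "\<dots> = (\<integral>\<^sup>+x. indicator A x \<partial>distr (density (bidisk_measure a) (\<lambda>x. ennreal (cmod (snd x) powr (2 - a)))) borel hartogs_map)"
      by (subst nn_integral_distr) auto
    finally show "emeasure (density lborel (\<lambda>x. ennreal (indicator hartogs_triangle x))) A
      = emeasure (distr (density (bidisk_measure a) (\<lambda>x. ennreal (cmod (snd x) powr (2 - a)))) borel hartogs_map) A"
      by simp
  qed simp
  have "(\<integral>x. indicator hartogs_triangle x *\<^sub>R F x \<partial>lborel) = integral\<^sup>L (density lborel (\<lambda>x. ennreal (indicator hartogs_triangle x))) F"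
    by (subst integral_density) auto
  also have "\<dots> = (\<integral>x. F (hartogs_map x) \<partial>density (bidisk_measure a) (\<lambda>x. ennreal (cmod (snd x) powr (2 - a))))"
    unfolding eq by (rule integral_distr) auto
  also have "\<dots> = (\<integral>x. (cmod (snd x) powr (2 - a)) *\<^sub>R F (hartogs_map x) \<partial>bidisk_measure a)"
    by (rule integral_density) auto
  finally show ?thesis .
qed

lemma holomorphic2_on_derivative:
  assumes "holomorphic2_on f hartogs_triangle" "x \<in> hartogs_triangle"
  obtains A B where "(f has_derivative (\<lambda>(h1, h2). A * h1 + B * h2)) (at x)"
proof -
  obtain A B where "(f has_derivative (\<lambda>(h1, h2). A * h1 + B * h2)) (at x within hartogs_triangle)"
    using assms unfolding holomorphic2_on_def by blast
  hence "(f has_derivative (\<lambda>(h1, h2). A * h1 + B * h2)) (at x)"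
    using at_within_open[OF assms(2) open_hartogs_triangle] by simp
  thus ?thesis by (rule that)
qed

lemma holomorphic2_on_imp_continuous_on:
  "holomorphic2_on f hartogs_triangle \<Longrightarrow> continuous_on hartogs_triangle f"
  unfolding holomorphic2_on_def continuous_on_eq_continuous_within
  by (meson has_derivative_continuous)

lemma holomorphic2_on_diff:
  assumes "holomorphic2_on f S" "holomorphic2_on g S"
  shows "holomorphic2_on (\<lambda>z. f z - g z) S"
  unfolding holomorphic2_on_def
proof
  fix z assume z: "z \<in> S"
  obtain a b c d where "(f has_derivative (\<lambda>(h1, h2). a * h1 + b * h2)) (at z within S)"
     "(g has_derivative (\<lambda>(h1, h2). c * h1 + d * h2)) (at z within S)"
    using assms z unfolding holomorphic2_on_def by blast
  from has_derivative_diff[OF this]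
  have "((\<lambda>z. f z - g z) has_derivative (\<lambda>(h1, h2). (a - c) * h1 + (b - d) * h2)) (at z within S)"
    by (simp add: case_prod_unfold algebra_simps)
  thus "\<exists>a b. ((\<lambda>z. f z - g z) has_derivative (\<lambda>(h1, h2). a * h1 + b * h2)) (at z within S)" by blast
qed

text \<open>A function \<open>f\<close> on the Hartogs triangle corresponds to \<open>(\<zeta>, w) \<mapsto> \<gamma> w * f (\<zeta> * w, w)\<close> on the bidisk,
  where \<open>\<gamma> w = w\<^sup>m * g w\<close>. The power \<open>m = k + 2\<close> is the one that removes the puncture \<open>w = 0\<close>: it turns the
  weight into \<open>|w|\<^sup>a\<close> with \<open>a = s - 2 \<in> (-2, 0]\<close>.\<close>

locale hartogs_weight =
  fixes g :: "complex \<Rightarrow> complex" and a :: real and m :: int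
  assumes g_meas [measurable]: "g \<in> borel_measurable borel"
    and g_nz: "\<And>w. g w \<noteq> 0"
    and g_holo: "g holomorphic_on unit_disk"
    and a: "- 2 < a" "a \<le> 0"
begin

text \<open>For a = s - 2 and m = k + 2 the exponent is s + 2k = s'.\<close>

definition weight :: "complex \<times> complex \<Rightarrow> real" where
  "weight x = cmod (snd x) powr (a + 2 * of_int m - 2) * (cmod (g (snd x)))\<^sup>2"

definition \<gamma> :: "complex \<Rightarrow> complex" where
  "\<gamma> w = w powi m * g w"

definition lift :: "(complex \<times> complex \<Rightarrow> complex) \<Rightarrow> complex \<times> complex \<Rightarrow> complex" where
  "lift f x = \<gamma> (snd x) * f (hartogs_map x)"

definition proj :: "(complex \<times> complex \<Rightarrow> complex) \<Rightarrow> complex \<times> complex \<Rightarrow> complex" where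
  "proj f x = indicator hartogs_triangle x * (bidisk_op a (lift f) (fst x / snd x, snd x) / \<gamma> (snd x))"

lemma measurable_powi [measurable]: "(\<lambda>w::complex. w powi m) \<in> borel_measurable borel"
  by (cases "m \<ge> 0") (simp_all add: power_int_def)

lemma measurable_\<gamma> [measurable]: "\<gamma> \<in> borel_measurable borel"
  unfolding \<gamma>_def by measurable

lemma measurable_weight [measurable]: "weight \<in> borel_measurable borel"
  unfolding weight_def by measurable

lemma measurable_lift [measurable]:
  assumes [measurable]: "f \<in> borel_measurable borel"
  shows "lift f \<in> borel_measurable borel"
  unfolding lift_def by measurable

lemma measurable_proj [measurable]:
  assumes [measurable]: "f \<in> borel_measurable borel"
  shows "proj f \<in> borel_measurable borel"
  unfolding proj_def by measurable

sublocale weighted_domain hartogs_triangle weight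
proof
  show "open hartogs_triangle" by (rule open_hartogs_triangle)
  show "weight \<in> borel_measurable borel" by (rule measurable_weight)
  show "0 \<le> weight x" for x by (simp add: weight_def)
  show "0 < weight x" if "x \<in> hartogs_triangle" for x
  proof -
    have "snd x \<noteq> 0" using that by (auto simp: hartogs_triangle_def)
    thus ?thesis by (simp add: weight_def g_nz)
  qed
qed

lemma \<gamma>_nz: "w \<noteq> 0 \<Longrightarrow> \<gamma> w \<noteq> 0"
  by (simp add: \<gamma>_def g_nz)

lemma norm_\<gamma>: "w \<noteq> 0 \<Longrightarrow> cmod (\<gamma> w) = cmod w powr of_int m * cmod (g w)"
  by (simp add: \<gamma>_def norm_mult norm_power_int powr_real_of_int')

text \<open>The weight times the part of the Jacobian not contained in
  \<open>bidisk_measure a\<close> is a perfect square; this makes \<open>lift\<close> an isometry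
  for p = 2.\<close>

lemma weight_eq: "w \<noteq> 0 \<Longrightarrow> weight (z, w) * cmod w powr (2 - a) = (cmod (\<gamma> w))\<^sup>2"
proof -
  assume w: "w \<noteq> 0"
  have "(cmod w powr of_int m)\<^sup>2 = cmod w powr (a + 2 * of_int m - 2) * cmod w powr (2 - a)"
    using w by (simp add: power2_eq_square powr_add[symmetric])
  thus ?thesis using w by (simp add: weight_def norm_\<gamma> power_mult_distrib)
qed

lemma Lp_mass_hartogs:
  assumes [measurable]: "f \<in> borel_measurable borel"
  shows "Lp_mass p hartogs_triangle weight f
     = (\<integral>\<^sup>+x. ennreal (cmod (lift f x) powr p * cmod (\<gamma> (snd x)) powr (2 - p)) \<partial>bidisk_measure a)"
proof -
  have "Lp_mass p hartogs_triangle weight f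
     = (\<integral>\<^sup>+x. ennreal (cmod (f (hartogs_map x)) powr p * weight (hartogs_map x)) * ennreal (cmod (snd x) powr (2 - a)) \<partial>bidisk_measure a)"
    unfolding Lp_mass_def by (rule nn_integral_hartogs) measurable
  also have "\<dots> = (\<integral>\<^sup>+x. ennreal (cmod (lift f x) powr p * cmod (\<gamma> (snd x)) powr (2 - p)) \<partial>bidisk_measure a)"
  proof (rule nn_integral_cong_AE)
    show "AE x in bidisk_measure a. ennreal (cmod (f (hartogs_map x)) powr p * weight (hartogs_map x)) * ennreal (cmod (snd x) powr (2 - a))
        = ennreal (cmod (lift f x) powr p * cmod (\<gamma> (snd x)) powr (2 - p))"
      using AE_bidisk
    proof eventually_elim
      fix x :: "complex \<times> complex" assume x: "cmod (fst x) < 1 \<and> cmod (snd x) < 1 \<and> snd x \<noteq> 0"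
      have "ennreal (cmod (f (hartogs_map x)) powr p * weight (hartogs_map x)) * ennreal (cmod (snd x) powr (2 - a))
         = ennreal (cmod (f (hartogs_map x)) powr p * (weight (hartogs_map x) * cmod (snd x) powr (2 - a)))"
        by (simp add: ennreal_mult''[symmetric] mult.assoc)
      also have "weight (hartogs_map x) * cmod (snd x) powr (2 - a) = (cmod (\<gamma> (snd x)))\<^sup>2"
        using x by (simp add: hartogs_map_def weight_eq)
      also have "(cmod (\<gamma> (snd x)))\<^sup>2 = cmod (\<gamma> (snd x)) powr p * cmod (\<gamma> (snd x)) powr (2 - p)"
        using \<gamma>_nz[of "snd x"] x by (simp add: powr_add[symmetric] powr_numeral)
      finally show "ennreal (cmod (f (hartogs_map x)) powr p * weight (hartogs_map x)) * ennreal (cmod (snd x) powr (2 - a))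
        = ennreal (cmod (lift f x) powr p * cmod (\<gamma> (snd x)) powr (2 - p))"
        by (simp add: lift_def norm_mult powr_mult ac_simps)
    qed
  qed
  finally show ?thesis .
qed

lemma L2_mass_hartogs:
  assumes "f \<in> borel_measurable borel"
  shows "Lp_mass 2 hartogs_triangle weight f = sq_mass (bidisk_measure a) (lift f)"
  unfolding Lp_mass_hartogs[OF assms]
proof (rule nn_integral_cong_AE)
  show "AE x in bidisk_measure a. ennreal (cmod (lift f x) powr 2 * cmod (\<gamma> (snd x)) powr (2 - 2)) = ennreal ((cmod (lift f x))\<^sup>2)"
    using AE_bidisk by eventually_elim (use \<gamma>_nz in \<open>auto simp: powr_numeral\<close>)
qed

lemma lift_proj:
  assumes "cmod (fst x) < 1" "cmod (snd x) < 1" "snd x \<noteq> 0"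
  shows "lift (proj f) x = bidisk_op a (lift f) x"
proof -
  have "hartogs_map x \<in> hartogs_triangle"
    using hartogs_map_mem_iff[OF assms(3), of "fst x"] assms by (simp add: hartogs_map_def unit_disk_def)
  thus ?thesis using assms(3) \<gamma>_nz[of "snd x"] by (simp add: lift_def proj_def hartogs_map_def)
qed

lemma AE_lift_proj: "AE x in bidisk_measure a. lift (proj f) x = bidisk_op a (lift f) x"
  using AE_bidisk by eventually_elim (simp add: lift_proj)

lemma \<gamma>_holomorphic: "\<gamma> holomorphic_on unit_disk - {0}"
  unfolding \<gamma>_def by (intro holomorphic_intros holomorphic_on_subset[OF g_holo]) auto

lemma proj_holomorphic:
  assumes G: "integrable (bidisk_measure a) (lift f)"
  shows "holomorphic2_on (proj f) hartogs_triangle"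
  unfolding holomorphic2_on_def
proof
  fix x assume x: "x \<in> hartogs_triangle"
  define z w where "z = fst x" and "w = snd x"
  have x': "cmod z < cmod w" "cmod w < 1" "w \<noteq> 0" and xe: "x = (z, w)"
    using x by (auto simp: z_def w_def hartogs_triangle_def)
  have zw: "cmod (z / w) < 1" using x' by (simp add: norm_divide)
  obtain A B where AB: "(bidisk_op a (lift f) has_derivative (\<lambda>(h1, h2). A * h1 + B * h2)) (at (z / w, w))"
    using bidisk_op_has_derivative[OF G, of "(z / w, w)"] zw x' by auto
  have d1: "((\<lambda>x. (fst x / snd x, snd x)) has_derivative (\<lambda>h. (fst h / w - z * snd h / w\<^sup>2, snd h))) (at x)"
    using x' unfolding xe
    by (auto intro!: derivative_eq_intros simp: fun_eq_iff field_simps power2_eq_square)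
  have d2: "((\<lambda>x. bidisk_op a (lift f) (fst x / snd x, snd x)) has_derivative
      (\<lambda>h. A * (fst h / w - z * snd h / w\<^sup>2) + B * snd h)) (at x)"
    using has_derivative_compose[OF d1, of "bidisk_op a (lift f)" "\<lambda>(h1, h2). A * h1 + B * h2"] AB
    by (simp add: xe)
  have "\<gamma> field_differentiable at w"
  proof (rule holomorphic_on_imp_differentiable_at[OF \<gamma>_holomorphic])
    show "open (unit_disk - {0})" by (auto simp: unit_disk_eq_ball)
  qed (use x' in \<open>auto simp: unit_disk_def\<close>)
  then obtain c where "(\<gamma> has_field_derivative c) (at w)" unfolding field_differentiable_def by blast
  hence c: "(\<gamma> has_derivative (\<lambda>h. c * h)) (at (snd x))" by (simp add: has_field_derivative_def w_def)
  have d3: "((\<lambda>x. \<gamma> (snd x)) has_derivative (\<lambda>h. c * snd h)) (at x)"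
    by (rule has_derivative_compose[OF has_derivative_snd[OF has_derivative_ident] c])
  define b where "b = bidisk_op a (lift f) (z / w, w)"
  have g0: "\<gamma> w \<noteq> 0" by (rule \<gamma>_nz[OF x'(3)])
  have d4: "((\<lambda>x. bidisk_op a (lift f) (fst x / snd x, snd x) / \<gamma> (snd x)) has_derivative
      (\<lambda>h. - b * (inverse (\<gamma> w) * (c * snd h) * inverse (\<gamma> w)) + (A * (fst h / w - z * snd h / w\<^sup>2) + B * snd h) / \<gamma> w)) (at x)"
    using has_derivative_divide[OF d2 d3] g0 by (simp add: b_def xe)
  have "(proj f has_derivative
      (\<lambda>h. - b * (inverse (\<gamma> w) * (c * snd h) * inverse (\<gamma> w)) + (A * (fst h / w - z * snd h / w\<^sup>2) + B * snd h) / \<gamma> w)) (at x)"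
    by (rule has_derivative_transform_within_open[OF d4 open_hartogs_triangle x]) (simp add: proj_def)
  moreover have "(\<lambda>h. - b * (inverse (\<gamma> w) * (c * snd h) * inverse (\<gamma> w)) + (A * (fst h / w - z * snd h / w\<^sup>2) + B * snd h) / \<gamma> w)
     = (\<lambda>(h1, h2). A / w / \<gamma> w * h1 + ((B - A * z / w\<^sup>2) / \<gamma> w - b * c / (\<gamma> w)\<^sup>2) * h2)"
    using g0 x'(3) by (auto simp: fun_eq_iff field_simps power2_eq_square)
  ultimately have "(proj f has_derivative (\<lambda>(h1, h2). A / w / \<gamma> w * h1 + ((B - A * z / w\<^sup>2) / \<gamma> w - b * c / (\<gamma> w)\<^sup>2) * h2)) (at x)"
    by simp
  thus "\<exists>a b. (proj f has_derivative (\<lambda>(h1, h2). a * h1 + b * h2)) (at x within hartogs_triangle)"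
    using has_derivative_at_withinI by blast
qed

text \<open>Restrictions to complex lines, by the chain rule. In w the origin must be excluded: its
  image (0, 0) is outside the triangle, and \<gamma> may have a pole there when m is
  negative.\<close>

lemma lift_holomorphic:
  assumes u: "holomorphic2_on u hartogs_triangle"
  shows "cmod w < 1 \<Longrightarrow> w \<noteq> 0 \<Longrightarrow> (\<lambda>\<zeta>. lift u (\<zeta>, w)) holomorphic_on unit_disk"
    and "cmod \<zeta> < 1 \<Longrightarrow> (\<lambda>w. lift u (\<zeta>, w)) holomorphic_on unit_disk - {0}"
proof -
  have mem: "(\<zeta> * w, w) \<in> hartogs_triangle" if "cmod \<zeta> < 1" "cmod w < 1" "w \<noteq> 0" for \<zeta> w
    using hartogs_map_mem_iff[of w \<zeta>] that by (simp add: unit_disk_def)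
  show "(\<lambda>\<zeta>. lift u (\<zeta>, w)) holomorphic_on unit_disk" if w: "cmod w < 1" "w \<noteq> 0"
  proof -
    have "(\<lambda>\<zeta>. u (\<zeta> * w, w)) holomorphic_on unit_disk"
      unfolding holomorphic_on_def
    proof
      fix \<zeta> assume "\<zeta> \<in> unit_disk"
      hence "(\<zeta> * w, w) \<in> hartogs_triangle" using mem w by (simp add: unit_disk_def)
      then obtain A B where AB: "(u has_derivative (\<lambda>(h1, h2). A * h1 + B * h2)) (at (\<zeta> * w, w))"
        using holomorphic2_on_derivative[OF u] by metis
      have "((\<lambda>\<zeta>. (\<zeta> * w, w)) has_derivative (\<lambda>h. (h * w, 0))) (at \<zeta>)"
        by (auto intro!: derivative_eq_intros)
      from has_derivative_compose[OF this AB]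
      have "((\<lambda>\<zeta>. u (\<zeta> * w, w)) has_field_derivative (A * w)) (at \<zeta>)"
        unfolding has_field_derivative_def by (rule has_derivative_eq_rhs) (simp add: fun_eq_iff)
      thus "(\<lambda>\<zeta>. u (\<zeta> * w, w)) field_differentiable at \<zeta> within unit_disk"
        using field_differentiable_at_within field_differentiable_def by blast
    qed
    thus ?thesis unfolding lift_def hartogs_map_def by (simp add: holomorphic_intros)
  qed
  show "(\<lambda>w. lift u (\<zeta>, w)) holomorphic_on unit_disk - {0}" if z: "cmod \<zeta> < 1"
  proof -
    have "(\<lambda>w. u (\<zeta> * w, w)) holomorphic_on unit_disk - {0}"
      unfolding holomorphic_on_def
    proof
      fix w assume "w \<in> unit_disk - {0}"
      hence "(\<zeta> * w, w) \<in> hartogs_triangle" using mem z by (simp add: unit_disk_def)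
      then obtain A B where AB: "(u has_derivative (\<lambda>(h1, h2). A * h1 + B * h2)) (at (\<zeta> * w, w))"
        using holomorphic2_on_derivative[OF u] by metis
      have "((\<lambda>w. (\<zeta> * w, w)) has_derivative (\<lambda>h. (\<zeta> * h, h))) (at w)"
        by (auto intro!: derivative_eq_intros)
      from has_derivative_compose[OF this AB]
      have "((\<lambda>w. u (\<zeta> * w, w)) has_field_derivative (A * \<zeta> + B)) (at w)"
        unfolding has_field_derivative_def by (rule has_derivative_eq_rhs) (simp add: fun_eq_iff algebra_simps)
      thus "(\<lambda>w. u (\<zeta> * w, w)) field_differentiable at w within unit_disk - {0}"
        using field_differentiable_at_within field_differentiable_def by blast
    qed
    thus ?thesis unfolding lift_def hartogs_map_def by (simp add: holomorphic_on_mult \<gamma>_holomorphic)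
  qed
qed

text \<open>\<open>lift\<close> carries the weighted inner product to that of
  \<open>bidisk_measure a\<close> and holomorphic functions to functions reproduced by the bidisk
  kernel; \<open>proj\<close> is the kernel operator pulled back.\<close>

lemma hartogs_projection:
  assumes f [measurable]: "f \<in> borel_measurable borel" and fL: "Lp_mass 2 hartogs_triangle weight f < \<infinity>"
  shows "bergman_projection holomorphic2_on hartogs_triangle weight f = proj f"
proof -
  define G where "G = lift f"
  have Gm [measurable]: "G \<in> borel_measurable borel" unfolding G_def by measurable
  have GL: "sq_mass (bidisk_measure a) G < \<infinity>"
    using fL unfolding L2_mass_hartogs[OF f] G_def .
  have Gint: "integrable (bidisk_measure a) G"
    using square_integrable_imp_integrable[OF finite_bidisk_measure[OF a(1)] _ GL] by simp
  obtain C where C: "\<And>G::complex \<times> complex \<Rightarrow> complex. G \<in> borel_measurable borel \<Longrightarrow>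
     (\<integral>\<^sup>+x. epow 2 (\<integral>\<^sup>+y. ennreal (cmod (bidisk_kernel a x y) * cmod (G y)) \<partial>bidisk_measure a) \<partial>bidisk_measure a)
       \<le> ennreal C * (\<integral>\<^sup>+x. ennreal (cmod (G x) powr 2) \<partial>bidisk_measure a)"
    using bidisk_kernel_Lp_bound[of 2 a] a by auto
  have TG: "(\<integral>\<^sup>+x. epow 2 (\<integral>\<^sup>+y. ennreal (cmod (bidisk_kernel a x y) * cmod (G y)) \<partial>bidisk_measure a) \<partial>bidisk_measure a) < \<infinity>"
    using le_less_trans[OF C[OF Gm]] GL by (simp add: powr_numeral ennreal_mult_less_top)
  have TGL: "sq_mass (bidisk_measure a) (bidisk_op a G) < \<infinity>"
  proof -
    have "ennreal ((cmod (bidisk_op a G x))\<^sup>2) \<le> epow 2 (\<integral>\<^sup>+y. ennreal (cmod (bidisk_kernel a x y) * cmod (G y)) \<partial>bidisk_measure a)" for x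
      using powr_norm_integral_le_epow[of 2 "bidisk_measure a" "\<lambda>y. bidisk_kernel a x y * G y"]
      by (simp add: bidisk_op_def norm_mult powr_numeral)
    hence "sq_mass (bidisk_measure a) (bidisk_op a G)
       \<le> (\<integral>\<^sup>+x. epow 2 (\<integral>\<^sup>+y. ennreal (cmod (bidisk_kernel a x y) * cmod (G y)) \<partial>bidisk_measure a) \<partial>bidisk_measure a)"
      by (intro nn_integral_mono)
    thus ?thesis using TG by simp
  qed
  show ?thesis
  proof (rule bergman_projection_eqI)
    show "f \<in> weighted_Lp 2 hartogs_triangle weight" using fL by (simp add: weighted_Lp_iff(1))
    have "(\<integral>\<^sup>+x. ennreal ((cmod (lift (proj f) x))\<^sup>2) \<partial>bidisk_measure a)
       = sq_mass (bidisk_measure a) (bidisk_op a G)"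
    proof (rule nn_integral_cong_AE)
      show "AE x in bidisk_measure a. ennreal ((cmod (lift (proj f) x))\<^sup>2) = ennreal ((cmod (bidisk_op a G x))\<^sup>2)"
        using AE_lift_proj[of f] by eventually_elim (simp add: G_def)
    qed
    hence "proj f \<in> weighted_Lp 2 hartogs_triangle weight"
      using TGL by (simp add: weighted_Lp_iff(1) L2_mass_hartogs)
    thus "proj f \<in> bergman_space holomorphic2_on hartogs_triangle weight"
      using proj_holomorphic[OF Gint[unfolded G_def]] by (simp add: bergman_space_def)
    show "\<And>z. z \<notin> hartogs_triangle \<Longrightarrow> proj f z = 0" by (simp add: proj_def)
  next
    fix u assume "u \<in> bergman_space holomorphic2_on hartogs_triangle weight"
    hence u: "u \<in> weighted_Lp 2 hartogs_triangle weight" "holomorphic2_on u hartogs_triangle"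
      by (auto simp: bergman_space_def)
    define v where "v w = indicator hartogs_triangle w *\<^sub>R u w" for w
    define U where "U = lift v"
    have vm [measurable]: "v \<in> borel_measurable borel" unfolding v_def
      using holomorphic2_on_imp_continuous_on[OF u(2)] by (intro borel_measurable_continuous_on_indicator) auto
    have Um [measurable]: "U \<in> borel_measurable borel" unfolding U_def by measurable
    have "AE x in lebesgue_on hartogs_triangle. u x = v x"
      unfolding AE_lebesgue_on_iff[OF dom_borel] by (simp add: v_def)
    from weighted_Lp_cong_AE(1)[OF u(1) vm this]
    have UL: "sq_mass (bidisk_measure a) U < \<infinity>"
      unfolding weighted_Lp_iff(1)[OF vm] L2_mass_hartogs[OF vm] U_def .
    have Uu: "U (\<zeta>, w) = lift u (\<zeta>, w)" if "cmod \<zeta> < 1" "cmod w < 1" "w \<noteq> 0" for \<zeta> w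
      using hartogs_map_mem_iff[of w \<zeta>] that by (simp add: U_def lift_def v_def hartogs_map_def unit_disk_def)
    have rep: "AE x in bidisk_measure a. (\<integral>y. bidisk_kernel a x y * U y \<partial>bidisk_measure a) = U x"
      unfolding bidisk_op_def[symmetric]
    proof (rule bidisk_reproducing[OF Um a UL])
      show "(\<lambda>\<zeta>. U (\<zeta>, w)) holomorphic_on unit_disk" if w: "cmod w < 1" "w \<noteq> 0" for w
        by (rule holomorphic_transform[OF lift_holomorphic(1)[OF u(2) w]]) (use w in \<open>auto simp: Uu unit_disk_def\<close>)
      show "(\<lambda>w. U (\<zeta>, w)) holomorphic_on unit_disk - {0}" if z: "cmod \<zeta> < 1" for \<zeta>
        by (rule holomorphic_transform[OF lift_holomorphic(2)[OF u(2) z]]) (use z in \<open>auto simp: Uu unit_disk_def\<close>)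
    qed
    have "weighted_inner hartogs_triangle weight (\<lambda>z. f z - proj f z) u
       = (\<integral>z. (f z - proj f z) * cnj (v z) * complex_of_real (weight z) \<partial>lebesgue_on hartogs_triangle)"
      unfolding weighted_inner_def by (intro Bochner_Integration.integral_cong refl) (simp add: v_def)
    also have "\<dots> = (\<integral>z. indicator hartogs_triangle z *\<^sub>R ((f z - proj f z) * cnj (v z) * complex_of_real (weight z)) \<partial>lborel)"
      by (rule integrable_lebesgue_on_borel_iff(2)) measurable
    also have "\<dots> = (\<integral>x. (cmod (snd x) powr (2 - a)) *\<^sub>R ((f (hartogs_map x) - proj f (hartogs_map x)) * cnj (v (hartogs_map x))
        * complex_of_real (weight (hartogs_map x))) \<partial>bidisk_measure a)"
      by (rule integral_hartogs) measurable
    also have "\<dots> = (\<integral>x. (G x - (\<integral>y. bidisk_kernel a x y * G y \<partial>bidisk_measure a)) * cnj (U x) \<partial>bidisk_measure a)"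
      unfolding bidisk_op_def[symmetric]
    proof (rule integral_cong_AE)
      show "AE x in bidisk_measure a. (cmod (snd x) powr (2 - a)) *\<^sub>R ((f (hartogs_map x) - proj f (hartogs_map x)) * cnj (v (hartogs_map x))
        * complex_of_real (weight (hartogs_map x))) = (G x - bidisk_op a G x) * cnj (U x)"
        using AE_bidisk
      proof eventually_elim
        fix x :: "complex \<times> complex" assume x: "cmod (fst x) < 1 \<and> cmod (snd x) < 1 \<and> snd x \<noteq> 0"
        \<comment> \<open>This splits as \<gamma> cnj \<gamma>, one factor for each entry of the
          inner product.\<close>
        have "weight (hartogs_map x) * cmod (snd x) powr (2 - a) = (cmod (\<gamma> (snd x)))\<^sup>2"
          using x by (simp add: hartogs_map_def weight_eq)
        hence "complex_of_real (weight (hartogs_map x)) * complex_of_real (cmod (snd x) powr (2 - a)) = \<gamma> (snd x) * cnj (\<gamma> (snd x))"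
          unfolding complex_norm_square[symmetric] of_real_mult[symmetric] by simp
        hence "(cmod (snd x) powr (2 - a)) *\<^sub>R ((f (hartogs_map x) - proj f (hartogs_map x)) * cnj (v (hartogs_map x))
            * complex_of_real (weight (hartogs_map x)))
          = (f (hartogs_map x) - proj f (hartogs_map x)) * cnj (v (hartogs_map x)) * (\<gamma> (snd x) * cnj (\<gamma> (snd x)))"
          by (simp add: scaleR_conv_of_real ac_simps)
        also have "\<dots> = (lift f x - lift (proj f) x) * cnj (lift v x)"
          by (simp add: lift_def algebra_simps)
        finally show "(cmod (snd x) powr (2 - a)) *\<^sub>R ((f (hartogs_map x) - proj f (hartogs_map x)) * cnj (v (hartogs_map x))
            * complex_of_real (weight (hartogs_map x))) = (G x - bidisk_op a G x) * cnj (U x)"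
          using x by (simp add: lift_proj G_def U_def)
      qed
    qed measurable
    also have "\<dots> = 0"
    proof (rule kernel_projection_orthogonal[OF sigma_finite_bidisk_measure _ _ _ _ TG GL UL rep])
      show "cnj (bidisk_kernel a x y) = bidisk_kernel a y x" for x y
        by (simp add: bidisk_kernel_def cnj_bergman_kernel)
    qed measurable
    finally show "weighted_inner hartogs_triangle weight (\<lambda>z. f z - proj f z) u = 0" .
  qed (auto intro: holomorphic2_on_imp_continuous_on holomorphic2_on_diff)
qed

end

subsection \<open>Exponents\<close>

text \<open>The conjugate of x / y is x / (x - y); clearing denominators turns membership into two
  inequalities linear in x and y.\<close>

lemma conj_interval_divide_iff:
  assumes "0 < y" "y < x"
  shows "p \<in> conj_interval (x / y) \<longleftrightarrow> x < p * y \<and> p * (x - y) < x"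
proof -
  have "x / y \<noteq> 1" using assms by simp
  moreover have "x / y / (x / y - 1) = x / (x - y)" using assms by (simp add: field_simps)
  ultimately show ?thesis
    using assms by (simp add: conj_interval_def conj_exponent_def pos_divide_less_eq pos_less_divide_eq mult.commute)
qed

lemma conj_interval_1: "p \<in> conj_interval 1 \<longleftrightarrow> 1 < p"
  by (simp add: conj_interval_def conj_exponent_def)

text \<open>Lets the hypothesis on the disk be used at the conjugate exponent as well.\<close>

lemma conj_interval_conjugate:
  assumes "p0 \<ge> 1" "p > 1" "p \<in> conj_interval p0"
  shows "p / (p - 1) \<in> conj_interval p0"
proof (cases "p0 = 1")
  case True
  thus ?thesis using assms by (simp add: conj_interval_1)
next
  case False
  hence p0: "(0::real) < 1" "1 < p0" using assms by auto
  have "p0 < p" "p * (p0 - 1) < p0" using conj_interval_divide_iff[OF p0, of p] assms by auto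
  hence "p0 < p / (p - 1) * 1" "p / (p - 1) * (p0 - 1) < p0"
    using assms by (auto simp: field_simps)
  thus ?thesis using conj_interval_divide_iff[OF p0, of "p / (p - 1)"] by simp
qed

text \<open>With n = k + 2 the right side asks that |w|^(n(2 - r)) be integrable near 0 against
  |w|^(s - 2) for r = p and for its conjugate. Multiplying the second condition by p - 1 leaves 0 <
  n(2 - p) + s and 0 < n(p - 2) + s(p - 1), which is compared with each branch of the
  exponent.\<close>

lemma hartogs_exponent_iff:
  assumes s: "0 < s" "s \<le> 2" and p: "p > 1"
  shows "p \<in> conj_interval (hartogs_exponent s k) \<longleftrightarrow>
     - 2 < of_int (k + 2) * (2 - p) + (s - 2) \<and> - 2 < of_int (k + 2) * (2 - p / (p - 1)) + (s - 2)"
proof -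
  define n where "n = (of_int (k + 2) :: real)"
  have k: "of_int k = n - 2" by (simp add: n_def)
  have "2 - p / (p - 1) = (p - 2) / (p - 1)" using p by (simp add: field_simps)
  hence "- 2 < n * (2 - p / (p - 1)) + (s - 2) \<longleftrightarrow> 0 < n * ((p - 2) / (p - 1)) + s" by auto
  also have "\<dots> \<longleftrightarrow> 0 < (n * ((p - 2) / (p - 1)) + s) * (p - 1)"
    using p by (simp add: zero_less_mult_iff)
  also have "(n * ((p - 2) / (p - 1)) + s) * (p - 1) = n * (p - 2) + s * (p - 1)"
    using p by (simp add: distrib_right)
  finally have R: "(- 2 < n * (2 - p) + (s - 2) \<and> - 2 < n * (2 - p / (p - 1)) + (s - 2))
     \<longleftrightarrow> 0 < n * (2 - p) + s \<and> 0 < n * (p - 2) + s * (p - 1)" by auto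
  have "p \<in> conj_interval (hartogs_exponent s k) \<longleftrightarrow> 0 < n * (2 - p) + s \<and> 0 < n * (p - 2) + s * (p - 1)"
  proof -
    \<comment> \<open>As 0 < s \<le> 2, the ranges of s' become ranges of k: s' > -2 is k \<ge> -1,
      the interval [-5, -2] is k = -2 or k = -3 with s \<ge> 1, (-6, -5) is k = -3 with s < 1, s' =
      -6 is k = -4 with s = 2, and the rest is s' < -6.\<close>
    consider "k \<ge> - 1" | "k = - 2" | "k = - 3" "s \<ge> 1" | "k = - 3" "s < 1" | "k = - 4" "s = 2" | "k \<le> - 4" "\<not> (k = - 4 \<and> s = 2)"
      by linarith
    thus ?thesis
    proof cases
      case 1
      hence n: "n \<ge> 1" unfolding n_def by linarith
      have "hartogs_exponent s k = (s + 2 * n) / (s + n)"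
        using n s unfolding hartogs_exponent_def k by (simp add: Let_def)
      thus ?thesis
        using conj_interval_divide_iff[of "s + n" "s + 2 * n" p] n s by (auto simp: algebra_simps)
    next
      case 2
      hence n: "n = 0" by (simp add: n_def)
      have "hartogs_exponent s k = 1"
        using s unfolding hartogs_exponent_def k n by (simp add: Let_def)
      thus ?thesis using p s by (simp add: conj_interval_1 n)
    next
      case 3
      hence n: "n = - 1" by (simp add: n_def)
      have "hartogs_exponent s k = 1"
        using s 3 unfolding hartogs_exponent_def k n by (simp add: Let_def)
      moreover have "0 < 2 - p + s * (p - 1)"
      proof (cases "s = 1")
        case False
        have "0 \<le> (s - 1) * (p - 1)" using 3 p by simp
        moreover have "0 < (s - 1) * (p - 1)" using False 3 p by simp
        ultimately show ?thesis using p by (simp add: algebra_simps)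
      qed simp
      ultimately show ?thesis using p s 3 by (simp add: conj_interval_1 n algebra_simps)
    next
      case 4
      hence n: "n = - 1" by (simp add: n_def)
      have "hartogs_exponent s k = (2 - s) / 1"
        using s 4 unfolding hartogs_exponent_def k n by (simp add: Let_def)
      hence "p \<in> conj_interval (hartogs_exponent s k) \<longleftrightarrow> 2 - s < p * 1 \<and> p * (2 - s - 1) < 2 - s"
        using 4 s by (simp only: conj_interval_divide_iff[of 1 "2 - s" p])
      thus ?thesis unfolding n by (auto simp: algebra_simps)
    next
      case 5
      hence n: "n = - 2" by (simp add: n_def)
      have "hartogs_exponent s k = 1"
        using 5 unfolding hartogs_exponent_def k n by (simp add: Let_def)
      thus ?thesis using p 5 by (simp add: conj_interval_1 n)
    next
      case 6
      hence n: "n \<le> - 2" unfolding n_def by linarith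
      have ns: "s < - n"
      proof (cases "k = - 4")
        case True
        thus ?thesis using 6 s by (simp add: n_def)
      next
        case False
        hence "n \<le> - 3" using 6 unfolding n_def by linarith
        thus ?thesis using s by simp
      qed
      have "hartogs_exponent s k = (s + 2 * n) / n"
      proof -
        have "s + 2 * (n - 2) = (s + n) + (n - 4)" by simp
        also have "\<dots> < 0 + (- 2 - 4)" using n ns by (intro add_less_le_mono) auto
        finally have "s + 2 * (n - 2) < - 6" by simp
        thus ?thesis unfolding hartogs_exponent_def k by (simp add: Let_def)
      qed
      also have "\<dots> = (- 2 * n - s) / (- n)" using n by (simp add: field_simps)
      finally show ?thesis
        using conj_interval_divide_iff[of "- n" "- 2 * n - s" p] n ns by (auto simp: algebra_simps)
    qed
  qed
  thus ?thesis using R by (simp add: n_def)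
qed

subsection \<open>Powers of the modulus\<close>

lemma nn_integral_disk_measure_shift:
  assumes [measurable]: "f \<in> borel_measurable borel"
  shows "(\<integral>\<^sup>+w. ennreal (cmod w powr y) * f w \<partial>disk_measure a) = (\<integral>\<^sup>+w. f w \<partial>disk_measure (a + y))"
  by (subst (1 2) nn_integral_disk_measure) (auto simp: powr_add ennreal_mult' ac_simps intro!: nn_integral_cong)

lemma disk_measure_density: "disk_measure a = density (disk_measure 0) (\<lambda>w. ennreal (cmod w powr a))"
proof (rule measure_eqI)
  fix A assume "A \<in> sets (disk_measure a)"
  hence [measurable]: "A \<in> sets borel" by simp
  have "emeasure (disk_measure a) A = (\<integral>\<^sup>+w. indicator A w \<partial>disk_measure (0 + a))" by simp
  also have "\<dots> = (\<integral>\<^sup>+w. ennreal (cmod w powr a) * indicator A w \<partial>disk_measure 0)"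
    by (rule nn_integral_disk_measure_shift[symmetric]) measurable
  also have "\<dots> = emeasure (density (disk_measure 0) (\<lambda>w. ennreal (cmod w powr a))) A"
    by (subst emeasure_density) auto
  finally show "emeasure (disk_measure a) A = emeasure (density (disk_measure 0) (\<lambda>w. ennreal (cmod w powr a))) A" .
qed simp

text \<open>Away from the origin every power of the modulus is harmless: its exponent costs only a
  constant.\<close>

lemma powr_le_2_powr_abs:
  assumes "1 / 2 < r" "r < (1 :: real)"
  shows "r powr x \<le> 2 powr \<bar>x\<bar>"
proof (cases "x \<ge> 0")
  case True
  have "r powr x \<le> 1 powr x" using assms True by (intro powr_mono2) auto
  also have "1 powr x \<le> 2 powr \<bar>x\<bar>" using ge_one_powr_ge_zero[of 2 "\<bar>x\<bar>"] by simp
  finally show ?thesis .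
next
  case False
  have "r powr x \<le> (1 / 2) powr x" using assms False by (intro powr_mono2') auto
  also have "\<dots> = 2 powr \<bar>x\<bar>" using False by (simp add: powr_divide powr_minus_divide[symmetric])
  finally show ?thesis .
qed

lemma powr_add3_le:
  assumes "0 \<le> x" "0 \<le> y" "0 \<le> z" "(p::real) > 0"
  shows "(x + y + z) powr p \<le> 3 powr p * (x powr p + y powr p + z powr p)"
proof -
  define M where "M = max x (max y z)"
  have "(x + y + z) powr p \<le> (3 * M) powr p" using assms by (intro powr_mono2) (auto simp: M_def)
  also have "\<dots> = 3 powr p * M powr p" using assms by (simp add: M_def powr_mult)
  also have "M powr p \<le> x powr p + y powr p + z powr p" unfolding M_def by (auto simp: max_def)
  finally show ?thesis by simp
qed

lemma nn_integral_inverse_diverges: "(\<integral>\<^sup>+u. indicator {0<..<1/4} u * ennreal (1 / u) \<partial>lborel) = \<infinity>"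
proof -
  have top: "x = \<infinity>" if "\<And>N. of_nat N \<le> x" for x :: ennreal
  proof (cases x rule: ennreal_cases)
    case (real r)
    have "of_nat (nat \<lceil>r\<rceil> + 1) \<le> x" by (rule that)
    hence "ennreal (real (nat \<lceil>r\<rceil> + 1)) \<le> ennreal r" by (simp only: ennreal_of_nat_eq_real_of_nat real)
    hence "real (nat \<lceil>r\<rceil> + 1) \<le> r" by (simp only: ennreal_le_iff[OF real(1)])
    moreover have "r \<le> real (nat \<lceil>r\<rceil>)" by (rule real_nat_ceiling_ge)
    ultimately show ?thesis by simp
  qed simp
  show ?thesis
  proof (rule top)
    fix N :: nat
    \<comment> \<open>Chosen so that the integral of 1 / u over [d, 1/8] is exactly N; the endpoint
      1/8 keeps the closed interval inside (0, 1/4).\<close>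
    define d where "d = exp (- real N) / 8"
    have d: "0 < d" "d \<le> 1 / 8" by (auto simp: d_def)
    have "((\<lambda>u. 1 / u) has_integral (ln (1 / 8) - ln d)) {d..1/8}"
      using d by (intro fundamental_theorem_of_calculus)
        (auto intro!: derivative_eq_intros simp: has_real_derivative_iff_has_vector_derivative[symmetric])
    hence "(\<integral>\<^sup>+u. ennreal (indicator {d..1/8} u * (1 / u)) \<partial>lborel) = ennreal (ln (1 / 8) - ln d)"
      using d by (intro nn_integral_has_integral_lebesgue) auto
    also have "ln (1 / 8) - ln d = real N" by (simp add: d_def ln_div)
    finally have "of_nat N = (\<integral>\<^sup>+u. ennreal (indicator {d..1/8} u * (1 / u)) \<partial>lborel)"
      by (simp add: ennreal_of_nat_eq_real_of_nat)
    also have "\<dots> \<le> (\<integral>\<^sup>+u. indicator {0<..<1/4} u * ennreal (1 / u) \<partial>lborel)"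
      using d by (intro nn_integral_mono) (auto simp: indicator_def)
    finally show "of_nat N \<le> (\<integral>\<^sup>+u. indicator {0<..<1/4} u * ennreal (1 / u) \<partial>lborel)" .
  qed
qed

lemma norm_less_half_iff: "cmod w < 1 / 2 \<longleftrightarrow> (cmod w)\<^sup>2 < 1 / 4"
proof -
  have "cmod w < 1 / 2 \<longleftrightarrow> (cmod w)\<^sup>2 < (1 / 2)\<^sup>2" by (rule power_mono_iff[symmetric, THEN arg_cong[where f = Not], unfolded not_le]) auto
  thus ?thesis by (simp add: power2_eq_square)
qed

text \<open>In the variable u = |w|^2 the exponent is (a + y) / 2; if it is at most -1, the
  integrand dominates 1 / u on (0, 1/4).\<close>

lemma integrable_power_imp_gt:
  assumes "(\<integral>\<^sup>+w. indicator (ball 0 (1 / 2)) w * ennreal (cmod w powr y) \<partial>disk_measure a) < \<infinity>"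
  shows "y + a > - 2"
proof (rule ccontr)
  assume n: "\<not> y + a > - 2"
  have i: "indicator (ball 0 (1 / 2)) w = (indicator {..<1/4} ((cmod w)\<^sup>2) :: ennreal)" for w :: complex
    unfolding indicator_def mem_ball dist_0_norm norm_less_half_iff by simp
  have "(\<integral>\<^sup>+w. indicator (ball 0 (1 / 2)) w * ennreal (cmod w powr y) \<partial>disk_measure a)
     = (\<integral>\<^sup>+w. ennreal (cmod w powr y) * indicator {..<1/4} ((cmod w)\<^sup>2) \<partial>disk_measure a)"
    by (simp add: i mult.commute)
  also have "\<dots> = (\<integral>\<^sup>+w. indicator {..<1/4} ((cmod w)\<^sup>2) \<partial>disk_measure (a + y))"
    by (rule nn_integral_disk_measure_shift) measurable
  also have "\<dots> = ennreal pi * (\<integral>\<^sup>+u. indicator {0<..<1::real} u * ennreal (u powr ((a + y) / 2)) * indicator {..<1/4} u \<partial>lborel)"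
    by (rule nn_integral_disk_radial) measurable
  also have "\<dots> \<ge> ennreal pi * (\<integral>\<^sup>+u. indicator {0<..<1/4} u * ennreal (1 / u) \<partial>lborel)"
  proof (intro mult_left_mono nn_integral_mono)
    fix u :: real
    show "indicator {0<..<1/4} u * ennreal (1 / u) \<le> indicator {0<..<1::real} u * ennreal (u powr ((a + y) / 2)) * indicator {..<1/4} u"
    proof (cases "0 < u \<and> u < 1 / 4")
      case True
      have "u powr (- 1) \<le> u powr ((a + y) / 2)" using True n by (intro powr_mono') auto
      hence "1 / u \<le> u powr ((a + y) / 2)" using True by (simp add: powr_minus_divide)
      thus ?thesis using True by (simp add: ennreal_leI)
    qed (auto simp: indicator_def)
  qed simp
  finally show False using assms by (simp add: nn_integral_inverse_diverges ennreal_mult_top top_unique)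
qed

subsection \<open>The radial estimate\<close>

context hartogs_weight
begin

text \<open>The weight in the second variable that an L^r mass acquires under
  \<open>lift\<close>.\<close>

definition wt :: "real \<Rightarrow> complex \<Rightarrow> real" where
  "wt r w = cmod (\<gamma> w) powr (2 - r)"

definition far :: "complex set" where
  "far = {w. 1 / 2 < cmod w}"

text \<open>The factor in the second variable: the Bergman projection of the disk with the radial
  weight |w|^a.\<close>

definition radial_op :: "(complex \<Rightarrow> complex) \<Rightarrow> complex \<Rightarrow> complex" where
  "radial_op u z = (\<integral>w. bergman_kernel a z w * u w \<partial>disk_measure a)"

text \<open>The r-th power of the norm of v / g in the space on the disk with weight |g|^2.\<close>

abbreviation disk_mass :: "real \<Rightarrow> (complex \<Rightarrow> complex) \<Rightarrow> ennreal" where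
  "disk_mass r v \<equiv> (\<integral>\<^sup>+w. ennreal (cmod (v w) powr r * cmod (g w) powr (2 - r)) \<partial>disk_measure 0)"

abbreviation radial_mass :: "real \<Rightarrow> (complex \<Rightarrow> complex) \<Rightarrow> ennreal" where
  "radial_mass r u \<equiv> (\<integral>\<^sup>+w. ennreal (cmod (u w) powr r * wt r w) \<partial>disk_measure a)"

abbreviation bidisk_mass :: "real \<Rightarrow> (complex \<times> complex \<Rightarrow> complex) \<Rightarrow> ennreal" where
  "bidisk_mass r G \<equiv> (\<integral>\<^sup>+x. ennreal (cmod (G x) powr r * wt r (snd x)) \<partial>bidisk_measure a)"

lemma measurable_wt [measurable]: "wt r \<in> borel_measurable borel"
  unfolding wt_def by measurable

lemma wt_nonneg [simp]: "0 \<le> wt r w"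
  by (simp add: wt_def)

lemma far_borel [measurable]: "far \<in> sets borel"
  unfolding far_def by measurable

lemma measurable_radial_op [measurable]:
  assumes [measurable]: "u \<in> borel_measurable borel"
  shows "radial_op u \<in> borel_measurable borel"
proof -
  have "(\<lambda>z. \<integral>w. bergman_kernel a z w * u w \<partial>disk_measure a) \<in> borel_measurable (borel :: complex measure)"
    by (rule disk_measure.borel_measurable_lebesgue_integral) measurable
  thus ?thesis by (simp add: radial_op_def[abs_def])
qed

lemma wt_eq: "w \<noteq> 0 \<Longrightarrow> wt r w = cmod w powr (of_int m * (2 - r)) * cmod (g w) powr (2 - r)"
  by (simp add: wt_def norm_\<gamma> powr_mult powr_powr)

lemma g_powr_bounded: "\<exists>B>0. \<forall>w\<in>cball 0 (1 / 2). cmod (g w) powr x \<le> B"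
proof -
  have "continuous_on (cball 0 (1 / 2)) g"
    using holomorphic_on_imp_continuous_on[OF g_holo] by (rule continuous_on_subset) (auto simp: unit_disk_def)
  hence "continuous_on (cball 0 (1 / 2)) (\<lambda>w. cmod (g w) powr x)"
    by (intro continuous_intros) (simp_all add: g_nz)
  hence "bounded ((\<lambda>w. cmod (g w) powr x) ` cball 0 (1 / 2))"
    by (intro compact_imp_bounded compact_continuous_image) auto
  thus ?thesis unfolding bounded_pos by (auto simp: bounded_iff)
qed

text \<open>Near the origin |g|^(2 - r) is bounded and \<open>I\<close> makes the power of |w|
  integrable; away from it the powers are bounded and \<open>gr\<close> controls what is
  left.\<close>

lemma wt_finite:
  assumes I: "- 2 < of_int m * (2 - r) + a"
    and gr: "(\<integral>\<^sup>+w. ennreal (cmod (g w) powr (2 - r)) \<partial>disk_measure 0) < \<infinity>"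
  shows "(\<integral>\<^sup>+w. ennreal (wt r w) \<partial>disk_measure a) < \<infinity>"
proof -
  define y where "y = of_int m * (2 - r)"
  obtain B where B: "B > 0" "\<And>w. w \<in> cball 0 (1 / 2) \<Longrightarrow> cmod (g w) powr (2 - r) \<le> B"
    using g_powr_bounded by blast
  interpret F: finite_measure "disk_measure (a + y)"
    by (rule finite_disk_measure) (use I in \<open>simp add: y_def\<close>)
  let ?c = "2 powr \<bar>y\<bar> * 2 powr \<bar>a\<bar>"
  have "(\<integral>\<^sup>+w. ennreal (wt r w) \<partial>disk_measure a)
     \<le> (\<integral>\<^sup>+w. ennreal B * (ennreal (cmod w powr y) * 1)
         + ennreal (2 powr \<bar>y\<bar>) * (indicator far w * ennreal (cmod (g w) powr (2 - r))) \<partial>disk_measure a)"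
  proof (rule nn_integral_mono_AE)
    show "AE w in disk_measure a. ennreal (wt r w) \<le> ennreal B * (ennreal (cmod w powr y) * 1)
         + ennreal (2 powr \<bar>y\<bar>) * (indicator far w * ennreal (cmod (g w) powr (2 - r)))"
      using AE_disk_measure_punctured
    proof eventually_elim
      fix w :: complex assume w: "cmod w < 1 \<and> w \<noteq> 0"
      show "ennreal (wt r w) \<le> ennreal B * (ennreal (cmod w powr y) * 1)
         + ennreal (2 powr \<bar>y\<bar>) * (indicator far w * ennreal (cmod (g w) powr (2 - r)))"
      proof (cases "w \<in> far")
        case True
        have "wt r w \<le> 2 powr \<bar>y\<bar> * cmod (g w) powr (2 - r)"
          unfolding y_def using w True by (simp add: wt_eq mult_right_mono powr_le_2_powr_abs far_def)
        hence "ennreal (wt r w) \<le> ennreal (2 powr \<bar>y\<bar>) * (indicator far w * ennreal (cmod (g w) powr (2 - r)))"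
          using True by (simp add: ennreal_mult'[symmetric] ennreal_leI)
        thus ?thesis by (rule order_trans) simp
      next
        case False
        have "wt r w \<le> B * cmod w powr y"
          unfolding y_def using w False B(2)[of w] by (simp add: wt_eq far_def mult.commute mult_left_mono)
        hence "ennreal (wt r w) \<le> ennreal B * (ennreal (cmod w powr y) * 1)"
          using B by (simp add: ennreal_mult'[symmetric] ennreal_leI)
        thus ?thesis by (rule order_trans) simp
      qed
    qed
  qed
  also have "\<dots> = ennreal B * (\<integral>\<^sup>+w. ennreal (cmod w powr y) * 1 \<partial>disk_measure a)
      + ennreal (2 powr \<bar>y\<bar>) * (\<integral>\<^sup>+w. indicator far w * ennreal (cmod (g w) powr (2 - r)) \<partial>disk_measure a)"
    by (subst nn_integral_add, measurable, subst (1 2) nn_integral_cmult) auto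
  also have "(\<integral>\<^sup>+w. ennreal (cmod w powr y) * 1 \<partial>disk_measure a) = emeasure (disk_measure (a + y)) UNIV"
    by (subst nn_integral_disk_measure_shift) auto
  also have "(\<integral>\<^sup>+w. indicator far w * ennreal (cmod (g w) powr (2 - r)) \<partial>disk_measure a)
     = (\<integral>\<^sup>+w. ennreal (cmod w powr a) * (indicator far w * ennreal (cmod (g w) powr (2 - r))) \<partial>disk_measure 0)"
    by (subst nn_integral_disk_measure_shift) auto
  also have "\<dots> \<le> (\<integral>\<^sup>+w. ennreal (2 powr \<bar>a\<bar>) * ennreal (cmod (g w) powr (2 - r)) \<partial>disk_measure 0)"
  proof (rule nn_integral_mono_AE)
    show "AE w in disk_measure 0. ennreal (cmod w powr a) * (indicator far w * ennreal (cmod (g w) powr (2 - r)))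
        \<le> ennreal (2 powr \<bar>a\<bar>) * ennreal (cmod (g w) powr (2 - r))"
      using AE_disk_measure_punctured
      by eventually_elim (auto simp: indicator_def far_def powr_le_2_powr_abs intro!: mult_right_mono ennreal_leI)
  qed
  also have "\<dots> = ennreal (2 powr \<bar>a\<bar>) * (\<integral>\<^sup>+w. ennreal (cmod (g w) powr (2 - r)) \<partial>disk_measure 0)"
    by (rule nn_integral_cmult) measurable
  finally have "(\<integral>\<^sup>+w. ennreal (wt r w) \<partial>disk_measure a) \<le> ennreal B * emeasure (disk_measure (a + y)) UNIV
      + ennreal (2 powr \<bar>y\<bar>) * (ennreal (2 powr \<bar>a\<bar>) * (\<integral>\<^sup>+w. ennreal (cmod (g w) powr (2 - r)) \<partial>disk_measure 0))"
    by (simp add: add_left_mono mult_left_mono)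
  also have "\<dots> < \<infinity>"
  proof -
    have "emeasure (disk_measure (a + y)) UNIV < top" by (simp add: less_top[symmetric])
    thus ?thesis using gr by (simp add: ennreal_mult_less_top)
  qed
  finally show ?thesis .
qed

text \<open>If one point has modulus at most 1/2, the kernel is bounded and only the integral of |u|
  is seen. For two far points the numerator 1 - z cnj w contributes a multiple of \<open>v\<close>
  and, with z pulled out of the integral, a multiple of cnj w times \<open>v\<close>;
  \<open>v\<close> contains the density |w|^a, so the unweighted \<open>disk_op\<close>
  appears.\<close>

lemma radial_op_split:
  assumes u: "integrable (disk_measure a) u" and z: "cmod z < 1"
  defines "v \<equiv> \<lambda>w. indicator far w *\<^sub>R ((cmod w powr a) *\<^sub>R u w)"
  shows "cmod (radial_op u z) \<le> 4 * (1 + \<bar>a\<bar>) * (\<integral>w. cmod (u w) \<partial>disk_measure a)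
     + indicator far z * cmod (disk_op v z) + indicator far z * cmod (disk_op (\<lambda>w. cnj w * v w) z)"
proof -
  have um [measurable]: "u \<in> borel_measurable borel" using borel_measurable_integrable[OF u] by simp
  \<comment> \<open>The 4 is the square of 1 / (1 - 1/2), the bound of the absolute kernel when one
    modulus is at most 1/2.\<close>
  define K where "K = 4 * (1 + \<bar>a\<bar>)"
  have K: "cmod (bergman_kernel a z w) \<le> K" if w: "cmod w < 1" and n: "z \<notin> far \<or> w \<notin> far" for w
  proof -
    have ab: "abs_kernel x y \<le> 4" if "x \<notin> far" "cmod y < 1" for x y
    proof -
      have x: "cmod x \<le> 1 / 2" using that by (simp add: far_def)
      have "abs_kernel x y \<le> (1 / (1 - cmod x))\<^sup>2" using x that by (intro abs_kernel_le) auto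
      also have "1 / (1 - cmod x) \<le> 1 / (1 / 2)" using x by (intro divide_left_mono) auto
      hence "(1 / (1 - cmod x))\<^sup>2 \<le> 2\<^sup>2" using x by (intro power_mono) auto
      finally show ?thesis by simp
    qed
    have "cmod (bergman_kernel a z w) \<le> (1 + \<bar>a\<bar>) * abs_kernel z w" by (rule norm_bergman_kernel_le[OF z w])
    also have "\<dots> \<le> (1 + \<bar>a\<bar>) * 4"
      using n ab[of z w] ab[of w z] z w by (intro mult_left_mono) (auto simp: abs_kernel_commute)
    finally show ?thesis by (simp add: K_def mult.commute)
  qed
  have near: "cmod (\<integral>w. bergman_kernel a z w * u' w \<partial>disk_measure a) \<le> K * (\<integral>w. cmod (u w) \<partial>disk_measure a)"
    if u': "integrable (disk_measure a) u'" "\<And>w. cmod (u' w) \<le> cmod (u w)" "\<And>w. z \<in> far \<Longrightarrow> w \<in> far \<Longrightarrow> u' w = 0" for u'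
  proof -
    have "cmod (\<integral>w. bergman_kernel a z w * u' w \<partial>disk_measure a) \<le> (\<integral>w. cmod (bergman_kernel a z w * u' w) \<partial>disk_measure a)"
      by (rule integral_norm_bound)
    also have "\<dots> \<le> (\<integral>w. K * cmod (u w) \<partial>disk_measure a)"
    proof (rule integral_mono_AE)
      show "AE w in disk_measure a. cmod (bergman_kernel a z w * u' w) \<le> K * cmod (u w)"
        using AE_disk_measure_punctured
      proof eventually_elim
        fix w :: complex assume w: "cmod w < 1 \<and> w \<noteq> 0"
        show "cmod (bergman_kernel a z w * u' w) \<le> K * cmod (u w)"
        proof (cases "z \<in> far \<and> w \<in> far")
          case True
          thus ?thesis using u'(3) by (simp add: K_def)
        next
          case False
          thus ?thesis unfolding norm_mult using K[of w] w u'(2)[of w] by (intro mult_mono) (auto simp: K_def)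
        qed
      qed
    qed (use u u' integrable_kernel_mult[OF u'(1) z] in auto)
    finally show ?thesis by simp
  qed
  show ?thesis
  proof (cases "z \<in> far")
    case False
    thus ?thesis using near[of u] u by (simp add: radial_op_def K_def)
  next
    case True
    define u1 u2 where "u1 = (\<lambda>w. indicator far w *\<^sub>R u w)" and "u2 = (\<lambda>w. indicator (- far) w *\<^sub>R u w)"
    have i1: "integrable (disk_measure a) u1" unfolding u1_def
      by (rule Bochner_Integration.integrable_bound[OF u]) (auto simp: indicator_def)
    have i2: "integrable (disk_measure a) u2" unfolding u2_def
      by (rule Bochner_Integration.integrable_bound[OF u]) (auto simp: indicator_def)
    have "radial_op u z = (\<integral>w. bergman_kernel a z w * u1 w + bergman_kernel a z w * u2 w \<partial>disk_measure a)"
      unfolding radial_op_def by (intro Bochner_Integration.integral_cong refl) (auto simp: u1_def u2_def indicator_def)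
    also have "\<dots> = (\<integral>w. bergman_kernel a z w * u1 w \<partial>disk_measure a) + (\<integral>w. bergman_kernel a z w * u2 w \<partial>disk_measure a)"
      by (rule Bochner_Integration.integral_add[OF integrable_kernel_mult[OF i1 z] integrable_kernel_mult[OF i2 z]])
    finally have eq: "radial_op u z = (\<integral>w. bergman_kernel a z w * u1 w \<partial>disk_measure a) + (\<integral>w. bergman_kernel a z w * u2 w \<partial>disk_measure a)" .
    have n2: "cmod (\<integral>w. bergman_kernel a z w * u2 w \<partial>disk_measure a) \<le> K * (\<integral>w. cmod (u w) \<partial>disk_measure a)"
      by (rule near[OF i2]) (auto simp: u2_def indicator_def)
    have vi: "integrable (disk_measure 0) v"
    proof -
      have "integrable (disk_measure 0) (\<lambda>w. (cmod w powr a) *\<^sub>R u1 w)"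
        using i1 unfolding disk_measure_density[of a] u1_def by (subst (asm) integrable_density) auto
      thus ?thesis by (simp add: v_def u1_def mult.commute)
    qed
    have vi': "integrable (disk_measure 0) (\<lambda>w. cnj w * v w)"
    proof (rule Bochner_Integration.integrable_bound[OF vi])
      show "AE w in disk_measure 0. norm (cnj w * v w) \<le> norm (v w)"
        using AE_disk_measure_punctured by eventually_elim (auto simp: norm_mult intro!: mult_left_le_one_le)
    qed (use borel_measurable_integrable[OF vi] in measurable)
    have "(\<integral>w. bergman_kernel a z w * u1 w \<partial>disk_measure a) = (\<integral>w. (cmod w powr a) *\<^sub>R (bergman_kernel a z w * u1 w) \<partial>disk_measure 0)"
      unfolding disk_measure_density[of a] u1_def by (rule integral_density) auto
    also have "\<dots> = (\<integral>w. of_real (1 + a / 2) * (bergman_kernel 0 z w * v w)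
         - of_real (a / 2) * z * (bergman_kernel 0 z w * (cnj w * v w)) \<partial>disk_measure 0)"
    proof (rule integral_cong_AE)
      show "AE w in disk_measure 0. (cmod w powr a) *\<^sub>R (bergman_kernel a z w * u1 w)
         = of_real (1 + a / 2) * (bergman_kernel 0 z w * v w) - of_real (a / 2) * z * (bergman_kernel 0 z w * (cnj w * v w))"
        using AE_disk_measure_punctured
      proof eventually_elim
        fix w :: complex assume w: "cmod w < 1 \<and> w \<noteq> 0"
        have ne: "1 - z * cnj w \<noteq> 0" using one_minus_mult_cnj_neq_0[of z w] z w by auto
        define Y where "Y = 1 / (1 - z * cnj w)"
        have Y: "Y = (1 - z * cnj w) * Y\<^sup>2" using ne by (simp add: Y_def power2_eq_square)
        have "bergman_kernel a z w = (Y\<^sup>2 + of_real (a / 2) * ((1 - z * cnj w) * Y\<^sup>2)) / of_real pi"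
          unfolding bergman_kernel_def Y_def[symmetric] using Y by simp
        also have "\<dots> = of_real (1 + a / 2) * (Y\<^sup>2 / of_real pi) - of_real (a / 2) * z * cnj w * (Y\<^sup>2 / of_real pi)"
          by (simp add: add_divide_distrib diff_divide_distrib ring_distribs)
        also have "Y\<^sup>2 / of_real pi = bergman_kernel 0 z w" by (simp add: bergman_kernel_def Y_def)
        finally have k: "bergman_kernel a z w = of_real (1 + a / 2) * bergman_kernel 0 z w - of_real (a / 2) * z * cnj w * bergman_kernel 0 z w" .
        have "(cmod w powr a) *\<^sub>R (bergman_kernel a z w * u1 w) = bergman_kernel a z w * v w"
          by (simp add: u1_def v_def scaleR_conv_of_real)
        thus "(cmod w powr a) *\<^sub>R (bergman_kernel a z w * u1 w)
         = of_real (1 + a / 2) * (bergman_kernel 0 z w * v w) - of_real (a / 2) * z * (bergman_kernel 0 z w * (cnj w * v w))"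
          unfolding k by (simp add: algebra_simps)
      qed
    qed (use borel_measurable_integrable[OF vi] in \<open>auto simp: u1_def\<close>)
    also have "\<dots> = of_real (1 + a / 2) * disk_op v z - of_real (a / 2) * z * disk_op (\<lambda>w. cnj w * v w) z"
      unfolding disk_op_def using integrable_kernel_mult[OF vi z, of 0] integrable_kernel_mult[OF vi' z, of 0]
      by (subst Bochner_Integration.integral_diff) auto
    finally have "cmod (\<integral>w. bergman_kernel a z w * u1 w \<partial>disk_measure a)
       \<le> cmod (of_real (1 + a / 2) * disk_op v z) + cmod (of_real (a / 2) * z * disk_op (\<lambda>w. cnj w * v w) z)"
      by (simp only: norm_triangle_ineq4)
    also have "\<dots> \<le> 1 * cmod (disk_op v z) + 1 * cmod (disk_op (\<lambda>w. cnj w * v w) z)"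
      \<comment> \<open>For -2 < a \<le> 0 both 1 + a / 2 and a / 2 have modulus at most 1.\<close>
      unfolding norm_mult norm_of_real using a z by (intro add_mono mult_right_mono mult_le_one) auto
    finally have "cmod (\<integral>w. bergman_kernel a z w * u1 w \<partial>disk_measure a)
       \<le> cmod (disk_op v z) + cmod (disk_op (\<lambda>w. cnj w * v w) z)" by simp
    thus ?thesis
      using n2 norm_triangle_ineq[of "\<integral>w. bergman_kernel a z w * u1 w \<partial>disk_measure a" "\<integral>w. bergman_kernel a z w * u2 w \<partial>disk_measure a"] True
      unfolding eq by (simp add: K_def)
  qed
qed

end

section \<open>Weighted Lp bounds in the second variable and on the bidisk\<close>

context hartogs_weight
begin

text \<open>The three terms of \<open>radial_op_split\<close> are estimated separately. The first is
  constant in z, so its norm is the integral of |u| times the mass of \<open>wt p\<close>, and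
  Hoelder bounds that integral through the mass of \<open>wt q\<close>. The other two live on
  \<open>far\<close>, where the powers of |w| are bounded above and below and the hypothesis
  \<open>disk\<close> applies.\<close>

lemma radial_op_Lp:
  assumes p: "p > 1" and q: "q = p / (p - 1)"
    and Wp: "(\<integral>\<^sup>+w. ennreal (wt p w) \<partial>disk_measure a) < \<infinity>"
    and Wq: "(\<integral>\<^sup>+w. ennreal (wt q w) \<partial>disk_measure a) < \<infinity>"
    and disk: "\<And>v. v \<in> borel_measurable borel \<Longrightarrow> sq_mass (disk_measure 0) v < \<infinity> \<Longrightarrow>
       disk_mass p v < \<infinity> \<Longrightarrow>
       disk_mass p (disk_op v)
         \<le> ennreal C * disk_mass p v"
  shows "\<exists>D\<ge>0. \<forall>u. u \<in> borel_measurable borel \<longrightarrow> sq_mass (disk_measure a) u < \<infinity> \<longrightarrow>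
       radial_mass p u < \<infinity> \<longrightarrow>
       radial_mass p (radial_op u)
         \<le> ennreal D * radial_mass p u"
proof -
  have q1: "q > 1" "1 / p + 1 / q = 1" using p by (auto simp: q field_simps)
  \<comment> \<open>The added 1 makes \<open>B\<close> positive, as Hoelder's inequality
    requires.\<close>
  define W B where "W = enn2real (\<integral>\<^sup>+w. ennreal (wt p w) \<partial>disk_measure a)"
    and "B = enn2real (\<integral>\<^sup>+w. ennreal (wt q w) \<partial>disk_measure a) + 1"
  have W: "W \<ge> 0" "(\<integral>\<^sup>+w. ennreal (wt p w) \<partial>disk_measure a) = ennreal W"
    using Wp by (auto simp: W_def)
  have B: "B > 0" "(\<integral>\<^sup>+w. ennreal (wt q w) \<partial>disk_measure a) \<le> ennreal B"
    using Wq by (auto simp: B_def ennreal_enn2real_if intro: add_nonneg_pos)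
  define C' where "C' = max C 0"
  define K where "K = 4 * (1 + \<bar>a\<bar>)"
  define y where "y = of_int m * (2 - p)"
  \<comment> \<open>On \<open>far\<close>, B1 bounds the powers by which |w|^a \<open>wt p\<close>
    differs from |g|^(2 - p), needed after applying \<open>disk_op\<close>. B2 serves the opposite
    passage, for the input \<open>v\<close>, whose p-th power carries |w|^(a p).\<close>
  define B1 where "B1 = 2 powr \<bar>a\<bar> * 2 powr \<bar>y\<bar>"
  define B2 where "B2 = 2 powr \<bar>a * p - y - a\<bar>"
  have nn: "K \<ge> 0" "B1 \<ge> 0" "B2 \<ge> 0" "C' \<ge> 0" by (auto simp: K_def B1_def B2_def C'_def)
  \<comment> \<open>The factor 3^p comes from the p-th power of a sum of three terms, the 2 from the
    two terms with \<open>disk_op\<close>.\<close>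
  define D where "D = 3 powr p * (K powr p * B powr (p - 1) * W + 2 * (B1 * C' * B2))"
  have D: "D \<ge> 0" using nn W B by (simp add: D_def)
  let ?S = "\<lambda>v. disk_mass p v"
  show ?thesis
  proof (intro exI[of _ D] conjI D allI impI)
    fix u :: "complex \<Rightarrow> complex"
    assume um [measurable]: "u \<in> borel_measurable borel"
      and u2: "sq_mass (disk_measure a) u < \<infinity>"
      and up: "radial_mass p u < \<infinity>"
    let ?N = "radial_mass p u"
    have ui: "integrable (disk_measure a) u"
      using square_integrable_imp_integrable[OF finite_disk_measure[OF a(1)] _ u2] by simp
    define I where "I = (\<integral>w. cmod (u w) \<partial>disk_measure a)"
    have I0: "I \<ge> 0" by (simp add: I_def)
    have I: "ennreal (I powr p) \<le> ennreal (B powr (p - 1)) * ?N"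
    proof -
      have "ennreal I = (\<integral>\<^sup>+w. ennreal (cmod (u w)) \<partial>disk_measure a)"
        unfolding I_def using ui by (intro nn_integral_eq_integral[symmetric]) auto
      also have "\<dots> = (\<integral>\<^sup>+w. ennreal (cmod (u w) * wt p w powr (1 / p) * wt p w powr (- (1 / p))) \<partial>disk_measure a)"
      proof (rule nn_integral_cong_AE)
        show "AE w in disk_measure a. ennreal (cmod (u w)) = ennreal (cmod (u w) * wt p w powr (1 / p) * wt p w powr (- (1 / p)))"
          using AE_disk_measure_punctured
        proof eventually_elim
          fix w :: complex assume "cmod w < 1 \<and> w \<noteq> 0"
          hence "wt p w > 0" using \<gamma>_nz[of w] by (simp add: wt_def)
          thus "ennreal (cmod (u w)) = ennreal (cmod (u w) * wt p w powr (1 / p) * wt p w powr (- (1 / p)))"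
            by (simp add: powr_minus mult.assoc)
        qed
      qed
      finally have "ennreal (I powr p) = epow p (\<integral>\<^sup>+w. ennreal (cmod (u w) * wt p w powr (1 / p) * wt p w powr (- (1 / p))) \<partial>disk_measure a)"
        using I0 by (metis epow_ennreal)
      also have "\<dots> \<le> (\<integral>\<^sup>+w. ennreal ((cmod (u w) * wt p w powr (1 / p)) powr p) \<partial>disk_measure a) * ennreal (B powr (p - 1))"
      proof (rule nn_integral_Hoelder[OF p q1])
        \<comment> \<open>The dual weight of \<open>wt p\<close> is \<open>wt q\<close>: both
          exponents equal (p - 2) / (p - 1).\<close>
        have "(2 - p) * (- (1 / p)) * q = 2 - q" using p by (simp add: q field_simps)
        hence "(wt p w powr (- (1 / p))) powr q = wt q w" for w
          by (simp only: wt_def powr_powr)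
        thus "(\<integral>\<^sup>+w. ennreal ((wt p w powr (- (1 / p))) powr q) \<partial>disk_measure a) \<le> ennreal B"
          using B by simp
      qed (use B in auto)
      also have "(\<lambda>w. (cmod (u w) * wt p w powr (1 / p)) powr p) = (\<lambda>w. cmod (u w) powr p * wt p w)"
        using p by (simp add: powr_mult powr_powr)
      finally show ?thesis by (simp add: mult.commute)
    qed
    define v where "v = (\<lambda>w. indicator far w *\<^sub>R ((cmod w powr a) *\<^sub>R u w))"
    define v' where "v' = (\<lambda>w. cnj w * v w)"
    have vm [measurable]: "v \<in> borel_measurable borel" unfolding v_def by measurable
    have vm' [measurable]: "v' \<in> borel_measurable borel" unfolding v'_def by measurable
    have v'le: "AE w in disk_measure 0. cmod (v' w) \<le> cmod (v w)"
      using AE_disk_measure_punctured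
      by eventually_elim (auto simp: v'_def norm_mult intro!: mult_left_le_one_le)
    have v2: "sq_mass (disk_measure 0) v < \<infinity>"
    proof -
      have "sq_mass (disk_measure 0) v
         \<le> (\<integral>\<^sup>+w. ennreal (2 powr \<bar>a\<bar>) * (ennreal (cmod w powr a) * ennreal ((cmod (u w))\<^sup>2)) \<partial>disk_measure 0)"
      proof (rule nn_integral_mono_AE)
        show "AE w in disk_measure 0. ennreal ((cmod (v w))\<^sup>2) \<le> ennreal (2 powr \<bar>a\<bar>) * (ennreal (cmod w powr a) * ennreal ((cmod (u w))\<^sup>2))"
          using AE_disk_measure_punctured
        proof eventually_elim
          fix w :: complex assume w: "cmod w < 1 \<and> w \<noteq> 0"
          have "(cmod (v w))\<^sup>2 \<le> 2 powr \<bar>a\<bar> * (cmod w powr a * (cmod (u w))\<^sup>2)"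
          proof (cases "w \<in> far")
            case True
            hence "(cmod (v w))\<^sup>2 = cmod w powr a * (cmod w powr a * (cmod (u w))\<^sup>2)"
              by (simp add: v_def power_mult_distrib power2_eq_square)
            also have "\<dots> \<le> 2 powr \<bar>a\<bar> * (cmod w powr a * (cmod (u w))\<^sup>2)"
              using True w by (intro mult_right_mono powr_le_2_powr_abs) (auto simp: far_def)
            finally show ?thesis .
          qed (simp add: v_def)
          thus "ennreal ((cmod (v w))\<^sup>2) \<le> ennreal (2 powr \<bar>a\<bar>) * (ennreal (cmod w powr a) * ennreal ((cmod (u w))\<^sup>2))"
            by (simp add: ennreal_mult'[symmetric] ennreal_leI)
        qed
      qed
      also have "\<dots> = ennreal (2 powr \<bar>a\<bar>) * sq_mass (disk_measure a) u"
        by (subst nn_integral_cmult, measurable, subst nn_integral_disk_measure_shift) auto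
      also have "\<dots> < \<infinity>" using u2 by (simp add: ennreal_mult_less_top)
      finally show ?thesis .
    qed
    have v'2: "sq_mass (disk_measure 0) v' < \<infinity>"
    proof (rule le_less_trans[OF _ v2], rule nn_integral_mono_AE)
      show "AE w in disk_measure 0. ennreal ((cmod (v' w))\<^sup>2) \<le> ennreal ((cmod (v w))\<^sup>2)"
        using v'le by eventually_elim (auto intro!: ennreal_leI power_mono)
    qed
    have Sv: "?S v \<le> ennreal B2 * ?N"
    proof -
      have "?S v \<le> (\<integral>\<^sup>+w. ennreal B2 * (ennreal (cmod w powr a) * ennreal (cmod (u w) powr p * wt p w)) \<partial>disk_measure 0)"
      proof (rule nn_integral_mono_AE)
        show "AE w in disk_measure 0. ennreal (cmod (v w) powr p * cmod (g w) powr (2 - p))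
           \<le> ennreal B2 * (ennreal (cmod w powr a) * ennreal (cmod (u w) powr p * wt p w))"
          using AE_disk_measure_punctured
        proof eventually_elim
          fix w :: complex assume w: "cmod w < 1 \<and> w \<noteq> 0"
          have "cmod (v w) powr p * cmod (g w) powr (2 - p) \<le> B2 * (cmod w powr a * (cmod (u w) powr p * wt p w))"
          proof (cases "w \<in> far")
            case True
            have "cmod w powr (a * p) = cmod w powr (a * p - y - a) * (cmod w powr a * cmod w powr y)"
              using w by (simp add: powr_add[symmetric])
            hence "cmod (v w) powr p * cmod (g w) powr (2 - p)
               = cmod w powr (a * p - y - a) * (cmod w powr a * (cmod (u w) powr p * wt p w))"
              using w True by (simp add: v_def wt_eq y_def[symmetric] powr_mult powr_powr)
            also have "\<dots> \<le> B2 * (cmod w powr a * (cmod (u w) powr p * wt p w))"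
              unfolding B2_def using True w by (intro mult_right_mono powr_le_2_powr_abs) (auto simp: far_def)
            finally show ?thesis .
          qed (use nn in \<open>simp add: v_def\<close>)
          thus "ennreal (cmod (v w) powr p * cmod (g w) powr (2 - p))
             \<le> ennreal B2 * (ennreal (cmod w powr a) * ennreal (cmod (u w) powr p * wt p w))"
            using nn by (simp add: ennreal_mult'[symmetric] ennreal_leI)
        qed
      qed
      also have "\<dots> = ennreal B2 * ?N"
        by (subst nn_integral_cmult, measurable, subst nn_integral_disk_measure_shift) auto
      finally show ?thesis .
    qed
    have Sv': "?S v' \<le> ennreal B2 * ?N"
    proof (rule order_trans[OF _ Sv], rule nn_integral_mono_AE)
      show "AE w in disk_measure 0. ennreal (cmod (v' w) powr p * cmod (g w) powr (2 - p)) \<le> ennreal (cmod (v w) powr p * cmod (g w) powr (2 - p))"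
        using v'le by eventually_elim (use p in \<open>auto intro!: ennreal_leI mult_right_mono powr_mono2\<close>)
    qed
    have fin: "ennreal B2 * ?N < \<infinity>" using up by (simp add: ennreal_mult_less_top)
    have T: "(\<integral>\<^sup>+w. indicator far w * ennreal (cmod (disk_op h w) powr p * wt p w) \<partial>disk_measure a) \<le> ennreal (B1 * C' * B2) * ?N"
      if hm [measurable]: "h \<in> borel_measurable borel" and h2: "sq_mass (disk_measure 0) h < \<infinity>"
        and Sh: "?S h \<le> ennreal B2 * ?N" for h
    proof -
      have "(\<integral>\<^sup>+w. indicator far w * ennreal (cmod (disk_op h w) powr p * wt p w) \<partial>disk_measure a)
        = (\<integral>\<^sup>+w. ennreal (cmod w powr a) * (indicator far w * ennreal (cmod (disk_op h w) powr p * wt p w)) \<partial>disk_measure 0)"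
        by (subst nn_integral_disk_measure_shift) auto
      also have "\<dots> \<le> (\<integral>\<^sup>+w. ennreal B1 * ennreal (cmod (disk_op h w) powr p * cmod (g w) powr (2 - p)) \<partial>disk_measure 0)"
      proof (rule nn_integral_mono_AE)
        show "AE w in disk_measure 0. ennreal (cmod w powr a) * (indicator far w * ennreal (cmod (disk_op h w) powr p * wt p w))
            \<le> ennreal B1 * ennreal (cmod (disk_op h w) powr p * cmod (g w) powr (2 - p))"
          using AE_disk_measure_punctured
        proof eventually_elim
          fix w :: complex assume w: "cmod w < 1 \<and> w \<noteq> 0"
          show "ennreal (cmod w powr a) * (indicator far w * ennreal (cmod (disk_op h w) powr p * wt p w))
            \<le> ennreal B1 * ennreal (cmod (disk_op h w) powr p * cmod (g w) powr (2 - p))"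
          proof (cases "w \<in> far")
            case True
            hence f: "1 / 2 < cmod w" "cmod w < 1" using w by (auto simp: far_def)
            have "cmod w powr a * cmod w powr y \<le> B1"
              unfolding B1_def using f by (intro mult_mono powr_le_2_powr_abs) auto
            hence "cmod w powr a * cmod w powr y * (cmod (disk_op h w) powr p * cmod (g w) powr (2 - p))
               \<le> B1 * (cmod (disk_op h w) powr p * cmod (g w) powr (2 - p))"
              by (rule mult_right_mono) simp
            hence "cmod w powr a * (cmod (disk_op h w) powr p * wt p w) \<le> B1 * (cmod (disk_op h w) powr p * cmod (g w) powr (2 - p))"
              using w by (simp add: wt_eq y_def[symmetric] ac_simps)
            thus ?thesis using True nn by (simp add: ennreal_mult'[symmetric] ennreal_leI)
          qed simp
        qed
      qed
      also have "\<dots> = ennreal B1 * ?S (disk_op h)" by (rule nn_integral_cmult) measurable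
      also have "?S (disk_op h) \<le> ennreal C * ?S h"
        by (rule disk[OF hm h2]) (use Sh fin in \<open>auto intro: le_less_trans\<close>)
      also have "\<dots> \<le> ennreal C' * (ennreal B2 * ?N)"
        by (intro mult_mono Sh ennreal_leI) (auto simp: C'_def)
      finally show ?thesis using nn by (simp add: ennreal_mult' mult.assoc mult_left_mono)
    qed
    have "radial_mass p (radial_op u)
       \<le> (\<integral>\<^sup>+w. ennreal (3 powr p) * (ennreal (K powr p * I powr p) * ennreal (wt p w)
           + (indicator far w * ennreal (cmod (disk_op v w) powr p * wt p w) + indicator far w * ennreal (cmod (disk_op v' w) powr p * wt p w))) \<partial>disk_measure a)"
    proof (rule nn_integral_mono_AE)
      show "AE w in disk_measure a. ennreal (cmod (radial_op u w) powr p * wt p w)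
         \<le> ennreal (3 powr p) * (ennreal (K powr p * I powr p) * ennreal (wt p w)
           + (indicator far w * ennreal (cmod (disk_op v w) powr p * wt p w) + indicator far w * ennreal (cmod (disk_op v' w) powr p * wt p w)))"
        using AE_disk_measure_punctured
      proof eventually_elim
        fix w :: complex assume w: "cmod w < 1 \<and> w \<noteq> 0"
        let ?i = "indicator far w :: real"
        have "cmod (radial_op u w) \<le> K * I + ?i * cmod (disk_op v w) + ?i * cmod (disk_op v' w)"
          using radial_op_split[OF ui, of w] w unfolding K_def I_def v_def v'_def by simp
        hence "cmod (radial_op u w) powr p \<le> (K * I + ?i * cmod (disk_op v w) + ?i * cmod (disk_op v' w)) powr p"
          using p by (intro powr_mono2) auto
        also have "\<dots> \<le> 3 powr p * ((K * I) powr p + (?i * cmod (disk_op v w)) powr p + (?i * cmod (disk_op v' w)) powr p)"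
          using p nn I0 by (intro powr_add3_le) auto
        also have "\<dots> = 3 powr p * (K powr p * I powr p + (?i * cmod (disk_op v w) powr p + ?i * cmod (disk_op v' w) powr p))"
          using p nn I0 by (auto simp: powr_mult indicator_def)
        finally have "cmod (radial_op u w) powr p * wt p w
           \<le> 3 powr p * (K powr p * I powr p + (?i * cmod (disk_op v w) powr p + ?i * cmod (disk_op v' w) powr p)) * wt p w"
          by (rule mult_right_mono) simp
        hence "ennreal (cmod (radial_op u w) powr p * wt p w)
           \<le> ennreal (3 powr p * (K powr p * I powr p * wt p w + (?i * (cmod (disk_op v w) powr p * wt p w) + ?i * (cmod (disk_op v' w) powr p * wt p w))))"
          by (intro ennreal_leI) (simp add: algebra_simps)
        also have "\<dots> = ennreal (3 powr p) * (ennreal (K powr p * I powr p) * ennreal (wt p w)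
           + (indicator far w * ennreal (cmod (disk_op v w) powr p * wt p w) + indicator far w * ennreal (cmod (disk_op v' w) powr p * wt p w)))"
          by (cases "w \<in> far") (simp_all add: ennreal_mult' ennreal_plus)
        finally show "ennreal (cmod (radial_op u w) powr p * wt p w)
         \<le> ennreal (3 powr p) * (ennreal (K powr p * I powr p) * ennreal (wt p w)
           + (indicator far w * ennreal (cmod (disk_op v w) powr p * wt p w) + indicator far w * ennreal (cmod (disk_op v' w) powr p * wt p w)))" .
      qed
    qed
    also have "\<dots> = ennreal (3 powr p) * (ennreal (K powr p * I powr p) * (\<integral>\<^sup>+w. ennreal (wt p w) \<partial>disk_measure a)
           + ((\<integral>\<^sup>+w. indicator far w * ennreal (cmod (disk_op v w) powr p * wt p w) \<partial>disk_measure a)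
             + (\<integral>\<^sup>+w. indicator far w * ennreal (cmod (disk_op v' w) powr p * wt p w) \<partial>disk_measure a)))"
      by (subst nn_integral_cmult, measurable, subst nn_integral_add, measurable, subst nn_integral_cmult, measurable,
          subst nn_integral_add, measurable)
    also have "\<dots> \<le> ennreal (3 powr p) * (ennreal (K powr p * B powr (p - 1) * W) * ?N
        + (ennreal (B1 * C' * B2) * ?N + ennreal (B1 * C' * B2) * ?N))"
    proof (intro mult_left_mono add_mono T)
      have "ennreal (K powr p * I powr p) * (\<integral>\<^sup>+w. ennreal (wt p w) \<partial>disk_measure a) = ennreal (K powr p) * ennreal W * ennreal (I powr p)"
        unfolding W(2) by (simp add: ennreal_mult' ac_simps)
      also have "\<dots> \<le> ennreal (K powr p) * ennreal W * (ennreal (B powr (p - 1)) * ?N)"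
        by (rule mult_left_mono[OF I]) simp
      also have "\<dots> = ennreal (K powr p * B powr (p - 1) * W) * ?N"
        using W by (simp add: ennreal_mult' ac_simps)
      finally show "ennreal (K powr p * I powr p) * (\<integral>\<^sup>+w. ennreal (wt p w) \<partial>disk_measure a) \<le> ennreal (K powr p * B powr (p - 1) * W) * ?N" .
    qed (use v2 v'2 Sv Sv' in auto)
    also have "\<dots> = ennreal D * ?N"
    proof -
      have e: "ennreal D = ennreal (3 powr p) * (ennreal (K powr p * B powr (p - 1) * W) + (ennreal (B1 * C' * B2) + ennreal (B1 * C' * B2)))"
        unfolding D_def using nn W B by (simp add: ennreal_mult'[symmetric] ennreal_plus[symmetric] del: ennreal_plus)
      show ?thesis unfolding e by (simp add: distrib_right distrib_left mult.assoc)
    qed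
    finally show "radial_mass p (radial_op u) \<le> ennreal D * ?N" .
  qed
qed

text \<open>The operator is iterated. In the first variable the weight is a constant factor, so the
  unweighted bound applies for each w; the result \<open>H\<close> is then fed into the bound for
  \<open>radial_op\<close> for almost every \<zeta>.\<close>

lemma bidisk_op_Lp:
  assumes p: "p > 1" and D: "\<And>u. u \<in> borel_measurable borel \<Longrightarrow> sq_mass (disk_measure a) u < \<infinity> \<Longrightarrow>
       radial_mass p u < \<infinity> \<Longrightarrow>
       radial_mass p (radial_op u)
         \<le> ennreal D * radial_mass p u"
    and D0: "D \<ge> 0"
  shows "\<exists>C. \<forall>G. G \<in> borel_measurable borel \<longrightarrow> sq_mass (bidisk_measure a) G < \<infinity> \<longrightarrow>
       bidisk_mass p G < \<infinity> \<longrightarrow>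
       bidisk_mass p (bidisk_op a G)
         \<le> ennreal C * bidisk_mass p G"
proof -
  have ex: "\<exists>C\<ge>0. \<forall>v. v \<in> borel_measurable borel \<longrightarrow>
     (\<integral>\<^sup>+z. ennreal (cmod (disk_op v z) powr r) \<partial>disk_measure 0) \<le> ennreal C * (\<integral>\<^sup>+w. ennreal (cmod (v w) powr r) \<partial>disk_measure 0)"
    if r: "r > 1" for r
  proof -
    obtain C where C: "C > 0" "\<And>f::complex \<Rightarrow> ennreal. f \<in> borel_measurable borel \<Longrightarrow>
     (\<integral>\<^sup>+z. epow r (\<integral>\<^sup>+w. ennreal (cmod (bergman_kernel 0 z w)) * f w \<partial>disk_measure 0) \<partial>disk_measure 0)
       \<le> ennreal C * (\<integral>\<^sup>+w. epow r (f w) \<partial>disk_measure 0)"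
      using kernel_Lp_bound[OF r, of 0] by auto
    show ?thesis
    proof (intro exI[of _ C] conjI allI impI)
      fix v :: "complex \<Rightarrow> complex" assume [measurable]: "v \<in> borel_measurable borel"
      have "(\<integral>\<^sup>+z. ennreal (cmod (disk_op v z) powr r) \<partial>disk_measure 0)
        \<le> (\<integral>\<^sup>+z. epow r (\<integral>\<^sup>+w. ennreal (cmod (bergman_kernel 0 z w)) * ennreal (cmod (v w)) \<partial>disk_measure 0) \<partial>disk_measure 0)"
      proof (rule nn_integral_mono)
        fix z
        show "ennreal (cmod (disk_op v z) powr r) \<le> epow r (\<integral>\<^sup>+w. ennreal (cmod (bergman_kernel 0 z w)) * ennreal (cmod (v w)) \<partial>disk_measure 0)"
          using powr_norm_integral_le_epow[of r "disk_measure 0" "\<lambda>w. bergman_kernel 0 z w * v w"] r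
          by (simp add: disk_op_def norm_mult ennreal_mult')
      qed
      also have "\<dots> \<le> ennreal C * (\<integral>\<^sup>+w. epow r (ennreal (cmod (v w))) \<partial>disk_measure 0)"
        by (rule C(2)) measurable
      finally show "(\<integral>\<^sup>+z. ennreal (cmod (disk_op v z) powr r) \<partial>disk_measure 0) \<le> ennreal C * (\<integral>\<^sup>+w. ennreal (cmod (v w) powr r) \<partial>disk_measure 0)"
        by (simp add: epow_ennreal)
    qed (use C in simp)
  qed
  obtain C2 where C2: "C2 \<ge> 0" "\<And>v. v \<in> borel_measurable borel \<Longrightarrow>
     (\<integral>\<^sup>+z. ennreal (cmod (disk_op v z) powr 2) \<partial>disk_measure 0) \<le> ennreal C2 * (\<integral>\<^sup>+w. ennreal (cmod (v w) powr 2) \<partial>disk_measure 0)"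
    using ex[of 2] by auto
  obtain Cp where Cp: "Cp \<ge> 0" "\<And>v. v \<in> borel_measurable borel \<Longrightarrow>
     (\<integral>\<^sup>+z. ennreal (cmod (disk_op v z) powr p) \<partial>disk_measure 0) \<le> ennreal Cp * (\<integral>\<^sup>+w. ennreal (cmod (v w) powr p) \<partial>disk_measure 0)"
    using ex[OF p] by auto
  show ?thesis
  proof (intro exI[of _ "D * Cp"] allI impI)
    fix G :: "complex \<times> complex \<Rightarrow> complex"
    assume Gm [measurable]: "G \<in> borel_measurable borel"
      and G2: "sq_mass (bidisk_measure a) G < \<infinity>"
      and Gp: "bidisk_mass p G < \<infinity>"
    have Gint: "integrable (bidisk_measure a) G"
      using square_integrable_imp_integrable[OF finite_bidisk_measure[OF a(1)] _ G2] by simp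
    define H where "H \<zeta> w = disk_op (\<lambda>\<omega>. G (\<omega>, w)) \<zeta>" for \<zeta> w
    have Hm0: "(\<lambda>x. H (fst x) (snd x)) \<in> borel_measurable (borel :: (complex \<times> complex) measure)"
      unfolding H_def disk_op_def by measurable
    have Hm [measurable]: "(\<lambda>x. H (f x) (h x)) \<in> borel_measurable M"
      if "f \<in> borel_measurable M" "h \<in> borel_measurable M" for f h and M :: "'z measure"
      using measurable_compose[OF borel_measurable_Pair[OF that] Hm0] by simp
    have wts: "(\<integral>\<^sup>+\<zeta>. ennreal (cmod (F \<zeta>) powr p * wt p w) \<partial>disk_measure 0) = ennreal (wt p w) * (\<integral>\<^sup>+\<zeta>. ennreal (cmod (F \<zeta>) powr p) \<partial>disk_measure 0)"
      if [measurable]: "F \<in> borel_measurable borel" for F w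
      by (subst nn_integral_cmult[symmetric]) (auto simp: ennreal_mult' mult.commute)
    \<comment> \<open>The bound \<open>D\<close> asks for finite square mass as well as finite
      weighted mass of its argument; \<open>H2\<close> and \<open>Hp\<close> provide both for almost
      every slice of \<open>H\<close>.\<close>
    have H2: "(\<integral>\<^sup>+\<zeta>. \<integral>\<^sup>+w. ennreal ((cmod (H \<zeta> w))\<^sup>2) \<partial>disk_measure a \<partial>disk_measure 0) \<noteq> \<infinity>"
    proof -
      have "(\<integral>\<^sup>+\<zeta>. \<integral>\<^sup>+w. ennreal ((cmod (H \<zeta> w))\<^sup>2) \<partial>disk_measure a \<partial>disk_measure 0)
         = (\<integral>\<^sup>+w. \<integral>\<^sup>+\<zeta>. ennreal ((cmod (H \<zeta> w))\<^sup>2) \<partial>disk_measure 0 \<partial>disk_measure a)"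
        by (rule disk_disk.Fubini') measurable
      also have "\<dots> \<le> (\<integral>\<^sup>+w. ennreal C2 * (\<integral>\<^sup>+\<zeta>. ennreal ((cmod (G (\<zeta>, w)))\<^sup>2) \<partial>disk_measure 0) \<partial>disk_measure a)"
      proof (rule nn_integral_mono)
        fix w
        show "(\<integral>\<^sup>+\<zeta>. ennreal ((cmod (H \<zeta> w))\<^sup>2) \<partial>disk_measure 0) \<le> ennreal C2 * (\<integral>\<^sup>+\<zeta>. ennreal ((cmod (G (\<zeta>, w)))\<^sup>2) \<partial>disk_measure 0)"
          using C2(2)[of "\<lambda>\<omega>. G (\<omega>, w)"] by (simp add: H_def powr_numeral)
      qed
      also have "\<dots> = ennreal C2 * sq_mass (bidisk_measure a) G"
        by (subst nn_integral_cmult, measurable, subst nn_integral_bidisk(2), measurable)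
      also have "\<dots> < \<infinity>" using G2 by (simp add: ennreal_mult_less_top)
      finally show ?thesis by simp
    qed
    have Hp: "(\<integral>\<^sup>+\<zeta>. \<integral>\<^sup>+w. ennreal (cmod (H \<zeta> w) powr p * wt p w) \<partial>disk_measure a \<partial>disk_measure 0)
       \<le> ennreal Cp * bidisk_mass p G"
    proof -
      have "(\<integral>\<^sup>+\<zeta>. \<integral>\<^sup>+w. ennreal (cmod (H \<zeta> w) powr p * wt p w) \<partial>disk_measure a \<partial>disk_measure 0)
         = (\<integral>\<^sup>+w. \<integral>\<^sup>+\<zeta>. ennreal (cmod (H \<zeta> w) powr p * wt p w) \<partial>disk_measure 0 \<partial>disk_measure a)"
        by (rule disk_disk.Fubini') measurable
      also have "\<dots> \<le> (\<integral>\<^sup>+w. ennreal Cp * (\<integral>\<^sup>+\<zeta>. ennreal (cmod (G (\<zeta>, w)) powr p * wt p w) \<partial>disk_measure 0) \<partial>disk_measure a)"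
      proof (rule nn_integral_mono)
        fix w
        have "ennreal (wt p w) * (\<integral>\<^sup>+\<zeta>. ennreal (cmod (H \<zeta> w) powr p) \<partial>disk_measure 0)
           \<le> ennreal (wt p w) * (ennreal Cp * (\<integral>\<^sup>+\<zeta>. ennreal (cmod (G (\<zeta>, w)) powr p) \<partial>disk_measure 0))"
          using Cp(2)[of "\<lambda>\<omega>. G (\<omega>, w)"] by (intro mult_left_mono) (simp_all add: H_def)
        thus "(\<integral>\<^sup>+\<zeta>. ennreal (cmod (H \<zeta> w) powr p * wt p w) \<partial>disk_measure 0)
           \<le> ennreal Cp * (\<integral>\<^sup>+\<zeta>. ennreal (cmod (G (\<zeta>, w)) powr p * wt p w) \<partial>disk_measure 0)"
          by (simp add: wts mult.left_commute)
      qed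
      also have "\<dots> = ennreal Cp * bidisk_mass p G"
        by (subst nn_integral_cmult, measurable, subst nn_integral_bidisk(2)) auto
      finally show ?thesis .
    qed
    have Hpf: "(\<integral>\<^sup>+\<zeta>. \<integral>\<^sup>+w. ennreal (cmod (H \<zeta> w) powr p * wt p w) \<partial>disk_measure a \<partial>disk_measure 0) \<noteq> \<infinity>"
    proof -
      have "ennreal Cp * bidisk_mass p G < \<infinity>"
        using Gp by (simp add: ennreal_mult_less_top)
      from le_less_trans[OF Hp this] show ?thesis by simp
    qed
    have "AE \<zeta> in disk_measure 0. (\<integral>\<^sup>+w. ennreal ((cmod (H \<zeta> w))\<^sup>2) \<partial>disk_measure a) \<noteq> \<infinity>"
      by (rule nn_integral_PInf_AE[OF _ H2]) measurable
    moreover have "AE \<zeta> in disk_measure 0. (\<integral>\<^sup>+w. ennreal (cmod (H \<zeta> w) powr p * wt p w) \<partial>disk_measure a) \<noteq> \<infinity>"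
      by (rule nn_integral_PInf_AE[OF _ Hpf]) measurable
    ultimately have ae: "AE \<zeta> in disk_measure 0. (\<integral>\<^sup>+z. ennreal (cmod (bidisk_op a G (\<zeta>, z)) powr p * wt p z) \<partial>disk_measure a)
       \<le> ennreal D * (\<integral>\<^sup>+w. ennreal (cmod (H \<zeta> w) powr p * wt p w) \<partial>disk_measure a)"
      using AE_disk_measure_punctured
    proof eventually_elim
      fix \<zeta> assume f: "(\<integral>\<^sup>+w. ennreal ((cmod (H \<zeta> w))\<^sup>2) \<partial>disk_measure a) \<noteq> \<infinity>"
        "(\<integral>\<^sup>+w. ennreal (cmod (H \<zeta> w) powr p * wt p w) \<partial>disk_measure a) \<noteq> \<infinity>" and z: "cmod \<zeta> < 1 \<and> \<zeta> \<noteq> 0"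
      have "(\<integral>\<^sup>+z. ennreal (cmod (bidisk_op a G (\<zeta>, z)) powr p * wt p z) \<partial>disk_measure a)
        = (\<integral>\<^sup>+z. ennreal (cmod (radial_op (H \<zeta>) z) powr p * wt p z) \<partial>disk_measure a)"
      proof (rule nn_integral_cong_AE)
        show "AE w in disk_measure a. ennreal (cmod (bidisk_op a G (\<zeta>, w)) powr p * wt p w) = ennreal (cmod (radial_op (H \<zeta>) w) powr p * wt p w)"
          using AE_disk_measure_punctured
        proof eventually_elim
          fix w :: complex assume w: "cmod w < 1 \<and> w \<noteq> 0"
          have "bidisk_op a G (\<zeta>, w) = radial_op (H \<zeta>) w"
            using z w by (subst bidisk_op_iterated[OF Gint]) (simp_all only: radial_op_def H_def disk_op_def)
          thus "ennreal (cmod (bidisk_op a G (\<zeta>, w)) powr p * wt p w) = ennreal (cmod (radial_op (H \<zeta>) w) powr p * wt p w)"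
            by (simp only:)
        qed
      qed
      also have "\<dots> \<le> ennreal D * (\<integral>\<^sup>+w. ennreal (cmod (H \<zeta> w) powr p * wt p w) \<partial>disk_measure a)"
      proof (rule D)
        have "(\<lambda>w. (\<zeta>, w)) \<in> borel_measurable borel"
          by (intro borel_measurable_continuous_onI continuous_intros)
        from measurable_compose[OF this Hm0] show "H \<zeta> \<in> borel_measurable borel"
          by (simp only: fst_conv snd_conv)
        show "(\<integral>\<^sup>+w. ennreal ((cmod (H \<zeta> w))\<^sup>2) \<partial>disk_measure a) < \<infinity>"
          "(\<integral>\<^sup>+w. ennreal (cmod (H \<zeta> w) powr p * wt p w) \<partial>disk_measure a) < \<infinity>"
          using f unfolding infinity_ennreal_def less_top by blast+
      qed
      finally show "(\<integral>\<^sup>+z. ennreal (cmod (bidisk_op a G (\<zeta>, z)) powr p * wt p z) \<partial>disk_measure a)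
       \<le> ennreal D * (\<integral>\<^sup>+w. ennreal (cmod (H \<zeta> w) powr p * wt p w) \<partial>disk_measure a)" .
    qed
    have "bidisk_mass p (bidisk_op a G)
       = (\<integral>\<^sup>+\<zeta>. \<integral>\<^sup>+z. ennreal (cmod (bidisk_op a G (\<zeta>, z)) powr p * wt p z) \<partial>disk_measure a \<partial>disk_measure 0)"
      by (subst nn_integral_bidisk(1)) auto
    also have "\<dots> \<le> (\<integral>\<^sup>+\<zeta>. ennreal D * (\<integral>\<^sup>+w. ennreal (cmod (H \<zeta> w) powr p * wt p w) \<partial>disk_measure a) \<partial>disk_measure 0)"
      by (rule nn_integral_mono_AE[OF ae])
    also have "\<dots> = ennreal D * (\<integral>\<^sup>+\<zeta>. \<integral>\<^sup>+w. ennreal (cmod (H \<zeta> w) powr p * wt p w) \<partial>disk_measure a \<partial>disk_measure 0)"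
      by (rule nn_integral_cmult) measurable
    also have "\<dots> \<le> ennreal D * (ennreal Cp * bidisk_mass p G)"
      by (rule mult_left_mono[OF Hp]) simp
    finally show "bidisk_mass p (bidisk_op a G)
       \<le> ennreal (D * Cp) * bidisk_mass p G"
      using D0 by (simp add: ennreal_mult' mult.assoc)
  qed
qed

end

subsection \<open>Testing on radial functions\<close>

text \<open>The circle mean of the kernel is that of h = 1, the constant (1 + b / 2) / \<pi>. So the
  image of a radial function is a constant, explicit up to one integral.\<close>

lemma bergman_kernel_radial:
  assumes [measurable]: "f \<in> borel_measurable borel"
    and int: "integrable (disk_measure b) (\<lambda>w. f ((cmod w)\<^sup>2))" and z: "cmod z < 1"
  shows "(\<integral>w. bergman_kernel b z w * of_real (f ((cmod w)\<^sup>2)) \<partial>disk_measure b)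
     = of_real ((1 + b / 2) / pi * (\<integral>w. f ((cmod w)\<^sup>2) \<partial>disk_measure b))"
proof -
  let ?F = "\<lambda>w. bergman_kernel b z w * of_real (f ((cmod w)\<^sup>2)) :: complex"
  let ?P = "\<lambda>u. of_real ((1 + b / 2) / pi * f u) :: complex"
  have h: "(\<lambda>_. 1) holomorphic_on unit_disk" by simp
  have k: "((\<lambda>t. bergman_kernel b z (rot t * w)) has_integral (of_real ((1 + b / 2) / pi))) {0..1}" if w: "cmod w < 1" for w
  proof -
    have "((\<lambda>t. (1 * (1 / (1 - z * cnj (rot t * w)))\<^sup>2 + of_real (b / 2) * (1 * (1 / (1 - z * cnj (rot t * w))))) / of_real pi)
       has_integral (1 + of_real ((cmod w)\<^sup>2) * z * deriv (\<lambda>_. 1) (of_real ((cmod w)\<^sup>2) * z) + of_real (b / 2) * 1) / of_real pi) {0..1}"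
      by (intro has_integral_divide has_integral_add has_integral_mult_right circle_mean_1[OF h z w] circle_mean_2[OF h z w])
    thus ?thesis by (simp add: bergman_kernel_def)
  qed
  have fint: "integrable (disk_measure b) (\<lambda>w. of_real (f ((cmod w)\<^sup>2)) :: complex)"
    using int by simp
  have "integral\<^sup>L (disk_measure b) ?F = integral\<^sup>L (radial_measure b) ?P"
  proof (rule disk_integral_average(2))
    show "integrable (disk_measure b) ?F" by (rule integrable_kernel_mult[OF fint z])
    fix w :: complex assume w: "cmod w < 1"
    have "1 - z * cnj (rot t * w) \<noteq> 0" for t
      using z w by (intro one_minus_mult_cnj_neq_0) (auto simp: norm_mult)
    thus "continuous_on {0..1} (\<lambda>t. ?F (rot t * w))"
      unfolding bergman_kernel_def by (simp only: norm_mult norm_rot) (intro continuous_intros; simp)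
    show "((\<lambda>t. ?F (rot t * w)) has_integral ?P ((cmod w)\<^sup>2)) {0..1}"
      using has_integral_mult_left[OF k[OF w], of "of_real (f ((cmod w)\<^sup>2))"] by (simp add: norm_mult)
  qed measurable
  also have "\<dots> = (\<integral>w. ?P ((cmod w)\<^sup>2) \<partial>disk_measure b)"
    unfolding distr_disk_measure_norm_square[symmetric] by (rule integral_distr) measurable
  also have "\<dots> = of_real (\<integral>w. (1 + b / 2) / pi * f ((cmod w)\<^sup>2) \<partial>disk_measure b)"
    by (rule integral_complex_of_real)
  finally show ?thesis by simp
qed

lemma AE_disk_measure_open_False:
  assumes "open A" "A \<subseteq> unit_disk" "A \<noteq> {}" "AE w in disk_measure b. w \<notin> A"
  shows False
proof -
  have "AE w in lborel. w \<notin> A"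
    using assms(4) unfolding AE_disk_measure_iff by eventually_elim (use assms(2) in auto)
  hence "A \<in> null_sets lborel" using assms(1) by (subst AE_iff_null_sets) auto
  hence "negligible A" by (simp add: negligible_iff_null_sets null_sets_completionI)
  thus False using open_not_negligible[OF assms(1,3)] by blast
qed

context hartogs_weight
begin

text \<open>As a function of the squared modulus: |w|^t on the annulus e < |w|^2 < 1/4. The cut at e
  > 0 keeps it bounded whatever the sign of t.\<close>

definition annulus_test :: "real \<Rightarrow> real \<Rightarrow> real \<Rightarrow> real" where
  "annulus_test t e u = indicator {e<..<1/4} u * u powr (t / 2)"

lemma measurable_annulus_test [measurable]: "annulus_test t e \<in> borel_measurable borel"
  unfolding annulus_test_def by measurable

lemma annulus_test_eq: "0 \<le> e \<Longrightarrow> annulus_test t e ((cmod w)\<^sup>2) = (if e < (cmod w)\<^sup>2 \<and> cmod w < 1 / 2 then cmod w powr t else 0)"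
proof -
  assume e: "0 \<le> e"
  have pw: "(cmod w)\<^sup>2 powr (t / 2) = cmod w powr t" if "w \<noteq> 0"
    using that by (simp add: powr_powr flip: powr_numeral)
  show ?thesis
    unfolding annulus_test_def norm_less_half_iff using e pw by (cases "w = 0") (auto simp: indicator_def)
qed

lemma annulus_test_nonneg [simp]: "0 \<le> annulus_test t e u"
  by (simp add: annulus_test_def)

lemma annulus_test_bounded:
  assumes e: "e > 0"
  shows "\<exists>M. \<forall>u. annulus_test t e u \<le> M"
proof -
  have "annulus_test t e u \<le> e powr (t / 2) + (1 / 4) powr (t / 2)" for u
  proof (cases "e < u \<and> u < 1 / 4")
    case True
    show ?thesis
    proof (cases "t \<ge> 0")
      case False
      have "u powr (t / 2) \<le> e powr (t / 2)" using True False e by (intro powr_mono2') auto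
      thus ?thesis using True by (simp add: annulus_test_def add_increasing2)
    next
      case t: True
      have "u powr (t / 2) \<le> (1 / 4) powr (t / 2)" using True t e by (intro powr_mono2) auto
      thus ?thesis using True by (simp add: annulus_test_def add_increasing)
    qed
  qed (auto simp: annulus_test_def)
  thus ?thesis by blast
qed

lemma annulus_test_integrable:
  assumes "e > 0"
  shows "integrable (disk_measure a) (\<lambda>w. annulus_test t e ((cmod w)\<^sup>2))"
proof -
  interpret F: finite_measure "disk_measure a" by (rule finite_disk_measure[OF a(1)])
  obtain M where "\<And>u. annulus_test t e u \<le> M" using annulus_test_bounded[OF assms] by blast
  thus ?thesis by (intro F.integrable_const_bound[of _ M]) auto
qed

lemma annulus_test_integral_pos:
  assumes e: "e > 0" "e < 1 / 4"
  shows "(\<integral>w. annulus_test t e ((cmod w)\<^sup>2) \<partial>disk_measure a) > 0"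
proof (rule ccontr)
  let ?A = "{w. e < (cmod w)\<^sup>2 \<and> cmod w < 1 / 2}"
  assume "\<not> (\<integral>w. annulus_test t e ((cmod w)\<^sup>2) \<partial>disk_measure a) > 0"
  moreover have "(\<integral>w. annulus_test t e ((cmod w)\<^sup>2) \<partial>disk_measure a) \<ge> 0" by simp
  ultimately have "(\<integral>w. annulus_test t e ((cmod w)\<^sup>2) \<partial>disk_measure a) = 0" by linarith
  hence "AE w in disk_measure a. annulus_test t e ((cmod w)\<^sup>2) = 0"
    using annulus_test_integrable[OF e(1)] by (subst (asm) integral_nonneg_eq_0_iff_AE) auto
  hence "AE w in disk_measure a. w \<notin> ?A"
    by eventually_elim (use e in \<open>auto simp: annulus_test_eq\<close>)
  moreover have "open ?A" by (intro open_Collect_conj open_Collect_less continuous_intros)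
  moreover have "?A \<subseteq> unit_disk" by (auto simp: unit_disk_def)
  moreover have "of_real (sqrt ((e + 1 / 4) / 2)) \<in> ?A"
    unfolding mem_Collect_eq norm_less_half_iff norm_of_real using e by simp
  ultimately show False using AE_disk_measure_open_False[of ?A a] by blast
qed

lemma bidisk_op_radial:
  assumes e: "e > 0" and x: "cmod (fst x) < 1" "cmod (snd x) < 1"
  shows "bidisk_op a (\<lambda>x. of_real (annulus_test t e ((cmod (snd x))\<^sup>2))) x
     = of_real ((1 + a / 2) / pi * (\<integral>w. annulus_test t e ((cmod w)\<^sup>2) \<partial>disk_measure a))"
proof -
  let ?G = "\<lambda>x :: complex \<times> complex. of_real (annulus_test t e ((cmod (snd x))\<^sup>2)) :: complex"
  interpret F: finite_measure "bidisk_measure a" by (rule finite_bidisk_measure[OF a(1)])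
  interpret F0: finite_measure "disk_measure 0" by (rule finite_disk_measure) simp
  obtain M where M: "\<And>u. annulus_test t e u \<le> M" using annulus_test_bounded[OF e] by blast
  have G: "integrable (bidisk_measure a) ?G"
    by (rule F.integrable_const_bound[of _ M]) (auto simp: M)
  have one: "(\<integral>\<omega>. bergman_kernel 0 (fst x) \<omega> * c \<partial>disk_measure 0) = c" for c
    using bergman_reproducing[of "\<lambda>_. c" 0 "fst x"] x by simp
  have "bidisk_op a ?G (fst x, snd x) = (\<integral>w. bergman_kernel a (snd x) w * of_real (annulus_test t e ((cmod w)\<^sup>2)) \<partial>disk_measure a)"
    by (subst bidisk_op_iterated[OF G x]) (simp only: one snd_conv)
  also have "\<dots> = of_real ((1 + a / 2) / pi * (\<integral>w. annulus_test t e ((cmod w)\<^sup>2) \<partial>disk_measure a))"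
    by (rule bergman_kernel_radial[OF _ annulus_test_integrable[OF e] x(2)]) measurable
  finally show ?thesis by simp
qed

lemma nn_integral_bidisk_snd:
  assumes [measurable]: "F \<in> borel_measurable borel"
  shows "(\<integral>\<^sup>+x. F (snd x) \<partial>bidisk_measure a) = emeasure (disk_measure 0) UNIV * (\<integral>\<^sup>+w. F w \<partial>disk_measure a)"
  by (subst nn_integral_bidisk(1)) (auto simp: mult.commute)

lemma hartogs_bounded_iff:
  assumes "p > 1"
  shows "Lp_bounded p hartogs_triangle weight (bergman_projection holomorphic2_on hartogs_triangle weight) \<longleftrightarrow>
    (\<exists>C. \<forall>f. f \<in> borel_measurable borel \<longrightarrow> Lp_mass 2 hartogs_triangle weight f < \<infinity> \<longrightarrow>
      Lp_mass p hartogs_triangle weight f < \<infinity> \<longrightarrow>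
      Lp_mass p hartogs_triangle weight (proj f) \<le> ennreal C * Lp_mass p hartogs_triangle weight f)"
  by (rule Lp_bounded_iff[OF _ hartogs_projection measurable_proj]) (use assms in simp_all)

text \<open>The image of an annulus function is the constant c J, with J its integral, so its p-th
  mass is (c J)^p times the mass W of \<open>wt p\<close>. The power t is chosen so that the p-th
  mass of the function itself is at most a multiple of J. Boundedness then reads (c J)^p W \<le>
  const J: one annulus already forces W to be finite, and J stays bounded as the annulus grows to
  the punctured half disk, which makes |w|^t integrable there.\<close>

lemma Lp_bounded_imp_exponents:
  assumes p: "p > 1" and q: "q = p / (p - 1)"
    and bd: "Lp_bounded p hartogs_triangle weight (bergman_projection holomorphic2_on hartogs_triangle weight)"
  shows "- 2 < of_int m * (2 - p) + a" "- 2 < of_int m * (2 - q) + a"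
proof -
  obtain C where C: "\<And>f. f \<in> borel_measurable borel \<Longrightarrow> Lp_mass 2 hartogs_triangle weight f < \<infinity> \<Longrightarrow>
      Lp_mass p hartogs_triangle weight f < \<infinity> \<Longrightarrow>
      Lp_mass p hartogs_triangle weight (proj f) \<le> ennreal C * Lp_mass p hartogs_triangle weight f"
    using bd unfolding hartogs_bounded_iff[OF p] by blast
  \<comment> \<open>The exponent for which the p-th power of |w|^t times |w|^(m(2 - p)) is again
    |w|^t; see \<open>tp\<close>.\<close>
  define t where "t = of_int m * (2 - q)"
  have q': "(2 - q) * (p - 1) = p - 2" using p by (simp add: q field_simps)
  have tp: "t * p + of_int m * (2 - p) = t"
  proof -
    have "t * (p - 1) = of_int m * (p - 2)" unfolding t_def mult.assoc q' ..
    thus ?thesis by (simp add: algebra_simps)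
  qed
  obtain B where B: "B > 0" "\<And>w. w \<in> cball 0 (1 / 2) \<Longrightarrow> cmod (g w) powr (2 - p) \<le> B"
    using g_powr_bounded by blast
  obtain B' where B': "B' > 0" "\<And>w. w \<in> cball 0 (1 / 2) \<Longrightarrow> cmod (g w) powr (- (2 - p)) \<le> B'"
    using g_powr_bounded by blast
  let ?W = "\<integral>\<^sup>+w. ennreal (wt p w) \<partial>disk_measure a"
  define E where "E = emeasure (disk_measure 0) UNIV"
  interpret F0: finite_measure "disk_measure 0" by (rule finite_disk_measure) simp
  have E: "E \<noteq> 0" "E < \<infinity>"
  proof -
    show "E < \<infinity>" by (simp add: E_def less_top[symmetric])
    show "E \<noteq> 0"
    proof
      assume "E = 0"
      hence "AE w in disk_measure 0. w \<notin> unit_disk"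
        unfolding E_def by (intro AE_I[of _ _ UNIV]) auto
      thus False by (rule AE_disk_measure_open_False[rotated -1]) (auto simp: unit_disk_eq_ball)
    qed
  qed
  define c where "c = (1 + a / 2) / pi"
  have c: "c > 0" using a by (simp add: c_def)
  define J where "J e = (\<integral>w. annulus_test t e ((cmod w)\<^sup>2) \<partial>disk_measure a)" for e
  have key: "ennreal ((c * J e) powr p) * ?W \<le> ennreal (max C 0 * B * J e)" if e: "e > 0" "e < 1 / 4" for e
  proof -
    \<comment> \<open>Division by \<gamma> makes \<open>lift f\<close> the radial test function
      itself. At snd x = 0, where \<gamma> may vanish, the test function is 0.\<close>
    define f where "f x = of_real (annulus_test t e ((cmod (snd x))\<^sup>2)) / \<gamma> (snd x)" for x :: "complex \<times> complex"
    have fm [measurable]: "f \<in> borel_measurable borel" unfolding f_def by measurable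
    have lf: "lift f = (\<lambda>x. of_real (annulus_test t e ((cmod (snd x))\<^sup>2)))"
    proof
      fix x :: "complex \<times> complex"
      show "lift f x = of_real (annulus_test t e ((cmod (snd x))\<^sup>2))"
      proof (cases "snd x = 0")
        case True
        thus ?thesis using e by (simp add: lift_def f_def hartogs_map_def annulus_test_def)
      qed (simp add: lift_def f_def hartogs_map_def \<gamma>_nz)
    qed
    obtain M where M: "\<And>u. annulus_test t e u \<le> M" using annulus_test_bounded[OF e(1)] by blast
    interpret F: finite_measure "bidisk_measure a" by (rule finite_bidisk_measure[OF a(1)])
    have m2: "Lp_mass 2 hartogs_triangle weight f < \<infinity>"
    proof -
      have "Lp_mass 2 hartogs_triangle weight f \<le> (\<integral>\<^sup>+x. ennreal (M\<^sup>2) \<partial>bidisk_measure a)"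
        unfolding L2_mass_hartogs[OF fm] lf
        by (intro nn_integral_mono ennreal_leI) (auto intro!: power_mono M)
      also have "\<dots> < \<infinity>"
      proof -
        have "emeasure (bidisk_measure a) UNIV < top" by (simp add: less_top[symmetric])
        thus ?thesis by (simp add: ennreal_mult_less_top)
      qed
      finally show ?thesis .
    qed
    have mp: "Lp_mass p hartogs_triangle weight f \<le> E * ennreal (B * J e)"
    proof -
      have "Lp_mass p hartogs_triangle weight f = (\<integral>\<^sup>+x. ennreal (annulus_test t e ((cmod (snd x))\<^sup>2) powr p * wt p (snd x)) \<partial>bidisk_measure a)"
        unfolding Lp_mass_hartogs[OF fm] lf wt_def by simp
      also have "\<dots> = E * (\<integral>\<^sup>+w. ennreal (annulus_test t e ((cmod w)\<^sup>2) powr p * wt p w) \<partial>disk_measure a)"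
        unfolding E_def by (rule nn_integral_bidisk_snd) measurable
      also have "(\<integral>\<^sup>+w. ennreal (annulus_test t e ((cmod w)\<^sup>2) powr p * wt p w) \<partial>disk_measure a)
         \<le> (\<integral>\<^sup>+w. ennreal (B * annulus_test t e ((cmod w)\<^sup>2)) \<partial>disk_measure a)"
      proof (intro nn_integral_mono ennreal_leI)
        fix w :: complex
        show "annulus_test t e ((cmod w)\<^sup>2) powr p * wt p w \<le> B * annulus_test t e ((cmod w)\<^sup>2)"
        proof (cases "e < (cmod w)\<^sup>2 \<and> cmod w < 1 / 2")
          case True
          hence w: "w \<noteq> 0" using e by auto
          have "(cmod w powr t) powr p * wt p w = cmod w powr (t * p + of_int m * (2 - p)) * cmod (g w) powr (2 - p)"
            using w by (simp add: wt_eq powr_powr powr_add)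
          also have "\<dots> \<le> cmod w powr t * B"
            unfolding tp using B(2)[of w] True by (intro mult_left_mono) auto
          finally show ?thesis using True e by (simp add: annulus_test_eq mult.commute)
        next
          case False
          hence "annulus_test t e ((cmod w)\<^sup>2) = 0" using e by (subst annulus_test_eq) auto
          thus ?thesis by simp
        qed
      qed
      also have "\<dots> = ennreal (B * J e)"
        unfolding J_def using annulus_test_integrable[OF e(1)] B
        by (subst nn_integral_eq_integral) auto
      finally show ?thesis by (simp add: mult_left_mono)
    qed
    have "Lp_mass p hartogs_triangle weight (proj f) = (\<integral>\<^sup>+x. ennreal ((c * J e) powr p) * ennreal (wt p (snd x)) \<partial>bidisk_measure a)"
      unfolding Lp_mass_hartogs[OF measurable_proj[OF fm]]
    proof (rule nn_integral_cong_AE)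
      show "AE x in bidisk_measure a. ennreal (cmod (lift (proj f) x) powr p * cmod (\<gamma> (snd x)) powr (2 - p))
         = ennreal ((c * J e) powr p) * ennreal (wt p (snd x))"
        using AE_bidisk
      proof eventually_elim
        fix x :: "complex \<times> complex" assume x: "cmod (fst x) < 1 \<and> cmod (snd x) < 1 \<and> snd x \<noteq> 0"
        have J0: "J e \<ge> 0" by (simp add: J_def)
        have "lift (proj f) x = of_real (c * J e)"
          using x e bidisk_op_radial[of e x t] by (simp add: lift_proj lf c_def J_def)
        hence "cmod (lift (proj f) x) = c * J e" using c J0 by (simp only: norm_of_real) simp
        thus "ennreal (cmod (lift (proj f) x) powr p * cmod (\<gamma> (snd x)) powr (2 - p))
         = ennreal ((c * J e) powr p) * ennreal (wt p (snd x))"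
          by (simp add: wt_def ennreal_mult')
      qed
    qed
    also have "\<dots> = E * (ennreal ((c * J e) powr p) * ?W)"
      unfolding E_def by (subst nn_integral_bidisk_snd, measurable) (simp add: nn_integral_cmult)
    finally have "E * (ennreal ((c * J e) powr p) * ?W) = Lp_mass p hartogs_triangle weight (proj f)" ..
    also have "\<dots> \<le> ennreal C * Lp_mass p hartogs_triangle weight f"
      by (rule C[OF fm m2]) (use mp E in \<open>auto intro: le_less_trans simp: ennreal_mult_less_top\<close>)
    also have "\<dots> \<le> ennreal (max C 0) * (E * ennreal (B * J e))"
      by (intro mult_mono mp ennreal_leI) auto
    also have "\<dots> = E * ennreal (max C 0 * B * J e)"
    proof -
      have "ennreal (max C 0 * B * J e) = ennreal (max C 0) * ennreal (B * J e)"
        unfolding mult.assoc by (rule ennreal_mult') simp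
      thus ?thesis by (simp only: mult.left_commute)
    qed
    \<comment> \<open>The area E of the disk in the first variable occurs on both sides and cancels,
      being positive and finite.\<close>
    finally show ?thesis using E by (simp add: ennreal_mult_le_mult_iff less_top)
  qed
  have Jpos: "J e > 0" if "e > 0" "e < 1 / 4" for e
    unfolding J_def by (rule annulus_test_integral_pos[OF that])
  have Wfin: "?W < \<infinity>"
  proof (rule ccontr)
    \<comment> \<open>Any e in (0, 1/4) would do; the left side of \<open>key\<close> would be
      infinite because J is positive.\<close>
    assume "\<not> ?W < \<infinity>"
    hence "?W = top" by (simp add: less_top[symmetric])
    moreover have "ennreal ((c * J (1 / 8)) powr p) \<noteq> 0" using c Jpos[of "1 / 8"] by simp
    ultimately have "top \<le> ennreal (max C 0 * B * J (1 / 8))"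
      using key[of "1 / 8"] by (simp add: ennreal_mult_top)
    thus False by (simp add: top_unique)
  qed
  define W where "W = enn2real ?W"
  have W: "?W = ennreal W" "W \<ge> 0" using Wfin by (auto simp: W_def)
  have W0: "W > 0"
  proof (rule ccontr)
    assume "\<not> W > 0"
    hence "?W = 0" using W by simp
    hence "AE w in disk_measure a. ennreal (wt p w) = 0" by (subst (asm) nn_integral_0_iff_AE) auto
    hence "AE w in disk_measure a. w \<notin> unit_disk - {0}"
      by eventually_elim (use \<gamma>_nz in \<open>auto simp: wt_def ennreal_eq_0_iff\<close>)
    moreover have "(1 / 2 :: complex) \<in> unit_disk - {0}" by (simp add: unit_disk_def)
    moreover have "open (unit_disk - {0})" by (auto simp: unit_disk_eq_ball)
    ultimately show False using AE_disk_measure_open_False[of "unit_disk - {0}" a] by blast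
  qed
  show "- 2 < of_int m * (2 - p) + a"
  proof (rule integrable_power_imp_gt)
    \<comment> \<open>On the half disk |g|^(-(2 - p)) is bounded, so the pure power is dominated by
      \<open>wt p\<close>.\<close>
    have "(\<integral>\<^sup>+w. indicator (ball 0 (1 / 2)) w * ennreal (cmod w powr (of_int m * (2 - p))) \<partial>disk_measure a)
       \<le> (\<integral>\<^sup>+w. ennreal B' * ennreal (wt p w) \<partial>disk_measure a)"
    proof (rule nn_integral_mono_AE)
      show "AE w in disk_measure a. indicator (ball 0 (1 / 2)) w * ennreal (cmod w powr (of_int m * (2 - p))) \<le> ennreal B' * ennreal (wt p w)"
        using AE_disk_measure_punctured
      proof eventually_elim
        fix w :: complex assume w: "cmod w < 1 \<and> w \<noteq> 0"
        show "indicator (ball 0 (1 / 2)) w * ennreal (cmod w powr (of_int m * (2 - p))) \<le> ennreal B' * ennreal (wt p w)"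
        proof (cases "w \<in> ball 0 (1 / 2)")
          case True
          have "cmod w powr (of_int m * (2 - p)) = cmod (g w) powr (- (2 - p)) * wt p w"
            using w g_nz[of w] powr_add[of "cmod (g w)" "- (2 - p)" "2 - p"] by (simp add: wt_eq)
          also have "\<dots> \<le> B' * wt p w" using B'(2)[of w] True by (intro mult_right_mono) auto
          finally show ?thesis using True B' by (simp add: ennreal_mult'[symmetric] ennreal_leI)
        qed simp
      qed
    qed
    also have "\<dots> < \<infinity>" using Wfin by (subst nn_integral_cmult) (auto simp: ennreal_mult_less_top)
    finally show "(\<integral>\<^sup>+w. indicator (ball 0 (1 / 2)) w * ennreal (cmod w powr (of_int m * (2 - p))) \<partial>disk_measure a) < \<infinity>" .
  qed
  \<comment> \<open>Solving (c J)^p W \<le> (max C 0) B J for J, after division by J > 0; the bound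
    does not depend on e.\<close>
  define M where "M = (max C 0 * B / (c powr p * W)) powr (1 / (p - 1))"
  have Jle: "J e \<le> M" if e: "e > 0" "e < 1 / 4" for e
  proof -
    note J0 = Jpos[OF e]
    have "ennreal ((c * J e) powr p * W) \<le> ennreal (max C 0 * B * J e)"
      using key[OF e] W by (simp add: ennreal_mult')
    hence "(c * J e) powr p * W \<le> max C 0 * B * J e"
      using B J0 by (subst (asm) ennreal_le_iff) auto
    hence "c powr p * W * J e powr p \<le> max C 0 * B * J e"
      using c J0 by (simp add: powr_mult ac_simps)
    moreover have "J e powr p = J e powr (p - 1) * J e" using J0 by (simp add: powr_diff)
    ultimately have "(c powr p * W * J e powr (p - 1)) * J e \<le> (max C 0 * B) * J e" by (simp add: mult.assoc)
    hence "c powr p * W * J e powr (p - 1) \<le> max C 0 * B" using J0 by simp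
    hence "J e powr (p - 1) \<le> max C 0 * B / (c powr p * W)"
      using c W0 by (simp add: field_simps)
    hence "(J e powr (p - 1)) powr (1 / (p - 1)) \<le> M" unfolding M_def using p by (intro powr_mono2) auto
    thus ?thesis using p J0 by (simp add: powr_powr)
  qed
  show "- 2 < of_int m * (2 - q) + a"
    unfolding t_def[symmetric]
  proof (rule integrable_power_imp_gt)
    \<comment> \<open>A sequence decreasing to 0; the 5 keeps every term below 1/4.\<close>
    define e where "e n = 1 / (real n + 5)" for n
    have e: "e n > 0" "e n < 1 / 4" for n by (auto simp: e_def field_simps)
    let ?f = "\<lambda>n w. ennreal (annulus_test t (e n) ((cmod w)\<^sup>2))"
    let ?u = "\<lambda>w. indicator (ball 0 (1 / 2)) w * ennreal (cmod w powr t)"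
    have "(\<lambda>n. \<integral>\<^sup>+w. ?f n w \<partial>disk_measure a) \<longlonglongrightarrow> (\<integral>\<^sup>+w. ?u w \<partial>disk_measure a)"
    proof (rule nn_integral_LIMSEQ)
      have "e n \<le> e k" if "k \<le> n" for k n using that by (auto simp: e_def field_simps)
      thus "incseq ?f"
        by (auto simp: incseq_def le_fun_def annulus_test_eq less_imp_le[OF e(1)] intro: le_less_trans)
      fix w :: complex
      have "eventually (\<lambda>n. ?f n w = ?u w) sequentially"
      proof (cases "w = 0")
        case True
        thus ?thesis by (simp add: annulus_test_def)
      next
        case False
        hence pos: "(cmod w)\<^sup>2 > 0" by simp
        have "e \<longlonglongrightarrow> 0" unfolding e_def by real_asymp
        hence "eventually (\<lambda>n. e n < (cmod w)\<^sup>2) sequentially" using pos by (rule order_tendstoD)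
        thus ?thesis by eventually_elim (auto simp: annulus_test_eq less_imp_le[OF e(1)] indicator_def)
      qed
      thus "(\<lambda>n. ?f n w) \<longlonglongrightarrow> ?u w" by (rule tendsto_eventually)
    qed measurable
    moreover have "(\<integral>\<^sup>+w. ?f n w \<partial>disk_measure a) \<le> ennreal M" for n
    proof -
      have "(\<integral>\<^sup>+w. ?f n w \<partial>disk_measure a) = ennreal (J (e n))"
        unfolding J_def using annulus_test_integrable[OF e(1)] by (intro nn_integral_eq_integral) auto
      thus ?thesis using Jle[OF e] by (simp add: ennreal_leI)
    qed
    ultimately have "(\<integral>\<^sup>+w. ?u w \<partial>disk_measure a) \<le> ennreal M" by (intro LIMSEQ_le_const2) auto
    thus "(\<integral>\<^sup>+w. ?u w \<partial>disk_measure a) < \<infinity>" by (auto intro: le_less_trans)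
  qed
qed

text \<open>The projection of the restriction of \<open>1 / g\<close> to a disk around the origin is a multiple of \<open>1 / g\<close>.\<close>

lemma disk_bounded_imp_finite:
  assumes p: "p > 1"
    and disk: "\<And>v. v \<in> borel_measurable borel \<Longrightarrow> sq_mass (disk_measure 0) v < \<infinity> \<Longrightarrow>
       disk_mass p v < \<infinity> \<Longrightarrow>
       disk_mass p (disk_op v)
         \<le> ennreal C * disk_mass p v"
  shows "(\<integral>\<^sup>+w. ennreal (cmod (g w) powr (2 - p)) \<partial>disk_measure 0) < \<infinity>"
proof -
  interpret F0: finite_measure "disk_measure 0" by (rule finite_disk_measure) simp
  have E: "emeasure (disk_measure 0) UNIV < \<infinity>" by (simp add: less_top[symmetric])
  let ?f = "indicator {..<1/4} :: real \<Rightarrow> real"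
  \<comment> \<open>The product of g with the restriction of 1 / g to |w| < 1/2, where |g|^(2 - p)
    is bounded, so the mass of \<open>v\<close> is finite.\<close>
  define v where "v w = complex_of_real (?f ((cmod w)\<^sup>2))" for w
  have vm [measurable]: "v \<in> borel_measurable borel" unfolding v_def by measurable
  obtain B where B: "B > 0" "\<And>w. w \<in> cball 0 (1 / 2) \<Longrightarrow> cmod (g w) powr (2 - p) \<le> B"
    using g_powr_bounded by blast
  have v2: "sq_mass (disk_measure 0) v < \<infinity>"
  proof -
    have "sq_mass (disk_measure 0) v \<le> (\<integral>\<^sup>+w. 1 \<partial>disk_measure 0)"
      by (intro nn_integral_mono) (auto simp: v_def indicator_def)
    thus ?thesis using E by (auto intro: le_less_trans)
  qed
  have vp: "disk_mass p v < \<infinity>"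
  proof -
    have "disk_mass p v \<le> (\<integral>\<^sup>+w. ennreal B \<partial>disk_measure 0)"
    proof (intro nn_integral_mono ennreal_leI)
      fix w
      show "cmod (v w) powr p * cmod (g w) powr (2 - p) \<le> B"
        using B(1) B(2)[of w] norm_less_half_iff[of w] by (auto simp: v_def indicator_def)
    qed
    also have "\<dots> < \<infinity>" using E by (simp add: ennreal_mult_less_top)
    finally show ?thesis .
  qed
  define J where "J = (\<integral>w. ?f ((cmod w)\<^sup>2) \<partial>disk_measure 0)"
  have int: "integrable (disk_measure 0) (\<lambda>w. ?f ((cmod w)\<^sup>2))"
    by (rule F0.integrable_const_bound[of _ 1]) (auto simp: indicator_def)
  have J: "J > 0"
  proof (rule ccontr)
    assume "\<not> J > 0"
    moreover have "J \<ge> 0" by (simp add: J_def)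
    ultimately have "J = 0" by linarith
    hence "AE w in disk_measure 0. ?f ((cmod w)\<^sup>2) = 0"
      unfolding J_def using int by (subst (asm) integral_nonneg_eq_0_iff_AE) auto
    hence "AE w in disk_measure 0. w \<notin> ball 0 (1 / 2)"
    proof eventually_elim
      fix w :: complex assume "?f ((cmod w)\<^sup>2) = 0"
      thus "w \<notin> ball 0 (1 / 2)"
        unfolding mem_ball dist_0_norm norm_less_half_iff by (auto simp: indicator_def)
    qed
    thus False by (rule AE_disk_measure_open_False[rotated -1]) (auto simp: unit_disk_def)
  qed
  \<comment> \<open>Because the image is a non-zero constant, its mass is a positive multiple of the
    integral in question.\<close>
  have op: "disk_op v z = of_real (1 / pi * J)" if "cmod z < 1" for z
    using bergman_kernel_radial[OF _ int that] by (simp add: disk_op_def v_def J_def)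
  have "ennreal ((1 / pi * J) powr p) * (\<integral>\<^sup>+w. ennreal (cmod (g w) powr (2 - p)) \<partial>disk_measure 0)
     = (\<integral>\<^sup>+w. ennreal ((1 / pi * J) powr p) * ennreal (cmod (g w) powr (2 - p)) \<partial>disk_measure 0)"
    by (rule nn_integral_cmult[symmetric]) measurable
  also have "\<dots> = disk_mass p (disk_op v)"
  proof (rule nn_integral_cong_AE)
    show "AE w in disk_measure 0. ennreal ((1 / pi * J) powr p) * ennreal (cmod (g w) powr (2 - p))
       = ennreal (cmod (disk_op v w) powr p * cmod (g w) powr (2 - p))"
      using AE_disk_measure_punctured
    proof eventually_elim
      fix w :: complex assume "cmod w < 1 \<and> w \<noteq> 0"
      hence "cmod (disk_op v w) = 1 / pi * J" using J by (simp only: op norm_of_real) simp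
      thus "ennreal ((1 / pi * J) powr p) * ennreal (cmod (g w) powr (2 - p))
       = ennreal (cmod (disk_op v w) powr p * cmod (g w) powr (2 - p))" by (simp add: ennreal_mult')
    qed
  qed
  also have "\<dots> \<le> ennreal C * disk_mass p v"
    by (rule disk[OF vm v2 vp])
  also have "\<dots> < \<infinity>" using vp by (simp add: ennreal_mult_less_top)
  finally have "ennreal ((1 / pi * J) powr p) * (\<integral>\<^sup>+w. ennreal (cmod (g w) powr (2 - p)) \<partial>disk_measure 0) < \<infinity>" .
  moreover have "ennreal ((1 / pi * J) powr p) \<noteq> 0" using J by simp
  ultimately show ?thesis by (auto simp: ennreal_mult_less_top)
qed

section \<open>Sufficiency on the Hartogs triangle\<close>

lemma disk_bounded_iff:
  assumes p: "p > 1"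
  shows "Lp_bounded p unit_disk (\<lambda>w. (cmod (g w))\<^sup>2) (bergman_projection (holomorphic_on) unit_disk (\<lambda>w. (cmod (g w))\<^sup>2)) \<longleftrightarrow>
    (\<exists>C. \<forall>v. v \<in> borel_measurable borel \<longrightarrow> sq_mass (disk_measure 0) v < \<infinity> \<longrightarrow>
       disk_mass p v < \<infinity> \<longrightarrow>
       disk_mass p (disk_op v)
         \<le> ennreal C * disk_mass p v)"
    (is "?L \<longleftrightarrow> (\<exists>C. \<forall>v. ?P C v)")
proof -
  let ?nu = "\<lambda>w. (cmod (g w))\<^sup>2"
  let ?T = "\<lambda>f z. indicator unit_disk z * (disk_op (\<lambda>w. g w * f w) z / g z)"
  interpret D: weighted_domain unit_disk ?nu by (rule weighted_domain_disk[OF g_meas g_nz])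
  have Tm: "?T f \<in> borel_measurable borel" if [measurable]: "f \<in> borel_measurable borel" for f by measurable
  have mass: "Lp_mass r unit_disk ?nu f = (\<integral>\<^sup>+w. ennreal (cmod (g w * f w) powr r * cmod (g w) powr (2 - r)) \<partial>disk_measure 0)"
    if "f \<in> borel_measurable borel" for r f
    by (rule Lp_mass_unit_disk[OF g_meas that g_nz])
  have mass2: "Lp_mass 2 unit_disk ?nu f = (\<integral>\<^sup>+w. ennreal ((cmod (g w * f w))\<^sup>2) \<partial>disk_measure 0)"
    if "f \<in> borel_measurable borel" for f
    unfolding mass[OF that] using g_nz by (simp add: powr_numeral)
  have massT: "Lp_mass p unit_disk ?nu (?T f)
      = (\<integral>\<^sup>+w. ennreal (cmod (disk_op (\<lambda>w. g w * f w) w) powr p * cmod (g w) powr (2 - p)) \<partial>disk_measure 0)"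
    if "f \<in> borel_measurable borel" for f
    unfolding mass[OF Tm[OF that]]
  proof (rule nn_integral_cong_AE)
    show "AE w in disk_measure 0. ennreal (cmod (g w * ?T f w) powr p * cmod (g w) powr (2 - p))
      = ennreal (cmod (disk_op (\<lambda>w. g w * f w) w) powr p * cmod (g w) powr (2 - p))"
      using AE_disk_measure_punctured by eventually_elim (simp add: g_nz unit_disk_def)
  qed
  have "?L \<longleftrightarrow> (\<exists>C. \<forall>f. f \<in> borel_measurable borel \<longrightarrow> Lp_mass 2 unit_disk ?nu f < \<infinity> \<longrightarrow> Lp_mass p unit_disk ?nu f < \<infinity> \<longrightarrow>
       Lp_mass p unit_disk ?nu (?T f) \<le> ennreal C * Lp_mass p unit_disk ?nu f)"
    by (rule D.Lp_bounded_iff[OF _ disk_projection[OF g_meas g_nz g_holo] Tm]) (use p in auto)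
  also have "\<dots> \<longleftrightarrow> (\<exists>C. \<forall>f. f \<in> borel_measurable borel \<longrightarrow> ?P C (\<lambda>w. g w * f w))"
  proof (rule ex_cong1, rule all_cong1, rule imp_cong[OF refl])
    fix C :: real and f :: "complex \<Rightarrow> complex" assume fm: "f \<in> borel_measurable borel"
    hence gm: "(\<lambda>w. g w * f w) \<in> borel_measurable borel" by measurable
    show "(Lp_mass 2 unit_disk ?nu f < \<infinity> \<longrightarrow> Lp_mass p unit_disk ?nu f < \<infinity> \<longrightarrow>
       Lp_mass p unit_disk ?nu (?T f) \<le> ennreal C * Lp_mass p unit_disk ?nu f) = ?P C (\<lambda>w. g w * f w)"
      using gm by (simp only: mass[OF fm, of p] mass2[OF fm] massT[OF fm] simp_thms)
  qed
  also have "\<dots> \<longleftrightarrow> (\<exists>C. \<forall>v. ?P C v)"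
  proof (intro ex_cong1 iffI allI)
    fix C v assume h: "\<forall>f. f \<in> borel_measurable borel \<longrightarrow> ?P C (\<lambda>w. g w * f w)"
    \<comment> \<open>Every Borel v has the form g f with f = v / g Borel, since g vanishes nowhere;
      so the condition on products g f covers all functions.\<close>
    have eq: "g w * (v w / g w) = v w" for w by (simp add: g_nz)
    show "?P C v"
    proof (rule impI)
      assume vm: "v \<in> borel_measurable borel"
      hence "(\<lambda>w. v w / g w) \<in> borel_measurable borel" by measurable
      with h have "?P C (\<lambda>w. g w * (v w / g w))" by blast
      thus "sq_mass (disk_measure 0) v < \<infinity> \<longrightarrow>
       disk_mass p v < \<infinity> \<longrightarrow>
       disk_mass p (disk_op v)
         \<le> ennreal C * disk_mass p v"
        using vm unfolding eq by blast
    qed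
  qed auto
  finally show ?thesis .
qed

text \<open>Boundedness on the disk for p is used twice: as an operator bound, and to make |g|^(2 -
  p) integrable. Boundedness for q gives the integrability of |g|^(2 - q), that is, the dual weight
  for Hoelder.\<close>

lemma exponents_imp_Lp_bounded:
  assumes p: "p > 1" and q: "q = p / (p - 1)"
    and I: "- 2 < of_int m * (2 - p) + a" "- 2 < of_int m * (2 - q) + a"
    and dp: "Lp_bounded p unit_disk (\<lambda>w. (cmod (g w))\<^sup>2) (bergman_projection (holomorphic_on) unit_disk (\<lambda>w. (cmod (g w))\<^sup>2))"
    and dq: "Lp_bounded q unit_disk (\<lambda>w. (cmod (g w))\<^sup>2) (bergman_projection (holomorphic_on) unit_disk (\<lambda>w. (cmod (g w))\<^sup>2))"
  shows "Lp_bounded p hartogs_triangle weight (bergman_projection holomorphic2_on hartogs_triangle weight)"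
proof -
  have q1: "q > 1" using p by (simp add: q)
  from dp[unfolded disk_bounded_iff[OF p]] obtain C where C: "\<And>v. v \<in> borel_measurable borel \<Longrightarrow> sq_mass (disk_measure 0) v < \<infinity> \<Longrightarrow>
       disk_mass p v < \<infinity> \<Longrightarrow>
       disk_mass p (disk_op v)
         \<le> ennreal C * disk_mass p v" by blast
  from dq[unfolded disk_bounded_iff[OF q1]] obtain Cq where Cq: "\<And>v. v \<in> borel_measurable borel \<Longrightarrow> sq_mass (disk_measure 0) v < \<infinity> \<Longrightarrow>
       disk_mass q v < \<infinity> \<Longrightarrow>
       disk_mass q (disk_op v)
         \<le> ennreal Cq * disk_mass q v" by blast
  have Wp: "(\<integral>\<^sup>+w. ennreal (wt p w) \<partial>disk_measure a) < \<infinity>"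
    by (rule wt_finite[OF I(1) disk_bounded_imp_finite[OF p C]])
  have Wq: "(\<integral>\<^sup>+w. ennreal (wt q w) \<partial>disk_measure a) < \<infinity>"
    by (rule wt_finite[OF I(2) disk_bounded_imp_finite[OF q1 Cq]])
  obtain D where D: "D \<ge> 0" "\<And>u. u \<in> borel_measurable borel \<Longrightarrow> sq_mass (disk_measure a) u < \<infinity> \<Longrightarrow>
       radial_mass p u < \<infinity> \<Longrightarrow>
       radial_mass p (radial_op u)
         \<le> ennreal D * radial_mass p u"
    using radial_op_Lp[OF p q Wp Wq C] by blast
  obtain K where K: "\<And>G. G \<in> borel_measurable borel \<Longrightarrow> sq_mass (bidisk_measure a) G < \<infinity> \<Longrightarrow>
       bidisk_mass p G < \<infinity> \<Longrightarrow>
       bidisk_mass p (bidisk_op a G)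
         \<le> ennreal K * bidisk_mass p G"
    using bidisk_op_Lp[OF p D(2) D(1)] by blast
  have "\<exists>C. \<forall>f. f \<in> borel_measurable borel \<longrightarrow> Lp_mass 2 hartogs_triangle weight f < \<infinity> \<longrightarrow>
      Lp_mass p hartogs_triangle weight f < \<infinity> \<longrightarrow>
      Lp_mass p hartogs_triangle weight (proj f) \<le> ennreal C * Lp_mass p hartogs_triangle weight f"
  proof (intro exI[of _ K] allI impI)
    fix f :: "complex \<times> complex \<Rightarrow> complex"
    assume fm: "f \<in> borel_measurable borel" and f2: "Lp_mass 2 hartogs_triangle weight f < \<infinity>"
      and fp: "Lp_mass p hartogs_triangle weight f < \<infinity>"
    have "Lp_mass p hartogs_triangle weight (proj f) = (\<integral>\<^sup>+x. ennreal (cmod (bidisk_op a (lift f) x) powr p * wt p (snd x)) \<partial>bidisk_measure a)"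
      unfolding Lp_mass_hartogs[OF measurable_proj[OF fm]]
    proof (rule nn_integral_cong_AE)
      show "AE x in bidisk_measure a. ennreal (cmod (lift (proj f) x) powr p * cmod (\<gamma> (snd x)) powr (2 - p))
         = ennreal (cmod (bidisk_op a (lift f) x) powr p * wt p (snd x))"
        using AE_lift_proj[of f] by eventually_elim (simp add: wt_def)
    qed
    also have "\<dots> \<le> ennreal K * Lp_mass p hartogs_triangle weight f"
      using f2 fp unfolding L2_mass_hartogs[OF fm] Lp_mass_hartogs[OF fm, of p] wt_def[symmetric]
      by (rule K[OF measurable_lift[OF fm]])
    finally show "Lp_mass p hartogs_triangle weight (proj f) \<le> ennreal K * Lp_mass p hartogs_triangle weight f" .
  qed
  thus ?thesis unfolding hartogs_bounded_iff[OF p] .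
qed

end

section \<open>Passage to the given weights and conclusion\<close>

lemma Lp_bounded_weight_cong:
  assumes "\<And>x. x \<in> \<Omega> \<Longrightarrow> \<mu> x = \<mu>' x"
  shows "Lp_bounded p \<Omega> \<mu> (bergman_projection hol \<Omega> \<mu>) \<longleftrightarrow> Lp_bounded p \<Omega> \<mu>' (bergman_projection hol \<Omega> \<mu>')"
proof -
  have int: "integrable (lebesgue_on \<Omega>) (\<lambda>z. F z * \<mu> z) = integrable (lebesgue_on \<Omega>) (\<lambda>z. F z * \<mu>' z)" for F
    by (rule Bochner_Integration.integrable_cong[OF refl]) (simp add: assms)
  have L: "weighted_Lp r \<Omega> \<mu> = weighted_Lp r \<Omega> \<mu>'" for r
    unfolding weighted_Lp_def int ..
  have N: "weighted_Lp_norm r \<Omega> \<mu> = weighted_Lp_norm r \<Omega> \<mu>'" for r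
    unfolding weighted_Lp_norm_def
    by (intro ext arg_cong[where f = "\<lambda>t. t powr (1 / r)"] Bochner_Integration.integral_cong refl) (simp add: assms)
  have W: "weighted_inner \<Omega> \<mu> = weighted_inner \<Omega> \<mu>'"
    unfolding weighted_inner_def by (intro ext Bochner_Integration.integral_cong refl) (simp add: assms)
  have "bergman_projection hol \<Omega> \<mu> = bergman_projection hol \<Omega> \<mu>'"
    unfolding bergman_projection_def bergman_space_def L W ..
  thus ?thesis unfolding Lp_bounded_def L N by simp
qed

theorem theorem1p6:
  fixes g :: "complex \<Rightarrow> complex"
    and s s' p0 p1 :: real and k :: int
    and lam \<mu> :: "complex \<times> complex \<Rightarrow> real" and \<nu> :: "complex \<Rightarrow> real"
  assumes g_hol: "g holomorphic_on unit_disk"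
    and g_nz: "\<And>z. z \<in> unit_disk \<Longrightarrow> g z \<noteq> 0"
    and s: "0 < s" "s \<le> 2" "s' = s + 2 * of_int k"
    and nu: "\<nu> = (\<lambda>z. (cmod (g z))\<^sup>2)"
    and lam: "lam = (\<lambda>z. cmod (snd z) powr s')"
    and mu: "\<mu> = (\<lambda>z. cmod (snd z) powr s' * (cmod (g (snd z)))\<^sup>2)"
    and p0: "p0 \<ge> 1"
    and disk: "\<And>p. p > 1 \<Longrightarrow>
       Lp_bounded p unit_disk \<nu> (bergman_projection (holomorphic_on) unit_disk \<nu>)
         \<longleftrightarrow> p \<in> conj_interval p0"
    and p1: "p1 \<ge> 1" "p1 = hartogs_exponent s k"
    and hartogs: "\<And>p. p > 1 \<Longrightarrow>
       Lp_bounded p hartogs_triangle lam (bergman_projection holomorphic2_on hartogs_triangle lam)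
         \<longleftrightarrow> p \<in> conj_interval p1"
  shows "(\<forall>p>1. p \<in> conj_interval p0 \<inter> conj_interval p1 \<longrightarrow>
            Lp_bounded p hartogs_triangle \<mu> (bergman_projection holomorphic2_on hartogs_triangle \<mu>)) \<and>
         (conj_interval p1 \<subset> conj_interval p0 \<longrightarrow>
          (\<forall>p>1. Lp_bounded p hartogs_triangle \<mu> (bergman_projection holomorphic2_on hartogs_triangle \<mu>)
             \<longleftrightarrow> p \<in> conj_interval p1))"
proof -
  \<comment> \<open>Extending g by 1 makes it Borel and zero-free on the whole plane, as the locale
    requires; the weights on the two domains do not change.\<close>
  define g1 where "g1 w = (if w \<in> unit_disk then g w else 1)" for w
  have g1h: "g1 holomorphic_on unit_disk"
    using g_hol by (rule holomorphic_transform) (simp add: g1_def)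
  have "g1 = (\<lambda>w. indicator unit_disk w *\<^sub>R g w + indicator (- unit_disk) w)"
    by (auto simp: g1_def fun_eq_iff)
  moreover have "(\<lambda>w. indicator unit_disk w *\<^sub>R g w) \<in> borel_measurable borel"
    by (rule borel_measurable_continuous_on_indicator[OF unit_disk_borel holomorphic_on_imp_continuous_on[OF g_hol]])
  ultimately have g1m: "g1 \<in> borel_measurable borel" by simp
  interpret hartogs_weight g1 "s - 2" "k + 2"
    using g1m g1h g_nz s by unfold_locales (auto simp: g1_def)
  let ?bdd = "\<lambda>p. Lp_bounded p hartogs_triangle \<mu> (bergman_projection holomorphic2_on hartogs_triangle \<mu>)"
  have mu_iff: "?bdd p \<longleftrightarrow> Lp_bounded p hartogs_triangle weight (bergman_projection holomorphic2_on hartogs_triangle weight)" for p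
  proof (rule Lp_bounded_weight_cong)
    fix x assume "x \<in> hartogs_triangle"
    hence "snd x \<in> unit_disk" by (auto simp: hartogs_triangle_def unit_disk_def)
    \<comment> \<open>The instance a = s - 2, m = k + 2 reproduces the exponent s'.\<close>
    moreover have "s - 2 + 2 * of_int (k + 2) - 2 = s'" using s by simp
    ultimately show "\<mu> x = weight x" unfolding weight_def mu by (simp add: g1_def)
  qed
  have nu_iff: "Lp_bounded p unit_disk (\<lambda>w. (cmod (g1 w))\<^sup>2) (bergman_projection (holomorphic_on) unit_disk (\<lambda>w. (cmod (g1 w))\<^sup>2))
      \<longleftrightarrow> p \<in> conj_interval p0" if "p > 1" for p
    unfolding disk[OF that, symmetric] by (rule Lp_bounded_weight_cong) (simp add: nu g1_def)
  have suff: "?bdd p" if p: "p > 1" "p \<in> conj_interval p0" "p \<in> conj_interval p1" for p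
  proof -
    have q: "p / (p - 1) > 1" "p / (p - 1) \<in> conj_interval p0"
      using p conj_interval_conjugate[OF p0] by auto
    show ?thesis
      unfolding mu_iff
      by (rule exponents_imp_Lp_bounded[OF p(1) refl])
         (use p q nu_iff hartogs_exponent_iff[OF s(1,2) p(1), of k] p1 in auto)
  qed
  \<comment> \<open>Holds for every p > 1, independently of p0; together with the inclusion of the
    intervals, which lets \<open>suff\<close> apply throughout the smaller one, it yields the
    equivalence.\<close>
  have nec: "p \<in> conj_interval p1" if p: "p > 1" "?bdd p" for p
    using Lp_bounded_imp_exponents[OF p(1) refl] p(2) hartogs_exponent_iff[OF s(1,2) p(1), of k] p1
    unfolding mu_iff by auto
  show ?thesis using suff nec by blast
qed

end
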